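(* Let $\mathbf{U}_{JK}$ be the full subcategory of $\mathbf{CSM}$ (modular operads in sets) spanned by the modular operads $\langle G\rangle$ generated by safe connected graphs $G$. The inclusion $I:\mathbf{U}_{JK}\to\mathbf{CSM}$ induces a fully faithful functor $N_{JK}:\mathbf{CSM}\to\widehat{\mathbf{U}_{JK}}$, $N_{JK}(P)=\mathbf{CSM}(I(-),P)$. The essential image of $N_{JK}$ consists precisely of those presheaves which satisfy the (strict) Segal condition.
   Context: **Graphs.** A graph $G$ consists of finite sets $A=A(G)$ (arcs), $D=D(G)$, $V=V(G)$ (vertices), a fixed-point-free involution $i:A\to A$, an injection $D\to A$ (by which $D$ is regarded as a subset of $A$), a function $t:D\to V$, and a subset $\eth(G)\subseteq A\setminus D$ (the boundary) such that $i(D)\setminus D\subseteq\eth(G)$ and $\eth(G)\setminus i(D)$ is closed under $i$. (All these sets are subsets of a fixed infinite set.) $G$ is safe if $\eth(G)=A\setminus D$. A natural transformation $G\to G'$ is a triple of functions $A\to A'$, $D\to D'$, $V\to V'$ compatible with $i$, the injections and $t$; an isomorphism of graphs is an invertible one carrying $\eth(G)$ onto $\eth(G')$. $G$ is connected if its underlying diagram $(A,i)\leftarrow D\to V$ is nonempty and not a nontrivial coproduct of such diagrams. For $v\in V$ put $\mathrm{nb}(v)=t^{-1}(v)\subseteq D$. An edge is an $i$-orbit in $A$; it is internal if both its arcs lie in $D$. For a set $S$, $2S=S\amalg S^\dagger$ with involution $s\leftrightarrow s^\dagger$. The exceptional edge $\updownarrow$ has $V=D=\varnothing$ and $A=\eth(\updownarrow)=\{\epsilon,\epsilon^\dagger\}$;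 a nodeless loop is a graph isomorphic to the one with the same $A,D,V$ but empty boundary. The star $\bigstar_S$ ($S$ finite) has one vertex, $A=2S$, $D=S^\dagger$, $\eth(\bigstar_S)=S$. For $v\in V(G)$, $\bigstar_v$ has vertex set $\{v\}$, $D=\mathrm{nb}(v)$, $A=2\,\mathrm{nb}(v)$, $\eth(\bigstar_v)=\mathrm{nb}(v)^\dagger$. **Graph substitution.** Let $G$ be connected and for each $v\in V$ let $H_v$ be a connected graph with a bijection $m_v:i(\mathrm{nb}(v))\to\eth(H_v)$. If $V=\varnothing$ set $G\{H_v\}=G$. Otherwise choose for each internal edge $e$ an ordering $x_e^1,x_e^2$ of its arcs; the underlying diagram of $G\{H_v\}$ is the (objectwise) coequalizer of two maps $\coprod_e\updownarrow\ \rightrightarrows\coprod_v H_v$, the first given on the $e$-th copy by $\epsilon\mapsto m_{tx_e^1}(ix_e^1)$, the second by $\epsilon^\dagger\mapsto m_{tx_e^2}(ix_e^2)$. Its boundary is the image of the injection sending $a\in\eth(G)$ to the class of $m_{t(ia)}(a)$; this identifies $\eth(G)\cong\eth(G\{H_v\})$. **Modular operads (in sets).** Let $\mathfrak C$ be a set with involution $c\mapsto c^\dagger$. $\mathrm{Bij}_{\mathfrak C}$ is the groupoid of pairs $(S,\xi)$, $S$ a finite set, $\xi:S\to\mathfrak C$ a function, with bijections over $\mathfrak C$. A $\mathfrak C$-colored graph $(G,\zeta)$ is a connected graph (nodeless loops allowed) with an involutive map $\zeta:A(G)\to\mathfrak C$. $\mathrm{Gr}_{\mathfrak C}(S,\xi)$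 is the groupoid of triples $(f,G,\zeta)$ with $(G,\zeta)$ a $\mathfrak C$-colored graph and $f:S\to\eth(G)$ a bijection with $\zeta f=\xi$; isomorphisms are graph isomorphisms compatible with $f$ and $\zeta$. For $X:\mathrm{Bij}_{\mathfrak C}\to\mathrm{Set}$ put $X[G,\zeta]=\prod_{v\in V}X(i\,\mathrm{nb}(v),\zeta|)$ and $(F_{\mathfrak C}X)(S,\xi)=\mathrm{colim}_{(f,G,\zeta)\in\mathrm{Gr}_{\mathfrak C}(S,\xi)}X[G,\zeta]$. $F_{\mathfrak C}$ is a monad: $\mu$ sends the element of $F_{\mathfrak C}F_{\mathfrak C}X(S,\xi)$ given by $(f,G,\zeta)$, objects $(m_v,H_v,\zeta_v)\in\mathrm{Gr}_{\mathfrak C}(i\,\mathrm{nb}(v),\zeta|)$ and elements of $X[H_v,\zeta_v]$ to the class of the corresponding element of $X[G\{H_v\},\tilde\zeta]\cong\prod_vX[H_v,\zeta_v]$ at $(S\xrightarrow{f}\eth(G)\cong\eth(G\{H_v\}),G\{H_v\},\tilde\zeta)$, where $\tilde\zeta$ is the coloring induced by the $\zeta_v$ (and $\tilde\zeta=\zeta$ if $V=\varnothing$); $\eta$ is the inclusion of $X(S,\xi)=X[\bigstar_S,\xi^\bigstar]$ at $(\mathrm{id}_S,\bigstar_S,\xi^\bigstar)$, with $\xi^\bigstar$ the involutive extension of $\xi$ to $2S$. A ($\mathfrak C$-colored) modular operad is an $F_{\mathfrak C}$-algebra; their category is $\mathbf{CSM}_{\mathfrak C}$. For an involutive map $f:\mathfrak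 C\to\mathfrak D$ and $Q\in\mathbf{CSM}_{\mathfrak D}$, $f^*Q\in\mathbf{CSM}_{\mathfrak C}$ has $(f^*Q)(S,\xi)=Q(S,f\xi)$. $\mathbf{CSM}$ is the category of all modular operads, with $\mathbf{CSM}(P,Q)=\coprod_{f:\mathfrak C\to\mathfrak D}\mathbf{CSM}_{\mathfrak C}(P,f^*Q)$ for $P$ $\mathfrak C$-colored, $Q$ $\mathfrak D$-colored, $f$ ranging over involutive maps (Grothendieck construction composition). **The modular operad generated by a graph.** For a connected graph $G$ with arc set $A$, let $\underline G:\mathrm{Bij}_A\to\mathrm{Set}$ have $\underline G(S,\xi)$ a one-point set, labelled by $v$, if $\xi$ is injective with image $i\,\mathrm{nb}(v)$ for some $v\in V$, and empty otherwise. $\langle G\rangle$ is the free $A$-colored modular operad on $\underline G$. A morphism out of $\langle G\rangle$ is determined by an involutive map on colors and the images of the generators $v\in\langle G\rangle(i\,\mathrm{nb}(v),\mathrm{incl})$, $v\in V$. **The category $\mathbf U_{JK}$ and the Segal condition.** The objects of $\mathbf U_{JK}$ are the safe connected graphs and $\mathbf U_{JK}(G,H)=\mathbf{CSM}(\langle G\rangle,\langle H\rangle)$. $\widehat{\mathbf U_{JK}}=\mathrm{Set}^{\mathbf U_{JK}^{\mathrm{op}}}$ and $\mathbf U_{JK}[G]$ is the presheaf represented by $G$. For $v\in V(G)$ let $\iota_v:\bigstar_v\to G$ in $\mathbf U_{JK}$ be the morphism with color map $d\mapsto d$, $d^\dagger\mapsto i(d)$ sending the generator $v$ to the generator $v$.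 For $G$ with at least one vertex, choose for each internal edge $e$ an ordering $x_e^1,x_e^2$ of its arcs. The Segal core $\mathrm{Sc}[G]$ is the coequalizer in $\widehat{\mathbf U_{JK}}$ of the two maps $\coprod_e\mathbf U_{JK}[\updownarrow]\rightrightarrows\coprod_{v\in V}\mathbf U_{JK}[\bigstar_v]$ induced on the $e$-th summand by the morphisms $\updownarrow\to\bigstar_{tx_e^1}$, $\epsilon\mapsto(x_e^1)^\dagger$, and $\updownarrow\to\bigstar_{tx_e^2}$, $\epsilon\mapsto x_e^2$ (a morphism out of $\langle\updownarrow\rangle$ is determined by the image of the color $\epsilon$). The $\iota_v$ induce $\mathrm{Sc}[G]\to\mathbf U_{JK}[G]$. For $G=\updownarrow$ this map is the identity. A presheaf $X$ satisfies the Segal condition if $\mathrm{Hom}(\mathbf U_{JK}[G],X)\to\mathrm{Hom}(\mathrm{Sc}[G],X)$ is a bijection for every safe connected graph $G$. *)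

theory Defs
  imports Main "HOL-Library.FuncSet"
begin

section \<open>Preliminaries\<close>

text \<open>
  The type variable \<open>'u\<close> plays the role of the fixed infinite set containing all arcs, darts,
  vertices and finite index sets; the theorem assumes that it is infinite.
  Functions between sets are extensional (\<open>undefined\<close> off their domain), so that
  equality of HOL functions is equality of functions on the domain.
\<close>

definition eqcl :: "('a \<times> 'a) set \<Rightarrow> ('a \<times> 'a) set" where
  "eqcl r = (r \<union> r\<inverse>)\<^sup>*"

record 'c cset =
  cols :: "'c set"
  cinv :: "'c \<Rightarrow> 'c"

definition involutive_set :: "'c cset \<Rightarrow> bool" where
  "involutive_set C \<longleftrightarrow> cinv C \<in> cols C \<rightarrow> cols C \<and> (\<forall>c\<in>cols C. cinv C (cinv C c) = c)"

definition inv_maps :: "'c cset \<Rightarrow> 'd cset \<Rightarrow> ('c \<Rightarrow> 'd) set" where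
  "inv_maps C D = {\<phi> \<in> cols C \<rightarrow>\<^sub>E cols D. \<forall>c\<in>cols C. \<phi> (cinv C c) = cinv D (\<phi> c)}"


section \<open>Graphs\<close>

text \<open>\<open>gA\<close>, \<open>gD\<close>, \<open>gV\<close>: arcs, darts, vertices; \<open>gi\<close>: the involution; \<open>gs\<close>: the injection
  of darts into arcs; \<open>gt\<close>: the vertex of a dart; \<open>gB\<close>: the boundary.\<close>

record 'u graph =
  gA :: "'u set"
  gD :: "'u set"
  gV :: "'u set"
  gi :: "'u \<Rightarrow> 'u"
  gs :: "'u \<Rightarrow> 'u"
  gt :: "'u \<Rightarrow> 'u"
  gB :: "'u set"

text \<open>\<open>D\<close> regarded as a subset of \<open>A\<close>, and \<open>t\<close> as a function on that subset.\<close>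

definition dA :: "'u graph \<Rightarrow> 'u set" where
  "dA G = gs G ` gD G"

definition tA :: "'u graph \<Rightarrow> 'u \<Rightarrow> 'u" where
  "tA G a = gt G (inv_into (gD G) (gs G) a)"

definition is_graph :: "'u graph \<Rightarrow> bool" where
  "is_graph G \<longleftrightarrow>
     finite (gA G) \<and> finite (gD G) \<and> finite (gV G) \<and>
     gi G \<in> gA G \<rightarrow>\<^sub>E gA G \<and> (\<forall>a\<in>gA G. gi G (gi G a) = a \<and> gi G a \<noteq> a) \<and>
     gs G \<in> gD G \<rightarrow>\<^sub>E gA G \<and> inj_on (gs G) (gD G) \<and>
     gt G \<in> gD G \<rightarrow>\<^sub>E gV G \<and>
     gB G \<subseteq> gA G - dA G \<and>
     gi G ` dA G - dA G \<subseteq> gB G \<and>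
     gi G ` (gB G - gi G ` dA G) \<subseteq> gB G - gi G ` dA G"

definition safe :: "'u graph \<Rightarrow> bool" where
  "safe G \<longleftrightarrow> gB G = gA G - dA G"

text \<open>
  A decomposition of the underlying diagram as a binary coproduct amounts to subsets
  \<open>A1\<close> of arcs and \<open>V1\<close> of vertices such that \<open>A1\<close> is closed under the involution and each
  dart has its arc in \<open>A1\<close> iff it has its vertex in \<open>V1\<close>. Nodeless loops (two arcs, no darts,
  no vertices, empty boundary) are connected graphs, but not safe.
\<close>

definition connected_graph :: "'u graph \<Rightarrow> bool" where
  "connected_graph G \<longleftrightarrow>
     is_graph G \<and> (gA G \<noteq> {} \<or> gV G \<noteq> {}) \<and>
     (\<forall>A1 V1. A1 \<subseteq> gA G \<and> V1 \<subseteq> gV G \<and> gi G ` A1 \<subseteq> A1 \<and>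
        (\<forall>d\<in>gD G. gs G d \<in> A1 \<longleftrightarrow> gt G d \<in> V1) \<longrightarrow>
        (A1 = {} \<and> V1 = {}) \<or> (A1 = gA G \<and> V1 = gV G))"

text \<open>\<open>nb(v)\<close> is taken inside the set of arcs.\<close>

definition nb :: "'u graph \<Rightarrow> 'u \<Rightarrow> 'u set" where
  "nb G v = gs G ` {d \<in> gD G. gt G d = v}"

definition inb :: "'u graph \<Rightarrow> 'u \<Rightarrow> 'u set" where
  "inb G v = gi G ` nb G v"

definition arcset :: "'u graph \<Rightarrow> 'u cset" where
  "arcset G = \<lparr>cols = gA G, cinv = gi G\<rparr>"

definition graph_iso ::
  "'u graph \<Rightarrow> 'u graph \<Rightarrow> ('u \<Rightarrow> 'u) \<Rightarrow> ('u \<Rightarrow> 'u) \<Rightarrow> ('u \<Rightarrow> 'u) \<Rightarrow> bool" where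
  "graph_iso G G' \<alpha> \<delta> \<nu> \<longleftrightarrow>
     bij_betw \<alpha> (gA G) (gA G') \<and> bij_betw \<delta> (gD G) (gD G') \<and> bij_betw \<nu> (gV G) (gV G') \<and>
     (\<forall>a\<in>gA G. \<alpha> (gi G a) = gi G' (\<alpha> a)) \<and>
     (\<forall>d\<in>gD G. \<alpha> (gs G d) = gs G' (\<delta> d) \<and> \<nu> (gt G d) = gt G' (\<delta> d)) \<and>
     \<alpha> ` gB G = gB G'"

text \<open>\<open>2S\<close> is the union of \<open>S\<close> with a disjoint copy \<open>dg S ` S\<close>; such a copy exists for
  finite \<open>S\<close> because the universe is infinite.\<close>

definition dg :: "'u set \<Rightarrow> 'u \<Rightarrow> 'u" where
  "dg S = (SOME g. inj_on g S \<and> g ` S \<inter> S = {})"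

definition dbl :: "'u set \<Rightarrow> 'u set" where
  "dbl S = S \<union> dg S ` S"

definition dbl_inv :: "'u set \<Rightarrow> 'u \<Rightarrow> 'u" where
  "dbl_inv S = (\<lambda>a\<in>dbl S. if a \<in> S then dg S a else inv_into S (dg S) a)"

definition star :: "'u set \<Rightarrow> 'u graph" where
  "star S = \<lparr>gA = dbl S, gD = dg S ` S, gV = {undefined}, gi = dbl_inv S,
     gs = (\<lambda>d\<in>dg S ` S. d), gt = (\<lambda>d\<in>dg S ` S. undefined), gB = S\<rparr>"

definition star_at :: "'u graph \<Rightarrow> 'u \<Rightarrow> 'u graph" where
  "star_at G v = \<lparr>gA = dbl (nb G v), gD = nb G v, gV = {v}, gi = dbl_inv (nb G v),
     gs = (\<lambda>d\<in>nb G v. d), gt = (\<lambda>d\<in>nb G v. v), gB = dg (nb G v) ` nb G v\<rparr>"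

definition eps :: 'u where
  "eps = undefined"

definition eps_dg :: 'u where
  "eps_dg = (SOME a. a \<noteq> eps)"

definition exc_edge :: "'u graph" where
  "exc_edge = \<lparr>gA = {eps, eps_dg}, gD = {}, gV = {},
     gi = (\<lambda>a\<in>{eps, eps_dg}. if a = eps then eps_dg else eps),
     gs = (\<lambda>d\<in>{}. undefined), gt = (\<lambda>d\<in>{}. undefined), gB = {eps, eps_dg}\<rparr>"


section \<open>Graph substitution\<close>

text \<open>Disjoint unions are formed inside the universe by means of a pairing function.\<close>

definition enc :: "'u \<times> 'u \<Rightarrow> 'u" where
  "enc = (SOME f. inj f)"

text \<open>
  For an internal edge with arcs ordered as \<open>x\<close>, \<open>y = i x\<close>, the coequalizer identifies the two
  images of \<open>\<epsilon>\<close>, namely \<open>m (i x)\<close> and \<open>i (m (i y))\<close>, and the two images of \<open>\<epsilon>\<^sup>\<dagger>\<close>, namely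
  \<open>i (m (i x))\<close> and \<open>m (i y)\<close>. Taking \<open>a = x\<close> below yields the former pair and \<open>a = y\<close> the
  latter (reversed), so the generated equivalence is that of the coequalizer, whatever the
  chosen orderings.
\<close>

definition glue_rel ::
  "'u graph \<Rightarrow> ('u \<Rightarrow> 'u graph) \<Rightarrow> ('u \<Rightarrow> 'u \<Rightarrow> 'u) \<Rightarrow> (('u \<times> 'u) \<times> ('u \<times> 'u)) set" where
  "glue_rel G H m =
     {((tA G a, m (tA G a) (gi G a)),
       (tA G (gi G a), gi (H (tA G (gi G a))) (m (tA G (gi G a)) a))) | a.
        a \<in> dA G \<and> gi G a \<in> dA G}"

text \<open>The quotient map, an equivalence class being encoded by a chosen element of it.\<close>

definition glue ::
  "'u graph \<Rightarrow> ('u \<Rightarrow> 'u graph) \<Rightarrow> ('u \<Rightarrow> 'u \<Rightarrow> 'u) \<Rightarrow> 'u \<Rightarrow> 'u \<Rightarrow> 'u" where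
  "glue G H m v a = enc (SOME z. ((v, a), z) \<in> eqcl (glue_rel G H m))"

definition sub_bd ::
  "'u graph \<Rightarrow> ('u \<Rightarrow> 'u graph) \<Rightarrow> ('u \<Rightarrow> 'u \<Rightarrow> 'u) \<Rightarrow> 'u \<Rightarrow> 'u" where
  "sub_bd G H m a =
     (if gV G = {} then a else glue G H m (tA G (gi G a)) (m (tA G (gi G a)) a))"

definition sub_arcs ::
  "'u graph \<Rightarrow> ('u \<Rightarrow> 'u graph) \<Rightarrow> ('u \<Rightarrow> 'u \<Rightarrow> 'u) \<Rightarrow> 'u set" where
  "sub_arcs G H m = {glue G H m v a | v a. v \<in> gV G \<and> a \<in> gA (H v)}"

definition sub_darts :: "'u graph \<Rightarrow> ('u \<Rightarrow> 'u graph) \<Rightarrow> 'u set" where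
  "sub_darts G H = {enc (v, d) | v d. v \<in> gV G \<and> d \<in> gD (H v)}"

definition sub_graph ::
  "'u graph \<Rightarrow> ('u \<Rightarrow> 'u graph) \<Rightarrow> ('u \<Rightarrow> 'u \<Rightarrow> 'u) \<Rightarrow> 'u graph" where
  "sub_graph G H m =
     (if gV G = {} then G else
      \<lparr>gA = sub_arcs G H m,
       gD = sub_darts G H,
       gV = {enc (v, w) | v w. v \<in> gV G \<and> w \<in> gV (H v)},
       gi = (\<lambda>b\<in>sub_arcs G H m. THE c. \<exists>v\<in>gV G. \<exists>a\<in>gA (H v).
               b = glue G H m v a \<and> c = glue G H m v (gi (H v) a)),
       gs = (\<lambda>e\<in>sub_darts G H. THE c. \<exists>v\<in>gV G. \<exists>d\<in>gD (H v).
               e = enc (v, d) \<and> c = glue G H m v (gs (H v) d)),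
       gt = (\<lambda>e\<in>sub_darts G H. THE u. \<exists>v\<in>gV G. \<exists>d\<in>gD (H v).
               e = enc (v, d) \<and> u = enc (v, gt (H v) d)),
       gB = sub_bd G H m ` gB G\<rparr>)"

definition sub_col ::
  "'u graph \<Rightarrow> ('u \<Rightarrow> 'u graph) \<Rightarrow> ('u \<Rightarrow> 'u \<Rightarrow> 'u) \<Rightarrow> ('u \<Rightarrow> 'c) \<Rightarrow> ('u \<Rightarrow> 'u \<Rightarrow> 'c) \<Rightarrow> 'u \<Rightarrow> 'c"
  where
  "sub_col G H m \<zeta> \<zeta>v =
     (if gV G = {} then \<zeta> else
      (\<lambda>b\<in>sub_arcs G H m. THE c. \<exists>v\<in>gV G. \<exists>a\<in>gA (H v). b = glue G H m v a \<and> c = \<zeta>v v a))"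


section \<open>The groupoid of colored finite sets and functors on it\<close>

type_synonym ('u, 'c) bob = "'u set \<times> ('u \<Rightarrow> 'c)"

definition bij_ob :: "'c cset \<Rightarrow> ('u, 'c) bob set" where
  "bij_ob C = {(S, \<xi>). finite S \<and> \<xi> \<in> S \<rightarrow>\<^sub>E cols C}"

definition bij_hom :: "('u, 'c) bob \<Rightarrow> ('u, 'c) bob \<Rightarrow> ('u \<Rightarrow> 'u) set" where
  "bij_hom p q = {\<sigma> \<in> extensional (fst p). bij_betw \<sigma> (fst p) (fst q) \<and>
                    (\<forall>s\<in>fst p. snd q (\<sigma> s) = snd p s)}"

record ('u, 'c, 'x) bfun =
  bo :: "('u, 'c) bob \<Rightarrow> 'x set"
  ba :: "('u, 'c) bob \<Rightarrow> ('u, 'c) bob \<Rightarrow> ('u \<Rightarrow> 'u) \<Rightarrow> 'x \<Rightarrow> 'x"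

definition bij_functor :: "'c cset \<Rightarrow> ('u, 'c, 'x) bfun \<Rightarrow> bool" where
  "bij_functor C X \<longleftrightarrow>
     (\<forall>p\<in>bij_ob C. \<forall>q\<in>bij_ob C. \<forall>\<sigma>\<in>bij_hom p q. ba X p q \<sigma> \<in> bo X p \<rightarrow>\<^sub>E bo X q) \<and>
     (\<forall>p\<in>bij_ob C. \<forall>x\<in>bo X p. ba X p p (\<lambda>s\<in>fst p. s) x = x) \<and>
     (\<forall>p\<in>bij_ob C. \<forall>q\<in>bij_ob C. \<forall>r\<in>bij_ob C. \<forall>\<sigma>\<in>bij_hom p q. \<forall>\<tau>\<in>bij_hom q r. \<forall>x\<in>bo X p.
        ba X p r (compose (fst p) \<tau> \<sigma>) x = ba X q r \<tau> (ba X p q \<sigma> x))"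

definition bfun_hom ::
  "'c cset \<Rightarrow> ('u, 'c, 'x) bfun \<Rightarrow> ('u, 'c, 'y) bfun \<Rightarrow> (('u, 'c) bob \<Rightarrow> 'x \<Rightarrow> 'y) set" where
  "bfun_hom C X Y =
     {\<theta> \<in> extensional (bij_ob C).
        (\<forall>p\<in>bij_ob C. \<theta> p \<in> bo X p \<rightarrow>\<^sub>E bo Y p) \<and>
        (\<forall>p\<in>bij_ob C. \<forall>q\<in>bij_ob C. \<forall>\<sigma>\<in>bij_hom p q. \<forall>x\<in>bo X p.
           \<theta> q (ba X p q \<sigma> x) = ba Y p q \<sigma> (\<theta> p x))}"


section \<open>The monad of colored graphs\<close>

type_synonym ('u, 'c) gob = "('u \<Rightarrow> 'u) \<times> 'u graph \<times> ('u \<Rightarrow> 'c)"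

text \<open>\<open>gr C p\<close>: the objects of the groupoid of graphs with boundary labelled by \<open>p = (S, \<xi>)\<close>.\<close>

definition gr :: "'c cset \<Rightarrow> ('u, 'c) bob \<Rightarrow> ('u, 'c) gob set" where
  "gr C p = {(f, G, \<zeta>). connected_graph G \<and> \<zeta> \<in> inv_maps (arcset G) C \<and>
               f \<in> extensional (fst p) \<and> bij_betw f (fst p) (gB G) \<and>
               (\<forall>s\<in>fst p. \<zeta> (f s) = snd p s)}"

definition at_vertex :: "'u graph \<Rightarrow> ('u \<Rightarrow> 'c) \<Rightarrow> 'u \<Rightarrow> ('u, 'c) bob" where
  "at_vertex G \<zeta> v = (inb G v, restrict \<zeta> (inb G v))"

definition deco ::
  "('u, 'c, 'x) bfun \<Rightarrow> 'u graph \<Rightarrow> ('u \<Rightarrow> 'c) \<Rightarrow> ('u \<Rightarrow> 'x) set" where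
  "deco X G \<zeta> = PiE (gV G) (\<lambda>v. bo X (at_vertex G \<zeta> v))"

type_synonym ('u, 'c, 'x) gelt = "('u, 'c) gob \<times> ('u \<Rightarrow> 'x)"

definition gr_elts ::
  "'c cset \<Rightarrow> ('u, 'c, 'x) bfun \<Rightarrow> ('u, 'c) bob \<Rightarrow> ('u, 'c, 'x) gelt set" where
  "gr_elts C X p = {((f, G, \<zeta>), x). (f, G, \<zeta>) \<in> gr C p \<and> x \<in> deco X G \<zeta>}"

text \<open>
  The colimit over a groupoid of a set-valued functor is the quotient of the disjoint union by
  the relation of being carried to one another by an isomorphism.
\<close>

definition gr_rel ::
  "'c cset \<Rightarrow> ('u, 'c, 'x) bfun \<Rightarrow> ('u, 'c) bob \<Rightarrow>
     (('u, 'c, 'x) gelt \<times> ('u, 'c, 'x) gelt) set" where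
  "gr_rel C X p =
     {(((f, G, \<zeta>), x), ((f', G', \<zeta>'), x')).
        ((f, G, \<zeta>), x) \<in> gr_elts C X p \<and> ((f', G', \<zeta>'), x') \<in> gr_elts C X p \<and>
        (\<exists>\<alpha> \<delta> \<nu>. graph_iso G G' \<alpha> \<delta> \<nu> \<and>
           (\<forall>s\<in>fst p. \<alpha> (f s) = f' s) \<and> (\<forall>a\<in>gA G. \<zeta>' (\<alpha> a) = \<zeta> a) \<and>
           (\<forall>v\<in>gV G. x' (\<nu> v) =
              ba X (at_vertex G \<zeta> v) (at_vertex G' \<zeta>' (\<nu> v)) (restrict \<alpha> (inb G v)) (x v)))}"

text \<open>
  Maps between colimits send a class \<open>K\<close> to the class of the image of any of its elements; this
  is written \<open>gr_rel C Y q `` (g ` K)\<close>, where \<open>g\<close> is the map on elements.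
\<close>

definition F_ob ::
  "'c cset \<Rightarrow> ('u, 'c, 'x) bfun \<Rightarrow> ('u, 'c) bob \<Rightarrow> ('u, 'c, 'x) gelt set set" where
  "F_ob C X p = gr_elts C X p // gr_rel C X p"

definition F_fun ::
  "'c cset \<Rightarrow> ('u, 'c, 'x) bfun \<Rightarrow> ('u, 'c, ('u, 'c, 'x) gelt set) bfun" where
  "F_fun C X =
     \<lparr>bo = F_ob C X,
      ba = (\<lambda>p q \<sigma>. \<lambda>K\<in>F_ob C X p. gr_rel C X q ``
              ((\<lambda>((f, G, \<zeta>), x).
                  ((\<lambda>s\<in>fst q. f (inv_into (fst p) \<sigma> s), G, \<zeta>), x)) ` K))\<rparr>"

definition F_map ::
  "'c cset \<Rightarrow> ('u, 'c, 'x) bfun \<Rightarrow> ('u, 'c, 'y) bfun \<Rightarrow> (('u, 'c) bob \<Rightarrow> 'x \<Rightarrow> 'y) \<Rightarrow>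
     ('u, 'c) bob \<Rightarrow> ('u, 'c, 'x) gelt set \<Rightarrow> ('u, 'c, 'y) gelt set" where
  "F_map C X Y \<theta> =
     (\<lambda>p\<in>bij_ob C. \<lambda>K\<in>F_ob C X p. gr_rel C Y p ``
        ((\<lambda>((f, G, \<zeta>), x). ((f, G, \<zeta>), \<lambda>v\<in>gV G. \<theta> (at_vertex G \<zeta> v) (x v))) ` K))"

definition star_col :: "'c cset \<Rightarrow> ('u, 'c) bob \<Rightarrow> 'u \<Rightarrow> 'c" where
  "star_col C p = (\<lambda>a\<in>dbl (fst p).
     if a \<in> fst p then snd p a else cinv C (snd p (dbl_inv (fst p) a)))"

definition F_unit ::
  "'c cset \<Rightarrow> ('u, 'c, 'x) bfun \<Rightarrow> ('u, 'c) bob \<Rightarrow> 'x \<Rightarrow> ('u, 'c, 'x) gelt set" where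
  "F_unit C X =
     (\<lambda>p\<in>bij_ob C. \<lambda>x\<in>bo X p. gr_rel C X p ``
        {((\<lambda>s\<in>fst p. s, star (fst p), star_col C p), \<lambda>v\<in>gV (star (fst p)). x)})"

text \<open>The bijection from decorations of the graphs \<open>H\<^sub>v\<close> to decorations of the substituted
  graph: the set at a vertex is transported along the quotient map on arcs.\<close>

definition sub_deco ::
  "('u, 'c, 'x) bfun \<Rightarrow> 'u graph \<Rightarrow> ('u \<Rightarrow> 'u graph) \<Rightarrow> ('u \<Rightarrow> 'u \<Rightarrow> 'u) \<Rightarrow> ('u \<Rightarrow> 'c) \<Rightarrow>
     ('u \<Rightarrow> 'u \<Rightarrow> 'c) \<Rightarrow> ('u \<Rightarrow> 'u \<Rightarrow> 'x) \<Rightarrow> 'u \<Rightarrow> 'x" where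
  "sub_deco X G H m \<zeta> \<zeta>v x =
     (\<lambda>u\<in>gV (sub_graph G H m). THE y. \<exists>v\<in>gV G. \<exists>w\<in>gV (H v). u = enc (v, w) \<and>
        y = ba X (at_vertex (H v) (\<zeta>v v) w)
                 (at_vertex (sub_graph G H m) (sub_col G H m \<zeta> \<zeta>v) u)
                 (restrict (glue G H m v) (inb (H v) w)) (x v w))"

definition F_mult ::
  "'c cset \<Rightarrow> ('u, 'c, 'x) bfun \<Rightarrow> ('u, 'c) bob \<Rightarrow>
     ('u, 'c, ('u, 'c, 'x) gelt set) gelt set \<Rightarrow> ('u, 'c, 'x) gelt set" where
  "F_mult C X =
     (\<lambda>p\<in>bij_ob C. \<lambda>K\<in>F_ob C (F_fun C X) p. gr_rel C X p ``
        {((\<lambda>s\<in>fst p. sub_bd G H m (f s), sub_graph G H m, sub_col G H m \<zeta> \<zeta>v),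
          sub_deco X G H m \<zeta> \<zeta>v x) | f G \<zeta> y m H \<zeta>v x.
            ((f, G, \<zeta>), y) \<in> K \<and> (\<forall>v\<in>gV G. ((m v, H v, \<zeta>v v), x v) \<in> y v)})"


section \<open>Modular operads\<close>

record ('u, 'c, 'x) modop =
  mcol :: "'c cset"
  mop :: "('u, 'c, 'x) bfun"
  malg :: "('u, 'c) bob \<Rightarrow> ('u, 'c, 'x) gelt set \<Rightarrow> 'x"

definition modular_operad :: "('u, 'c, 'x) modop \<Rightarrow> bool" where
  "modular_operad P \<longleftrightarrow>
     involutive_set (mcol P) \<and> bij_functor (mcol P) (mop P) \<and>
     malg P \<in> bfun_hom (mcol P) (F_fun (mcol P) (mop P)) (mop P) \<and>
     (\<forall>p\<in>bij_ob (mcol P). \<forall>x\<in>bo (mop P) p. malg P p (F_unit (mcol P) (mop P) p x) = x) \<and>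
     (\<forall>p\<in>bij_ob (mcol P). \<forall>K\<in>F_ob (mcol P) (F_fun (mcol P) (mop P)) p.
        malg P p (F_map (mcol P) (F_fun (mcol P) (mop P)) (mop P) (malg P) p K) =
        malg P p (F_mult (mcol P) (mop P) p K))"

definition free_modop ::
  "'c cset \<Rightarrow> ('u, 'c, 'x) bfun \<Rightarrow> ('u, 'c, ('u, 'c, 'x) gelt set) modop" where
  "free_modop C X = \<lparr>mcol = C, mop = F_fun C X, malg = F_mult C X\<rparr>"

definition recolor :: "('c \<Rightarrow> 'd) \<Rightarrow> ('u, 'c) bob \<Rightarrow> ('u, 'd) bob" where
  "recolor \<phi> p = (fst p, \<lambda>s\<in>fst p. \<phi> (snd p s))"

definition pull_fun :: "('c \<Rightarrow> 'd) \<Rightarrow> ('u, 'd, 'x) bfun \<Rightarrow> ('u, 'c, 'x) bfun" where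
  "pull_fun \<phi> X = \<lparr>bo = (\<lambda>p. bo X (recolor \<phi> p)),
                  ba = (\<lambda>p q. ba X (recolor \<phi> p) (recolor \<phi> q))\<rparr>"

definition pull_modop ::
  "'c cset \<Rightarrow> ('c \<Rightarrow> 'd) \<Rightarrow> ('u, 'd, 'x) modop \<Rightarrow> ('u, 'c, 'x) modop" where
  "pull_modop C \<phi> Q =
     \<lparr>mcol = C, mop = pull_fun \<phi> (mop Q),
      malg = (\<lambda>p\<in>bij_ob C. \<lambda>K\<in>F_ob C (pull_fun \<phi> (mop Q)) p.
        malg Q (recolor \<phi> p) (gr_rel (mcol Q) (mop Q) (recolor \<phi> p) ``
          ((\<lambda>((f, G, \<zeta>), x). ((f, G, \<lambda>a\<in>gA G. \<phi> (\<zeta> a)), x)) ` K)))\<rparr>"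

text \<open>Morphisms of \<open>F\<^sub>C\<close>-algebras, for \<open>P\<close> and \<open>Q\<close> with the same colors.\<close>

definition csm_col_hom ::
  "('u, 'c, 'x) modop \<Rightarrow> ('u, 'c, 'y) modop \<Rightarrow> (('u, 'c) bob \<Rightarrow> 'x \<Rightarrow> 'y) set" where
  "csm_col_hom P Q =
     {\<theta> \<in> bfun_hom (mcol P) (mop P) (mop Q).
        \<forall>p\<in>bij_ob (mcol P). \<forall>K\<in>F_ob (mcol P) (mop P) p.
          \<theta> p (malg P p K) = malg Q p (F_map (mcol P) (mop P) (mop Q) \<theta> p K)}"

type_synonym ('u, 'c, 'x, 'd, 'y) csm_mor = "('c \<Rightarrow> 'd) \<times> (('u, 'c) bob \<Rightarrow> 'x \<Rightarrow> 'y)"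

definition csm_hom ::
  "('u, 'c, 'x) modop \<Rightarrow> ('u, 'd, 'y) modop \<Rightarrow> ('u, 'c, 'x, 'd, 'y) csm_mor set" where
  "csm_hom P Q = {(\<phi>, \<theta>). \<phi> \<in> inv_maps (mcol P) (mcol Q) \<and>
                            \<theta> \<in> csm_col_hom P (pull_modop (mcol P) \<phi> Q)}"

definition csm_id :: "('u, 'c, 'x) modop \<Rightarrow> ('u, 'c, 'x, 'c, 'x) csm_mor" where
  "csm_id P = (\<lambda>c\<in>cols (mcol P). c, \<lambda>p\<in>bij_ob (mcol P). \<lambda>x\<in>bo (mop P) p. x)"

text \<open>\<open>csm_comp P g f\<close> is the composite of \<open>g\<close> after \<open>f\<close>, where \<open>P\<close> is the source of \<open>f\<close>.\<close>

definition csm_comp ::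
  "('u, 'c, 'x) modop \<Rightarrow> ('u, 'd, 'y, 'e, 'z) csm_mor \<Rightarrow> ('u, 'c, 'x, 'd, 'y) csm_mor \<Rightarrow>
     ('u, 'c, 'x, 'e, 'z) csm_mor" where
  "csm_comp P g f =
     (\<lambda>c\<in>cols (mcol P). fst g (fst f c),
      \<lambda>p\<in>bij_ob (mcol P). \<lambda>x\<in>bo (mop P) p. snd g (recolor (fst f) p) (snd f p x))"


section \<open>The modular operad generated by a graph\<close>

definition vertex_fun :: "'u graph \<Rightarrow> ('u, 'u, 'u) bfun" where
  "vertex_fun G =
     (let X = (\<lambda>p. {v \<in> gV G. inj_on (snd p) (fst p) \<and> snd p ` fst p = inb G v})
      in \<lparr>bo = X, ba = (\<lambda>p q \<sigma>. \<lambda>v\<in>X p. v)\<rparr>)"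

type_synonym 'u gelts = "('u, 'u, 'u) gelt set"
type_synonym 'u umor = "('u, 'u, 'u gelts, 'u, 'u gelts) csm_mor"

definition gmod :: "'u graph \<Rightarrow> ('u, 'u, 'u gelts) modop" where
  "gmod G = free_modop (arcset G) (vertex_fun G)"

text \<open>The generator labelled \<open>v\<close> at any \<open>p = (S, \<xi>)\<close> with \<open>\<xi>\<close> injective with image \<open>i nb(v)\<close>.\<close>

definition generator :: "'u graph \<Rightarrow> ('u, 'u) bob \<Rightarrow> 'u \<Rightarrow> 'u gelts" where
  "generator G p v = F_unit (arcset G) (vertex_fun G) p v"

definition U_ob :: "'u graph set" where
  "U_ob = {G. connected_graph G \<and> safe G}"

definition U_hom :: "'u graph \<Rightarrow> 'u graph \<Rightarrow> 'u umor set" where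
  "U_hom G H = csm_hom (gmod G) (gmod H)"


section \<open>Presheaves and the nerve\<close>

record ('u, 'p) psh =
  pob :: "'u graph \<Rightarrow> 'p set"
  par :: "'u graph \<Rightarrow> 'u graph \<Rightarrow> 'u umor \<Rightarrow> 'p \<Rightarrow> 'p"

definition presheaf :: "('u, 'p) psh \<Rightarrow> bool" where
  "presheaf X \<longleftrightarrow>
     (\<forall>G\<in>U_ob. \<forall>H\<in>U_ob. \<forall>f\<in>U_hom G H. par X G H f \<in> pob X H \<rightarrow>\<^sub>E pob X G) \<and>
     (\<forall>G\<in>U_ob. \<forall>x\<in>pob X G. par X G G (csm_id (gmod G)) x = x) \<and>
     (\<forall>G\<in>U_ob. \<forall>H\<in>U_ob. \<forall>K\<in>U_ob. \<forall>f\<in>U_hom G H. \<forall>g\<in>U_hom H K. \<forall>x\<in>pob X K.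
        par X G K (csm_comp (gmod G) g f) x = par X G H f (par X H K g x))"

definition psh_hom :: "('u, 'p) psh \<Rightarrow> ('u, 'q) psh \<Rightarrow> ('u graph \<Rightarrow> 'p \<Rightarrow> 'q) set" where
  "psh_hom X Y =
     {\<tau> \<in> extensional U_ob.
        (\<forall>G\<in>U_ob. \<tau> G \<in> pob X G \<rightarrow>\<^sub>E pob Y G) \<and>
        (\<forall>G\<in>U_ob. \<forall>H\<in>U_ob. \<forall>f\<in>U_hom G H. \<forall>x\<in>pob X H.
           \<tau> G (par X G H f x) = par Y G H f (\<tau> H x))}"

definition psh_id :: "('u, 'p) psh \<Rightarrow> 'u graph \<Rightarrow> 'p \<Rightarrow> 'p" where
  "psh_id X = (\<lambda>G\<in>U_ob. \<lambda>x\<in>pob X G. x)"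

text \<open>\<open>psh_comp X \<sigma> \<tau>\<close> is the composite of \<open>\<sigma>\<close> after \<open>\<tau>\<close>, where \<open>X\<close> is the source of \<open>\<tau>\<close>.\<close>

definition psh_comp ::
  "('u, 'p) psh \<Rightarrow> ('u graph \<Rightarrow> 'q \<Rightarrow> 'r) \<Rightarrow> ('u graph \<Rightarrow> 'p \<Rightarrow> 'q) \<Rightarrow>
     'u graph \<Rightarrow> 'p \<Rightarrow> 'r" where
  "psh_comp X \<sigma> \<tau> = (\<lambda>G\<in>U_ob. \<lambda>x\<in>pob X G. \<sigma> G (\<tau> G x))"

definition psh_iso :: "('u, 'p) psh \<Rightarrow> ('u, 'q) psh \<Rightarrow> bool" where
  "psh_iso X Y \<longleftrightarrow>
     (\<exists>\<tau>\<in>psh_hom X Y. \<exists>\<sigma>\<in>psh_hom Y X.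
        psh_comp X \<sigma> \<tau> = psh_id X \<and> psh_comp Y \<tau> \<sigma> = psh_id Y)"

text \<open>
  Modular operads of all types \<open>('u, 'c, 'x) modop\<close> are considered, and morphisms go between
  operads of different types. A presheaf with values in \<open>'p set\<close> that satisfies the Segal
  condition comes from an operad with colors and operations in \<open>'p\<close>, since these are elements
  of its values at the exceptional edge and at stars.
\<close>

definition nerve ::
  "('u, 'c, 'x) modop \<Rightarrow> ('u, ('u, 'u, 'u gelts, 'c, 'x) csm_mor) psh" where
  "nerve P =
     \<lparr>pob = (\<lambda>G. csm_hom (gmod G) P),
      par = (\<lambda>G H f. \<lambda>h\<in>csm_hom (gmod H) P. csm_comp (gmod G) h f)\<rparr>"

definition nerve_map ::
  "('u, 'c, 'x) modop \<Rightarrow> ('u, 'c, 'x, 'd, 'y) csm_mor \<Rightarrow>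
     'u graph \<Rightarrow> ('u, 'u, 'u gelts, 'c, 'x) csm_mor \<Rightarrow> ('u, 'u, 'u gelts, 'd, 'y) csm_mor" where
  "nerve_map P g = (\<lambda>G\<in>U_ob. \<lambda>h\<in>csm_hom (gmod G) P. csm_comp (gmod G) g h)"

definition rep :: "'u graph \<Rightarrow> ('u, 'u umor) psh" where
  "rep G =
     \<lparr>pob = (\<lambda>K. U_hom K G),
      par = (\<lambda>K L f. \<lambda>h\<in>U_hom L G. csm_comp (gmod K) h f)\<rparr>"


section \<open>The Segal condition\<close>

definition edge_mor :: "'u graph \<Rightarrow> 'u \<Rightarrow> 'u umor" where
  "edge_mor H a = (THE f. f \<in> U_hom exc_edge H \<and> fst f eps = a)"

definition vertex_col :: "'u graph \<Rightarrow> 'u \<Rightarrow> 'u \<Rightarrow> 'u" where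
  "vertex_col G v = (\<lambda>a\<in>gA (star_at G v). if a \<in> nb G v then a
                       else gi G (gi (star_at G v) a))"

text \<open>
  The generator \<open>v\<close> of \<open>star_at G v\<close> lives at \<open>p = (nb(v)\<^sup>\<dagger>, incl)\<close>; its image is the
  element labelled \<open>v\<close> at \<open>(nb(v)\<^sup>\<dagger>, d\<^sup>\<dagger> \<mapsto> i d)\<close>, which corresponds to the generator
  \<open>v\<close> at \<open>(i nb(v), incl)\<close> under the bijection \<open>d\<^sup>\<dagger> \<mapsto> i d\<close>.
\<close>

definition vertex_mor :: "'u graph \<Rightarrow> 'u \<Rightarrow> 'u umor" where
  "vertex_mor G v = (THE f. f \<in> U_hom (star_at G v) G \<and> fst f = vertex_col G v \<and>
     (let S = inb (star_at G v) v; p = (S, \<lambda>a\<in>S. a) in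
        snd f p (generator (star_at G v) p v) =
        generator G (recolor (vertex_col G v) p) v))"

text \<open>
  \<open>sc_rel G K\<close> generates the relation of the coequalizer at \<open>K\<close>: for an internal edge with arcs
  ordered as \<open>x\<close>, \<open>y = i x\<close>, the composites of a map \<open>g\<close> from \<open>K\<close> to the exceptional edge with
  \<open>\<epsilon> \<mapsto> x\<^sup>\<dagger>\<close> and with \<open>\<epsilon> \<mapsto> y\<close> are identified. All arcs \<open>x\<close> of internal edges are
  used, hence both orderings; the opposite ordering yields the same pairs (reversed, with \<open>g\<close>
  replaced by its composite with the flip of the exceptional edge), so that the generated
  equivalence is that for any choice of orderings.
\<close>

definition sc_rel :: "'u graph \<Rightarrow> 'u graph \<Rightarrow> (('u \<times> 'u umor) \<times> ('u \<times> 'u umor)) set" where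
  "sc_rel G K =
     {((tA G x, csm_comp (gmod K)
          (edge_mor (star_at G (tA G x)) (gi (star_at G (tA G x)) x)) g),
       (tA G (gi G x), csm_comp (gmod K) (edge_mor (star_at G (tA G (gi G x))) (gi G x)) g))
      | x g. x \<in> dA G \<and> gi G x \<in> dA G \<and> g \<in> U_hom K exc_edge}"

definition sc_elts :: "'u graph \<Rightarrow> 'u graph \<Rightarrow> ('u \<times> 'u umor) set" where
  "sc_elts G K = (SIGMA v:gV G. U_hom K (star_at G v))"

definition sc_coeq :: "'u graph \<Rightarrow> ('u, ('u \<times> 'u umor) set) psh" where
  "sc_coeq G =
     \<lparr>pob = (\<lambda>K. sc_elts G K // eqcl (sc_rel G K)),
      par = (\<lambda>K L f. \<lambda>k\<in>sc_elts G L // eqcl (sc_rel G L).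
               eqcl (sc_rel G K) `` ((\<lambda>(v, h). (v, csm_comp (gmod K) h f)) ` k))\<rparr>"

definition sc_map :: "'u graph \<Rightarrow> 'u graph \<Rightarrow> ('u \<times> 'u umor) set \<Rightarrow> 'u umor" where
  "sc_map G = (\<lambda>K\<in>U_ob. \<lambda>k\<in>pob (sc_coeq G) K.
     the_elem ((\<lambda>(v, h). csm_comp (gmod K) (vertex_mor G v) h) ` k))"

text \<open>
  For a safe connected graph without vertices (that is, isomorphic to the exceptional edge), the
  map from the Segal core is the identity and there is no condition.
\<close>

definition segal :: "('u, 'p) psh \<Rightarrow> bool" where
  "segal X \<longleftrightarrow>
     (\<forall>G\<in>U_ob. gV G \<noteq> {} \<longrightarrow>
        bij_betw (\<lambda>\<tau>. psh_comp (sc_coeq G) \<tau> (sc_map G))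
          (psh_hom (rep G) X) (psh_hom (sc_coeq G) X))"

end

theory Submission
  imports Defs
begin

text \<open>
  A morphism from the operad of a graph \<open>G\<close> to an operad \<open>P\<close> amounts to a decoration of \<open>G\<close>: a coloring of the
  arcs by colors of \<open>P\<close> and a compatible choice of operations of \<open>P\<close> at the vertices. A presheaf \<open>X\<close> has
  colors (the elements over the exceptional edge) and operations (the elements over the stars), hence
  decorations of \<open>G\<close> too, and the Segal core of \<open>G\<close> represents these. So \<open>X\<close> is Segal iff restriction to
  edges and stars identifies \<open>X(G)\<close> with the set of decorations of \<open>G\<close>, for all \<open>G\<close>.

  Given a Segal presheaf, a decoration of \<open>G\<close> is composed by extending it to an element of \<open>X(G)\<close> and
  restricting along the collapse, the morphism from a star to \<open>G\<close> that sends the generator to the class of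
  \<open>G\<close> itself. Associativity holds because the collapse onto \<open>G{H\<^sub>v}\<close> factors through the collapse onto \<open>G\<close>
  followed by the morphism refining each vertex \<open>v\<close> to \<open>H\<^sub>v\<close>, and because every morphism, restricted to the
  star of a vertex, is a collapse followed by an etale map. Naturality along etale maps and collapses
  likewise forces a map of nerves to preserve compositions, which gives fullness.
\<close>

section \<open>Graphs and etale maps\<close>

text \<open>The pivot is that a graph decorated in \<open>vertex_fun G\<close> is the same thing as
  an etale map to \<open>G\<close> (\<open>vf_dgr\<close>). Elements of the free operad on
  \<open>G\<close> are thus isomorphism classes of connected graphs over \<open>G\<close>, and a
  decoration of \<open>G\<close> extends to all of them by pullback. The obstacle is that
  substituted graphs are built from chosen representatives, so that different constructions of the
  same graph agree only up to isomorphism. Hence substitution is handled as a relation,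
  \<open>is_sub\<close> and its decorated form \<open>dsub\<close>, for which any model is as good
  as any other. The existence of a model is the combinatorial core: if some \<open>H v\<close> is an
  edge, gluing passes through it to a further edge, and one has to see where such chains end and to
  exclude that they lead from an arc to its own partner. A chain that closes up gives a nodeless
  loop. Such loops are legitimate colored graphs, but not objects of the category on which
  presheaves live; they are replaced by \<open>hat\<close>, which changes the boundary while keeping
  the generated operad.\<close>

lemma gi_in: "is_graph G ==> a : gA G ==> gi G a : gA G"
  by (auto simp: is_graph_def)

lemma gi_gi: "is_graph G ==> a : gA G ==> gi G (gi G a) = a"
  by (auto simp: is_graph_def)

lemma gi_neq: "is_graph G ==> a : gA G ==> gi G a ~= a"
  by (auto simp: is_graph_def)

lemma inj_gi: "is_graph G ==> inj_on (gi G) (gA G)"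
  by (metis gi_gi inj_onI)

lemma finite_gA: "is_graph G ==> finite (gA G)"
  by (simp add: is_graph_def)

lemma finite_gV: "is_graph G ==> finite (gV G)"
  by (simp add: is_graph_def)

lemma tA_gs: "is_graph G ==> d : gD G ==> tA G (gs G d) = gt G d"
  by (simp add: is_graph_def tA_def)

lemma nb_iff: "is_graph G ==> a : nb G v \<longleftrightarrow> a : dA G & tA G a = v"
  by (auto simp: nb_def dA_def tA_gs)

lemma dA_gA: "is_graph G ==> a : dA G ==> a : gA G"
  by (auto simp: is_graph_def dA_def)

lemma tA_gV: "is_graph G ==> a : dA G ==> tA G a : gV G"
  by (auto simp: dA_def tA_gs) (auto simp: is_graph_def)

lemma nb_gA: "is_graph G ==> a : nb G v ==> a : gA G"
  by (simp add: nb_iff dA_gA)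

lemma nb_gV: "is_graph G ==> a : nb G v ==> v : gV G"
  by (auto simp add: nb_iff tA_gV)

lemma nb_unique: "is_graph G ==> a : nb G v ==> a : nb G w ==> v = w"
  by (auto simp add: nb_iff)

lemma dA_iff_nb: "is_graph G ==> a : dA G \<longleftrightarrow> (EX v:gV G. a : nb G v)"
  by (auto simp add: nb_iff tA_gV)

lemma inb_iff: "is_graph G ==> a : inb G v \<longleftrightarrow> a : gA G & gi G a : nb G v"
  unfolding inb_def by (force simp: gi_in gi_gi nb_gA)

lemma inb_gA: "is_graph G ==> a : inb G v ==> a : gA G"
  by (simp add: inb_iff)

lemma inb_gV: "is_graph G ==> a : inb G v ==> v : gV G"
  by (auto simp add: inb_iff nb_gV)

lemma finite_inb: "is_graph G ==> finite (inb G v)"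
  by (meson finite_gA finite_subset inb_gA subsetI)

lemma gB_gA: "is_graph G ==> b : gB G ==> b : gA G"
  by (auto simp: is_graph_def)

lemma gB_dA: "is_graph G ==> b : gB G ==> b \<notin> dA G"
  by (auto simp: is_graph_def)

lemma conn_graph: "connected_graph G ==> is_graph G"
  by (simp add: connected_graph_def)

lemma conn_nonempty: "connected_graph G ==> gA G ~= {} | gV G ~= {}"
  by (simp add: connected_graph_def)

text \<open>Connectedness is defined with darts. In the form with the sets \<open>nb G v\<close> it
  speaks of arcs and vertices alone, as do most arguments below.\<close>

lemma clopen_iff:
  assumes "is_graph G"
  shows "(ALL d:gD G. gs G d : A1 \<longleftrightarrow> gt G d : V1) \<longleftrightarrow>
         (ALL v:gV G. ALL a:nb G v. a : A1 \<longleftrightarrow> v : V1)"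
proof (rule iffI; intro ballI)
  fix v a assume *: "ALL d:gD G. gs G d : A1 \<longleftrightarrow> gt G d : V1" and "a : nb G v"
  then obtain d where "d : gD G" "gt G d = v" "a = gs G d" by (auto simp: nb_def)
  then show "a : A1 \<longleftrightarrow> v : V1" using * by simp
next
  fix d assume *: "ALL v:gV G. ALL a:nb G v. a : A1 \<longleftrightarrow> v : V1" and d: "d : gD G"
  have "gt G d : gV G" using assms d by (auto simp: is_graph_def)
  moreover have "gs G d : nb G (gt G d)" using d by (auto simp: nb_def)
  ultimately show "gs G d : A1 \<longleftrightarrow> gt G d : V1" by (rule *[rule_format])
qed

text \<open>The hypotheses say that \<open>A1\<close> and \<open>V1\<close> form a union of
  components. Connectedness is used in this form and proved by \<open>connI\<close>.\<close>

lemma conn_clopen: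
  assumes "connected_graph G" "A1 \<subseteq> gA G" "V1 \<subseteq> gV G" "!!a. a : A1 ==> gi G a : A1"
    "!!v a. v : gV G ==> a : nb G v ==> a : A1 \<longleftrightarrow> v : V1"
  shows "(A1 = {} & V1 = {}) | (A1 = gA G & V1 = gV G)"
proof -
  have "ALL d:gD G. gs G d : A1 \<longleftrightarrow> gt G d : V1"
    unfolding clopen_iff[OF conn_graph[OF assms(1)]] using assms(5) by simp
  moreover have "gi G ` A1 \<subseteq> A1" using assms(4) by blast
  moreover have "A1 \<subseteq> gA G & V1 \<subseteq> gV G & gi G ` A1 \<subseteq> A1 &
      (ALL d:gD G. gs G d : A1 \<longleftrightarrow> gt G d : V1) -->
        (A1 = {} & V1 = {}) | (A1 = gA G & V1 = gV G)"
    using assms(1) unfolding connected_graph_def by (elim conjE allE)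
  ultimately show ?thesis using assms(2,3) by simp
qed

lemma connI:
  assumes "is_graph G" "gA G ~= {} | gV G ~= {}"
    "!!A1 V1. A1 \<subseteq> gA G ==> V1 \<subseteq> gV G ==> (!!a. a : A1 ==> gi G a : A1) ==>
      (!!v a. v : gV G ==> a : nb G v ==> a : A1 \<longleftrightarrow> v : V1) ==>
      (A1 = {} & V1 = {}) | (A1 = gA G & V1 = gV G)"
  shows "connected_graph G"
  unfolding connected_graph_def
proof (intro conjI allI impI)
  fix A1 V1
  assume *: "A1 \<subseteq> gA G & V1 \<subseteq> gV G & gi G ` A1 \<subseteq> A1 &
        (ALL d:gD G. gs G d : A1 \<longleftrightarrow> gt G d : V1)"
  then have "ALL d:gD G. gs G d : A1 \<longleftrightarrow> gt G d : V1" by (elim conjE)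
  then have "ALL v:gV G. ALL a:nb G v. a : A1 \<longleftrightarrow> v : V1"
    by (simp only: clopen_iff[OF assms(1)] simp_thms)
  then show "(A1 = {} & V1 = {}) | (A1 = gA G & V1 = gV G)"
    using * by (intro assms(3)) auto
qed (use assms in auto)

text \<open>The arcs of the edges with an end at a vertex, together with all vertices, form a union
  of components, which is nonempty as there is a vertex.\<close>

lemma conn_arc_cases:
  assumes c: "connected_graph G" and "gV G ~= {}" "a : gA G"
  shows "a : dA G | gi G a : dA G"
proof -
  note g = conn_graph[OF c]
  let ?A1 = "{a : gA G. a : dA G | gi G a : dA G}"
  have "(?A1 = {} & gV G = {}) | (?A1 = gA G & gV G = gV G)"
    using g by (intro conn_clopen[OF c]) (auto simp: gi_in gi_gi nb_iff dA_gA)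
  then show ?thesis using assms by blast
qed

lemma no_vertices_dA: "is_graph G ==> gV G = {} ==> dA G = {}"
  by (auto simp: dA_iff_nb)

text \<open>In the absence of vertices a single edge is already a union of components.\<close>

lemma conn_edge:
  assumes c: "connected_graph G" and e: "gV G = {}" and a: "a : gA G"
  shows "gA G = {a, gi G a}"
proof -
  note g = conn_graph[OF c]
  have "({a, gi G a} = {} & gV G = {}) | ({a, gi G a} = gA G & gV G = gV G)"
    using g a e by (intro conn_clopen[OF c]) (auto simp: gi_in gi_gi)
  then show ?thesis by blast
qed

text \<open>A connected graph is thus safe or a nodeless loop. Without vertices, \<open>gB G\<close>
  is closed under the involution of the only edge, hence empty or everything. With vertices, an arc
  outside \<open>dA G\<close> has its partner in \<open>dA G\<close>, and the axioms put such an arc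
  into the boundary.\<close>

lemma gB_cases:
  assumes c: "connected_graph G"
  shows "gB G = gA G - dA G | gV G = {} & gB G = {}"
proof (cases "gV G = {}")
  case True
  note g = conn_graph[OF c]
  have d: "dA G = {}" using no_vertices_dA[OF g True] .
  have cl: "gi G b : gB G" if "b : gB G" for b using g d that unfolding is_graph_def by auto
  have "gB G = gA G" if "b : gB G" for b
    using conn_edge[OF c True gB_gA[OF g that]] that cl[OF that] gB_gA[OF g] by (intro equalityI) auto
  then show ?thesis using d True by blast
next
  case False
  note g = conn_graph[OF c]
  have "b : gB G" if "b : gA G" "b \<notin> dA G" for b
  proof -
    have "gi G b : dA G" using conn_arc_cases[OF c False] that by blast
    then have "b : gi G ` dA G - dA G" using that gi_gi[OF g] by (metis DiffI imageI)
    then show ?thesis using g unfolding is_graph_def by blast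
  qed
  then show ?thesis using gB_gA[OF g] gB_dA[OF g] by blast
qed

text \<open>
  A nodeless loop is not safe; filling in its boundary makes it so and does not change the operad it
  generates.
\<close>

definition hat :: "'u graph => 'u graph" where
  "hat G = G\<lparr>gB := gA G - dA G\<rparr>"

lemma hat_simps [simp]:
  "gA (hat G) = gA G" "gD (hat G) = gD G" "gV (hat G) = gV G" "gi (hat G) = gi G"
  "gs (hat G) = gs G" "gt (hat G) = gt G" "gB (hat G) = gA G - dA G"
  "dA (hat G) = dA G" "nb (hat G) = nb G" "inb (hat G) = inb G" "arcset (hat G) = arcset G"
  "vertex_fun (hat G) = vertex_fun G" "gmod (hat G) = gmod G"
  by (auto simp: hat_def dA_def nb_def inb_def arcset_def vertex_fun_def gmod_def fun_eq_iff)

lemma hat_graph: "is_graph G ==> is_graph (hat G)"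
proof -
  assume g: "is_graph G"
  have "gi G x \<notin> dA G & gi G x \<notin> gi G ` dA G"
    if "x : gA G" "x \<notin> dA G" "x \<notin> gi G ` dA G" for x
    using that gi_gi[OF g] dA_gA[OF g] by (auto simp: image_iff) metis
  moreover have "gi G x : gA G" if "x : gA G" for x using gi_in[OF g that] .
  ultimately show "is_graph (hat G)" using g dA_gA[OF g] unfolding is_graph_def by auto
qed

lemma hat_conn: "connected_graph G ==> connected_graph (hat G)"
  unfolding connected_graph_def using hat_graph by (auto simp: hat_def)

lemma hat_U: "connected_graph G ==> hat G : U_ob"
  by (simp add: U_ob_def hat_conn safe_def)

lemma hat_id: "G : U_ob ==> hat G = G"
  by (simp add: U_ob_def safe_def hat_def)

lemma U_conn: "G : U_ob ==> connected_graph G"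
  by (simp add: U_ob_def)

text \<open>An etale map is formulated with arcs and vertices alone. Bijectivity on each
  \<open>nb H w\<close> is what the transport of decorations requires; globally \<open>al\<close>
  and \<open>nu\<close> may be far from injective.\<close>

definition et :: "'u graph => 'u graph => ('u => 'u) => ('u => 'u) => bool" where
  "et H K al nu \<longleftrightarrow> (ALL a:gA H. al a : gA K & al (gi H a) = gi K (al a)) &
     (ALL w:gV H. nu w : gV K & bij_betw al (nb H w) (nb K (nu w)))"

lemma et_A: "et H K al nu ==> a : gA H ==> al a : gA K"
  and et_i: "et H K al nu ==> a : gA H ==> al (gi H a) = gi K (al a)"
  and et_V: "et H K al nu ==> w : gV H ==> nu w : gV K"
  and et_nb: "et H K al nu ==> w : gV H ==> bij_betw al (nb H w) (nb K (nu w))"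
  by (auto simp: et_def)

lemma et_inb:
  assumes e: "et H K al nu" and h: "is_graph H" and k: "is_graph K" and w: "w : gV H"
  shows "bij_betw al (inb H w) (inb K (nu w))"
proof -
  have b: "bij_betw al (nb H w) (nb K (nu w))" using et_nb[OF e w] .
  have eq: "al a = gi K (al (gi H a))" if "a : gA H" for a
    using that h k e by (metis et_A et_i gi_gi)
  have "inj_on al (inb H w)"
  proof (rule inj_onI)
    fix a b assume ab: "a : inb H w" "b : inb H w" "al a = al b"
    then have "al (gi H a) = al (gi H b)" using et_i[OF e] inb_gA[OF h] by simp
    then have "gi H a = gi H b"
      using b ab inb_iff[OF h] by (meson bij_betw_def inj_onD)
    then show "a = b" using ab inb_gA[OF h] gi_gi[OF h] by metis
  qed
  moreover have "al ` inb H w = inb K (nu w)"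
  proof -
    have "al ` inb H w = (\<lambda>a. al (gi H a)) ` nb H w" by (simp add: inb_def image_image)
    also have "\<dots> = (\<lambda>a. gi K (al a)) ` nb H w"
      using et_i[OF e] nb_gA[OF h] by (intro image_cong) auto
    also have "\<dots> = inb K (nu w)" using b by (metis bij_betw_def image_image inb_def)
    finally show ?thesis .
  qed
  ultimately show ?thesis by (simp add: bij_betw_def)
qed

lemma et_id: "et G G (\<lambda>a. a) (\<lambda>v. v)"
  by (simp add: et_def bij_betw_def)

lemma et_comp: "et H K al nu ==> et K L be mu ==> et H L (\<lambda>a. be (al a)) (\<lambda>v. mu (nu v))"
  by (simp add: et_def) (metis (full_types) bij_betw_trans[unfolded comp_def])

lemma et_cong:
  assumes "is_graph H" "!!a. a : gA H ==> al a = al' a" "!!w. w : gV H ==> nu w = nu' w"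
  shows "et H K al nu \<longleftrightarrow> et H K al' nu'"
proof -
  have "bij_betw al (nb H w) Y \<longleftrightarrow> bij_betw al' (nb H w) Y" for w Y
    using assms(2) nb_gA[OF assms(1)] by (intro bij_betw_cong) auto
  then show ?thesis unfolding et_def using assms(2,3) gi_in[OF assms(1)] by simp
qed

lemma et_hat [simp]: "et (hat H) K = et H K" "et H (hat K) = et H K"
  by (auto simp: et_def fun_eq_iff)

text \<open>The map on darts is determined by that on arcs because \<open>gs\<close> is injective.
  Isomorphisms are therefore the bijective etale maps that respect the boundary, and graphs can be
  compared without mentioning darts.\<close>

lemma graph_iso_iff_et:
  assumes g: "is_graph G" and g': "is_graph G'"
  shows "(EX de. graph_iso G G' al de nu) \<longleftrightarrow> et G G' al nu & bij_betw al (gA G) (gA G') &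
           bij_betw nu (gV G) (gV G') & al ` gB G = gB G'" (is "?L \<longleftrightarrow> ?R")
proof
  assume ?L
  then obtain de where i: "graph_iso G G' al de nu" by blast
  have d: "bij_betw de (gD G) (gD G')" and ba: "bij_betw al (gA G) (gA G')"
    and bv: "bij_betw nu (gV G) (gV G')"
    and ds: "!!d. d : gD G ==> al (gs G d) = gs G' (de d) & nu (gt G d) = gt G' (de d)"
    using i by (auto simp: graph_iso_def)
  have gt: "gt G d : gV G" if "d : gD G" for d using g that by (auto simp: is_graph_def)
  have "bij_betw al (nb G w) (nb G' (nu w))" if w: "w : gV G" for w
  proof -
    have "inj_on al (nb G w)" using ba nb_gA[OF g] by (meson bij_betw_def inj_on_subset subsetI)
    moreover have "al ` nb G w = nb G' (nu w)"
    proof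
      show "al ` nb G w \<subseteq> nb G' (nu w)"
        using ds d by (fastforce simp: nb_def bij_betw_def)
      show "nb G' (nu w) \<subseteq> al ` nb G w"
      proof
        fix b assume "b : nb G' (nu w)"
        then obtain d' where d': "d' : gD G'" "gt G' d' = nu w" "b = gs G' d'" by (auto simp: nb_def)
        then obtain d0 where d0: "d0 : gD G" "d' = de d0" using d by (auto simp: bij_betw_def)
        then have "nu (gt G d0) = nu w" using ds d' by metis
        then have "gt G d0 = w" using bv gt d0 w by (meson bij_betw_def inj_onD)
        then show "b : al ` nb G w" using d0 d' ds by (intro image_eqI[where x="gs G d0"]) (auto simp: nb_def)
      qed
    qed
    ultimately show ?thesis by (simp add: bij_betw_def)
  qed
  moreover have "nu w : gV G'" if "w : gV G" for w using bv that by (auto simp: bij_betw_def)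
  moreover have "al a : gA G'" if "a : gA G" for a using ba that by (auto simp: bij_betw_def)
  ultimately show ?R using i unfolding et_def graph_iso_def by simp
next
  assume R: ?R
  then have e: "et G G' al nu" and ba: "bij_betw al (gA G) (gA G')"
    and bv: "bij_betw nu (gV G) (gV G')" by auto
  let ?de = "\<lambda>d. inv_into (gD G') (gs G') (al (gs G d))"
  have in': "inj_on (gs G') (gD G')" and ing: "inj_on (gs G) (gD G)"
    and gsA: "!!d. d : gD G ==> gs G d : gA G" and gtV: "!!d. d : gD G ==> gt G d : gV G"
    using g g' by (auto simp: is_graph_def)
  \<comment> \<open>Both sides are unions of the sets \<open>nb\<close> over all vertices, and
    \<open>nu\<close> is onto.\<close>
  have "al ` dA G = dA G'"
  proof -
    have "dA G = (\<Union>w\<in>gV G. nb G w)" using dA_iff_nb[OF g] by auto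
    then have "al ` dA G = (\<Union>w\<in>gV G. al ` nb G w)" by (simp add: image_UN)
    also have "\<dots> = (\<Union>w\<in>gV G. nb G' (nu w))"
      using et_nb[OF e] by (intro SUP_cong) (simp_all add: bij_betw_def)
    also have "\<dots> = (\<Union>w\<in>gV G'. nb G' w)" using bv by (simp add: bij_betw_def flip: image_image)
    also have "\<dots> = dA G'" using dA_iff_nb[OF g'] by auto
    finally show ?thesis .
  qed
  then have im: "al ` gs G ` gD G = gs G' ` gD G'" by (simp add: dA_def)
  have mem: "al (gs G d) : gs G' ` gD G'" if "d : gD G" for d using im that by blast
  have s: "gs G' (?de d) = al (gs G d)" if "d : gD G" for d by (rule f_inv_into_f[OF mem[OF that]])
  have deD: "?de d : gD G'" if "d : gD G" for d by (rule inv_into_into[OF mem[OF that]])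
  have t: "nu (gt G d) = gt G' (?de d)" if d: "d : gD G" for d
  proof -
    have "gs G d : nb G (gt G d)" using d by (auto simp: nb_def)
    then have "gs G' (?de d) : nb G' (nu (gt G d))"
      using et_nb[OF e gtV[OF d]] s[OF d] by (auto simp: bij_betw_def)
    then show ?thesis using nb_iff[OF g'] tA_gs[OF g' deD[OF d]] by auto
  qed
  have "bij_betw ?de (gD G) (gD G')"
    unfolding bij_betw_def
  proof
    show "inj_on ?de (gD G)"
    proof (rule inj_onI)
      fix x y assume xy: "x : gD G" "y : gD G" "?de x = ?de y"
      then have "al (gs G x) = al (gs G y)" using s by metis
      then show "x = y" using xy ba ing gsA by (meson bij_betw_def inj_onD)
    qed
    show "?de ` gD G = gD G'"
    proof
      show "?de ` gD G \<subseteq> gD G'" using deD by auto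
      show "gD G' \<subseteq> ?de ` gD G"
      proof
        fix d' assume d': "d' : gD G'"
        then obtain d where d: "d : gD G" "al (gs G d) = gs G' d'" using im by (force simp: image_iff)
        then have "?de d = d'" using in' d' by simp
        then show "d' : ?de ` gD G" using d by blast
      qed
    qed
  qed
  then have "graph_iso G G' al ?de nu"
    unfolding graph_iso_def using R s t et_i[OF e] by simp
  then show ?L by blast
qed

section \<open>Graphs with boundary up to isomorphism\<close>

lemma ba_in:
  "bij_functor C X ==> p : bij_ob C ==> q : bij_ob C ==> si : bij_hom p q ==> x : bo X p ==>
     ba X p q si x : bo X q"
  unfolding bij_functor_def by blast

lemma ba_id:
  "bij_functor C X ==> p : bij_ob C ==> x : bo X p ==> ba X p p (\<lambda>s\<in>fst p. s) x = x"
  unfolding bij_functor_def by blast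

lemma ba_comp:
  "bij_functor C X ==> p : bij_ob C ==> q : bij_ob C ==> r : bij_ob C ==> si : bij_hom p q ==>
     ta : bij_hom q r ==> x : bo X p ==>
     ba X q r ta (ba X p q si x) = ba X p r (\<lambda>s\<in>fst p. ta (si s)) x"
  unfolding bij_functor_def compose_def by fastforce

lemma bij_hom_comp:
  assumes "si : bij_hom p q" "ta : bij_hom q r"
  shows "(\<lambda>s\<in>fst p. ta (si s)) : bij_hom p r"
proof -
  have a: "bij_betw si (fst p) (fst q)" "bij_betw ta (fst q) (fst r)"
    using assms by (auto simp: bij_hom_def)
  have "bij_betw (\<lambda>s\<in>fst p. ta (si s)) (fst p) (fst r)"
    using bij_betw_trans[OF a] by (simp add: comp_def)
  moreover have "!!s. s : fst p ==> si s : fst q" using a by (auto simp: bij_betw_def)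
  ultimately show ?thesis using assms by (auto simp: bij_hom_def)
qed

lemma bij_hom_inv:
  assumes "si : bij_hom p q"
  shows "(\<lambda>t\<in>fst q. inv_into (fst p) si t) : bij_hom q p"
proof -
  have a: "bij_betw si (fst p) (fst q)" using assms by (auto simp: bij_hom_def)
  have "bij_betw (\<lambda>t\<in>fst q. inv_into (fst p) si t) (fst q) (fst p)"
    using bij_betw_inv_into[OF a] by simp
  moreover have "snd p (inv_into (fst p) si t) = snd q t" if t: "t : fst q" for t
  proof -
    have "inv_into (fst p) si t : fst p" "si (inv_into (fst p) si t) = t"
      using a t by (auto simp: bij_betw_def inv_into_into f_inv_into_f)
    then show ?thesis using assms by (auto simp: bij_hom_def)
  qed
  ultimately show ?thesis by (auto simp: bij_hom_def)
qed

lemma bij_hom_id: "(\<lambda>s\<in>fst p. s) : bij_hom p p"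
  by (auto simp: bij_hom_def bij_betw_def inj_on_def)

lemma ba_inj:
  assumes X: "bij_functor C X" and p: "p : bij_ob C" and q: "q : bij_ob C"
    and s: "si : bij_hom p q" and x: "x : bo X p"
  shows "ba X q p (\<lambda>t\<in>fst q. inv_into (fst p) si t) (ba X p q si x) = x"
proof -
  have b: "bij_betw si (fst p) (fst q)" using s by (auto simp: bij_hom_def)
  then have m: "!!u. u : fst p ==> si u : fst q" by (auto simp: bij_betw_def)
  have "(\<lambda>u\<in>fst p. (\<lambda>t\<in>fst q. inv_into (fst p) si t) (si u)) = (\<lambda>u\<in>fst p. u)"
    using b m by (auto simp: fun_eq_iff bij_betw_def)
  then show ?thesis using ba_comp[OF X p q p s bij_hom_inv[OF s] x] ba_id[OF X p x] by simp
qed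

section \<open>Colorings, decorations and their transport along etale maps\<close>

lemma at_fst [simp]: "fst (at_vertex G ze v) = inb G v"
  and at_snd [simp]: "snd (at_vertex G ze v) = restrict ze (inb G v)"
  by (auto simp: at_vertex_def)

lemma at_hat [simp]: "at_vertex (hat G) = at_vertex G"
  by (auto simp: at_vertex_def fun_eq_iff)

lemma deco_hat [simp]: "deco X (hat G) = deco X G"
  by (auto simp: deco_def fun_eq_iff)

lemma inv_mapsD:
  assumes "ze : inv_maps (arcset G) C"
  shows "a : gA G ==> ze a : cols C" "a : gA G ==> ze (gi G a) = cinv C (ze a)"
    "ze : extensional (gA G)"
  using assms by (auto simp: inv_maps_def arcset_def PiE_def)

lemma inv_mapsI:
  "[|ze : extensional (gA G); !!a. a : gA G ==> ze a : cols C;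
    !!a. a : gA G ==> ze (gi G a) = cinv C (ze a)|] ==> ze : inv_maps (arcset G) C"
  by (auto simp: inv_maps_def arcset_def PiE_def)

lemma at_ob:
  assumes "is_graph G" "ze : inv_maps (arcset G) C"
  shows "at_vertex G ze v : bij_ob C"
  using finite_inb[OF assms(1)] inb_gA[OF assms(1)] inv_mapsD(1)[OF assms(2)]
  by (auto simp: at_vertex_def bij_ob_def)

lemma at_cong:
  "is_graph G ==> (!!a. a : gA G ==> ze a = ze' a) ==> at_vertex G ze v = at_vertex G ze' v"
  unfolding at_vertex_def by (auto simp: fun_eq_iff restrict_def inb_gA)

lemma recolor_at:
  "is_graph G ==> recolor ph (at_vertex G ze v) = at_vertex G (\<lambda>a\<in>gA G. ph (ze a)) v"
  by (auto simp: at_vertex_def recolor_def fun_eq_iff restrict_def inb_gA)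

definition cpt :: "'u graph => ('u => 'c) => ('u => 'c) => ('u => 'u) => bool" where
  "cpt H ze ze' al \<longleftrightarrow> (ALL a:gA H. ze' (al a) = ze a)"

lemma cptD: "cpt H ze ze' al ==> a : gA H ==> ze' (al a) = ze a"
  by (simp add: cpt_def)

lemma et_hom:
  assumes "et H K al nu" "is_graph H" "is_graph K" "cpt H ze ze' al" "w : gV H"
  shows "restrict al (inb H w) : bij_hom (at_vertex H ze w) (at_vertex K ze' (nu w))"
proof -
  have b: "bij_betw al (inb H w) (inb K (nu w))" using et_inb[OF assms(1-3,5)] .
  then have "bij_betw (restrict al (inb H w)) (inb H w) (inb K (nu w))"
    by simp
  moreover have "!!s. s : inb H w ==> al s : inb K (nu w)" using b by (auto simp: bij_betw_def)
  ultimately show ?thesis using cptD[OF assms(4)] inb_gA[OF assms(2)] by (auto simp: bij_hom_def)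
qed

text \<open>Decorated graphs, and etale maps transporting one decoration to another.\<close>

definition det ::
  "('u, 'c, 'x) bfun => 'u graph => ('u => 'c) => ('u => 'x) => 'u graph => ('u => 'c) => ('u => 'x) =>
     ('u => 'u) => ('u => 'u) => bool" where
  "det X H ze x K ze' x' al nu \<longleftrightarrow> et H K al nu & cpt H ze ze' al &
     (ALL w:gV H. x' (nu w) =
        ba X (at_vertex H ze w) (at_vertex K ze' (nu w)) (restrict al (inb H w)) (x w))"

text \<open>A decorated graph before its boundary is labelled. By \<open>gr_elts_iff\<close> the
  elements from which the colimit is formed are such graphs with a labelling \<open>f\<close> of the
  boundary.\<close>

definition dgr :: "'c cset => ('u, 'c, 'x) bfun => 'u graph => ('u => 'c) => ('u => 'x) => bool" where
  "dgr C X G ze x \<longleftrightarrow> connected_graph G & ze : inv_maps (arcset G) C & x : deco X G ze"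

lemma dgrD:
  assumes "dgr C X G ze x"
  shows "connected_graph G" "is_graph G" "ze : inv_maps (arcset G) C" "x : deco X G ze"
    "!!v. at_vertex G ze v : bij_ob C" "!!v. v : gV G ==> x v : bo X (at_vertex G ze v)"
    "!!a. a : gA G ==> ze a : cols C" "!!a. a : gA G ==> ze (gi G a) = cinv C (ze a)"
    "ze : extensional (gA G)" "x : extensional (gV G)"
proof -
  show a: "connected_graph G" "ze : inv_maps (arcset G) C" "x : deco X G ze"
    using assms by (auto simp: dgr_def)
  then show "is_graph G" by (simp add: conn_graph)
  then show "!!v. at_vertex G ze v : bij_ob C" using a by (simp add: at_ob)
  show "!!v. v : gV G ==> x v : bo X (at_vertex G ze v)" "x : extensional (gV G)"
    using a by (auto simp: deco_def PiE_def)
  show "!!a. a : gA G ==> ze a : cols C" "!!a. a : gA G ==> ze (gi G a) = cinv C (ze a)"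
    "ze : extensional (gA G)" using inv_mapsD[OF a(2)] by auto
qed

lemma dgrI:
  assumes "connected_graph G" "ze : extensional (gA G)" "x : extensional (gV G)"
    "!!a. a : gA G ==> ze a : cols C" "!!a. a : gA G ==> ze (gi G a) = cinv C (ze a)"
    "!!v. v : gV G ==> x v : bo X (at_vertex G ze v)"
  shows "dgr C X G ze x"
  using assms by (auto simp: dgr_def deco_def PiE_def inv_mapsI)

lemma dgr_hat: "dgr C X G ze x ==> dgr C X (hat G) ze x"
  by (simp add: dgr_def hat_conn)

lemma gr_elts_iff:
  "((f, G, ze), x) : gr_elts C X p \<longleftrightarrow> dgr C X G ze x & f : extensional (fst p) &
     bij_betw f (fst p) (gB G) & (ALL s:fst p. ze (f s) = snd p s)"
  by (auto simp: gr_elts_def gr_def dgr_def)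

lemma det_D:
  assumes "det X H ze x K ze' x' al nu"
  shows "et H K al nu" "cpt H ze ze' al"
    "!!w. w : gV H ==> x' (nu w) =
        ba X (at_vertex H ze w) (at_vertex K ze' (nu w)) (restrict al (inb H w)) (x w)"
  using assms by (auto simp: det_def)

lemma det_cong:
  assumes g: "is_graph H" and "!!a. a : gA H ==> al a = al' a" "!!w. w : gV H ==> nu w = nu' w"
  shows "det X H ze x K ze' x' al nu \<longleftrightarrow> det X H ze x K ze' x' al' nu'"
proof -
  have "restrict al (inb H w) = restrict al' (inb H w)" for w
    using assms inb_gA[OF g] by (auto simp: fun_eq_iff restrict_def)
  then show ?thesis unfolding det_def cpt_def using assms(2,3) et_cong[OF assms] by simp
qed

lemma det_id:
  assumes "bij_functor C X" "dgr C X G ze x"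
  shows "det X G ze x G ze x (\<lambda>a. a) (\<lambda>v. v)"
  using ba_id[OF assms(1) dgrD(5,6)[OF assms(2)]] by (simp add: det_def cpt_def et_id)

text \<open>Functoriality of \<open>X\<close> for the transports that occur in \<open>det\<close>.
  The assumption on \<open>be\<close> is local at the vertex \<open>nu w\<close>, so the lemma also
  serves for maps going back.\<close>

lemma tr_comp:
  assumes X: "bij_functor C X"
    and obs: "at_vertex H ze w : bij_ob C" "at_vertex K ze' (nu w) : bij_ob C" "at_vertex L ze'' u : bij_ob C"
    and x: "x : bo X (at_vertex H ze w)"
    and g: "is_graph H" "is_graph K" "is_graph L"
    and a: "et H K al nu" "cpt H ze ze' al" "w : gV H"
    and b: "restrict be (inb K (nu w)) : bij_hom (at_vertex K ze' (nu w)) (at_vertex L ze'' u)"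
  shows "ba X (at_vertex K ze' (nu w)) (at_vertex L ze'' u) (restrict be (inb K (nu w)))
      (ba X (at_vertex H ze w) (at_vertex K ze' (nu w)) (restrict al (inb H w)) x) =
    ba X (at_vertex H ze w) (at_vertex L ze'' u) (restrict (\<lambda>a. be (al a)) (inb H w)) x"
proof -
  have "!!s. s : inb H w ==> al s : inb K (nu w)"
    using et_inb[OF a(1) g(1,2) a(3)] by (auto simp: bij_betw_def)
  then have "(\<lambda>s\<in>inb H w. restrict be (inb K (nu w)) (restrict al (inb H w) s)) =
       restrict (\<lambda>a. be (al a)) (inb H w)" by (auto simp: fun_eq_iff)
  then show ?thesis
    using ba_comp[OF X obs et_hom[OF a(1) g(1,2) a(2,3)] b x] by simp
qed

lemma det_comp:
  assumes X: "bij_functor C X" and d: "dgr C X H ze x" "dgr C X K ze' x'" "dgr C X L ze'' x''"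
    and a: "det X H ze x K ze' x' al nu" and b: "det X K ze' x' L ze'' x'' be mu"
  shows "det X H ze x L ze'' x'' (\<lambda>a. be (al a)) (\<lambda>v. mu (nu v))"
proof -
  note A = det_D[OF a] and B = det_D[OF b]
  note g = d[THEN dgrD(2)]
  have "x'' (mu (nu w)) = ba X (at_vertex H ze w) (at_vertex L ze'' (mu (nu w)))
      (restrict (\<lambda>a. be (al a)) (inb H w)) (x w)" if w: "w : gV H" for w
  proof -
    have v: "nu w : gV K" using et_V[OF A(1) w] .
    show ?thesis
      unfolding B(3)[OF v] A(3)[OF w]
      using w by (intro tr_comp[OF X dgrD(5)[OF d(1)] dgrD(5)[OF d(2)] dgrD(5)[OF d(3)] dgrD(6)[OF d(1) w] g A(1,2)]
        et_hom[OF B(1) g(2,3) B(2) v]) auto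
  qed
  moreover have "cpt H ze ze'' (\<lambda>a. be (al a))"
    using cptD[OF A(2)] cptD[OF B(2)] et_A[OF A(1)] by (simp add: cpt_def)
  ultimately show ?thesis unfolding det_def using et_comp[OF A(1) B(1)] by simp
qed

lemma et_inv:
  assumes g: "is_graph H" "is_graph K" and e: "et H K al nu"
    and ba: "bij_betw al (gA H) (gA K)" and bv: "bij_betw nu (gV H) (gV K)"
  shows "et K H (inv_into (gA H) al) (inv_into (gV H) nu)"
proof -
  let ?al = "inv_into (gA H) al" and ?nu = "inv_into (gV H) nu"
  have 1: "?al a : gA H" "al (?al a) = a" if "a : gA K" for a
    using ba that by (auto simp: bij_betw_def inv_into_into f_inv_into_f)
  have 2: "?nu v : gV H" "nu (?nu v) = v" if "v : gV K" for v
    using bv that by (auto simp: bij_betw_def inv_into_into f_inv_into_f)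
  have 3: "?al (al a) = a" if "a : gA H" for a
    using ba that by (auto simp: bij_betw_def)
  have i: "?al (gi K a) = gi H (?al a)" if a: "a : gA K" for a
    using 1[OF a] 3[OF gi_in[OF g(1) 1(1)[OF a]]] et_i[OF e 1(1)[OF a]] by simp
  have "bij_betw ?al (nb K v) (nb H (?nu v))" if v: "v : gV K" for v
  proof (rule bij_betw_byWitness[where f'=al])
    have b: "bij_betw al (nb H (?nu v)) (nb K v)" using et_nb[OF e 2(1)[OF v]] 2(2)[OF v] by simp
    show "ALL a:nb K v. al (?al a) = a" using 1 nb_gA[OF g(2)] by auto
    show "ALL a:nb H (?nu v). ?al (al a) = a" using 3 nb_gA[OF g(1)] by auto
    show "al ` nb H (?nu v) \<subseteq> nb K v" using b by (auto simp: bij_betw_def)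
    have im: "nb K v = al ` nb H (?nu v)" using b by (simp add: bij_betw_def)
    show "?al ` nb K v \<subseteq> nb H (?nu v)" unfolding im using 3 nb_gA[OF g(1)] by auto
  qed
  then show ?thesis unfolding et_def using 1(1) 2(1) i by simp
qed

text \<open>At each vertex, transport along \<open>al\<close> followed by transport along its
  inverse is transport along the identity.\<close>

lemma det_inv:
  assumes X: "bij_functor C X" and d: "dgr C X H ze x" "dgr C X K ze' x'"
    and a: "det X H ze x K ze' x' al nu"
    and ba: "bij_betw al (gA H) (gA K)" and bv: "bij_betw nu (gV H) (gV K)"
  shows "det X K ze' x' H ze x (inv_into (gA H) al) (inv_into (gV H) nu)"
proof -
  let ?al = "inv_into (gA H) al" and ?nu = "inv_into (gV H) nu"
  note A = det_D[OF a]
  note g = d[THEN dgrD(2)]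
  have e: "et K H ?al ?nu" using et_inv[OF g A(1) ba bv] .
  have 1: "?al a : gA H" "al (?al a) = a" if "a : gA K" for a
    using ba that by (auto simp: bij_betw_def inv_into_into f_inv_into_f)
  have 2: "?nu v : gV H" "nu (?nu v) = v" if "v : gV K" for v
    using bv that by (auto simp: bij_betw_def inv_into_into f_inv_into_f)
  have 3: "?al (al a) = a" if "a : gA H" for a
    using ba that by (auto simp: bij_betw_def)
  have c: "cpt K ze' ze ?al" unfolding cpt_def using 1 cptD[OF A(2)] by metis
  have "x (?nu v) = ba X (at_vertex K ze' v) (at_vertex H ze (?nu v)) (restrict ?al (inb K v)) (x' v)"
    if v: "v : gV K" for v
  proof -
    let ?w = "?nu v"
    note w = 2[OF v]
    have h: "restrict ?al (inb K (nu ?w)) : bij_hom (at_vertex K ze' (nu ?w)) (at_vertex H ze ?w)"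
      using et_hom[OF e g(2,1) c v] by (simp add: w(2))
    have "ba X (at_vertex K ze' (nu ?w)) (at_vertex H ze ?w) (restrict ?al (inb K (nu ?w))) (x' (nu ?w)) =
      ba X (at_vertex H ze ?w) (at_vertex H ze ?w) (restrict (\<lambda>a. ?al (al a)) (inb H ?w)) (x ?w)"
      unfolding A(3)[OF w(1)]
      using w(1) by (intro tr_comp[OF X dgrD(5)[OF d(1)] dgrD(5)[OF d(2)] dgrD(5)[OF d(1)] dgrD(6)[OF d(1) w(1)] g g(1) A(1,2)] h) auto
    also have "restrict (\<lambda>a. ?al (al a)) (inb H ?w) = (\<lambda>s\<in>fst (at_vertex H ze ?w). s)"
      using 3 inb_gA[OF g(1)] by (auto simp: fun_eq_iff restrict_def)
    also have "ba X (at_vertex H ze ?w) (at_vertex H ze ?w) \<dots> (x ?w) = x ?w"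
      by (rule ba_id[OF X dgrD(5)[OF d(1)] dgrD(6)[OF d(1) w(1)]])
    finally have "x ?w = ba X (at_vertex K ze' (nu ?w)) (at_vertex H ze ?w)
        (restrict ?al (inb K (nu ?w))) (x' (nu ?w))" by (rule sym)
    then show ?thesis by (simp only: w(2))
  qed
  then show ?thesis unfolding det_def using e c by blast
qed

text \<open>The boundary condition on isomorphisms has disappeared: it follows from compatibility
  with the labellings, which are onto the two boundaries.\<close>

lemma gr_rel_iff:
  "(((f, G, ze), x), ((f', G', ze'), x')) : gr_rel C X p \<longleftrightarrow>
     ((f, G, ze), x) : gr_elts C X p & ((f', G', ze'), x') : gr_elts C X p &
     (EX al nu. det X G ze x G' ze' x' al nu & bij_betw al (gA G) (gA G') & bij_betw nu (gV G) (gV G') &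
        (ALL s:fst p. al (f s) = f' s))" (is "?L \<longleftrightarrow> ?E & ?E' & ?R")
proof (cases "?E & ?E'")
  case True
  then have g: "is_graph G" "is_graph G'" and f: "bij_betw f (fst p) (gB G)"
      "bij_betw f' (fst p) (gB G')"
    unfolding gr_elts_iff by (auto simp: dgrD)
  have B: "al ` gB G = gB G'" if "ALL s:fst p. al (f s) = f' s" for al
  proof -
    have "al ` gB G = (\<lambda>s. al (f s)) ` fst p" using f by (simp add: bij_betw_def flip: image_image)
    also have "\<dots> = f' ` fst p" using that by simp
    finally show ?thesis using f by (simp add: bij_betw_def)
  qed
  have "?L \<longleftrightarrow> (EX al nu. (EX de. graph_iso G G' al de nu) &
           (ALL s:fst p. al (f s) = f' s) & (ALL a:gA G. ze' (al a) = ze a) &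
           (ALL v:gV G. x' (nu v) =
              ba X (at_vertex G ze v) (at_vertex G' ze' (nu v)) (restrict al (inb G v)) (x v)))"
    using True unfolding gr_rel_def by auto
  also have "\<dots> \<longleftrightarrow> ?R"
    unfolding graph_iso_iff_et[OF g] det_def cpt_def using B by blast
  finally show ?thesis using True by blast
next
  case False
  then show ?thesis by (auto simp: gr_rel_def)
qed

lemma gr_relI:
  "[|((f, G, ze), x) : gr_elts C X p; ((f', G', ze'), x') : gr_elts C X p;
    det X G ze x G' ze' x' al nu; bij_betw al (gA G) (gA G'); bij_betw nu (gV G) (gV G');
    !!s. s : fst p ==> al (f s) = f' s|] ==>
   (((f, G, ze), x), ((f', G', ze'), x')) : gr_rel C X p"
  unfolding gr_rel_iff by blast

lemma gr_relE:
  assumes "(((f, G, ze), x), ((f', G', ze'), x')) : gr_rel C X p"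
  obtains al nu where "det X G ze x G' ze' x' al nu" "bij_betw al (gA G) (gA G')"
    "bij_betw nu (gV G) (gV G')" "!!s. s : fst p ==> al (f s) = f' s"
  using assms unfolding gr_rel_iff by blast

lemma gr_rel_equiv:
  assumes X: "bij_functor C X"
  shows "equiv (gr_elts C X p) (gr_rel C X p)"
proof (rule equivI)
  show "gr_rel C X p \<subseteq> gr_elts C X p \<times> gr_elts C X p" by (auto simp: gr_rel_def)
  show "refl_on (gr_elts C X p) (gr_rel C X p)"
  proof (rule refl_onI)
    fix e assume e: "e : gr_elts C X p"
    obtain f G ze x where [simp]: "e = ((f, G, ze), x)" by (metis surj_pair)
    have "dgr C X G ze x" using e by (simp add: gr_elts_iff)
    then have "det X G ze x G ze x (\<lambda>a. a) (\<lambda>v. v)" using det_id[OF X] by blast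
    moreover have "bij_betw (\<lambda>a. a) (gA G) (gA G)" "bij_betw (\<lambda>a. a) (gV G) (gV G)"
      by (auto simp: bij_betw_def inj_on_def)
    ultimately show "(e, e) : gr_rel C X p" using e by (auto simp: gr_rel_iff)
  qed
  show "sym (gr_rel C X p)"
  proof (rule symI)
    fix e e' assume r: "(e, e') : gr_rel C X p"
    obtain f G ze x where [simp]: "e = ((f, G, ze), x)" by (metis surj_pair)
    obtain f' G' ze' x' where [simp]: "e' = ((f', G', ze'), x')" by (metis surj_pair)
    have el: "e : gr_elts C X p" "e' : gr_elts C X p" using r by (auto simp: gr_rel_iff)
    have d: "dgr C X G ze x" "dgr C X G' ze' x'" and f: "bij_betw f (fst p) (gB G)"
      using el by (auto simp: gr_elts_iff)
    obtain al nu where a: "det X G ze x G' ze' x' al nu" and b: "bij_betw al (gA G) (gA G')"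
      "bij_betw nu (gV G) (gV G')" and s: "ALL s:fst p. al (f s) = f' s"
      using r by (auto simp: gr_rel_iff)
    have "ALL s:fst p. f s : gA G" using f gB_gA[OF dgrD(2)[OF d(1)]] by (auto simp: bij_betw_def)
    then have "ALL s:fst p. inv_into (gA G) al (f' s) = f s" using b(1) s
      by (metis bij_betw_def inv_into_f_f)
    then show "(e', e) : gr_rel C X p"
      using det_inv[OF X d a b] el b[THEN bij_betw_inv_into] by (simp add: gr_rel_iff) blast
  qed
  show "trans (gr_rel C X p)"
  proof (rule transI)
    fix e e' e'' assume r: "(e, e') : gr_rel C X p" "(e', e'') : gr_rel C X p"
    obtain f G ze x where [simp]: "e = ((f, G, ze), x)" by (metis surj_pair)
    obtain f' G' ze' x' where [simp]: "e' = ((f', G', ze'), x')" by (metis surj_pair)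
    obtain f'' G'' ze'' x'' where [simp]: "e'' = ((f'', G'', ze''), x'')" by (metis surj_pair)
    have el: "e : gr_elts C X p" "e' : gr_elts C X p" "e'' : gr_elts C X p"
      using r by (auto simp: gr_rel_iff)
    have d: "dgr C X G ze x" "dgr C X G' ze' x'" "dgr C X G'' ze'' x''"
      using el by (auto simp: gr_elts_iff)
    obtain al nu where a: "det X G ze x G' ze' x' al nu" "bij_betw al (gA G) (gA G')"
      "bij_betw nu (gV G) (gV G')" "ALL s:fst p. al (f s) = f' s"
      using r by (auto simp: gr_rel_iff)
    obtain be mu where b: "det X G' ze' x' G'' ze'' x'' be mu" "bij_betw be (gA G') (gA G'')"
      "bij_betw mu (gV G') (gV G'')" "ALL s:fst p. be (f' s) = f'' s"
      using r by (auto simp: gr_rel_iff)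
    have c: "det X G ze x G'' ze'' x'' (\<lambda>a. be (al a)) (\<lambda>v. mu (nu v))" using det_comp[OF X d a(1) b(1)] .
    have c': "bij_betw (\<lambda>a. be (al a)) (gA G) (gA G'')" "bij_betw (\<lambda>a. mu (nu a)) (gV G) (gV G'')"
      using bij_betw_trans[OF a(2) b(2)] bij_betw_trans[OF a(3) b(3)] by (auto simp: comp_def)
    have "be (al (f s)) = f'' s" if "s : fst p" for s using a(4) b(4) that by simp
    then show "(e, e'') : gr_rel C X p"
      using el by (simp only: \<open>e = _\<close> \<open>e'' = _\<close>) (rule gr_relI[OF _ _ c c'])
  qed
qed

section \<open>Classes of decorated graphs, and the functor that they form\<close>

definition cls ::
  "'c cset => ('u, 'c, 'x) bfun => ('u, 'c) bob => ('u, 'c, 'x) gelt => ('u, 'c, 'x) gelt set" where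
  "cls C X p e = gr_rel C X p `` {e}"

lemma in_cls: "e' : cls C X p e \<longleftrightarrow> (e, e') : gr_rel C X p"
  by (simp add: cls_def)

lemma cls_eq_iff:
  "bij_functor C X ==> e : gr_elts C X p ==> e' : gr_elts C X p ==>
     cls C X p e = cls C X p e' \<longleftrightarrow> (e, e') : gr_rel C X p"
  unfolding cls_def by (rule eq_equiv_class_iff[OF gr_rel_equiv])

lemma gr_rel_refl: "bij_functor C X ==> e : gr_elts C X p ==> (e, e) : gr_rel C X p"
  by (rule refl_onD[OF equivE[OF gr_rel_equiv]])

lemma gr_rel_sym: "bij_functor C X ==> (e, e') : gr_rel C X p ==> (e', e) : gr_rel C X p"
  by (rule symD[OF equivE[OF gr_rel_equiv]])

lemma gr_rel_trans:
  "bij_functor C X ==> (e, e') : gr_rel C X p ==> (e', e'') : gr_rel C X p ==> (e, e'') : gr_rel C X p"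
  by (rule transD[OF equivE[OF gr_rel_equiv]])

lemma gr_rel_elts: "(e, e') : gr_rel C X p ==> e : gr_elts C X p & e' : gr_elts C X p"
  by (auto simp: gr_rel_def)

lemma self_cls: "bij_functor C X ==> e : gr_elts C X p ==> e : cls C X p e"
  by (simp add: in_cls gr_rel_refl)

lemma cls_F_ob: "e : gr_elts C X p ==> cls C X p e : F_ob C X p"
  by (simp add: F_ob_def cls_def quotientI)

lemma F_obE:
  assumes "K : F_ob C X p"
  obtains f G ze x where "((f, G, ze), x) : gr_elts C X p" "K = cls C X p ((f, G, ze), x)"
  using assms unfolding F_ob_def cls_def by (metis quotientE surj_pair)

text \<open>Maps between colimits are written as images of whole classes. If \<open>g\<close>
  respects the relations, such an image can be evaluated on one representative.\<close>

lemma cls_image: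
  assumes X: "bij_functor C X" and Y: "bij_functor D Y" and e: "e : gr_elts C X p"
    and g: "!!e'. (e, e') : gr_rel C X p ==> (g e, g e') : gr_rel D Y q"
  shows "gr_rel D Y q `` (g ` cls C X p e) = cls D Y q (g e)"
proof
  show "gr_rel D Y q `` (g ` cls C X p e) \<subseteq> cls D Y q (g e)"
  proof
    fix y assume "y : gr_rel D Y q `` (g ` cls C X p e)"
    then obtain e' where "(e, e') : gr_rel C X p" "(g e', y) : gr_rel D Y q" by (auto simp: in_cls)
    then show "y : cls D Y q (g e)" using gr_rel_trans[OF Y g] unfolding in_cls by blast
  qed
  show "cls D Y q (g e) \<subseteq> gr_rel D Y q `` (g ` cls C X p e)"
    using self_cls[OF X e] by (auto simp: in_cls)
qed

text \<open>The action of a bijection relabels the boundary and leaves the decorated graph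
  alone.\<close>

lemma ba_F:
  fixes X :: "('u, 'c, 'x) bfun"
  assumes X: "bij_functor C X" and s: "si : bij_hom p q"
    and e: "((f, G, ze), x) : gr_elts C X p"
  shows "ba (F_fun C X) p q si (cls C X p ((f, G, ze), x)) =
      cls C X q ((\<lambda>s\<in>fst q. f (inv_into (fst p) si s), G, ze), x)" (is ?A)
    "((\<lambda>s\<in>fst q. f (inv_into (fst p) si s), G, ze), x) : gr_elts C X q" (is ?B)
proof -
  let ?g = "\<lambda>((f :: 'u => 'u, G :: 'u graph, ze :: 'u => 'c), x :: 'u => 'x). ((\<lambda>s\<in>fst q. f (inv_into (fst p) si s), G, ze), x)"
  have b: "bij_betw si (fst p) (fst q)" using s by (simp add: bij_hom_def)
  have b': "bij_betw (inv_into (fst p) si) (fst q) (fst p)" using bij_betw_inv_into[OF b] .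
  have c: "snd p (inv_into (fst p) si t) = snd q t" "inv_into (fst p) si t : fst p" if "t : fst q" for t
    using bij_hom_inv[OF s] that b' by (auto simp: bij_hom_def bij_betw_def)
  have el: "?g ((f, G, ze), x) : gr_elts C X q" if "((f, G, ze), x) : gr_elts C X p"
    for f G ze x
  proof -
    have "bij_betw (\<lambda>s\<in>fst q. f (inv_into (fst p) si s)) (fst q) (gB G)"
      using bij_betw_trans[OF b'] that by (auto simp: gr_elts_iff comp_def)
    then show ?thesis using that c by (auto simp: gr_elts_iff)
  qed
  show ?B using el[OF e] by simp
  have rel: "(?g ((f, G, ze), x), ?g e') : gr_rel C X q" if r: "(((f, G, ze), x), e') : gr_rel C X p" for e'
  proof -
    obtain f' G' ze' x' where [simp]: "e' = ((f', G', ze'), x')" by (metis surj_pair)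
    obtain al nu where "det X G ze x G' ze' x' al nu" "bij_betw al (gA G) (gA G')"
        "bij_betw nu (gV G) (gV G')" "!!s. s : fst p ==> al (f s) = f' s"
      using r[unfolded \<open>e' = _\<close>] by (rule gr_relE) blast
    moreover have "?g ((f, G, ze), x) : gr_elts C X q" "?g e' : gr_elts C X q"
      using gr_rel_elts[OF r] el by simp_all
    ultimately show ?thesis using c(2) by (auto intro!: gr_relI)
  qed
  have "ba (F_fun C X) p q si (cls C X p ((f, G, ze), x)) = gr_rel C X q `` (?g ` cls C X p ((f, G, ze), x))"
    using cls_F_ob[OF e] by (simp add: F_fun_def)
  then show ?A using cls_image[where g = ?g, OF X X e rel] by simp
qed

lemma F_fun_bo [simp]: "bo (F_fun C X) = F_ob C X"
  by (simp add: F_fun_def)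

lemma F_functor:
  assumes X: "bij_functor C X"
  shows "bij_functor C (F_fun C X)"
  unfolding bij_functor_def
proof (intro conjI ballI)
  fix p q :: "('b, 'a) bob" and si assume s: "si : bij_hom p q"
  have "ba (F_fun C X) p q si K : F_ob C X q" if K: "K : F_ob C X p" for K
  proof -
    obtain f G ze x where e: "((f, G, ze), x) : gr_elts C X p" "K = cls C X p ((f, G, ze), x)"
      using F_obE[OF K] .
    show ?thesis using ba_F[OF X s e(1)] e(2) cls_F_ob by metis
  qed
  moreover have "ba (F_fun C X) p q si : extensional (F_ob C X p)"
    by (simp add: F_fun_def)
  ultimately show "ba (F_fun C X) p q si : bo (F_fun C X) p \<rightarrow>\<^sub>E bo (F_fun C X) q"
    by (simp add: PiE_iff)
next
  fix p K assume p: "p : bij_ob C" and "K : bo (F_fun C X) p"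
  then obtain f G ze x where e: "((f, G, ze), x) : gr_elts C X p" "K = cls C X p ((f, G, ze), x)"
    using F_obE by (metis F_fun_bo)
  have "inv_into (fst p) (\<lambda>s\<in>fst p. s) s = s" if "s : fst p" for s
    using that by (intro inv_into_f_eq) (auto simp: inj_on_def)
  then have "(\<lambda>s\<in>fst p. f (inv_into (fst p) (\<lambda>s\<in>fst p. s) s)) = f"
    using e(1) by (auto simp: gr_elts_iff extensional_def fun_eq_iff)
  then show "ba (F_fun C X) p p (\<lambda>s\<in>fst p. s) K = K" using ba_F(1)[OF X bij_hom_id e(1)] e(2) by simp
next
  fix p q r si ta K
  assume o: "p : bij_ob C" "q : bij_ob C" "r : bij_ob C"
    and s: "si : bij_hom p q" and t: "ta : bij_hom q r" and "K : bo (F_fun C X) p"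
  then obtain f G ze x where e: "((f, G, ze), x) : gr_elts C X p" "K = cls C X p ((f, G, ze), x)"
    using F_obE by (metis F_fun_bo)
  have c: "compose (fst p) ta si : bij_hom p r" using bij_hom_comp[OF s t] by (simp add: compose_def)
  have b: "bij_betw si (fst p) (fst q)" "bij_betw ta (fst q) (fst r)" using s t by (auto simp: bij_hom_def)
  have "inv_into (fst p) (compose (fst p) ta si) u = inv_into (fst p) si (inv_into (fst q) ta u)"
    if u: "u : fst r" for u
  proof (rule inv_into_f_eq)
    show "inj_on (compose (fst p) ta si) (fst p)" using c by (simp add: bij_hom_def bij_betw_def)
    have 1: "inv_into (fst q) ta u : fst q" using b u by (auto simp: bij_betw_def inv_into_into)
    then show 2: "inv_into (fst p) si (inv_into (fst q) ta u) : fst p"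
      using b by (auto simp: bij_betw_def inv_into_into)
    show "compose (fst p) ta si (inv_into (fst p) si (inv_into (fst q) ta u)) = u"
      using 1 2 b u by (auto simp: compose_def bij_betw_def f_inv_into_f)
  qed
  moreover have "!!u. u : fst r ==> inv_into (fst q) ta u : fst q"
    using b by (auto simp: bij_betw_def inv_into_into)
  ultimately have "(\<lambda>s\<in>fst r. (\<lambda>s\<in>fst q. f (inv_into (fst p) si s)) (inv_into (fst q) ta s)) =
     (\<lambda>s\<in>fst r. f (inv_into (fst p) (compose (fst p) ta si) s))"
    by (auto simp: fun_eq_iff)
  then show "ba (F_fun C X) p r (compose (fst p) ta si) K = ba (F_fun C X) q r ta (ba (F_fun C X) p q si K)"
    using ba_F(1)[OF X c e(1)] ba_F(1)[OF X t ba_F(2)[OF X s e(1)]] ba_F(1)[OF X s e(1)] e(2) by simp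
qed

text \<open>Naturality separated from the extensionality conditions of \<open>bfun_hom\<close>, so
  that it can be proved for maps given by formulas.\<close>

definition nat_on :: "'c cset => ('u, 'c, 'x) bfun => ('u, 'c, 'y) bfun => (('u, 'c) bob => 'x => 'y) => bool" where
  "nat_on C X Y th \<longleftrightarrow> (ALL p:bij_ob C. ALL x:bo X p. th p x : bo Y p) &
        (ALL p:bij_ob C. ALL q:bij_ob C. ALL si:bij_hom p q. ALL x:bo X p.
           th q (ba X p q si x) = ba Y p q si (th p x))"

lemma bfun_hom_iff:
  "th : bfun_hom C X Y \<longleftrightarrow> nat_on C X Y th & th : extensional (bij_ob C) &
     (ALL p:bij_ob C. th p : extensional (bo X p))"
  by (auto simp: bfun_hom_def nat_on_def PiE_def)

lemma nat_onD:
  assumes "nat_on C X Y th"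
  shows "p : bij_ob C ==> x : bo X p ==> th p x : bo Y p"
    "p : bij_ob C ==> q : bij_ob C ==> si : bij_hom p q ==> x : bo X p ==>
       th q (ba X p q si x) = ba Y p q si (th p x)"
  using assms by (auto simp: nat_on_def)

lemma dgr_map:
  assumes n: "nat_on C X Y th" and d: "dgr C X G ze x"
  shows "dgr C Y G ze (\<lambda>v\<in>gV G. th (at_vertex G ze v) (x v))"
  using dgrD[OF d] nat_onD(1)[OF n] by (intro dgrI) auto

lemma det_map:
  assumes n: "nat_on C X Y th" and d: "dgr C X G ze x" "dgr C X G' ze' x'"
    and a: "det X G ze x G' ze' x' al nu"
  shows "det Y G ze (\<lambda>v\<in>gV G. th (at_vertex G ze v) (x v))
      G' ze' (\<lambda>v\<in>gV G'. th (at_vertex G' ze' v) (x' v)) al nu"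
proof -
  note A = det_D[OF a]
  have "th (at_vertex G' ze' (nu w)) (x' (nu w)) = ba Y (at_vertex G ze w) (at_vertex G' ze' (nu w))
      (restrict al (inb G w)) (th (at_vertex G ze w) (x w))" if w: "w : gV G" for w
    unfolding A(3)[OF w]
    using dgrD(5,6)[OF d(1)] dgrD(5)[OF d(2)] w dgrD(2)[OF d(1)] dgrD(2)[OF d(2)] A
    by (intro nat_onD(2)[OF n] et_hom) auto
  then show ?thesis unfolding det_def using A(1,2) et_V[OF A(1)] by simp
qed

lemma F_map_cls:
  fixes X :: "('u, 'c, 'x) bfun" and Y :: "('u, 'c, 'y) bfun"
  assumes X: "bij_functor C X" and Y: "bij_functor C Y" and n: "nat_on C X Y th"
    and p: "p : bij_ob C" and e: "((f, G, ze), x) : gr_elts C X p"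
  shows "F_map C X Y th p (cls C X p ((f, G, ze), x)) =
      cls C Y p ((f, G, ze), \<lambda>v\<in>gV G. th (at_vertex G ze v) (x v))" (is ?A)
    "((f, G, ze), \<lambda>v\<in>gV G. th (at_vertex G ze v) (x v)) : gr_elts C Y p" (is ?B)
proof -
  let ?g = "\<lambda>((f :: 'u => 'u, G :: 'u graph, ze :: 'u => 'c), x :: 'u => 'x). ((f, G, ze), \<lambda>v\<in>gV G. th (at_vertex G ze v) (x v))"
  have el: "?g ((f, G, ze), x) : gr_elts C Y p" if "((f, G, ze), x) : gr_elts C X p"
    for f G ze x
    using that dgr_map[OF n] by (auto simp: gr_elts_iff)
  show ?B using el[OF e] by simp
  have rel: "(?g ((f, G, ze), x), ?g e') : gr_rel C Y p" if r: "(((f, G, ze), x), e') : gr_rel C X p" for e'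
  proof -
    obtain f' G' ze' x' where [simp]: "e' = ((f', G', ze'), x')" by (metis surj_pair)
    have d: "dgr C X G ze x" "dgr C X G' ze' x'" using gr_rel_elts[OF r] by (auto simp: gr_elts_iff)
    obtain al nu where "det X G ze x G' ze' x' al nu" "bij_betw al (gA G) (gA G')"
        "bij_betw nu (gV G) (gV G')" "!!s. s : fst p ==> al (f s) = f' s"
      using r[unfolded \<open>e' = _\<close>] by (rule gr_relE) blast
    moreover have "?g ((f, G, ze), x) : gr_elts C Y p" "?g e' : gr_elts C Y p"
      using gr_rel_elts[OF r] el by simp_all
    ultimately show ?thesis using det_map[OF n d] by (auto intro!: gr_relI)
  qed
  have "F_map C X Y th p (cls C X p ((f, G, ze), x)) = gr_rel C Y p `` (?g ` cls C X p ((f, G, ze), x))"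
    using cls_F_ob[OF e] p by (simp add: F_map_def)
  then show ?A using cls_image[where g = ?g, OF X Y e rel] by simp
qed

section \<open>Substitution as a pushout\<close>

definition sub_ok :: "'u graph => ('u => 'u graph) => ('u => 'u => 'u) => bool" where
  "sub_ok G H m \<longleftrightarrow> connected_graph G &
     (ALL v:gV G. connected_graph (H v) & bij_betw (m v) (inb G v) (gB (H v)))"

text \<open>Test data for the pushout: maps on the arcs of \<open>G\<close> and of each
  \<open>H v\<close> that respect the identification of an arc \<open>a\<close> in
  \<open>inb G v\<close> with \<open>m v a\<close>, and of its partner with the partner of
  \<open>m v a\<close>.\<close>

definition glue_compat ::
  "'u graph => ('u => 'u graph) => ('u => 'u => 'u) => ('u => 't) => ('u => 'u => 't) => bool" where
  "glue_compat G H m P Q \<longleftrightarrow> (ALL v:gV G. ALL a:inb G v.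
     Q v (m v a) = P a & Q v (gi (H v) (m v a)) = P (gi G a))"

text \<open>
  The arcs of \<open>G{H\<^sub>v}\<close> are characterized up to isomorphism as the pushout of the arcs of \<open>G\<close> and
  of the \<open>H\<^sub>v\<close>; it suffices to test the universal property on predicates. Including the arcs of
  \<open>G\<close> makes the description uniform: it also covers graphs \<open>G\<close> without vertices.
\<close>

definition is_sub ::
  "'u graph => ('u => 'u graph) => ('u => 'u => 'u) => 'u graph => ('u => 'u) => ('u => 'u => 'u) =>
     ('u => 'u => 'u) => bool" where
  "is_sub G H m K j q p \<longleftrightarrow> is_graph K &
     (ALL a:gA G. j a : gA K & j (gi G a) = gi K (j a)) &
     (ALL v:gV G. et (H v) K (q v) (p v)) &
     (ALL v:gV G. ALL a:inb G v. q v (m v a) = j a) &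
     (ALL b:gA K. (EX a:gA G. b = j a) | (EX v:gV G. EX a:gA (H v). b = q v a)) &
     (ALL P Q. glue_compat G H m P Q -->
        (EX R :: 'u => bool. (ALL a:gA G. R (j a) = P a) & (ALL v:gV G. ALL a:gA (H v). R (q v a) = Q v a))) &
     (ALL v:gV G. ALL w:gV (H v). ALL v':gV G. ALL w':gV (H v'). p v w = p v' w' --> v = v' & w = w') &
     (ALL u:gV K. EX v:gV G. EX w:gV (H v). u = p v w) &
     bij_betw j (gB G) (gB K)"

lemma sub_okD:
  assumes "sub_ok G H m"
  shows "connected_graph G" "is_graph G"
    "!!v. v : gV G ==> connected_graph (H v)" "!!v. v : gV G ==> is_graph (H v)"
    "!!v. v : gV G ==> bij_betw (m v) (inb G v) (gB (H v))"
    "!!v a. v : gV G ==> a : inb G v ==> m v a : gB (H v)"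
    "!!v a. v : gV G ==> a : inb G v ==> m v a : gA (H v)"
proof -
  show *: "connected_graph G" "!!v. v : gV G ==> connected_graph (H v)"
    "!!v. v : gV G ==> bij_betw (m v) (inb G v) (gB (H v))"
    using assms by (simp_all add: sub_ok_def)
  then show g: "is_graph G" "!!v. v : gV G ==> is_graph (H v)" by (simp_all add: conn_graph)
  show b: "!!v a. v : gV G ==> a : inb G v ==> m v a : gB (H v)"
    using *(3) bij_betwE by blast
  show "!!v a. v : gV G ==> a : inb G v ==> m v a : gA (H v)"
    using b gB_gA[OF g(2)] by blast
qed

lemma is_subD:
  fixes G :: "'u graph"
  assumes "is_sub G H m K j q p"
  shows "is_graph K" "!!a. a : gA G ==> j a : gA K" "!!a. a : gA G ==> j (gi G a) = gi K (j a)"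
    "!!v. v : gV G ==> et (H v) K (q v) (p v)"
    "!!v a. v : gV G ==> a : inb G v ==> q v (m v a) = j a"
    "!!b. b : gA K ==> (EX a:gA G. b = j a) | (EX v:gV G. EX a:gA (H v). b = q v a)"
    "!!P Q. glue_compat G H m P Q ==>
        (EX R :: 'u => bool. (ALL a:gA G. R (j a) = P a) & (ALL v:gV G. ALL a:gA (H v). R (q v a) = Q v a))"
    "!!v w v' w'. v : gV G ==> w : gV (H v) ==> v' : gV G ==> w' : gV (H v') ==> p v w = p v' w' ==>
       v = v' & w = w'"
    "!!u. u : gV K ==> EX v:gV G. EX w:gV (H v). u = p v w"
    "bij_betw j (gB G) (gB K)"
  using assms unfolding is_sub_def by simp_all

lemma is_subI:
  fixes G :: "'u graph"
  assumes "is_graph K" "!!a. a : gA G ==> j a : gA K" "!!a. a : gA G ==> j (gi G a) = gi K (j a)"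
    "!!v. v : gV G ==> et (H v) K (q v) (p v)"
    "!!v a. v : gV G ==> a : inb G v ==> q v (m v a) = j a"
    "!!b. b : gA K ==> (EX a:gA G. b = j a) | (EX v:gV G. EX a:gA (H v). b = q v a)"
    "!!P Q. glue_compat G H m P Q ==>
        (EX R :: 'u => bool. (ALL a:gA G. R (j a) = P a) & (ALL v:gV G. ALL a:gA (H v). R (q v a) = Q v a))"
    "!!v w v' w'. v : gV G ==> w : gV (H v) ==> v' : gV G ==> w' : gV (H v') ==> p v w = p v' w' ==>
       v = v' & w = w'"
    "!!u. u : gV K ==> EX v:gV G. EX w:gV (H v). u = p v w"
    "bij_betw j (gB G) (gB K)"
  shows "is_sub G H m K j q p"
  unfolding is_sub_def using assms by (intro conjI ballI allI impI) (assumption | simp)+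

lemma is_sub_cong:
  assumes s: "is_sub G H m K j q p"
    and H: "!!v. v : gV G ==> H' v = H v" and m: "!!v a. v : gV G ==> a : inb G v ==> m' v a = m v a"
  shows "is_sub G H' m' K j q p"
proof -
  have "glue_compat G H' m' P Q = glue_compat G H m P Q" for P :: "'a => bool" and Q
    unfolding glue_compat_def using H m by simp
  then show ?thesis using s unfolding is_sub_def by (simp add: H m)
qed

text \<open>The universal property for maps into any type follows from that for predicates: for
  fixed \<open>t\<close>, the predicates \<open>P a = t\<close> and \<open>Q v a = t\<close> are
  test data, so no arc of \<open>K\<close> is given two values.\<close>

lemma sub_fun:
  fixes P :: "'u => 't"
  assumes s: "is_sub G H m K j q p" and c: "glue_compat G H m P Q"
  shows "EX R. (ALL a:gA G. R (j a) = P a) & (ALL v:gV G. ALL a:gA (H v). R (q v a) = Q v a)"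
proof -
  define S where "S = {(b, t). (EX a:gA G. b = j a & t = P a) | (EX v:gV G. EX a:gA (H v). b = q v a & t = Q v a)}"
  have sv: "t = t'" if 1: "(b, t) : S" and 2: "(b, t') : S" for b t t'
  proof -
    have "glue_compat G H m (\<lambda>a. P a = t) (\<lambda>v a. Q v a = t)" using c by (simp add: glue_compat_def)
    from is_subD(7)[OF s this] obtain R where R: "!!a. a : gA G ==> R (j a) = (P a = t)"
      "!!v a. v : gV G ==> a : gA (H v) ==> R (q v a) = (Q v a = t)" by blast
    have "R b" using 1 R unfolding S_def by auto
    moreover have "R b = (t' = t)" using 2 R unfolding S_def by auto
    ultimately show ?thesis by simp
  qed
  define R where "R b = (THE t. (b, t) : S)" for b
  have "R b = t" if "(b, t) : S" for b t unfolding R_def using that sv by (intro the_equality) auto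
  then have "R (j a) = P a" if "a : gA G" for a using that unfolding S_def by auto
  moreover have "R (q v a) = Q v a" if "v : gV G" "a : gA (H v)" for v a
  proof -
    have "(q v a, Q v a) : S" unfolding S_def using that by auto
    then show ?thesis using \<open>!!b t. (b, t) : S ==> R b = t\<close> by simp
  qed
  ultimately show ?thesis by blast
qed

text \<open>A union of components of \<open>K\<close> meets each \<open>H v\<close> in everything or
  nothing. The vertices \<open>v\<close> of the first kind and the arcs of \<open>G\<close> that
  \<open>j\<close> sends into \<open>A1\<close> form a union of components of
  \<open>G\<close>.\<close>

lemma sub_conn:
  assumes ok: "sub_ok G H m" and s: "is_sub G H m K j q p"
  shows "connected_graph K"
proof (rule connI)
  note O = sub_okD[OF ok] and S = is_subD[OF s]
  show "is_graph K" using S(1) .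
  show "gA K ~= {} | gV K ~= {}"
  proof (cases "gV G = {}")
    case True then show ?thesis using conn_nonempty[OF O(1)] S(2) by blast
  next
    case False
    then obtain v where v: "v : gV G" by blast
    then show ?thesis using conn_nonempty[OF O(3)[OF v]] et_A[OF S(4)[OF v]] et_V[OF S(4)[OF v]] by blast
  qed
  fix A1 V1
  assume A1: "A1 \<subseteq> gA K" and V1: "V1 \<subseteq> gV K" and cl: "!!a. a : A1 ==> gi K a : A1"
    and co: "!!v a. v : gV K ==> a : nb K v ==> a : A1 \<longleftrightarrow> v : V1"
  have cl': "gi K a : A1 \<longleftrightarrow> a : A1" if "a : gA K" for a using cl gi_gi[OF S(1) that] by metis
  define Av where "Av v = {a : gA (H v). q v a : A1}" for v
  define Vv where "Vv v = {w : gV (H v). p v w : V1}" for v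
  have dich: "(Av v = {} & Vv v = {}) | (Av v = gA (H v) & Vv v = gV (H v))" if v: "v : gV G" for v
  proof (rule conn_clopen[OF O(3)[OF v]])
    note e = S(4)[OF v]
    show "Av v \<subseteq> gA (H v)" "Vv v \<subseteq> gV (H v)" by (auto simp: Av_def Vv_def)
    show "gi (H v) a : Av v" if "a : Av v" for a
      using that cl et_i[OF e] gi_in[OF O(4)[OF v]] by (simp add: Av_def)
    show "a : Av v \<longleftrightarrow> w : Vv v" if w: "w : gV (H v)" and a: "a : nb (H v) w" for w a
    proof -
      have "q v a : nb K (p v w)" using bij_betwE[OF et_nb[OF e w]] a by blast
      then have "q v a : A1 \<longleftrightarrow> p v w : V1" by (rule co[OF et_V[OF e w]])
      then show ?thesis using w nb_gA[OF O(4)[OF v] a] by (simp add: Av_def Vv_def)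
    qed
  qed
  define AG where "AG = {a : gA G. j a : A1}"
  define VG where "VG = {v : gV G. Av v = gA (H v) & Vv v = gV (H v)}"
  have ne: "Av v = gA (H v) & Vv v = gV (H v)" if "v : gV G" "a : Av v | w : Vv v" for v a w
    using dich[OF that(1)] that(2) by blast
  have "(AG = {} & VG = {}) | (AG = gA G & VG = gV G)"
  proof (rule conn_clopen[OF O(1)])
    show "AG \<subseteq> gA G" "VG \<subseteq> gV G" by (auto simp: AG_def VG_def)
    show "gi G a : AG" if "a : AG" for a using that S(3) cl gi_in[OF O(2)] by (simp add: AG_def)
    show "a : AG \<longleftrightarrow> v : VG" if v: "v : gV G" and a: "a : nb G v" for v a
    proof -
      have aA: "a : gA G" using nb_gA[OF O(2) a] .
      have ia: "gi G a : inb G v" using a by (simp add: inb_def)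
      have "a : AG \<longleftrightarrow> j (gi G a) : A1" using aA cl' S(2,3) by (simp add: AG_def)
      \<comment> \<open>The partner of a dart \<open>a\<close> at \<open>v\<close> is glued to an
        arc of \<open>H v\<close>; this links the arcs of \<open>G\<close> with the alternative for
        \<open>H v\<close>.\<close>
      also have "\<dots> \<longleftrightarrow> m v (gi G a) : Av v" using S(5)[OF v ia] O(7)[OF v ia] by (simp add: Av_def)
      also have "\<dots> \<longleftrightarrow> v : VG" using ne[OF v] v O(7)[OF v ia] unfolding VG_def by blast
      finally show ?thesis .
    qed
  qed
  then show "(A1 = {} & V1 = {}) | (A1 = gA K & V1 = gV K)"
  proof
    assume e: "AG = {} & VG = {}"
    have emp: "Av v = {} & Vv v = {}" if "v : gV G" for v using dich[OF that] e that unfolding VG_def by blast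
    have "b \<notin> A1" for b
    proof
      assume b: "b : A1"
      then consider a where "a : gA G" "b = j a" | v a where "v : gV G" "a : gA (H v)" "b = q v a"
        using S(6) A1 by blast
      then show False using b e emp by cases (auto simp: AG_def Av_def)
    qed
    moreover have "u \<notin> V1" for u
    proof
      assume u: "u : V1"
      then obtain v w where "v : gV G" "w : gV (H v)" "u = p v w" using S(9) V1 by blast
      then show False using emp u by (auto simp: Vv_def)
    qed
    ultimately show ?thesis by blast
  next
    assume f: "AG = gA G & VG = gV G"
    have full: "Av v = gA (H v) & Vv v = gV (H v)" if "v : gV G" for v using f that unfolding VG_def by blast
    have "b : A1" if b: "b : gA K" for b
    proof -
      consider a where "a : gA G" "b = j a" | v a where "v : gV G" "a : gA (H v)" "b = q v a"
        using S(6)[OF b] by blast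
      then show ?thesis using f full by cases (auto simp: AG_def Av_def)
    qed
    moreover have "u : V1" if u: "u : gV K" for u
    proof -
      obtain v w where "v : gV G" "w : gV (H v)" "u = p v w" using S(9)[OF u] by blast
      then show ?thesis using full by (auto simp: Vv_def)
    qed
    ultimately show ?thesis using A1 V1 by blast
  qed
qed

text \<open>The structure maps of a model are themselves test data, which is what provides
  comparison maps between two models.\<close>

lemma sub_compat_map:
  assumes ok: "sub_ok G H m" and s: "is_sub G H m K j q p"
  shows "glue_compat G H m j q"
  unfolding glue_compat_def
proof (intro ballI)
  note O = sub_okD[OF ok] and S = is_subD[OF s]
  fix v a assume v: "v : gV G" and a: "a : inb G v"
  show "q v (m v a) = j a & q v (gi (H v) (m v a)) = j (gi G a)"
    using S(5)[OF v a] et_i[OF S(4)[OF v] O(7)[OF v a]] S(3)[OF inb_gA[OF O(2) a]] by simp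
qed

text \<open>On arcs, the universal properties give maps in both directions, which are mutually
  inverse because the structure maps are jointly onto. On vertices, both graphs consist of the
  disjoint union of the \<open>gV (H v)\<close>.\<close>

lemma sub_unique:
  assumes ok: "sub_ok G H m" and s: "is_sub G H m K j q p" and s': "is_sub G H m K' j' q' p'"
  shows "EX al nu. bij_betw al (gA K) (gA K') & bij_betw nu (gV K) (gV K') & et K K' al nu &
    (ALL a:gA G. al (j a) = j' a) & (ALL v:gV G. ALL a:gA (H v). al (q v a) = q' v a) &
    (ALL v:gV G. ALL w:gV (H v). nu (p v w) = p' v w)"
proof -
  note O = sub_okD[OF ok] and S = is_subD[OF s] and S' = is_subD[OF s']
  obtain al where al: "!!a. a : gA G ==> al (j a) = j' a" "!!v a. v : gV G ==> a : gA (H v) ==> al (q v a) = q' v a"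
    using sub_fun[OF s sub_compat_map[OF ok s']] by blast
  obtain be where be: "!!a. a : gA G ==> be (j' a) = j a" "!!v a. v : gV G ==> a : gA (H v) ==> be (q' v a) = q v a"
    using sub_fun[OF s' sub_compat_map[OF ok s]] by blast
  have al1: "al b : gA K' & be (al b) = b & al (gi K b) = gi K' (al b)" if b: "b : gA K" for b
  proof -
    consider a where "a : gA G" "b = j a" | v a where "v : gV G" "a : gA (H v)" "b = q v a"
      using S(6)[OF b] by blast
    then show ?thesis
    proof cases
      case 1
      have "al (gi K b) = al (j (gi G a))" using 1 S(3) by simp
      also have "\<dots> = gi K' (j' a)" using 1 al(1) gi_in[OF O(2)] S'(3) by simp
      finally show ?thesis using 1 al(1) be(1) S'(2) by simp
    next
      case 2
      note e = et_i[OF S(4)[OF 2(1)] 2(2)] et_i[OF S'(4)[OF 2(1)] 2(2)]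
      have "al (gi K b) = al (q v (gi (H v) a))" using 2 e by simp
      also have "\<dots> = gi K' (q' v a)" using al(2)[OF 2(1) gi_in[OF O(4)[OF 2(1)] 2(2)]] e(2) by simp
      finally show ?thesis using 2 al(2) be(2) et_A[OF S'(4)[OF 2(1)]] by simp
    qed
  qed
  have be1: "be b : gA K & al (be b) = b" if b: "b : gA K'" for b
  proof -
    consider a where "a : gA G" "b = j' a" | v a where "v : gV G" "a : gA (H v)" "b = q' v a"
      using S'(6)[OF b] by blast
    then show ?thesis using al be S(2) et_A[OF S(4)] by cases simp_all
  qed
  have ba: "bij_betw al (gA K) (gA K')"
    using al1 be1 by (intro bij_betw_byWitness[where f' = be]) auto
  define T where "T = (SIGMA v:gV G. gV (H v))"
  have bp: "bij_betw (\<lambda>(v, w). p v w) T (gV K)"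
    unfolding bij_betw_def T_def using S(8,9) et_V[OF S(4)] by (fastforce simp: inj_on_def)
  have bp': "bij_betw (\<lambda>(v, w). p' v w) T (gV K')"
    unfolding bij_betw_def T_def using S'(8,9) et_V[OF S'(4)] by (fastforce simp: inj_on_def)
  define nu where "nu u = (\<lambda>(v, w). p' v w) (inv_into T (\<lambda>(v, w). p v w) u)" for u
  have nu: "nu (p v w) = p' v w" if "v : gV G" "w : gV (H v)" for v w
  proof -
    have t: "(v, w) : T" using that by (simp add: T_def)
    show ?thesis using bij_betw_inv_into_left[OF bp t] by (simp add: nu_def)
  qed
  have bv: "bij_betw nu (gV K) (gV K')"
    using bij_betw_trans[OF bij_betw_inv_into[OF bp] bp'] by (simp add: comp_def nu_def[abs_def])
  have "et K K' al nu"
    unfolding et_def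
  proof (intro conjI ballI)
    fix u assume u: "u : gV K"
    then obtain v w where v: "v : gV G" and w: "w : gV (H v)" and uu: "u = p v w" using S(9) by blast
    show "nu u : gV K'" using nu[OF v w] uu et_V[OF S'(4)[OF v] w] by simp
    have "nb K u = q v ` nb (H v) w" using et_nb[OF S(4)[OF v] w] uu by (simp add: bij_betw_def)
    then have "al ` nb K u = (\<lambda>a. al (q v a)) ` nb (H v) w" by (simp add: image_image)
    also have "\<dots> = q' v ` nb (H v) w" using al(2)[OF v] nb_gA[OF O(4)[OF v]] by (intro image_cong) auto
    also have "\<dots> = nb K' (nu u)" using et_nb[OF S'(4)[OF v] w] uu nu[OF v w] by (simp add: bij_betw_def)
    finally have "al ` nb K u = nb K' (nu u)" .
    moreover have "inj_on al (nb K u)"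
      using ba nb_gA[OF S(1)] by (meson bij_betw_def inj_on_subset subsetI)
    ultimately show "bij_betw al (nb K u) (nb K' (nu u))" by (simp add: bij_betw_def)
  qed (use al1 in auto)
  then show ?thesis using ba bv al nu by blast
qed

text \<open>Substitution depends only on the isomorphism type of the data: a model for
  \<open>G1\<close>, \<open>H1\<close>, \<open>m1\<close> becomes one for isomorphic
  \<open>G\<close>, \<open>H\<close>, \<open>m\<close> by precomposing its structure maps. That the
  multiplication is well defined on classes rests on this.\<close>

lemma sub_precomp:
  assumes g: "is_graph G" "is_graph G1" and e: "et G G1 al nu"
    and ba: "bij_betw al (gA G) (gA G1)" and bv: "bij_betw nu (gV G) (gV G1)"
    and bB: "bij_betw al (gB G) (gB G1)"
    and h: "!!v. v : gV G ==> is_graph (H v)" "!!v. v : gV G ==> et (H v) (H1 (nu v)) (be v) (mu v)"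
      "!!v. v : gV G ==> bij_betw (be v) (gA (H v)) (gA (H1 (nu v)))"
      "!!v. v : gV G ==> bij_betw (mu v) (gV (H v)) (gV (H1 (nu v)))"
    and m: "!!v a. v : gV G ==> a : inb G v ==> m v a : gA (H v)"
      "!!v a. v : gV G ==> a : inb G v ==> be v (m v a) = m1 (nu v) (al a)"
    and s: "is_sub G1 H1 m1 K j q p"
  shows "is_sub G H m K (\<lambda>a. j (al a)) (\<lambda>v a. q (nu v) (be v a)) (\<lambda>v w. p (nu v) (mu v w))"
proof (rule is_subI)
  note S = is_subD[OF s]
  note eV = et_V[OF e]
  have inb1: "al a : inb G1 (nu v)" if "v : gV G" "a : inb G v" for v a
    using bij_betwE[OF et_inb[OF e g that(1)]] that(2) by blast
  show "is_graph K" using S(1) .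
  show "j (al a) : gA K" if "a : gA G" for a using S(2) et_A[OF e that] by blast
  show "j (al (gi G a)) = gi K (j (al a))" if "a : gA G" for a
    using S(3)[OF et_A[OF e that]] et_i[OF e that] by simp
  show "et (H v) K (\<lambda>a. q (nu v) (be v a)) (\<lambda>w. p (nu v) (mu v w))" if "v : gV G" for v
    using et_comp[OF h(2)[OF that] S(4)[OF eV[OF that]]] .
  show "q (nu v) (be v (m v a)) = j (al a)" if "v : gV G" "a : inb G v" for v a
    using m(2)[OF that] S(5)[OF eV[OF that(1)] inb1[OF that]] by simp
  have surjA: "EX a:gA G. a1 = al a" if "a1 : gA G1" for a1 using ba that by (auto simp: bij_betw_def)
  have surjV: "EX v:gV G. v1 = nu v" if "v1 : gV G1" for v1 using bv that by (auto simp: bij_betw_def)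
  have surjH: "EX a:gA (H v). a1 = be v a" if "v : gV G" "a1 : gA (H1 (nu v))" for v a1
    using h(3)[OF that(1)] that(2) by (auto simp: bij_betw_def)
  have surjHV: "EX a:gV (H v). a1 = mu v a" if "v : gV G" "a1 : gV (H1 (nu v))" for v a1
    using h(4)[OF that(1)] that(2) by (auto simp: bij_betw_def)
  show "(EX a:gA G. b = j (al a)) | (EX v:gV G. EX a:gA (H v). b = q (nu v) (be v a))" if "b : gA K" for b
    using S(6)[OF that]
  proof (elim disjE bexE)
    fix a assume "a : gA G1" "b = j a" then show ?thesis using surjA by metis
  next
    fix v a assume v: "v : gV G1" "a : gA (H1 v)" "b = q v a"
    then obtain v0 where v0: "v0 : gV G" "v = nu v0" using surjV by blast
    then obtain a0 where "a0 : gA (H v0)" "a = be v0 a0" using surjH[OF v0(1)] v(2) by blast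
    then show ?thesis using v v0 by blast
  qed
  show "EX R :: 'a => bool. (ALL a:gA G. R (j (al a)) = P a) & (ALL v:gV G. ALL a:gA (H v). R (q (nu v) (be v a)) = Q v a)"
    if c: "glue_compat G H m P Q" for P Q
  proof -
    let ?al = "inv_into (gA G) al" and ?nu = "inv_into (gV G) nu"
    let ?be = "\<lambda>v. inv_into (gA (H v)) (be v)"
    have i: "!!a. a : gA G ==> ?al (al a) = a" "!!v. v : gV G ==> ?nu (nu v) = v"
      "!!v a. v : gV G ==> a : gA (H v) ==> ?be v (be v a) = a"
      using ba bv h(3) by (auto simp: bij_betw_def)
    \<comment> \<open>Test data for \<open>G\<close> are moved to \<open>G1\<close> along the
      inverse bijections.\<close>
    have "glue_compat G1 H1 m1 (\<lambda>a. P (?al a)) (\<lambda>v a. Q (?nu v) (?be (?nu v) a))"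
      unfolding glue_compat_def
    proof (intro ballI)
      fix v1 a1 assume v1: "v1 : gV G1" and a1: "a1 : inb G1 v1"
      obtain v where v: "v : gV G" "v1 = nu v" using surjV[OF v1] by blast
      have "a1 : al ` inb G v" using a1 et_inb[OF e g v(1)] v(2) by (simp add: bij_betw_def)
      then obtain a where a: "a : inb G v" "a1 = al a" by blast
      have aA: "a : gA G" "gi G a : gA G" using inb_gA[OF g(1) a(1)] gi_in[OF g(1)] by auto
      have mA: "m v a : gA (H v)" "gi (H v) (m v a) : gA (H v)"
        using m(1)[OF v(1) a(1)] gi_in[OF h(1)[OF v(1)]] by auto
      have 1: "m1 v1 a1 = be v (m v a)" using m(2)[OF v(1) a(1)] v(2) a(2) by simp
      have 2: "gi (H1 v1) (m1 v1 a1) = be v (gi (H v) (m v a))"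
        using 1 et_i[OF h(2)[OF v(1)] mA(1)] v(2) by simp
      have 3: "gi G1 a1 = al (gi G a)" using et_i[OF e aA(1)] a(2) by simp
      have "Q v (m v a) = P a & Q v (gi (H v) (m v a)) = P (gi G a)"
        using c v(1) a(1) by (simp add: glue_compat_def)
      then show "Q (?nu v1) (?be (?nu v1) (m1 v1 a1)) = P (?al a1) &
        Q (?nu v1) (?be (?nu v1) (gi (H1 v1) (m1 v1 a1))) = P (?al (gi G1 a1))"
        unfolding 2 3 unfolding 1 unfolding v(2) a(2) by (simp only: i v(1) aA mA)
    qed
    from S(7)[OF this] obtain R where R: "!!a. a : gA G1 ==> R (j a) = P (?al a)"
      "!!v a. v : gV G1 ==> a : gA (H1 v) ==> R (q v a) = Q (?nu v) (?be (?nu v) a)" by blast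
    have "R (j (al a)) = P a" if "a : gA G" for a using R(1)[OF et_A[OF e that]] i(1)[OF that] by simp
    moreover have "R (q (nu v) (be v a)) = Q v a" if "v : gV G" "a : gA (H v)" for v a
      using R(2)[OF eV[OF that(1)] et_A[OF h(2)[OF that(1)] that(2)]] i(2)[OF that(1)] i(3)[OF that] by simp
    ultimately show ?thesis by blast
  qed
  show "v = v' & w = w'" if vw: "v : gV G" "w : gV (H v)" "v' : gV G" "w' : gV (H v')"
    and eq: "p (nu v) (mu v w) = p (nu v') (mu v' w')" for v w v' w'
  proof -
    have *: "nu v = nu v' & mu v w = mu v' w'"
      by (rule S(8)[OF eV[OF vw(1)] et_V[OF h(2)[OF vw(1)] vw(2)] eV[OF vw(3)] et_V[OF h(2)[OF vw(3)] vw(4)] eq])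
    then have 1: "v = v'" using bv vw(1,3) by (auto simp: bij_betw_def inj_on_def)
    then have "mu v w = mu v w'" "w' : gV (H v)" using * vw(4) by auto
    then show ?thesis using h(4)[OF vw(1)] vw(2) 1 by (auto simp: bij_betw_def inj_on_def)
  qed
  show "EX v:gV G. EX w:gV (H v). u = p (nu v) (mu v w)" if u: "u : gV K" for u
  proof -
    obtain v w where v: "v : gV G1" "w : gV (H1 v)" "u = p v w" using S(9)[OF u] by blast
    then obtain v0 where v0: "v0 : gV G" "v = nu v0" using surjV by blast
    then obtain a0 where "a0 : gV (H v0)" "w = mu v0 a0" using surjHV[OF v0(1)] v(2) by blast
    then show ?thesis using v v0 by blast
  qed
  show "bij_betw (\<lambda>a. j (al a)) (gB G) (gB K)" using bij_betw_trans[OF bB S(10)] by (simp add: comp_def)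
qed

text \<open>Pasting of pushouts. \<open>M\<close> is \<open>G\<close> with the \<open>H v\<close>
  substituted, \<open>N\<close> is \<open>M\<close> with the \<open>L u\<close> substituted, and
  \<open>Nv v\<close> is \<open>H v\<close> with those \<open>L u\<close> substituted whose vertex
  \<open>u = p v w\<close> comes from \<open>H v\<close>. Then \<open>N\<close> is also
  \<open>G\<close> with the \<open>Nv v\<close> substituted, and the equations identify the
  composite structure maps.\<close>

lemma sub_assoc:
  assumes ok: "sub_ok G H m" and s: "is_sub G H m M j q p"
    and ok2: "sub_ok M L n" and s2: "is_sub M L n N j2 q2 p2"
    and sv: "!!v. v : gV G ==>
      is_sub (H v) (\<lambda>w. L (p v w)) (\<lambda>w a. n (p v w) (q v a)) (Nv v) (jv v) (qv v) (pv v)"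
  shows "EX Q P. is_sub G Nv (\<lambda>v a. jv v (m v a)) N (\<lambda>a. j2 (j a)) Q P &
    (ALL v:gV G. ALL a:gA (H v). Q v (jv v a) = j2 (q v a)) &
    (ALL v:gV G. ALL w:gV (H v). ALL a:gA (L (p v w)). Q v (qv v w a) = q2 (p v w) a) &
    (ALL v:gV G. ALL w:gV (H v). ALL x:gV (L (p v w)). P v (pv v w x) = p2 (p v w) x)"
proof -
  note O = sub_okD[OF ok] and S = is_subD[OF s] and O2 = sub_okD[OF ok2] and S2 = is_subD[OF s2]
  note SV = is_subD[OF sv]
  have pV: "p v w : gV M" if "v : gV G" "w : gV (H v)" for v w using et_V[OF S(4)] that by blast
  have qinb: "q v a : inb M (p v w)" if "v : gV G" "w : gV (H v)" "a : inb (H v) w" for v w a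
    using bij_betwE[OF et_inb[OF S(4)[OF that(1)] O(4)[OF that(1)] S(1) that(2)]] that(3) by blast
  \<comment> \<open>The map from \<open>Nv v\<close> to \<open>N\<close> comes from the universal
    property of \<open>Nv v\<close>: the map from \<open>H v\<close> through \<open>M\<close> and
    the maps from the \<open>L (p v w)\<close> are test data.\<close>
  have ex: "EX Qv. (ALL a:gA (H v). Qv (jv v a) = j2 (q v a)) &
      (ALL w:gV (H v). ALL a:gA (L (p v w)). Qv (qv v w a) = q2 (p v w) a)" if v: "v : gV G" for v
  proof (rule sub_fun[OF sv[OF v]])
    show "glue_compat (H v) (\<lambda>w. L (p v w)) (\<lambda>w a. n (p v w) (q v a)) (\<lambda>a. j2 (q v a)) (\<lambda>w. q2 (p v w))"
      unfolding glue_compat_def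
    proof (intro ballI)
      fix w a assume w: "w : gV (H v)" and a: "a : inb (H v) w"
      have "q2 (p v w) (n (p v w) (q v a)) = j2 (q v a) &
          q2 (p v w) (gi (L (p v w)) (n (p v w) (q v a))) = j2 (gi M (q v a))"
        using sub_compat_map[OF ok2 s2] pV[OF v w] qinb[OF v w a] by (simp add: glue_compat_def)
      then show "q2 (p v w) (n (p v w) (q v a)) = j2 (q v a) &
          q2 (p v w) (gi (L (p v w)) (n (p v w) (q v a))) = j2 (q v (gi (H v) a))"
        using et_i[OF S(4)[OF v] inb_gA[OF O(4)[OF v] a]] by simp
    qed
  qed
  define Q where "Q v = (SOME Qv. (ALL a:gA (H v). Qv (jv v a) = j2 (q v a)) &
      (ALL w:gV (H v). ALL a:gA (L (p v w)). Qv (qv v w a) = q2 (p v w) a))" for v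
  have Q: "Q v (jv v a) = j2 (q v a)" if "v : gV G" "a : gA (H v)" for v a
    using someI_ex[OF ex[OF that(1)]] that(2) unfolding Q_def by blast
  have Q2: "Q v (qv v w a) = q2 (p v w) a" if "v : gV G" "w : gV (H v)" "a : gA (L (p v w))" for v w a
    using someI_ex[OF ex[OF that(1)]] that(2,3) unfolding Q_def by blast
  note Q = Q Q2
  \<comment> \<open>A vertex of \<open>Nv v\<close> comes from exactly one vertex \<open>y\<close>
    of one \<open>L (p v w)\<close>, so the choice is among a single pair.\<close>
  define P where "P v x = (let (w, y) = SOME (w, y). w : gV (H v) & y : gV (L (p v w)) & x = pv v w y
     in p2 (p v w) y)" for v x
  have P: "P v (pv v w y) = p2 (p v w) y" if v: "v : gV G" and w: "w : gV (H v)" and y: "y : gV (L (p v w))" for v w y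
  proof -
    have "(SOME (w', y'). w' : gV (H v) & y' : gV (L (p v w')) & pv v w y = pv v w' y') = (w, y)"
    proof (rule some_equality)
      show "case (w, y) of (w', y') => w' : gV (H v) & y' : gV (L (p v w')) & pv v w y = pv v w' y'"
        using w y by simp
      fix z assume "case z of (w', y') => w' : gV (H v) & y' : gV (L (p v w')) & pv v w y = pv v w' y'"
      then obtain w' y' where z: "z = (w', y')" and c: "w' : gV (H v)" "y' : gV (L (p v w'))"
          "pv v w y = pv v w' y'" by (cases z) auto
      show "z = (w, y)" using SV(8)[OF v w y c] z by blast
    qed
    then show ?thesis by (simp add: P_def)
  qed
  have iA: "a : gA (Nv v) ==> (EX b:gA (H v). a = jv v b) | (EX w:gV (H v). EX b:gA (L (p v w)). a = qv v w b)"
    if "v : gV G" for v a using SV(6)[OF that] .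
  have eQ: "et (Nv v) N (Q v) (P v)" if v: "v : gV G" for v
    unfolding et_def
  proof (intro conjI ballI)
    fix a assume a: "a : gA (Nv v)"
    have "Q v a : gA N & Q v (gi (Nv v) a) = gi N (Q v a)"
      using iA[OF v a]
    proof (elim disjE bexE)
      fix b assume b: "b : gA (H v)" "a = jv v b"
      have "Q v (gi (Nv v) a) = Q v (jv v (gi (H v) b))" using SV(3)[OF v b(1)] b(2) by simp
      also have "\<dots> = j2 (q v (gi (H v) b))" using Q(1)[OF v gi_in[OF O(4)[OF v] b(1)]] .
      also have "\<dots> = gi N (j2 (q v b))"
        using et_i[OF S(4)[OF v] b(1)] S2(3)[OF et_A[OF S(4)[OF v] b(1)]] by simp
      finally show ?thesis using Q(1)[OF v b(1)] b(2) S2(2)[OF et_A[OF S(4)[OF v] b(1)]] by simp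
    next
      fix w b assume w: "w : gV (H v)" and b: "b : gA (L (p v w))" "a = qv v w b"
      note e1 = SV(4)[OF v w] and e2 = S2(4)[OF pV[OF v w]]
      have "Q v (gi (Nv v) a) = Q v (qv v w (gi (L (p v w)) b))" using et_i[OF e1 b(1)] b(2) by simp
      also have "\<dots> = q2 (p v w) (gi (L (p v w)) b)"
        using Q(2)[OF v w gi_in[OF O2(4)[OF pV[OF v w]] b(1)]] .
      also have "\<dots> = gi N (q2 (p v w) b)" using et_i[OF e2 b(1)] .
      finally show ?thesis using Q(2)[OF v w b(1)] b(2) et_A[OF e2 b(1)] by simp
    qed
    then show "Q v a : gA N" "Q v (gi (Nv v) a) = gi N (Q v a)" by auto
  next
    fix x assume "x : gV (Nv v)"
    then obtain w y where w: "w : gV (H v)" and y: "y : gV (L (p v w))" and x: "x = pv v w y"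
      using SV(9)[OF v] by blast
    note e1 = SV(4)[OF v w] and e2 = S2(4)[OF pV[OF v w]]
    show "P v x : gV N" using P[OF v w y] x et_V[OF e2 y] by simp
    have b1: "bij_betw (qv v w) (nb (L (p v w)) y) (nb (Nv v) x)" using et_nb[OF e1 y] x by simp
    have b2: "bij_betw (q2 (p v w)) (nb (L (p v w)) y) (nb N (P v x))" using et_nb[OF e2 y] x P[OF v w y] by simp
    have eq: "Q v (qv v w b) = q2 (p v w) b" if "b : nb (L (p v w)) y" for b
      using Q(2)[OF v w nb_gA[OF O2(4)[OF pV[OF v w]] that]] .
    have "bij_betw (\<lambda>b. Q v (qv v w b)) (nb (L (p v w)) y) (nb N (P v x)) "
      using b2 eq by (subst bij_betw_cong[where g = "q2 (p v w)"]) auto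
    then show "bij_betw (Q v) (nb (Nv v) x) (nb N (P v x))"
      using bij_betw_comp_iff[OF b1, of "Q v"] by (simp add: comp_def)
  qed
  have "is_sub G Nv (\<lambda>v a. jv v (m v a)) N (\<lambda>a. j2 (j a)) Q P"
  proof (rule is_subI)
    show "is_graph N" using S2(1) .
    show "j2 (j a) : gA N" "j2 (j (gi G a)) = gi N (j2 (j a))" if "a : gA G" for a
      using S(2,3)[OF that] S2(2,3)[OF S(2)[OF that]] by simp_all
    show "et (Nv v) N (Q v) (P v)" if "v : gV G" for v using eQ[OF that] .
    show "Q v (jv v (m v a)) = j2 (j a)" if "v : gV G" "a : inb G v" for v a
      using Q(1)[OF that(1) O(7)[OF that]] S(5)[OF that] by simp
    show "(EX a:gA G. b = j2 (j a)) | (EX v:gV G. EX a:gA (Nv v). b = Q v a)" if b: "b : gA N" for b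
      using S2(6)[OF b]
    proof (elim disjE bexE)
      fix c assume c: "c : gA M" "b = j2 c"
      show ?thesis using S(6)[OF c(1)]
      proof (elim disjE bexE)
        fix a assume "a : gA G" "c = j a" then show ?thesis using c by blast
      next
        fix v a assume v: "v : gV G" and a: "a : gA (H v)" "c = q v a"
        then have "b = Q v (jv v a)" using c Q(1) by simp
        then show ?thesis using v SV(2)[OF v a(1)] by blast
      qed
    next
      fix u a assume u: "u : gV M" and a: "a : gA (L u)" "b = q2 u a"
      obtain v w where v: "v : gV G" and w: "w : gV (H v)" and uu: "u = p v w" using S(9)[OF u] by blast
      then have "b = Q v (qv v w a)" using a Q(2) by simp
      then show ?thesis using v et_A[OF SV(4)[OF v w]] a uu by blast
    qed
    show "EX R :: 'a => bool. (ALL a:gA G. R (j2 (j a)) = A a) & (ALL v:gV G. ALL a:gA (Nv v). R (Q v a) = B v a)"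
      if c: "glue_compat G Nv (\<lambda>v a. jv v (m v a)) A B" for A B
    proof -
      have cB: "B v (jv v (m v a)) = A a & B v (gi (Nv v) (jv v (m v a))) = A (gi G a)"
        if "v : gV G" "a : inb G v" for v a using c that by (simp add: glue_compat_def)
      \<comment> \<open>The universal property is applied twice: \<open>A\<close> and the values of
        \<open>B\<close> on the \<open>H v\<close> descend to the arcs of \<open>M\<close> as
        \<open>R1\<close>, and \<open>R1\<close> with the values of \<open>B\<close> on the
        \<open>L u\<close> descends to \<open>N\<close>.\<close>
      have "glue_compat G H m A (\<lambda>v a. B v (jv v a))"
        unfolding glue_compat_def using cB SV(3) O(7) by simp
      from S(7)[OF this] obtain R1 where R1: "!!a. a : gA G ==> R1 (j a) = A a"
        "!!v a. v : gV G ==> a : gA (H v) ==> R1 (q v a) = B v (jv v a)" by blast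
      define inv where "inv u = (SOME (v, w). v : gV G & w : gV (H v) & u = p v w)" for u
      have inv: "inv (p v w) = (v, w)" if v: "v : gV G" and w: "w : gV (H v)" for v w
        unfolding inv_def
      proof (rule some_equality)
        show "case (v, w) of (v', w') => v' : gV G & w' : gV (H v') & p v w = p v' w'" using v w by simp
        fix z assume "case z of (v', w') => v' : gV G & w' : gV (H v') & p v w = p v' w'"
        then obtain v' w' where z: "z = (v', w')" and c: "v' : gV G" "w' : gV (H v')"
            "p v w = p v' w'" by (cases z) auto
        show "z = (v, w)" using S(8)[OF v w c] z by blast
      qed
      define B' where "B' u a = (case inv u of (v, w) => B v (qv v w a))" for u a
      have "glue_compat M L n R1 B'"
        unfolding glue_compat_def
      proof (intro ballI)
        fix u a assume u: "u : gV M" and a: "a : inb M u"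
        obtain v w where v: "v : gV G" and w: "w : gV (H v)" and uu: "u = p v w" using S(9)[OF u] by blast
        have "a : q v ` inb (H v) w"
          using a uu et_inb[OF S(4)[OF v] O(4)[OF v] S(1) w] by (simp add: bij_betw_def)
        then obtain b where b: "b : inb (H v) w" "a = q v b" by blast
        have iu: "inv u = (v, w)" using inv[OF v w] uu by simp
        have bA: "b : gA (H v)" using inb_gA[OF O(4)[OF v] b(1)] .
        have nA: "n u a : gA (L u)" using O2(7)[OF u a] .
        have 1: "qv v w (n u a) = jv v b" using SV(5)[OF v w b(1)] b uu by simp
        have 2: "qv v w (gi (L u) (n u a)) = jv v (gi (H v) b)"
          using et_i[OF SV(4)[OF v w]] nA 1 SV(3)[OF v bA] uu by simp
        have 3: "R1 a = B v (jv v b)" using R1(2)[OF v bA] b by simp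
        have 4: "R1 (gi M a) = B v (jv v (gi (H v) b))"
          using R1(2)[OF v gi_in[OF O(4)[OF v] bA]] b et_i[OF S(4)[OF v] bA] by simp
        show "B' u (n u a) = R1 a & B' u (gi (L u) (n u a)) = R1 (gi M a)"
          using 1 2 3 4 iu by (simp add: B'_def)
      qed
      from S2(7)[OF this] obtain R where R: "!!a. a : gA M ==> R (j2 a) = R1 a"
        "!!u a. u : gV M ==> a : gA (L u) ==> R (q2 u a) = B' u a" by blast
      have "R (j2 (j a)) = A a" if "a : gA G" for a using R(1)[OF S(2)[OF that]] R1(1)[OF that] by simp
      moreover have "R (Q v a) = B v a" if v: "v : gV G" and a: "a : gA (Nv v)" for v a
        using iA[OF v a]
      proof (elim disjE bexE)
        fix b assume b: "b : gA (H v)" "a = jv v b"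
        then show ?thesis using Q(1)[OF v b(1)] R(1)[OF et_A[OF S(4)[OF v] b(1)]] R1(2)[OF v b(1)] by simp
      next
        fix w b assume w: "w : gV (H v)" and b: "b : gA (L (p v w))" "a = qv v w b"
        then show ?thesis using Q(2)[OF v w b(1)] R(2)[OF pV[OF v w] b(1)] inv[OF v w] by (simp add: B'_def)
      qed
      ultimately show ?thesis by blast
    qed
    show "v = v' & x = x'" if v: "v : gV G" and x: "x : gV (Nv v)" and v': "v' : gV G"
      and x': "x' : gV (Nv v')" and eq: "P v x = P v' x'" for v x v' x'
    proof -
      obtain w y where w: "w : gV (H v)" and y: "y : gV (L (p v w))" and xx: "x = pv v w y"
        using SV(9)[OF v x] by blast
      obtain w' y' where w': "w' : gV (H v')" and y': "y' : gV (L (p v' w'))" and xx': "x' = pv v' w' y'"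
        using SV(9)[OF v' x'] by blast
      have "p2 (p v w) y = p2 (p v' w') y'" using eq P[OF v w y] P[OF v' w' y'] xx xx' by simp
      then have 1: "p v w = p v' w' & y = y'" by (rule S2(8)[OF pV[OF v w] y pV[OF v' w'] y'])
      then have "v = v' & w = w'" using S(8)[OF v w v' w'] by blast
      then show ?thesis using 1 xx xx' by simp
    qed
    show "EX v:gV G. EX x:gV (Nv v). z = P v x" if z: "z : gV N" for z
    proof -
      obtain u y where u: "u : gV M" and y: "y : gV (L u)" and zz: "z = p2 u y" using S2(9)[OF z] by blast
      obtain v w where v: "v : gV G" and w: "w : gV (H v)" and uu: "u = p v w" using S(9)[OF u] by blast
      have "z = P v (pv v w y)" using P[OF v w] y zz uu by simp
      then show ?thesis using v et_V[OF SV(4)[OF v w]] y uu by blast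
    qed
    show "bij_betw (\<lambda>a. j2 (j a)) (gB G) (gB N)" using bij_betw_trans[OF S(10) S2(10)] by (simp add: comp_def)
  qed
  then show ?thesis using Q P by blast
qed

text \<open>The extension of \<open>m\<close> from \<open>S\<close> to its double that commutes with
  the involutions \<open>dbl_inv S\<close> and \<open>i\<close>. It describes colorings of stars as
  well as maps out of stars.\<close>

definition sx :: "'u set => ('u => 't) => ('t => 't) => 'u => 't" where
  "sx S m i a = (if a : S then m a else i (m (dbl_inv S a)))"

text \<open>Infinity of the universe gives the disjoint copy \<open>dg S\<close> of a finite set,
  the injective pairing \<open>enc\<close>, and the second arc of the exceptional edge.\<close>

locale infinite_universe =
  fixes type_u :: "'u itself"
  assumes inf_U: "infinite (UNIV :: 'u set)"
begin

section \<open>Stars, and the unit laws of substitution\<close>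

lemma dg_props:
  assumes "finite (S :: 'u set)"
  shows "inj_on (dg S) S" "dg S ` S \<inter> S = {}"
proof -
  have "infinite (UNIV - S)" using inf_U assms by simp
  then obtain T where T: "T \<subseteq> UNIV - S" "finite T" "card T = card S" by (meson infinite_arbitrarily_large)
  then obtain g where "bij_betw g S T" using assms finite_same_card_bij by metis
  then have "inj_on g S & g ` S \<inter> S = {}" using T by (auto simp: bij_betw_def)
  then have "inj_on (dg S) S & dg S ` S \<inter> S = {}" unfolding dg_def by (rule someI[where P = "\<lambda>g. inj_on g S & g ` S \<inter> S = {}"])
  then show "inj_on (dg S) S" "dg S ` S \<inter> S = {}" by auto
qed

lemma dbl_inv_props:
  assumes f: "finite (S :: 'u set)"
  shows "s : S ==> dbl_inv S s = dg S s" "s : S ==> dbl_inv S (dg S s) = s"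
    "a : dbl S ==> dbl_inv S a : dbl S" "a : dbl S ==> dbl_inv S (dbl_inv S a) = a"
    "a : dbl S ==> dbl_inv S a : S \<longleftrightarrow> a \<notin> S"
proof -
  note d = dg_props[OF f]
  show 1: "dbl_inv S s = dg S s" if "s : S" for s using that by (simp add: dbl_inv_def dbl_def)
  show 2: "dbl_inv S (dg S s) = s" if "s : S" for s using that d by (auto simp: dbl_inv_def dbl_def)
  have c: "a : S | (EX s:S. a = dg S s)" if "a : dbl S" for a using that by (auto simp: dbl_def)
  show "dbl_inv S a : dbl S" if "a : dbl S" for a using c[OF that] 1 2 by (auto simp: dbl_def)
  show "dbl_inv S (dbl_inv S a) = a" if "a : dbl S" for a using c[OF that] 1 2 by auto
  show "dbl_inv S a : S \<longleftrightarrow> a \<notin> S" if "a : dbl S" for a using c[OF that] 1 2 d by auto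
qed

lemma star_simps [simp]:
  "gA (star S) = dbl S" "gV (star S) = {undefined}" "gi (star S) = dbl_inv S" "gB (star S) = S"
  by (auto simp: star_def)

lemma star_nb:
  assumes f: "finite (S :: 'u set)"
  shows "nb (star S) undefined = dg S ` S" "dA (star S) = dg S ` S" "inb (star S) undefined = S"
proof -
  show 1: "nb (star S) undefined = dg S ` S" "dA (star S) = dg S ` S"
    by (auto simp: nb_def dA_def star_def)
  show "inb (star S) undefined = S"
    unfolding inb_def 1 using dbl_inv_props(2)[OF f] by (auto simp: image_iff)
qed

lemma star_graph:
  assumes f: "finite (S :: 'u set)"
  shows "is_graph (star S)"
proof -
  note d = dg_props[OF f] dbl_inv_props[OF f]
  have c: "a : S | (EX s:S. a = dg S s)" if "a : dbl S" for a using that by (auto simp: dbl_def)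
  have ne: "dbl_inv S a ~= a" if "a : dbl S" for a using d(7)[OF that] by auto
  have 1: "dbl_inv S : dbl S \<rightarrow>\<^sub>E dbl S"
    using d(5) by (auto simp: PiE_def dbl_inv_def[of S] simp del: restrict_apply)
  have 2: "dbl_inv S ` dg S ` S = S" using d(4) by (auto simp: image_iff)
  show ?thesis
    unfolding is_graph_def star_nb(2)[OF f] star_simps 2
    using f 1 2 d(2,6) ne by (auto simp: star_def dbl_def inj_on_def)
qed

lemma star_conn:
  assumes f: "finite (S :: 'u set)"
  shows "connected_graph (star S)"
proof (rule connI[OF star_graph[OF f]])
  show "gA (star S) ~= {} | gV (star S) ~= {}" by simp
  fix A1 V1
  assume A1: "A1 \<subseteq> gA (star S)" and V1: "V1 \<subseteq> gV (star S)" and i: "!!a. a : A1 ==> gi (star S) a : A1"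
    and co: "!!v a. v : gV (star S) ==> a : nb (star S) v ==> a : A1 \<longleftrightarrow> v : V1"
  note d = dbl_inv_props[OF f]
  have "a : A1 \<longleftrightarrow> undefined : V1" if a: "a : dbl S" for a
  proof -
    have "dbl_inv S a : A1 \<longleftrightarrow> a : A1" using i d(4)[OF a] by (metis star_simps(3))
    moreover have "a : dg S ` S | dbl_inv S a : dg S ` S" using a d(1) by (auto simp: dbl_def)
    ultimately show ?thesis using co[of undefined] star_nb(1)[OF f] by auto
  qed
  then show "(A1 = {} & V1 = {}) | (A1 = gA (star S) & V1 = gV (star S))" using A1 V1 by auto
qed

lemma star_U: "finite (S :: 'u set) ==> star S : U_ob"
  using star_conn[of S] dg_props(2)[of S] by (auto simp: U_ob_def safe_def star_nb dbl_def)

lemma sx_in: "a : S ==> sx S m i a = m a"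
  by (simp add: sx_def)

lemma sx_inv:
  assumes "finite (S :: 'u set)" "a : dbl S" "!!s. s : S ==> i (i (m s)) = m s"
  shows "sx S m i (dbl_inv S a) = i (sx S m i a)"
  using assms(2,3) dbl_inv_props[OF assms(1)] by (auto simp: sx_def)

lemma sx_cases:
  assumes "finite (S :: 'u set)" "a : dbl S"
  obtains "a : S" "sx S m i a = m a" | s where "s : S" "a = dbl_inv S s" "sx S m i a = i (m s)"
proof (cases "a : S")
  case True then show ?thesis using that(1) by (simp add: sx_def)
next
  case False
  have "dbl_inv S a : S" using dbl_inv_props(5)[OF assms] False by simp
  then show ?thesis
    using dbl_inv_props(4)[OF assms, symmetric] by (rule that(2)) (use False in \<open>simp add: sx_def\<close>)
qed

text \<open>A map on the double is determined by its values on \<open>S\<close> and its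
  compatibility with the involutions. Most equations about stars are proved this way.\<close>

lemma sx_unique:
  assumes "finite (S :: 'u set)" "a : dbl S" "!!s. s : S ==> h s = m s"
    "!!s. s : S ==> h (dbl_inv S s) = i (m s)"
  shows "sx S m i a = h a"
  by (rule sx_cases[OF assms(1,2), where m = m and i = i]) (use assms(3,4) in auto)

text \<open>A vertex \<open>v\<close> of \<open>K\<close> and a labelling of \<open>inb K v\<close>
  by \<open>S\<close> amount to an etale map from the star on \<open>S\<close>.\<close>

lemma sx_et:
  assumes f: "finite (S :: 'u set)" and k: "is_graph K" and v: "v : gV K" and m: "bij_betw m S (inb K v)"
  shows "et (star S) K (sx S m (gi K)) (\<lambda>_. v)"
  unfolding et_def
proof (intro conjI ballI)
  have mA: "m s : gA K" if "s : S" for s using bij_betwE[OF m] that inb_gA[OF k] by blast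
  fix a assume "a : gA (star S)"
  then have a: "a : dbl S" by simp
  show "sx S m (gi K) a : gA K"
    by (rule sx_cases[OF f a, where m = m and i = "gi K"]) (use mA gi_in[OF k] in auto)
  show "sx S m (gi K) (gi (star S) a) = gi K (sx S m (gi K) a)"
    using sx_inv[OF f a, of "gi K" m] mA gi_gi[OF k] by simp
next
  have mA: "m s : gA K" if "s : S" for s using bij_betwE[OF m] that inb_gA[OF k] by blast
  fix w assume "w : gV (star S)"
  then have w: "w = undefined" by simp
  note d = dg_props[OF f] dbl_inv_props[OF f]
  have eq: "sx S m (gi K) (dg S s) = gi K (m s)" if "s : S" for s
    using d(2) d(4)[OF that] that by (auto simp: sx_def)
  have b: "bij_betw (\<lambda>s. gi K (m s)) S (nb K v)"
  proof -
    have "bij_betw (gi K) (inb K v) (nb K v)"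
      using inb_iff[OF k] nb_gA[OF k] gi_gi[OF k] gi_in[OF k] unfolding inb_def
      by (intro bij_betw_byWitness[where f' = "gi K"]) (auto simp: image_iff)
    then show ?thesis using bij_betw_trans[OF m] by (simp add: comp_def)
  qed
  have "bij_betw (\<lambda>s. sx S m (gi K) (dg S s)) S (nb K v)"
    using b eq by (subst bij_betw_cong[where g = "\<lambda>s. gi K (m s)"]) auto
  moreover have "bij_betw (dg S) S (dg S ` S)" using d(1) by (simp add: bij_betw_def)
  ultimately show "bij_betw (sx S m (gi K)) (nb (star S) w) (nb K v)"
    using bij_betw_comp_iff[of "dg S" S "dg S ` S" "sx S m (gi K)" "nb K v"] w star_nb(1)[OF f]
    by (simp add: comp_def)
qed (use v in simp)

text \<open>Left unit law. The arcs of the star are glued to boundary edges of \<open>H\<close>, so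
  the single copy of \<open>H\<close> contains all arcs and the function required by the universal
  property is \<open>Q\<close> itself.\<close>

lemma sub_star_left:
  assumes f: "finite (S :: 'u set)" and h: "connected_graph H" and m: "bij_betw m S (gB H)"
  shows "is_sub (star S) (\<lambda>_. H) (\<lambda>_. m) H (sx S m (gi H)) (\<lambda>_ a. a) (\<lambda>_ w. w)"
proof (rule is_subI)
  note g = conn_graph[OF h]
  have mA: "m s : gA H" if "s : S" for s using bij_betwE[OF m] that gB_gA[OF g] by blast
  show "is_graph H" using g .
  show "sx S m (gi H) a : gA H" if "a : gA (star S)" for a
    by (rule sx_cases[OF f that[simplified], where m = m and i = "gi H"]) (use mA gi_in[OF g] in auto)
  show "sx S m (gi H) (gi (star S) a) = gi H (sx S m (gi H) a)" if "a : gA (star S)" for a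
    using sx_inv[OF f that[simplified], of "gi H" m] mA gi_gi[OF g] by simp
  show "et H H (\<lambda>a. a) (\<lambda>w. w)" by (rule et_id)
  show "m a = sx S m (gi H) a" if "v : gV (star S)" "a : inb (star S) v" for v a
    using that star_nb(3)[OF f] by (simp add: sx_in)
  show "(EX a:gA (star S). b = sx S m (gi H) a) | (EX v:gV (star S). EX a:gA H. b = a)" if "b : gA H" for b
    using that by simp
  show "EX R :: 'u => bool. (ALL a:gA (star S). R (sx S m (gi H) a) = P a) &
      (ALL v:gV (star S). ALL a:gA H. R a = Q v a)"
    if c: "glue_compat (star S) (\<lambda>_. H) (\<lambda>_. m) P Q" for P Q
  proof (intro exI conjI ballI)
    have c': "Q undefined (m s) = P s" "Q undefined (gi H (m s)) = P (dbl_inv S s)" if "s : S" for s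
      using c that star_nb(3)[OF f] by (auto simp: glue_compat_def)
    show "Q undefined (sx S m (gi H) a) = P a" if "a : gA (star S)" for a
      by (rule sx_cases[OF f that[simplified], where m = m and i = "gi H"]) (use c' in auto)
    show "Q undefined a = Q v a" if "v : gV (star S)" for v a using that by simp
  qed
  show "bij_betw (sx S m (gi H)) (gB (star S)) (gB H)"
    using m by (simp add: bij_betw_cong[of S "sx S m (gi H)" m] sx_in)
qed simp_all

text \<open>Right unit law. Here all arcs come from \<open>G\<close>, and \<open>P\<close> solves
  the universal property.\<close>

lemma sub_star_right:
  assumes g: "connected_graph (G :: 'u graph)"
  shows "is_sub G (\<lambda>v. star (inb G v)) (\<lambda>v. \<lambda>s\<in>inb G v. s) G (\<lambda>a. a) (\<lambda>v. sx (inb G v) (\<lambda>s. s) (gi G)) (\<lambda>v _. v)"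
proof (rule is_subI)
  note gg = conn_graph[OF g]
  note f = finite_inb[OF gg]
  show "is_graph G" using gg .
  show "et (star (inb G v)) G (sx (inb G v) (\<lambda>s. s) (gi G)) (\<lambda>_. v)" if "v : gV G" for v
    using sx_et[OF f gg that, of "\<lambda>s. s"] by (simp add: bij_betw_def)
  show "sx (inb G v) (\<lambda>s. s) (gi G) ((\<lambda>s\<in>inb G v. s) a) = a" if "a : inb G v" for v a
    using that by (simp add: sx_in)
  show "EX R :: 'u => bool. (ALL a:gA G. R a = P a) &
      (ALL v:gV G. ALL a:gA (star (inb G v)). R (sx (inb G v) (\<lambda>s. s) (gi G) a) = Q v a)"
    if c: "glue_compat G (\<lambda>v. star (inb G v)) (\<lambda>v. \<lambda>s\<in>inb G v. s) P Q" for P Q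
  proof (intro exI conjI ballI)
    show "P (sx (inb G v) (\<lambda>s. s) (gi G) a) = Q v a" if "v : gV G" "a : gA (star (inb G v))" for v a
      by (rule sx_cases[OF f that(2)[simplified], where m = "\<lambda>s. s" and i = "gi G"])
        (use c that(1) in \<open>auto simp: glue_compat_def\<close>)
  qed simp
qed (auto simp: bij_betw_def)

end

section \<open>The substituted graph\<close>

lemma eqcl_refl: "(x, x) : eqcl r"
  and eqcl_base: "(x, y) : r ==> (x, y) : eqcl r"
  and eqcl_trans: "(x, y) : eqcl r ==> (y, z) : eqcl r ==> (x, z) : eqcl r"
  by (auto simp: eqcl_def)

lemma eqcl_sym: "(x, y) : eqcl r ==> (y, x) : eqcl r"
  unfolding eqcl_def by (rule symD[OF sym_rtrancl]) (auto simp: sym_def)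

lemma eqcl_rtrancl: "(x, y) : r\<^sup>* ==> (x, y) : eqcl r"
  unfolding eqcl_def by (meson in_rtrancl_UnI)

lemma eqcl_invariant:
  assumes "(x, y) : eqcl r" "!!x y. (x, y) : r ==> f x = f y"
  shows "f x = f y"
  using assms(1) unfolding eqcl_def by (induction rule: rtrancl_induct) (use assms(2) in auto)

text \<open>If \<open>r\<close> and its converse are single-valued, \<open>r\<close> is a disjoint
  union of paths and cycles, so equivalent points lie on a common directed path.\<close>

lemma eqcl_cases:
  assumes "(x, y) : eqcl r" and s: "!!x y z. (x, y) : r ==> (x, z) : r ==> y = z"
    and t: "!!x y z. (y, x) : r ==> (z, x) : r ==> y = z"
  shows "(x, y) : r\<^sup>* | (y, x) : r\<^sup>*"
  using assms(1) unfolding eqcl_def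
proof (induction rule: rtrancl_induct)
  case base then show ?case by simp
next
  case (step y z)
  from step.hyps(2) consider "(y, z) : r" | "(z, y) : r" by auto
  then show ?case
  proof cases
    case 1
    from step.IH show ?thesis
    proof
      assume "(x, y) : r\<^sup>*" then show ?thesis using 1 by (meson rtrancl_into_rtrancl)
    next
      assume "(y, x) : r\<^sup>*"
      then show ?thesis
      proof (cases rule: converse_rtranclE)
        case base then show ?thesis using 1 by blast
      next
        case (step u) then show ?thesis using s[OF 1 step(1)] by simp
      qed
    qed
  next
    case 2
    from step.IH show ?thesis
    proof
      assume "(y, x) : r\<^sup>*" then show ?thesis using 2 by (meson converse_rtrancl_into_rtrancl)
    next
      assume "(x, y) : r\<^sup>*"
      then show ?thesis
      proof (cases rule: rtranclE)
        case base then show ?thesis using 2 by blast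
      next
        case (step u) then show ?thesis using t[OF 2 step(2)] by simp
      qed
    qed
  qed
qed

context infinite_universe
begin

lemma enc_eq [simp]: "enc (x :: 'u \<times> 'u) = enc y \<longleftrightarrow> x = y"
proof -
  have "EX f :: 'u \<times> 'u => 'u. bij_betw f (UNIV \<times> UNIV) UNIV"
    using card_of_Times_same_infinite[OF inf_U] unfolding card_of_ordIso .
  then obtain f :: "'u \<times> 'u => 'u" where "inj f" by (auto simp: bij_betw_def)
  then have "inj (enc :: 'u \<times> 'u => 'u)" unfolding enc_def by (rule someI[where P = inj])
  then show ?thesis by (simp add: inj_eq)
qed

end

text \<open>For an internal arc \<open>b\<close>, the relation \<open>rh\<close> sends the boundary
  arc \<open>m v b\<close> of \<open>H v\<close> to the arc of the neighbouring \<open>H w\<close>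
  with which it is glued. If \<open>H w\<close> is an edge, the image is again a boundary arc and
  may be glued further; the analysis is about the resulting chains.\<close>

locale gluing = infinite_universe type_u for type_u :: "'u itself" +
  fixes G :: "'u graph" and H :: "'u => 'u graph" and m :: "'u => 'u => 'u"
  assumes ok: "sub_ok G H m" and ne: "gV G ~= {}"
begin

abbreviation "rh \<equiv> glue_rel G H m"
abbreviation "ga \<equiv> glue G H m"
abbreviation "K \<equiv> sub_graph G H m"

definition "W = (SIGMA v:gV G. gA (H v))"
definition "I = (\<lambda>(v, a). (v, gi (H v) a))"

lemmas O = sub_okD[OF ok]

lemma m_inj: "v : gV G ==> a : inb G v ==> b : inb G v ==> m v a = m v b ==> a = b"
  using O(5) by (meson bij_betw_def inj_onD)

lemma I_simp [simp]: "I (v, a) = (v, gi (H v) a)"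
  by (simp add: I_def)

lemma W_iff [simp]: "(v, a) : W \<longleftrightarrow> v : gV G & a : gA (H v)"
  by (simp add: W_def)

lemma I_I: "x : W ==> I (I x) = x" "x : W ==> I x : W"
  using gi_gi[OF O(4)] gi_in[OF O(4)] by (cases x; simp)+

lemma rho_iff:
  "((v, x), (w, y)) : rh \<longleftrightarrow>
     (EX b. b : inb G v & b : nb G w & x = m v b & y = gi (H w) (m w (gi G b)))" (is "?L \<longleftrightarrow> ?R")
proof
  assume ?L
  then obtain a where a: "a : dA G" "gi G a : dA G" "v = tA G a" "x = m v (gi G a)"
    "w = tA G (gi G a)" "y = gi (H w) (m w a)" by (auto simp: glue_rel_def)
  have "gi G (gi G a) = a" using gi_gi[OF O(2) dA_gA[OF O(2) a(1)]] .
  then have "gi G a : inb G v & gi G a : nb G w & x = m v (gi G a) & y = gi (H w) (m w (gi G (gi G a)))"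
    using a dA_gA[OF O(2)] by (simp add: inb_iff[OF O(2)] nb_iff[OF O(2)])
  then show ?R by blast
next
  assume ?R
  then obtain b where b: "b : inb G v" "b : nb G w" "x = m v b" "y = gi (H w) (m w (gi G b))" by blast
  have i: "gi G (gi G b) = b" using gi_gi[OF O(2) inb_gA[OF O(2) b(1)]] .
  have "gi G b : dA G" "tA G (gi G b) = v" "b : dA G" "tA G b = w"
    using b by (auto simp: inb_iff[OF O(2)] nb_iff[OF O(2)])
  then show ?L using b i unfolding glue_rel_def by (auto intro!: exI[of _ "gi G b"])
qed

lemma rhoE:
  assumes "(z, z') : rh"
  obtains v w b where "z = (v, m v b)" "z' = (w, gi (H w) (m w (gi G b)))" "b : inb G v" "b : nb G w"
    "v : gV G" "w : gV G" "gi G b : inb G w" "gi G b : nb G v" "gi G (gi G b) = b"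
proof -
  obtain v x w y where z: "z = (v, x)" "z' = (w, y)" by (metis surj_pair)
  obtain b where b: "b : inb G v" "b : nb G w" "x = m v b" "y = gi (H w) (m w (gi G b))"
    using assms unfolding z rho_iff by blast
  have i: "gi G (gi G b) = b" using gi_gi[OF O(2) inb_gA[OF O(2) b(1)]] .
  show ?thesis
    using b i inb_gV[OF O(2) b(1)] nb_gV[OF O(2) b(2)] inb_gA[OF O(2) b(1)] gi_in[OF O(2)]
    by (intro that[of v b w]) (auto simp: z inb_iff[OF O(2)])
qed

lemma rho_W: "(z, z') : rh ==> z : W & z' : W"
  by (erule rhoE) (simp add: O(7) gi_in[OF O(4)])

lemma rho_fun: "(x, y) : rh ==> (x, z) : rh ==> y = z"
proof (elim rhoE)
  fix v w b v' w' b'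
  assume *: "x = (v, m v b)" "x = (v', m v' b')" "y = (w, gi (H w) (m w (gi G b)))"
    "z = (w', gi (H w') (m w' (gi G b')))" "b : inb G v" "b' : inb G v'" "b : nb G w" "b' : nb G w'" "v : gV G"
  then have "(v, m v b) = (v', m v' b')" by metis
  then have "b = b'" using * by (metis m_inj prod.inject)
  moreover have "w = w'" using nb_unique[OF O(2)] * \<open>b = b'\<close> by blast
  ultimately show "y = z" using * by simp
qed

text \<open>Turning both arcs around means reading the internal edge from its other end.\<close>

lemma rho_rev: "(x, y) : rh ==> (I y, I x) : rh"
proof (elim rhoE)
  fix v w b
  assume *: "x = (v, m v b)" "y = (w, gi (H w) (m w (gi G b)))" "gi G b : inb G w" "gi G b : nb G v"
    "w : gV G" "gi G (gi G b) = b"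
  then have "gi (H w) (gi (H w) (m w (gi G b))) = m w (gi G b)" using gi_gi[OF O(4) O(7)] by simp
  then show "(I y, I x) : rh" using * by (auto simp: rho_iff)
qed

lemma rho_inj:
  assumes "(y, x) : rh" "(z, x) : rh" shows "y = z"
proof -
  have "I y = I z" using rho_fun[OF rho_rev[OF assms(1)] rho_rev[OF assms(2)]] .
  then show ?thesis using I_I(1) rho_W assms by metis
qed

lemma rho_cases: "(x, y) : eqcl rh ==> (x, y) : rh\<^sup>* | (y, x) : rh\<^sup>*"
  by (rule eqcl_cases) (assumption | erule (1) rho_fun | erule (1) rho_inj)+

lemma rho_star_rev: "(x, y) : rh\<^sup>* ==> (I y, I x) : rh\<^sup>*"
  by (induction rule: rtrancl_induct) (auto intro: converse_rtrancl_into_rtrancl rho_rev)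

lemma rho_star_W: "(x, y) : rh\<^sup>* ==> x : W ==> y : W"
  by (induction rule: rtrancl_induct) (auto dest: rho_W)

lemma eq_I: "(x, y) : eqcl rh ==> (I x, I y) : eqcl rh"
  using rho_cases[of x y] rho_star_rev[of x y] rho_star_rev[of y x]
    eqcl_rtrancl[of "I y" "I x" rh] eqcl_rtrancl[of "I x" "I y" rh] eqcl_sym[of "I y" "I x" rh] by blast

text \<open>Suppose that a chain of length \<open>n\<close> leads from \<open>x\<close> to
  \<open>I x\<close>. Its first step, to \<open>x1\<close>, is mirrored by a step from
  \<open>I x1\<close> to \<open>I x\<close>, which is the last one of the chain because
  \<open>rh\<close> is injective. So a chain of length \<open>n - 2\<close> leads from
  \<open>x1\<close> to \<open>I x1\<close>. At length 0 or 1 the involution of \<open>H v\<close> or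
  of \<open>G\<close> would have a fixed point.\<close>

lemma relpow_no_fix: "x : W ==> (x, I x) \<notin> rh ^^ n"
proof (induction n arbitrary: x rule: less_induct)
  case (less n)
  obtain v a where x: "x = (v, a)" "v : gV G" "a : gA (H v)" using less.prems by (cases x) simp
  consider "n = 0" | "n = 1" | k where "n = Suc (Suc k)" by (metis One_nat_def not0_implies_Suc)
  then show ?case
  proof cases
    case 1 then show ?thesis using x gi_neq[OF O(4)[OF x(2)] x(3), symmetric] by auto
  next
    case 2
    show ?thesis
    proof
      assume "(x, I x) : rh ^^ n"
      then have "(x, I x) : rh" using 2 by simp
      then show False
      proof (elim rhoE)
        fix v' w b
        assume *: "x = (v', m v' b)" "I x = (w, gi (H w) (m w (gi G b)))" "b : inb G v'" "gi G b : inb G w" "w : gV G"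
        then have w: "w = v'" by simp
        then have "gi (H w) (m w b) = gi (H w) (m w (gi G b))" using * by simp
        then have "m w b = m w (gi G b)"
          using * w O(7) inj_onD[OF inj_gi[OF O(4)[OF \<open>w : gV G\<close>]]] by blast
        then have "b = gi G b" using m_inj[of w b "gi G b"] * w by blast
        then show False using gi_neq[OF O(2) inb_gA[OF O(2) \<open>b : inb G v'\<close>]] by simp
      qed
    qed
  next
    case 3
    show ?thesis
    proof
      assume "(x, I x) : rh ^^ n"
      then obtain x1 where x1: "(x, x1) : rh" "(x1, I x) : rh ^^ Suc k" using 3 by (meson relpow_Suc_D2)
      then obtain y where y: "(x1, y) : rh ^^ k" "(y, I x) : rh" by (meson relpow_Suc_E)
      have "y = I x1" using rho_inj[OF y(2) rho_rev[OF x1(1)]] .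
      then show False using less.IH[of k x1] 3 y(1) rho_W[OF x1(1)] by simp
    qed
  qed
qed

lemma no_fix: "x : W ==> (x, I x) \<notin> eqcl rh"
proof
  assume x: "x : W" and "(x, I x) : eqcl rh"
  then consider "(x, I x) : rh\<^sup>*" | "(I x, x) : rh\<^sup>*" using rho_cases by blast
  then show False
  proof cases
    case 1 then show ?thesis using relpow_no_fix[OF x] by (meson rtrancl_imp_relpow)
  next
    case 2
    then have "(I x, I (I x)) : rh\<^sup>*" using I_I(1)[OF x] by simp
    then show ?thesis using relpow_no_fix[OF I_I(2)[OF x]] by (meson rtrancl_imp_relpow)
  qed
qed

lemma terminal_unique:
  assumes "(x, y) : eqcl rh" "x \<notin> Domain rh" "y \<notin> Domain rh"
  shows "x = y"
proof -
  have t: "a = b" if "(a, b) : rh\<^sup>*" "a \<notin> Domain rh" for a b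
    using that by (metis Domain.DomainI converse_rtranclE)
  show ?thesis using rho_cases[OF assms(1)] t assms(2,3) by metis
qed

text \<open>Chains continue only from arcs \<open>m v b\<close> with \<open>b\<close> in
  \<open>dA G\<close>. Darts of the \<open>H v\<close> and outer boundary arcs are therefore ends of
  chains, and \<open>terminal_unique\<close> keeps them distinct in the quotient.\<close>

lemma dart_terminal: "v : gV G ==> d : dA (H v) ==> (v, d) \<notin> Domain rh"
  using gB_dA[OF O(4) O(6)] by (auto elim!: rhoE)

lemma outer_terminal: "v : gV G ==> b : inb G v ==> b \<notin> dA G ==> (v, m v b) \<notin> Domain rh"
proof
  assume *: "v : gV G" "b : inb G v" "b \<notin> dA G" and "(v, m v b) : Domain rh"
  then obtain z where "((v, m v b), z) : rh" by blast
  then show False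
  proof (elim rhoE)
    fix v' b' w assume **: "(v, m v b) = (v', m v' b')" "b' : inb G v'" "b' : nb G w"
    then have "b = b'" using * by (metis m_inj prod.inject)
    then show False using * ** nb_iff[OF O(2)] by blast
  qed
qed

text \<open>The arcs whose chains never end, that is, which lie on cycles of
  \<open>rh\<close>.\<close>

definition "N = {x : W. ALL y. (x, y) : rh\<^sup>* --> y : Domain rh}"

lemma finite_W: "finite W"
  unfolding W_def using finite_gV[OF O(2)] finite_gA[OF O(4)] by blast

text \<open>\<open>rh\<close> restricts to an injective self-map of the finite set \<open>N\<close>,
  which is hence onto.\<close>

lemma N_pred:
  assumes "x : N" shows "EX y:N. (y, x) : rh"
proof -
  define s where "s x = (SOME y. (x, y) : rh)" for x
  have s: "(x, s x) : rh" if "x : N" for x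
  proof -
    have "EX y. (x, y) : rh" using that rtrancl.rtrancl_refl[of x rh] unfolding N_def by blast
    then show ?thesis unfolding s_def by (rule someI_ex)
  qed
  have "s x : N" if "x : N" for x
    using s[OF that] rho_W[OF s[OF that]] that unfolding N_def by (auto intro: converse_rtrancl_into_rtrancl)
  moreover have "inj_on s N" using s rho_inj by (metis inj_onI)
  moreover have "finite N" using finite_W by (auto simp: N_def)
  ultimately have "s ` N = N" by (intro endo_inj_surj) auto
  then have "x : s ` N" using assms by simp
  then show ?thesis using s by auto
qed

text \<open>By \<open>N_pred\<close> the chain of \<open>x\<close> can be followed backwards inside
  \<open>N\<close> without end; \<open>I\<close> turns this into an endless chain of
  \<open>I x\<close>.\<close>

lemma N_I:
  assumes x: "x : N" shows "I x : N"
proof -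
  have "EX x':N. z = I x'" if "(I x, z) : rh\<^sup>*" for z
    using that
  proof (induction rule: rtrancl_induct)
    case base then show ?case using x by blast
  next
    case (step y z)
    then obtain x' where x': "x' : N" "y = I x'" by blast
    obtain u where u: "u : N" "(u, x') : rh" using N_pred[OF x'(1)] by blast
    have "z = I u" using rho_fun[OF step.hyps(2)] rho_rev[OF u(2)] x' by simp
    then show ?case using u by blast
  qed
  moreover have "I x' : Domain rh" if "x' : N" for x'
    using N_pred[OF that] rho_rev by blast
  moreover have "I x : W" using x I_I(2) by (simp add: N_def)
  ultimately show ?thesis unfolding N_def by blast
qed

text \<open>The third case is that of a nodeless loop \<open>H w\<close>, whose arcs are neither
  darts nor in the boundary.\<close>

lemma terminal_cases:
  assumes "(w, y) : W" "(w, y) \<notin> Domain rh"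
  shows "y : dA (H w) | (EX b:inb G w. b \<notin> dA G & y = m w b) | gV (H w) = {} & gB (H w) = {}"
proof (rule ccontr)
  assume n: "\<not> ?thesis"
  have w: "w : gV G" and y: "y : gA (H w)" using assms(1) by auto
  have "y : gB (H w)" using gB_cases[OF O(3)[OF w]] n y by blast
  then obtain b where b: "b : inb G w" "y = m w b" using O(5)[OF w] by (auto simp: bij_betw_def)
  then have "b : dA G" using n by blast
  then have "b : nb G (tA G b)" by (simp add: nb_iff[OF O(2)])
  then have "((w, y), (tA G b, gi (H (tA G b)) (m (tA G b) (gi G b)))) : rh" using b rho_iff by blast
  then show False using assms(2) by blast
qed

text \<open>The partner of \<open>a\<close> is an end of a chain, hence not in \<open>N\<close>; by
  \<open>N_I\<close> neither is \<open>a\<close>, so its chain ends. It cannot end in a nodeless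
  loop: at the start this is excluded by \<open>nl\<close>, and later because a chain only enters
  graphs with nonempty boundary.\<close>

lemma reach_terminal:
  assumes v: "v : gV G" and a: "a : gA (H v)" and t: "(v, gi (H v) a) \<notin> Domain rh"
    and nl: "gV (H v) ~= {} | gB (H v) ~= {}"
  shows "EX w y. w : gV G & ((v, a), (w, y)) : eqcl rh &
    (y : dA (H w) | (EX b:inb G w. b \<notin> dA G & y = m w b))"
proof -
  have W: "(v, a) : W" "I (v, a) : W" using v a I_I(2) by auto
  have "(v, a) \<notin> N"
  proof
    assume "(v, a) : N"
    then have "I (v, a) : N" by (rule N_I)
    then show False using t unfolding N_def by auto
  qed
  then obtain z where z: "((v, a), z) : rh\<^sup>*" "z \<notin> Domain rh" using W unfolding N_def by auto
  obtain w y where wy: "z = (w, y)" by (cases z)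
  have zW: "(w, y) : W" using rho_star_W[OF z(1) W(1)] wy by simp
  have "\<not> (gV (H w) = {} & gB (H w) = {})"
  proof (cases "z = (v, a)")
    case True then show ?thesis using nl wy by auto
  next
    case False
    then obtain u where "(u, z) : rh" using z(1) by (metis rtranclE)
    then have "gB (H w) ~= {}" using O(6) by (elim rhoE) (auto simp: wy)
    then show ?thesis by blast
  qed
  then show ?thesis using terminal_cases[OF zW] z(2) eqcl_rtrancl[OF z(1)] zW wy by auto
qed

section \<open>The graph structure on the glued arcs\<close>

lemma glue_eq: "ga v a = ga w b \<longleftrightarrow> ((v, a), (w, b)) : eqcl rh"
proof
  assume "ga v a = ga w b"
  then have e: "(SOME z. ((v, a), z) : eqcl rh) = (SOME z. ((w, b), z) : eqcl rh)" (is "?x = ?y")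
    by (simp add: glue_def)
  have "((v, a), ?x) : eqcl rh" "((w, b), ?y) : eqcl rh"
    using someI[of "\<lambda>z. ((v, a), z) : eqcl rh", OF eqcl_refl]
      someI[of "\<lambda>z. ((w, b), z) : eqcl rh", OF eqcl_refl] by auto
  then show "((v, a), (w, b)) : eqcl rh" using e eqcl_sym eqcl_trans by metis
next
  assume e: "((v, a), (w, b)) : eqcl rh"
  have "((v, a), z) : eqcl rh \<longleftrightarrow> ((w, b), z) : eqcl rh" for z using e eqcl_sym eqcl_trans by metis
  then show "ga v a = ga w b" by (simp add: glue_def)
qed

lemma glue_i: "ga v a = ga w b ==> ga v (gi (H v) a) = ga w (gi (H w) b)"
  unfolding glue_eq using eq_I[of "(v, a)" "(w, b)"] by simp

lemma glue_dart: "v : gV G ==> d : dA (H v) ==> w : gV G ==> e : dA (H w) ==>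
  ga v d = ga w e ==> v = w & d = e"
  using terminal_unique[of "(v, d)" "(w, e)"] dart_terminal unfolding glue_eq by simp

lemma glue_outer: "v : gV G ==> a : inb G v ==> a \<notin> dA G ==> w : gV G ==> b : inb G w ==> b \<notin> dA G ==>
  ga v (m v a) = ga w (m w b) ==> a = b"
  using terminal_unique[of "(v, m v a)" "(w, m w b)"] outer_terminal m_inj unfolding glue_eq by auto

lemma glue_dart_outer: "v : gV G ==> d : dA (H v) ==> w : gV G ==> b : inb G w ==> b \<notin> dA G ==>
  ga v d ~= ga w (m w b)"
  using terminal_unique[of "(v, d)" "(w, m w b)"] outer_terminal dart_terminal gB_dA[OF O(4) O(6)]
  unfolding glue_eq by auto

lemma glue_link: "b : inb G v ==> b : nb G w ==> ga v (m v b) = ga w (gi (H w) (m w (gi G b)))"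
  unfolding glue_eq by (intro eqcl_base) (auto simp: rho_iff)

lemma K_simps:
  "gA K = {ga v a | v a. v : gV G & a : gA (H v)}" "gD K = {enc (v, d) | v d. v : gV G & d : gD (H v)}"
  "gV K = {enc (v, w) | v w. v : gV G & w : gV (H v)}" "gB K = sub_bd G H m ` gB G"
  using ne by (auto simp: sub_graph_def sub_arcs_def sub_darts_def)

lemma K_i: "v : gV G ==> a : gA (H v) ==> gi K (ga v a) = ga v (gi (H v) a)"
proof -
  assume va: "v : gV G" "a : gA (H v)"
  then have "ga v a : sub_arcs G H m" by (auto simp: sub_arcs_def)
  moreover have "(THE c. EX w:gV G. EX b:gA (H w). ga v a = ga w b & c = ga w (gi (H w) b)) = ga v (gi (H v) a)"
    by (rule the_equality) (use va in \<open>auto dest: glue_i[symmetric]\<close>)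
  ultimately show ?thesis using ne by (simp add: sub_graph_def)
qed

lemma K_s: "v : gV G ==> d : gD (H v) ==> gs K (enc (v, d)) = ga v (gs (H v) d)"
proof -
  assume va: "v : gV G" "d : gD (H v)"
  then have "enc (v, d) : sub_darts G H" by (auto simp: sub_darts_def)
  moreover have "(THE c. EX w:gV G. EX e:gD (H w). enc (v, d) = enc (w, e) & c = ga w (gs (H w) e)) = ga v (gs (H v) d)"
    by (rule the_equality) (use va in auto)
  ultimately show ?thesis using ne by (simp add: sub_graph_def)
qed

lemma K_t: "v : gV G ==> d : gD (H v) ==> gt K (enc (v, d)) = enc (v, gt (H v) d)"
proof -
  assume va: "v : gV G" "d : gD (H v)"
  then have "enc (v, d) : sub_darts G H" by (auto simp: sub_darts_def)
  moreover have "(THE c. EX w:gV G. EX e:gD (H w). enc (v, d) = enc (w, e) & c = enc (w, gt (H w) e)) = enc (v, gt (H v) d)"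
    by (rule the_equality) (use va in auto)
  ultimately show ?thesis using ne by (simp add: sub_graph_def)
qed

lemma K_ext: "gi K : extensional (gA K)" "gs K : extensional (gD K)" "gt K : extensional (gD K)"
  using ne by (auto simp: sub_graph_def)

lemma K_dA: "dA K = {ga v a | v a. v : gV G & a : dA (H v)}"
proof -
  have "dA K = {gs K (enc (v, d)) | v d. v : gV G & d : gD (H v)}"
    unfolding dA_def K_simps by blast
  also have "\<dots> = {ga v (gs (H v) d) | v d. v : gV G & d : gD (H v)}"
    using K_s by (intro Collect_cong ex_cong1) auto
  also have "\<dots> = {ga v a | v a. v : gV G & a : dA (H v)}" unfolding dA_def by blast
  finally show ?thesis .
qed

lemma K_nb:
  assumes v: "v : gV G" shows "nb K (enc (v, w)) = ga v ` nb (H v) w"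
proof -
  have "nb K (enc (v, w)) = {gs K (enc (v', d)) | v' d. v' : gV G & d : gD (H v') & gt K (enc (v', d)) = enc (v, w)}"
    unfolding nb_def K_simps by blast
  also have "\<dots> = {ga v' (gs (H v') d) | v' d. v' : gV G & d : gD (H v') & enc (v', gt (H v') d) = enc (v, w)}"
    using K_s K_t by (intro Collect_cong ex_cong1) auto
  also have "\<dots> = {ga v (gs (H v) d) | d. d : gD (H v) & gt (H v) d = w}" using v by auto
  also have "\<dots> = ga v ` nb (H v) w" unfolding nb_def by blast
  finally show ?thesis .
qed

lemma boundary_inb:
  assumes "b : gB G" shows "tA G (gi G b) : gV G" "b : inb G (tA G (gi G b))" "b \<notin> dA G"
proof -
  have bA: "b : gA G" using gB_gA[OF O(2) assms] .
  show n: "b \<notin> dA G" using gB_dA[OF O(2) assms] .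
  then have "gi G b : dA G" using conn_arc_cases[OF O(1) ne bA] by blast
  then show "tA G (gi G b) : gV G" "b : inb G (tA G (gi G b))"
    using bA by (auto simp: inb_iff[OF O(2)] nb_iff[OF O(2)] tA_gV[OF O(2)])
qed

lemma inb_tA: "b : inb G v ==> tA G (gi G b) = v" "b : inb G v ==> gi G b : dA G"
  by (auto simp: inb_iff[OF O(2)] nb_iff[OF O(2)])

lemma outer_gB: "b : inb G v ==> b \<notin> dA G ==> b : gB G"
  using gB_cases[OF O(1)] ne inb_gA[OF O(2)] by blast

lemma K_gB: "gB K = {ga v (m v b) | v b. v : gV G & b : inb G v & b \<notin> dA G}"
proof
  show "gB K \<subseteq> {ga v (m v b) | v b. v : gV G & b : inb G v & b \<notin> dA G}"
  proof
    fix c assume "c : gB K"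
    then obtain b where b: "b : gB G" "c = sub_bd G H m b" by (auto simp: K_simps)
    then have "c = ga (tA G (gi G b)) (m (tA G (gi G b)) b)" using ne by (simp add: sub_bd_def)
    then show "c : {ga v (m v b) | v b. v : gV G & b : inb G v & b \<notin> dA G}"
      using boundary_inb[OF b(1)] by blast
  qed
  show "{ga v (m v b) | v b. v : gV G & b : inb G v & b \<notin> dA G} \<subseteq> gB K"
  proof clarsimp
    fix v b assume b: "v : gV G" "b : inb G v" "b \<notin> dA G"
    then have "ga v (m v b) = sub_bd G H m b" using ne inb_tA by (simp add: sub_bd_def)
    then show "ga v (m v b) : gB K" using outer_gB[OF b(2,3)] by (simp add: K_simps)
  qed
qed

lemma K_graph: "is_graph K"
  unfolding is_graph_def
proof (intro conjI)
  have gAW: "gA K = (\<lambda>(v, a). ga v a) ` W" by (auto simp: K_simps W_def image_iff)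
  show "finite (gA K)" unfolding gAW using finite_W by blast
  have "gD K = enc ` (SIGMA v:gV G. gD (H v))" by (auto simp: K_simps image_iff)
  moreover have "finite (gD (H v))" if "v : gV G" for v using O(4)[OF that] by (simp add: is_graph_def)
  ultimately show "finite (gD K)" using finite_gV[OF O(2)] by simp
  have "gV K = enc ` (SIGMA v:gV G. gV (H v))" by (auto simp: K_simps image_iff)
  then show "finite (gV K)" using finite_gV[OF O(2)] finite_gV[OF O(4)] by simp
  have iA: "gi K c : gA K & gi K (gi K c) = c & gi K c ~= c" if c: "c : gA K" for c
  proof -
    obtain v a where v: "v : gV G" and a: "a : gA (H v)" and cc: "c = ga v a" using c by (auto simp: K_simps)
    note ia = gi_in[OF O(4)[OF v] a] gi_gi[OF O(4)[OF v] a]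
    \<comment> \<open>Here it is needed that no chain leads from an arc to its own partner.\<close>
    have "ga v (gi (H v) a) ~= ga v a"
      using no_fix[of "(v, a)"] v a eqcl_sym[of "(v, gi (H v) a)" "(v, a)" rh] unfolding glue_eq by auto
    then show ?thesis using cc v a ia K_i K_simps(1) by auto
  qed
  show "gi K : gA K \<rightarrow>\<^sub>E gA K" using iA K_ext by (auto simp: PiE_def)
  show "ALL a:gA K. gi K (gi K a) = a & gi K a ~= a" using iA by blast
  have gsA: "gs (H v) d : dA (H v)" if "d : gD (H v)" for v d using that by (simp add: dA_def)
  have "gs K e : gA K" if "e : gD K" for e
    using that gsA dA_gA[OF O(4)] by (auto simp: K_simps(1,2) K_s) blast
  then show "gs K : gD K \<rightarrow>\<^sub>E gA K" using K_ext by (auto simp: PiE_def)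
  show "inj_on (gs K) (gD K)"
  proof (rule inj_onI)
    fix x y assume x: "x : gD K" and y: "y : gD K" and eq: "gs K x = gs K y"
    obtain v d where v: "v : gV G" "d : gD (H v)" "x = enc (v, d)" using x by (auto simp: K_simps)
    obtain w e where w: "w : gV G" "e : gD (H w)" "y = enc (w, e)" using y by (auto simp: K_simps)
    have "v = w & gs (H v) d = gs (H w) e"
      using eq v w K_s by (intro glue_dart gsA) auto
    moreover have "inj_on (gs (H v)) (gD (H v))" using O(4)[OF v(1)] by (simp add: is_graph_def)
    ultimately have "v = w & d = e" using v w by (auto simp: inj_on_def)
    then show "x = y" using v w by simp
  qed
  have "gt K e : gV K" if e: "e : gD K" for e
  proof -
    obtain v d where v: "v : gV G" "d : gD (H v)" "e = enc (v, d)" using e by (auto simp: K_simps)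
    have "gt (H v) d : gV (H v)" using O(4)[OF v(1)] v(2) by (auto simp: is_graph_def)
    then show ?thesis using K_t v by (auto simp: K_simps(3))
  qed
  then show "gt K : gD K \<rightarrow>\<^sub>E gV K" using K_ext by (auto simp: PiE_def)
  have mK: "ga v (m v b) : gA K" if "v : gV G" "b : inb G v" for v b
    using O(7) that by (auto simp: K_simps(1))
  show disj: "gB K \<subseteq> gA K - dA K"
    using glue_dart_outer mK unfolding K_gB K_dA by (auto dest: sym)
  \<comment> \<open>The chain of the partner of a dart ends in a dart or in an outer boundary
    arc.\<close>
  show "gi K ` dA K - dA K \<subseteq> gB K"
  proof
    fix c assume c: "c : gi K ` dA K - dA K"
    then obtain v d where v: "v : gV G" and d: "d : dA (H v)" and cc: "c = gi K (ga v d)" unfolding K_dA by blast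
    have dA': "d : gA (H v)" using dA_gA[OF O(4)[OF v] d] .
    have cg: "c = ga v (gi (H v) d)" using cc K_i[OF v dA'] by simp
    have "gV (H v) ~= {}" using tA_gV[OF O(4)[OF v] d] by blast
    then obtain w y where wy: "w : gV G" "((v, gi (H v) d), (w, y)) : eqcl rh"
      "y : dA (H w) | (EX b:inb G w. b \<notin> dA G & y = m w b)"
      using reach_terminal[OF v gi_in[OF O(4)[OF v] dA']] gi_gi[OF O(4)[OF v] dA'] dart_terminal[OF v d] by auto
    have "c = ga w y" using wy(2) cg glue_eq by simp
    then show "c : gB K" using wy(1,3) c unfolding K_dA K_gB by blast
  qed
  \<comment> \<open>The same for the partner of an outer boundary arc. Ending in a dart is excluded
    by the choice of the arc, so the partner lies in the boundary too.\<close>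
  show "gi K ` (gB K - gi K ` dA K) \<subseteq> gB K - gi K ` dA K"
  proof
    fix c assume "c : gi K ` (gB K - gi K ` dA K)"
    then obtain c0 where c0: "c0 : gB K" "c0 \<notin> gi K ` dA K" "c = gi K c0" by blast
    obtain v b where v: "v : gV G" and b: "b : inb G v" "b \<notin> dA G" and cb: "c0 = ga v (m v b)"
      using c0(1) unfolding K_gB by blast
    have mA: "m v b : gA (H v)" using O(7)[OF v b(1)] .
    have cg: "c = ga v (gi (H v) (m v b))" using K_i[OF v mA] c0 cb by simp
    have "gB (H v) ~= {}" using O(6)[OF v b(1)] by blast
    then obtain w y where wy: "w : gV G" "((v, gi (H v) (m v b)), (w, y)) : eqcl rh"
      "y : dA (H w) | (EX b:inb G w. b \<notin> dA G & y = m w b)"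
      using reach_terminal[OF v gi_in[OF O(4)[OF v] mA]] gi_gi[OF O(4)[OF v] mA] outer_terminal[OF v b] by auto
    have cw: "c = ga w y" using wy(2) cg glue_eq by simp
    have c0A: "c0 : gA K" using disj c0(1) by blast
    then have ic: "gi K c = c0" using iA c0(3) by simp
    have "c \<notin> dA K" using c0(2) ic by blast
    then have "c : gB K" using wy(1,3) cw unfolding K_dA K_gB by blast
    moreover have "c \<notin> gi K ` dA K"
    proof
      assume "c : gi K ` dA K"
      then obtain e where e: "e : dA K" "c = gi K e" by blast
      have "e : gA K" using e(1) dA_gA[OF O(4)] unfolding K_dA K_simps(1) by blast
      then have "c0 = e" using iA ic e(2) by metis
      then show False using e(1) c0(1) disj by blast
    qed
    ultimately show "c : gB K - gi K ` dA K" by blast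
  qed
qed

text \<open>For an arc of an internal edge both formulas make sense and agree by
  \<open>glue_link\<close>. For any other arc exactly one of them does, since each edge of
  \<open>G\<close> has an end at a vertex.\<close>

definition "J a = (if gi G a : dA G then ga (tA G (gi G a)) (m (tA G (gi G a)) a)
   else ga (tA G a) (gi (H (tA G a)) (m (tA G a) (gi G a))))"

lemma J_inb: "a : inb G v ==> J a = ga v (m v a)"
  using inb_tA by (simp add: J_def)

lemma J_nb:
  assumes a: "a : nb G w" shows "J a = ga w (gi (H w) (m w (gi G a)))"
proof (cases "gi G a : dA G")
  case True
  have "a : inb G (tA G (gi G a))" using True nb_gA[OF O(2) a] by (simp add: inb_iff[OF O(2)] nb_iff[OF O(2)])
  then show ?thesis using J_inb glue_link[OF _ a] by simp
next
  case False
  have "tA G a = w" using a nb_iff[OF O(2)] by blast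
  then show ?thesis using False by (simp add: J_def)
qed

lemma arc_cases:
  assumes "a : gA G"
  obtains v where "v : gV G" "a : inb G v" "gi G a : nb G v" | w where "w : gV G" "a : nb G w" "gi G a : inb G w"
proof -
  note * = conn_arc_cases[OF O(1) ne assms]
  have "EX v:gV G. a : inb G v & gi G a : nb G v" if "gi G a : dA G"
    using that assms by (auto simp: dA_iff_nb[OF O(2)] inb_iff[OF O(2)])
  moreover have "EX v:gV G. a : nb G v & gi G a : inb G v" if "a : dA G"
    using that assms gi_gi[OF O(2) assms] gi_in[OF O(2) assms] by (auto simp: dA_iff_nb[OF O(2)] inb_iff[OF O(2)])
  ultimately show ?thesis using * that by blast
qed

lemma K_is_sub: "is_sub G H m K J ga (\<lambda>v w. enc (v, w))"
proof (rule is_subI)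
  show "is_graph K" by (rule K_graph)
  have mA: "m v b : gA (H v)" "gi (H v) (m v b) : gA (H v)" if "v : gV G" "b : inb G v" for v b
    using O(7)[OF that] gi_in[OF O(4)[OF that(1)]] by auto
  have gK: "ga v a : gA K" if "v : gV G" "a : gA (H v)" for v a using that by (auto simp: K_simps)
  have imm: "gi (H v) (gi (H v) (m v b)) = m v b" if "v : gV G" "b : inb G v" for v b
    using gi_gi[OF O(4) mA(1)] that by blast
  show "J a : gA K" if "a : gA G" for a
    using that by (rule arc_cases) (auto simp: J_inb J_nb mA gK)
  show "J (gi G a) = gi K (J a)" if a: "a : gA G" for a
    using a by (rule arc_cases) (simp_all add: J_inb J_nb K_i mA gi_gi[OF O(2) a] imm)
  show "et (H v) K (ga v) (\<lambda>w. enc (v, w))" if v: "v : gV G" for v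
    unfolding et_def
  proof (intro conjI ballI)
    fix w assume w: "w : gV (H v)"
    show "enc (v, w) : gV K" using v w by (auto simp: K_simps)
    have "inj_on (ga v) (nb (H v) w)"
      using glue_dart[OF v _ v] nb_iff[OF O(4)[OF v]] by (auto intro!: inj_onI)
    then show "bij_betw (ga v) (nb (H v) w) (nb K (enc (v, w)))" using K_nb[OF v] by (simp add: bij_betw_def)
  qed (use v gK K_i in auto)
  show "ga v (m v a) = J a" if "v : gV G" "a : inb G v" for v a using J_inb[OF that(2)] by simp
  show "(EX a:gA G. b = J a) | (EX v:gV G. EX a:gA (H v). b = ga v a)" if "b : gA K" for b
    using that by (auto simp: K_simps)
  show "EX R :: 'u => bool. (ALL a:gA G. R (J a) = P a) & (ALL v:gV G. ALL a:gA (H v). R (ga v a) = Q v a)"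
    if c: "glue_compat G H m P Q" for P Q
  proof -
    have c': "Q v (m v a) = P a" "Q v (gi (H v) (m v a)) = P (gi G a)" if "v : gV G" "a : inb G v" for v a
      using c that by (auto simp: glue_compat_def)
    \<comment> \<open>\<open>Q\<close> is constant along \<open>rh\<close>, hence on the generated
      equivalence.\<close>
    have inv: "Q v a = Q w b" if "ga v a = ga w b" for v a w b
    proof -
      have "(\<lambda>(v, a). Q v a) (v, a) = (\<lambda>(v, a). Q v a) (w, b)"
        by (rule eqcl_invariant[OF that[unfolded glue_eq]], erule rhoE) (simp add: c')
      then show ?thesis by simp
    qed
    define R where "R c = (EX v a. v : gV G & a : gA (H v) & c = ga v a & Q v a)" for c
    have R: "R (ga v a) = Q v a" if "v : gV G" "a : gA (H v)" for v a
      unfolding R_def using inv that by metis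
    have "R (J a) = P a" if a: "a : gA G" for a
      using a by (rule arc_cases) (simp_all add: J_inb J_nb R mA c' gi_gi[OF O(2) a])
    then show ?thesis using R by blast
  qed
  show "EX v:gV G. EX w:gV (H v). u = enc (v, w)" if "u : gV K" for u using that by (auto simp: K_simps)
  show "bij_betw J (gB G) (gB K)"
    unfolding bij_betw_def
  proof
    show "inj_on J (gB G)"
    proof (rule inj_onI)
      fix a b assume "a : gB G" "b : gB G" "J a = J b"
      then show "a = b" using boundary_inb glue_outer J_inb by metis
    qed
    have "J b = sub_bd G H m b" if "b : gB G" for b
      using J_inb[OF boundary_inb(2)[OF that]] ne by (simp add: sub_bd_def)
    then show "J ` gB G = gB K" by (simp add: K_simps(4))
  qed
qed simp

lemma J_bd: "b : gB G ==> J b = sub_bd G H m b"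
  using J_inb[OF boundary_inb(2)] ne by (simp add: sub_bd_def)

end

context infinite_universe
begin

text \<open>The case without vertices lies outside the gluing, but it fits \<open>is_sub\<close>
  with the identity as \<open>j\<close>.\<close>

lemma sub_graph_is_sub:
  assumes ok: "sub_ok (G :: 'u graph) H m"
  shows "EX j. is_sub G H m (sub_graph G H m) j (glue G H m) (\<lambda>v w. enc (v, w)) &
     (ALL b:gB G. j b = sub_bd G H m b) & (gV G = {} --> (ALL a:gA G. j a = a))"
proof (cases "gV G = {}")
  case False
  then interpret gluing type_u G H m using ok by unfold_locales
  show ?thesis using K_is_sub J_bd False by blast
next
  case True
  then have "is_sub G H m (sub_graph G H m) (\<lambda>a. a) (glue G H m) (\<lambda>v w. enc (v, w))"
    using sub_okD(2)[OF ok] by (intro is_subI) (auto simp: sub_graph_def bij_betw_def)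
  then show ?thesis using True by (intro exI[of _ "\<lambda>a. a"]) (simp add: sub_bd_def)
qed

text \<open>The description in \<open>sub_col\<close> is well defined because \<open>ze\<close> and
  \<open>zev\<close> are test data and so come from one function on the glued arcs.\<close>

lemma sub_col_props:
  assumes ok: "sub_ok (G :: 'u graph) H m" and c: "glue_compat G H m ze zev" and x: "ze : extensional (gA G)"
    and s: "is_sub G H m (sub_graph G H m) j (glue G H m) p" and V: "gV G = {} --> (ALL a:gA G. j a = a)"
  shows "sub_col G H m ze zev : extensional (gA (sub_graph G H m))"
    "!!a. a : gA G ==> sub_col G H m ze zev (j a) = ze a"
    "!!v a. v : gV G ==> a : gA (H v) ==> sub_col G H m ze zev (glue G H m v a) = zev v a"
proof -
  obtain R where R: "!!a. a : gA G ==> R (j a) = ze a"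
    "!!v a. v : gV G ==> a : gA (H v) ==> R (glue G H m v a) = zev v a"
    using sub_fun[OF s c] by blast
  show "sub_col G H m ze zev : extensional (gA (sub_graph G H m))"
    using x by (auto simp: sub_col_def sub_graph_def)
  show 3: "sub_col G H m ze zev (glue G H m v a) = zev v a" if v: "v : gV G" and a: "a : gA (H v)" for v a
  proof -
    have "(THE c. EX w:gV G. EX b:gA (H w). glue G H m v a = glue G H m w b & c = zev w b) = zev v a"
      using v a R(2) by (intro the_equality) (blast, metis)
    moreover have "glue G H m v a : sub_arcs G H m" using v a by (auto simp: sub_arcs_def)
    ultimately show ?thesis using v by (auto simp: sub_col_def)
  qed
  show "sub_col G H m ze zev (j a) = ze a" if a: "a : gA G" for a
  proof (cases "gV G = {}")
    case True then show ?thesis using V a by (simp add: sub_col_def)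
  next
    case False
    have "j a : gA (sub_graph G H m)" using is_subD(2)[OF s a] .
    then obtain v b where vb: "v : gV G" "b : gA (H v)" "j a = glue G H m v b"
      using False by (auto simp: sub_graph_def sub_arcs_def)
    then show ?thesis using 3 R a by metis
  qed
qed

end

section \<open>Substitution of decorated graphs\<close>

definition data_ok ::
  "'c cset => ('u, 'c, 'x) bfun => 'u graph => ('u => 'c) => ('u => 'u graph) => ('u => 'u => 'u) =>
     ('u => 'u => 'c) => ('u => 'u => 'x) => bool" where
  "data_ok C X G ze H m zev x \<longleftrightarrow> connected_graph G & ze : inv_maps (arcset G) C &
     (ALL v:gV G. ((m v, H v, zev v), x v) : gr_elts C X (at_vertex G ze v))"

text \<open>Substitution of decorated graphs, again as a relation: the coloring of \<open>K\<close>
  restricts along the structure maps to those of \<open>G\<close> and of the \<open>H v\<close>, and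
  each \<open>q v\<close> transports the decoration of \<open>H v\<close>. Models are unique up to
  isomorphism by \<open>dsub_unique\<close>.\<close>

definition dsub ::
  "('u, 'c, 'x) bfun => 'u graph => ('u => 'c) => ('u => 'u graph) => ('u => 'u => 'u) =>
     ('u => 'u => 'c) => ('u => 'u => 'x) => 'u graph => ('u => 'c) => ('u => 'x) =>
     ('u => 'u) => ('u => 'u => 'u) => ('u => 'u => 'u) => bool" where
  "dsub X G ze H m zev x K ze' x' j q p \<longleftrightarrow> is_sub G H m K j q p &
     ze' : extensional (gA K) & x' : extensional (gV K) & cpt G ze ze' j &
     (ALL v:gV G. det X (H v) (zev v) (x v) K ze' x' (q v) (p v))"

text \<open>Meant for the multiplication, where \<open>Z\<close> is the set of substituted graphs
  for all choices of representatives.\<close>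

lemma cls_eqI:
  assumes X: "bij_functor C X" and "Z ~= {}" "!!z. z : Z ==> (e, z) : gr_rel C X r"
  shows "gr_rel C X r `` Z = cls C X r e"
proof
  show "gr_rel C X r `` Z \<subseteq> cls C X r e"
    using gr_rel_trans[OF X assms(3)] by (auto simp: in_cls)
  obtain z where z: "z : Z" using assms(2) by blast
  show "cls C X r e \<subseteq> gr_rel C X r `` Z"
  proof
    fix w assume "w : cls C X r e"
    then have "(z, w) : gr_rel C X r"
      using gr_rel_trans[OF X gr_rel_sym[OF X assms(3)[OF z]]] by (simp add: in_cls)
    then show "w : gr_rel C X r `` Z" using z by (rule ImageI)
  qed
qed

lemma data_okD:
  assumes "data_ok C X G ze H m zev x"
  shows "sub_ok G H m" "ze : inv_maps (arcset G) C" "!!v. v : gV G ==> dgr C X (H v) (zev v) (x v)"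
    "glue_compat G H m ze zev" "!!v. v : gV G ==> ((m v, H v, zev v), x v) : gr_elts C X (at_vertex G ze v)"
    "is_graph G" "!!v. at_vertex G ze v : bij_ob C"
proof -
  show i: "ze : inv_maps (arcset G) C" and
    *: "!!v. v : gV G ==> ((m v, H v, zev v), x v) : gr_elts C X (at_vertex G ze v)"
    using assms by (simp_all add: data_ok_def)
  have c: "connected_graph G" using assms by (simp add: data_ok_def)
  then show g: "is_graph G" by (rule conn_graph)
  then show "!!v. at_vertex G ze v : bij_ob C" by (rule at_ob[OF _ i])
  show d: "!!v. v : gV G ==> dgr C X (H v) (zev v) (x v)" using * by (simp add: gr_elts_iff)
  show ok: "sub_ok G H m"
    unfolding sub_ok_def using c d[THEN dgrD(1)] * by (simp add: gr_elts_iff)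
  show "glue_compat G H m ze zev"
    unfolding glue_compat_def
  proof (intro ballI)
    fix v a assume v: "v : gV G" and a: "a : inb G v"
    have 1: "zev v (m v a) = ze a" using *[OF v] a by (simp add: gr_elts_iff)
    have "zev v (gi (H v) (m v a)) = cinv C (zev v (m v a))" using dgrD(8)[OF d[OF v] sub_okD(7)[OF ok v a]] .
    then show "zev v (m v a) = ze a & zev v (gi (H v) (m v a)) = ze (gi G a)"
      using 1 inv_mapsD(2)[OF i inb_gA[OF g a]] by simp
  qed
qed

lemma dsubD:
  assumes "dsub X G ze H m zev x K ze' x' j q p"
  shows "is_sub G H m K j q p" "ze' : extensional (gA K)" "x' : extensional (gV K)" "cpt G ze ze' j"
    "!!v. v : gV G ==> det X (H v) (zev v) (x v) K ze' x' (q v) (p v)"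
  using assms by (simp_all add: dsub_def)

text \<open>Every arc of \<open>K\<close> comes from \<open>G\<close> or from some
  \<open>H v\<close>, and every vertex from some \<open>H v\<close>, where the conditions on colors
  and operations are known.\<close>

lemma dsub_dgr:
  assumes X: "bij_functor C X" and ok: "data_ok C X G ze H m zev x"
    and s: "dsub X G ze H m zev x K ze' x' j q p"
  shows "dgr C X K ze' x'"
proof -
  note O = data_okD[OF ok] and D = dsubD[OF s]
  note S = is_subD[OF D(1)] and OG = sub_okD[OF O(1)]
  have K: "connected_graph K" using sub_conn[OF O(1) D(1)] .
  have col: "ze' b : cols C & ze' (gi K b) = cinv C (ze' b)" if b: "b : gA K" for b
    using S(6)[OF b]
  proof (elim disjE bexE)
    fix a assume a: "a : gA G" "b = j a"
    then show ?thesis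
      using inv_mapsD(1,2)[OF O(2) a(1)] cptD[OF D(4)] gi_in[OF O(6) a(1)] S(3)[OF a(1)] by metis
  next
    fix v a assume v: "v : gV G" and a: "a : gA (H v)" "b = q v a"
    note e = det_D[OF D(5)[OF v]] and d = dgrD[OF O(3)[OF v]]
    have "ze' b = zev v a" using cptD[OF e(2) a(1)] a(2) by simp
    moreover have "ze' (gi K b) = zev v (gi (H v) a)"
      using cptD[OF e(2) gi_in[OF d(2) a(1)]] et_i[OF e(1) a(1)] a(2) by simp
    ultimately show ?thesis using d(7,8)[OF a(1)] by simp
  qed
  have i: "ze' : inv_maps (arcset K) C" using col D(2) by (auto intro: inv_mapsI)
  have "x' u : bo X (at_vertex K ze' u)" if u: "u : gV K" for u
  proof -
    obtain v w where v: "v : gV G" and w: "w : gV (H v)" and uu: "u = p v w" using S(9)[OF u] by blast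
    note e = det_D[OF D(5)[OF v]] and d = dgrD[OF O(3)[OF v]]
    show ?thesis
      unfolding uu e(3)[OF w]
      by (rule ba_in[OF X d(5) at_ob[OF S(1) i] et_hom[OF e(1) d(2) S(1) e(2) w] d(6)[OF w]])
  qed
  then show ?thesis using K D(2,3) col by (intro dgrI) auto
qed

lemma dsub_elt:
  assumes X: "bij_functor C X" and ok: "data_ok C X G ze H m zev x"
    and s: "dsub X G ze H m zev x K ze' x' j q p"
    and f: "bij_betw f (fst r) (gB G)" "!!s. s : fst r ==> ze (f s) = snd r s"
  shows "((\<lambda>s\<in>fst r. j (f s), K, ze'), x') : gr_elts C X r"
proof -
  note O = data_okD[OF ok] and D = dsubD[OF s]
  note S = is_subD[OF D(1)]
  have "bij_betw (\<lambda>s. j (f s)) (fst r) (gB K)" using bij_betw_trans[OF f(1) S(10)] by (simp add: comp_def)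
  moreover have "ze' (j (f s)) = snd r s" if "s : fst r" for s
    using cptD[OF D(4)] gB_gA[OF O(6)] bij_betwE[OF f(1)] f(2) that by auto
  ultimately show ?thesis using dsub_dgr[OF X ok s] by (simp add: gr_elts_iff)
qed

text \<open>The isomorphism of \<open>sub_unique\<close> respects the decorations because at
  \<open>p v w\<close> both of them are transported from the same operation of
  \<open>H v\<close>.\<close>

lemma dsub_unique:
  assumes X: "bij_functor C X" and ok: "data_ok C X G ze H m zev x"
    and s: "dsub X G ze H m zev x K ze' x' j q p" and s2: "dsub X G ze H m zev x K2 ze2 x2 j2 q2 p2"
  shows "EX al nu. det X K ze' x' K2 ze2 x2 al nu & bij_betw al (gA K) (gA K2) &
    bij_betw nu (gV K) (gV K2) & (ALL a:gA G. al (j a) = j2 a)"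
proof -
  note O = data_okD[OF ok] and D = dsubD[OF s] and D2 = dsubD[OF s2]
  note S = is_subD[OF D(1)] and S2 = is_subD[OF D2(1)]
  note d1 = dgrD[OF dsub_dgr[OF X ok s]] and d2 = dgrD[OF dsub_dgr[OF X ok s2]]
  obtain al nu where b: "bij_betw al (gA K) (gA K2)" "bij_betw nu (gV K) (gV K2)" and e: "et K K2 al nu"
    and al: "!!a. a : gA G ==> al (j a) = j2 a" "!!v a. v : gV G ==> a : gA (H v) ==> al (q v a) = q2 v a"
    and nu: "!!v w. v : gV G ==> w : gV (H v) ==> nu (p v w) = p2 v w"
    using sub_unique[OF O(1) D(1) D2(1)] by blast
  have c: "cpt K ze' ze2 al"
    unfolding cpt_def
  proof
    fix b0 assume b0: "b0 : gA K"
    show "ze2 (al b0) = ze' b0" using S(6)[OF b0]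
    proof (elim disjE bexE)
      fix a assume a: "a : gA G" "b0 = j a"
      then show ?thesis using al(1) cptD[OF D(4)] cptD[OF D2(4)] by simp
    next
      fix v a assume v: "v : gV G" and a: "a : gA (H v)" "b0 = q v a"
      then show ?thesis using al(2) cptD[OF det_D(2)[OF D(5)[OF v]]] cptD[OF det_D(2)[OF D2(5)[OF v]]] by simp
    qed
  qed
  have "x2 (nu u) = ba X (at_vertex K ze' u) (at_vertex K2 ze2 (nu u)) (restrict al (inb K u)) (x' u)"
    if u: "u : gV K" for u
  proof -
    obtain v w where v: "v : gV G" and w: "w : gV (H v)" and uu: "u = p v w" using S(9)[OF u] by blast
    note e1 = det_D[OF D(5)[OF v]] and e2 = det_D[OF D2(5)[OF v]] and d = dgrD[OF O(3)[OF v]]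
    have h: "restrict al (inb K (p v w)) : bij_hom (at_vertex K ze' (p v w)) (at_vertex K2 ze2 (nu (p v w)))"
      using et_hom[OF e S(1) S2(1) c] u uu by simp
    have "ba X (at_vertex K ze' (p v w)) (at_vertex K2 ze2 (nu (p v w))) (restrict al (inb K (p v w))) (x' (p v w)) =
      ba X (at_vertex (H v) (zev v) w) (at_vertex K2 ze2 (nu (p v w))) (restrict (\<lambda>a. al (q v a)) (inb (H v) w)) (x v w)"
      unfolding e1(3)[OF w]
      by (rule tr_comp[OF X d(5) d1(5) d2(5) d(6)[OF w] d(2) S(1) S2(1) e1(1,2) w h])
    also have "restrict (\<lambda>a. al (q v a)) (inb (H v) w) = restrict (q2 v) (inb (H v) w)"
      using al(2)[OF v] inb_gA[OF d(2)] by (auto simp: fun_eq_iff restrict_def)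
    also have "ba X (at_vertex (H v) (zev v) w) (at_vertex K2 ze2 (nu (p v w))) \<dots> (x v w) = x2 (nu (p v w))"
      using e2(3)[OF w] nu[OF v w] by simp
    finally show ?thesis by (simp only: uu)
  qed
  then have "det X K ze' x' K2 ze2 x2 al nu" using e c by (simp add: det_def)
  then show ?thesis using b al(1) by blast
qed

lemma dsub_precomp:
  assumes X: "bij_functor C X" and ok: "data_ok C X G ze H m zev x" and ok1: "data_ok C X G1 ze1 H1 m1 zev1 x1"
    and e: "et G G1 al nu" and c: "cpt G ze ze1 al"
    and ba: "bij_betw al (gA G) (gA G1)" and bv: "bij_betw nu (gV G) (gV G1)"
    and bB: "bij_betw al (gB G) (gB G1)"
    and h: "!!v. v : gV G ==> det X (H v) (zev v) (x v) (H1 (nu v)) (zev1 (nu v)) (x1 (nu v)) (be v) (mu v)"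
      "!!v. v : gV G ==> bij_betw (be v) (gA (H v)) (gA (H1 (nu v)))"
      "!!v. v : gV G ==> bij_betw (mu v) (gV (H v)) (gV (H1 (nu v)))"
    and m: "!!v a. v : gV G ==> a : inb G v ==> be v (m v a) = m1 (nu v) (al a)"
    and s: "dsub X G1 ze1 H1 m1 zev1 x1 K ze' x' j q p"
  shows "dsub X G ze H m zev x K ze' x' (\<lambda>a. j (al a)) (\<lambda>v a. q (nu v) (be v a)) (\<lambda>v w. p (nu v) (mu v w))"
proof -
  note O = data_okD[OF ok] and O1 = data_okD[OF ok1] and D = dsubD[OF s]
  note OG = sub_okD[OF O(1)]
  have "is_sub G H m K (\<lambda>a. j (al a)) (\<lambda>v a. q (nu v) (be v a)) (\<lambda>v w. p (nu v) (mu v w))"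
    by (rule sub_precomp[OF O(6) O1(6) e ba bv bB OG(4) det_D(1)[OF h(1)] h(2,3) OG(7) m D(1)])
  moreover have "cpt G ze ze' (\<lambda>a. j (al a))"
    using cptD[OF c] cptD[OF D(4)] et_A[OF e] by (simp add: cpt_def)
  moreover have "det X (H v) (zev v) (x v) K ze' x' (\<lambda>a. q (nu v) (be v a)) (\<lambda>w. p (nu v) (mu v w))" if v: "v : gV G" for v
  proof -
    have v1: "nu v : gV G1" using et_V[OF e v] .
    show ?thesis by (rule det_comp[OF X O(3)[OF v] O1(3)[OF v1] dsub_dgr[OF X ok1 s] h(1)[OF v] D(5)[OF v1]])
  qed
  ultimately show ?thesis using D(2,3) by (simp add: dsub_def)
qed

context infinite_universe
begin

text \<open>The construction used in the definition of the multiplication is a model; what follows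
  relies on it mainly through the relation \<open>dsub\<close>.\<close>

lemma dsub_exists:
  fixes G :: "'u graph"
  assumes X: "bij_functor C X" and ok: "data_ok C X G ze H m zev x"
  shows "EX j. dsub X G ze H m zev x (sub_graph G H m) (sub_col G H m ze zev) (sub_deco X G H m ze zev x)
      j (glue G H m) (\<lambda>v w. enc (v, w)) & (ALL b:gB G. j b = sub_bd G H m b)"
proof -
  note O = data_okD[OF ok]
  let ?K = "sub_graph G H m"
  obtain j where j: "is_sub G H m ?K j (glue G H m) (\<lambda>v w. enc (v, w))" "ALL b:gB G. j b = sub_bd G H m b"
    "gV G = {} --> (ALL a:gA G. j a = a)"
    using sub_graph_is_sub[OF O(1)] by blast
  note S = is_subD[OF j(1)]
  note c = sub_col_props[OF O(1,4) inv_mapsD(3)[OF O(2)] j(1,3)]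
  have "det X (H v) (zev v) (x v) ?K (sub_col G H m ze zev) (sub_deco X G H m ze zev x) (glue G H m v) (\<lambda>w. enc (v, w))"
    if v: "v : gV G" for v
    unfolding det_def
  proof (intro conjI ballI)
    show "et (H v) ?K (glue G H m v) (\<lambda>w. enc (v, w))" using S(4)[OF v] .
    show "cpt (H v) (zev v) (sub_col G H m ze zev) (glue G H m v)" using c(3)[OF v] by (simp add: cpt_def)
    fix w assume w: "w : gV (H v)"
    have "enc (v, w) : gV ?K" using et_V[OF S(4)[OF v] w] .
    then show "sub_deco X G H m ze zev x (enc (v, w)) = ba X (at_vertex (H v) (zev v) w)
       (at_vertex ?K (sub_col G H m ze zev) (enc (v, w))) (restrict (glue G H m v) (inb (H v) w)) (x v w)"
      unfolding sub_deco_def using v w by (auto intro: the_equality)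
  qed
  moreover have "sub_deco X G H m ze zev x : extensional (gV ?K)" by (simp add: sub_deco_def)
  ultimately have "dsub X G ze H m zev x ?K (sub_col G H m ze zev) (sub_deco X G H m ze zev x)
      j (glue G H m) (\<lambda>v w. enc (v, w))"
    using j(1) c(1,2) by (simp add: dsub_def cpt_def)
  then show ?thesis using j(2) by blast
qed

text \<open>The multiplication may be computed from one representative, one choice of elements of
  the classes \<open>y v\<close> and any model \<open>K\<close> of the substitution. The definition
  takes all choices at once, so each of them has to be shown to give a graph isomorphic to
  \<open>K\<close>.\<close>

lemma F_mult_cls:
  fixes X :: "('u, 'c, 'x) bfun"
  assumes X: "bij_functor C X" and r: "r : bij_ob C"
    and e: "((f, G, ze), y) : gr_elts C (F_fun C X) r"
    and y: "!!v. v : gV G ==> ((m v, H v, zev v), x v) : gr_elts C X (at_vertex G ze v)"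
      "!!v. v : gV G ==> y v = cls C X (at_vertex G ze v) ((m v, H v, zev v), x v)"
    and s: "dsub X G ze H m zev x K ze' x' j q p"
  shows "F_mult C X r (cls C (F_fun C X) r ((f, G, ze), y)) = cls C X r ((\<lambda>s\<in>fst r. j (f s), K, ze'), x')"
    (is "_ = cls C X r ?e'")
proof -
  note FX = F_functor[OF X]
  have d: "dgr C (F_fun C X) G ze y" and f: "bij_betw f (fst r) (gB G)"
    "!!s. s : fst r ==> ze (f s) = snd r s" using e by (auto simp: gr_elts_iff)
  note dd = dgrD[OF d]
  have ok: "data_ok C X G ze H m zev x" using dd(1,3) y(1) by (simp add: data_ok_def)
  have e': "?e' : gr_elts C X r" using dsub_elt[OF X ok s f] .
  let ?K = "cls C (F_fun C X) r ((f, G, ze), y)"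
  let ?Z = "{((\<lambda>s\<in>fst r. sub_bd G H m (f s), sub_graph G H m, sub_col G H m ze zev),
          sub_deco X G H m ze zev x) | f G ze y m H zev x.
            ((f, G, ze), y) : ?K & (ALL v:gV G. ((m v, H v, zev v), x v) : y v)}"
  have key: "(?e', ((\<lambda>s\<in>fst r. sub_bd G1 H1 m1 (f1 s), sub_graph G1 H1 m1, sub_col G1 H1 m1 ze1 zev1),
          sub_deco X G1 H1 m1 ze1 zev1 x1)) : gr_rel C X r"
    if k: "((f1, G1, ze1), y1) : ?K" and m1: "!!v. v : gV G1 ==> ((m1 v, H1 v, zev1 v), x1 v) : y1 v"
    for f1 G1 ze1 y1 m1 H1 zev1 x1
  proof -
    have rel: "(((f, G, ze), y), ((f1, G1, ze1), y1)) : gr_rel C (F_fun C X) r" using k by (simp add: in_cls)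
    have e1: "((f1, G1, ze1), y1) : gr_elts C (F_fun C X) r" using gr_rel_elts[OF rel] by blast
    have d1: "dgr C (F_fun C X) G1 ze1 y1" and f1: "bij_betw f1 (fst r) (gB G1)"
      "!!s. s : fst r ==> ze1 (f1 s) = snd r s" using e1 by (auto simp: gr_elts_iff)
    note dd1 = dgrD[OF d1]
    have el1: "((m1 v, H1 v, zev1 v), x1 v) : gr_elts C X (at_vertex G1 ze1 v)" if v: "v : gV G1" for v
    proof -
      have "y1 v : F_ob C X (at_vertex G1 ze1 v)" using dd1(6)[OF v] by simp
      then obtain e2 where "y1 v = cls C X (at_vertex G1 ze1 v) e2" by (metis F_obE)
      then show ?thesis using m1[OF v] gr_rel_elts by (metis in_cls)
    qed
    have ok1: "data_ok C X G1 ze1 H1 m1 zev1 x1" using dd1(1,3) el1 by (simp add: data_ok_def)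
    obtain al nu where a: "det (F_fun C X) G ze y G1 ze1 y1 al nu" "bij_betw al (gA G) (gA G1)"
      "bij_betw nu (gV G) (gV G1)" "!!s. s : fst r ==> al (f s) = f1 s"
      using rel by (rule gr_relE) blast
    note A = det_D[OF a(1)]
    have bB: "bij_betw al (gB G) (gB G1)"
    proof -
      have "al ` gB G = (\<lambda>s. al (f s)) ` fst r" using f(1) by (simp add: bij_betw_def flip: image_image)
      also have "\<dots> = f1 ` fst r" using a(4) by simp
      finally have "al ` gB G = gB G1" using f1(1) by (simp add: bij_betw_def)
      moreover have "inj_on al (gB G)" using a(2) gB_gA[OF dd(2)] by (meson bij_betw_def inj_on_subset subsetI)
      ultimately show ?thesis by (simp add: bij_betw_def)
    qed
    \<comment> \<open>That the class \<open>y1 (nu v)\<close> is the transport of \<open>y v\<close>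
      means that \<open>H v\<close> and \<open>H1 (nu v)\<close> are isomorphic decorated graphs,
      compatibly with their attachment to \<open>G\<close> and \<open>G1\<close>.\<close>
    have ex: "EX be mu. det X (H v) (zev v) (x v) (H1 (nu v)) (zev1 (nu v)) (x1 (nu v)) be mu &
        bij_betw be (gA (H v)) (gA (H1 (nu v))) & bij_betw mu (gV (H v)) (gV (H1 (nu v))) &
        (ALL a:inb G v. be (m v a) = m1 (nu v) (al a))" if v: "v : gV G" for v
    proof -
      have v1: "nu v : gV G1" using et_V[OF A(1) v] .
      let ?si = "restrict al (inb G v)"
      have h: "?si : bij_hom (at_vertex G ze v) (at_vertex G1 ze1 (nu v))"
        by (rule et_hom[OF A(1) dd(2) dd1(2) A(2) v])
      have "y1 (nu v) = cls C X (at_vertex G1 ze1 (nu v))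
          ((\<lambda>s\<in>inb G1 (nu v). m v (inv_into (inb G v) ?si s), H v, zev v), x v)"
        using A(3)[OF v] ba_F(1)[OF X h y(1)[OF v]] y(2)[OF v] by simp
      then have "(((\<lambda>s\<in>inb G1 (nu v). m v (inv_into (inb G v) ?si s), H v, zev v), x v),
          ((m1 (nu v), H1 (nu v), zev1 (nu v)), x1 (nu v))) : gr_rel C X (at_vertex G1 ze1 (nu v))"
        using m1[OF v1] by (simp add: in_cls)
      then obtain be mu where b: "det X (H v) (zev v) (x v) (H1 (nu v)) (zev1 (nu v)) (x1 (nu v)) be mu"
        "bij_betw be (gA (H v)) (gA (H1 (nu v)))" "bij_betw mu (gV (H v)) (gV (H1 (nu v)))"
        and bm: "!!s. s : fst (at_vertex G1 ze1 (nu v)) ==>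
          be ((\<lambda>s\<in>inb G1 (nu v). m v (inv_into (inb G v) ?si s)) s) = m1 (nu v) s"
        by (rule gr_relE) blast
      have "be (m v a) = m1 (nu v) (al a)" if a: "a : inb G v" for a
      proof -
        have bi: "bij_betw ?si (inb G v) (inb G1 (nu v))" using h by (simp add: bij_hom_def)
        then have "al a : inb G1 (nu v)" using a by (auto simp: bij_betw_def)
        moreover have "inv_into (inb G v) ?si (al a) = a"
          using bij_betw_inv_into_left[OF bi a] a by simp
        ultimately show ?thesis using bm[of "al a"] by simp
      qed
      then show ?thesis using b by blast
    qed
    define bemu where "bemu v = (SOME (be, mu). det X (H v) (zev v) (x v) (H1 (nu v)) (zev1 (nu v)) (x1 (nu v)) be mu &
        bij_betw be (gA (H v)) (gA (H1 (nu v))) & bij_betw mu (gV (H v)) (gV (H1 (nu v))) &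
        (ALL a:inb G v. be (m v a) = m1 (nu v) (al a)))" for v
    have b: "det X (H v) (zev v) (x v) (H1 (nu v)) (zev1 (nu v)) (x1 (nu v)) (fst (bemu v)) (snd (bemu v)) &
        bij_betw (fst (bemu v)) (gA (H v)) (gA (H1 (nu v))) & bij_betw (snd (bemu v)) (gV (H v)) (gV (H1 (nu v))) &
        (ALL a:inb G v. fst (bemu v) (m v a) = m1 (nu v) (al a))" if v: "v : gV G" for v
    proof -
      have "EX z. case z of (be, mu) => det X (H v) (zev v) (x v) (H1 (nu v)) (zev1 (nu v)) (x1 (nu v)) be mu &
        bij_betw be (gA (H v)) (gA (H1 (nu v))) & bij_betw mu (gV (H v)) (gV (H1 (nu v))) &
        (ALL a:inb G v. be (m v a) = m1 (nu v) (al a))" using ex[OF v] by auto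
      from someI_ex[OF this] show ?thesis unfolding bemu_def[symmetric] by (simp add: case_prod_beta)
    qed
    obtain j1 where j1: "dsub X G1 ze1 H1 m1 zev1 x1 (sub_graph G1 H1 m1) (sub_col G1 H1 m1 ze1 zev1)
        (sub_deco X G1 H1 m1 ze1 zev1 x1) j1 (glue G1 H1 m1) (\<lambda>v w. enc (v, w))"
      "ALL b:gB G1. j1 b = sub_bd G1 H1 m1 b" using dsub_exists[OF X ok1] by blast
    \<comment> \<open>The model for the second choice is also one for the first, so that uniqueness
      applies.\<close>
    have "dsub X G ze H m zev x (sub_graph G1 H1 m1) (sub_col G1 H1 m1 ze1 zev1)
        (sub_deco X G1 H1 m1 ze1 zev1 x1) (\<lambda>a. j1 (al a)) (\<lambda>v a. glue G1 H1 m1 (nu v) (fst (bemu v) a))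
        (\<lambda>v w. enc (nu v, snd (bemu v) w))"
      by (rule dsub_precomp[OF X ok ok1 A(1,2) a(2,3) bB _ _ _ _ j1(1)]) (use b in auto)
    from dsub_unique[OF X ok s this] obtain al' nu' where
      u: "det X K ze' x' (sub_graph G1 H1 m1) (sub_col G1 H1 m1 ze1 zev1) (sub_deco X G1 H1 m1 ze1 zev1 x1) al' nu'"
      "bij_betw al' (gA K) (gA (sub_graph G1 H1 m1))" "bij_betw nu' (gV K) (gV (sub_graph G1 H1 m1))"
      "!!a. a : gA G ==> al' (j a) = j1 (al a)" by blast
    have fB: "f s : gB G" "f1 s : gB G1" if "s : fst r" for s
      using bij_betwE[OF f(1)] bij_betwE[OF f1(1)] that by auto
    have e2: "((\<lambda>s\<in>fst r. j1 (f1 s), sub_graph G1 H1 m1, sub_col G1 H1 m1 ze1 zev1),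
          sub_deco X G1 H1 m1 ze1 zev1 x1) : gr_elts C X r" using dsub_elt[OF X ok1 j1(1) f1] .
    have eqf: "(\<lambda>s\<in>fst r. j1 (f1 s)) = (\<lambda>s\<in>fst r. sub_bd G1 H1 m1 (f1 s))"
      using j1(2) fB by (auto simp: fun_eq_iff)
    show ?thesis
    proof (rule gr_relI[OF e' _ u(1-3)])
      show "((\<lambda>s\<in>fst r. sub_bd G1 H1 m1 (f1 s), sub_graph G1 H1 m1, sub_col G1 H1 m1 ze1 zev1),
          sub_deco X G1 H1 m1 ze1 zev1 x1) : gr_elts C X r" using e2 eqf by simp
      show "al' ((\<lambda>s\<in>fst r. j (f s)) s) = (\<lambda>s\<in>fst r. sub_bd G1 H1 m1 (f1 s)) s" if "s : fst r" for s
        using that u(4) fB[OF that] gB_gA[OF dd(2)] a(4) j1(2) by simp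
    qed
  qed
  have "?Z ~= {}"
  proof -
    have "((f, G, ze), y) : ?K" using self_cls[OF FX e] .
    moreover have "ALL v:gV G. ((m v, H v, zev v), x v) : y v" using y self_cls[OF X] by simp
    ultimately show ?thesis by blast
  qed
  moreover have "(?e', z) : gr_rel C X r" if "z : ?Z" for z using that key by blast
  ultimately have "gr_rel C X r `` ?Z = cls C X r ?e'"
    by (rule cls_eqI[OF X])
  moreover have "F_mult C X r ?K = gr_rel C X r `` ?Z"
    unfolding F_mult_def using r cls_F_ob[OF e] by simp
  ultimately show ?thesis by simp
qed

end

section \<open>The free modular operad\<close>

lemma bij_obD:
  assumes "p : bij_ob C"
  shows "finite (fst p)" "snd p : extensional (fst p)" "!!s. s : fst p ==> snd p s : cols C"
  using assms by (cases p; auto simp: bij_ob_def PiE_def)+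

lemma involutive_arcset: "is_graph G ==> involutive_set (arcset G)"
  by (auto simp: involutive_set_def arcset_def gi_in gi_gi)

lemma involutiveD:
  assumes "involutive_set C"
  shows "c : cols C ==> cinv C c : cols C" "c : cols C ==> cinv C (cinv C c) = c"
  using assms by (auto simp: involutive_set_def)

context infinite_universe
begin

lemma sx_dbl:
  assumes "finite (S :: 'u set)" "s : S"
  shows "sx S m i (dbl_inv S s) = i (m s)"
proof -
  have "s : dbl S" using assms(2) by (simp add: dbl_def)
  then have "dbl_inv S s \<notin> S" "dbl_inv S (dbl_inv S s) = s"
    using dbl_inv_props(4,5)[OF assms(1)] assms(2) by auto
  then show ?thesis by (simp add: sx_def)
qed

lemma star_col_sx: "star_col C p = restrict (sx (fst p) (snd p) (cinv C)) (dbl (fst p))"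
  by (auto simp: star_col_def sx_def fun_eq_iff restrict_def)

lemma star_col_in: "s : fst p ==> star_col C (p :: ('u, 'c) bob) s = snd p s"
  by (simp add: star_col_sx sx_def dbl_def)

lemma star_col_maps:
  assumes C: "involutive_set C" and p: "(p :: ('u, 'c) bob) : bij_ob C"
  shows "star_col C p : inv_maps (arcset (star (fst p))) C"
proof (rule inv_mapsI)
  note P = bij_obD[OF p] and I = involutiveD[OF C]
  show "star_col C p : extensional (gA (star (fst p)))" by (simp add: star_col_sx)
  fix a assume a: "a : gA (star (fst p))"
  then have a': "a : dbl (fst p)" by simp
  show "star_col C p a : cols C"
    by (rule sx_cases[OF P(1) a', of "snd p" "cinv C"]) (use a' P(3) I in \<open>auto simp: star_col_sx\<close>)
  show "star_col C p (gi (star (fst p)) a) = cinv C (star_col C p a)"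
    using sx_inv[OF P(1) a', of "cinv C" "snd p"] P(3) I a' dbl_inv_props(3)[OF P(1) a']
    by (simp add: star_col_sx)
qed

lemma star_at_vertex:
  assumes p: "(p :: ('u, 'c) bob) : bij_ob C"
  shows "at_vertex (star (fst p)) (star_col C p) undefined = p"
proof -
  note P = bij_obD[OF p]
  have "restrict (star_col C p) (fst p) = snd p"
    using P(2) by (auto simp: fun_eq_iff restrict_def star_col_in extensional_def)
  then show ?thesis by (simp add: at_vertex_def star_nb(3)[OF P(1)])
qed

lemma star_elt:
  assumes C: "involutive_set C" and p: "(p :: ('u, 'c) bob) : bij_ob C" and x: "x : bo X p"
  shows "((\<lambda>s\<in>fst p. s, star (fst p), star_col C p), \<lambda>v\<in>gV (star (fst p)). x) : gr_elts C X p"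
  unfolding gr_elts_iff dgr_def deco_def
  using star_conn[OF bij_obD(1)[OF p]] star_col_maps[OF C p] x star_at_vertex[OF p]
  by (auto simp: bij_betw_def inj_on_def star_col_in)

lemma F_unit_cls:
  assumes p: "(p :: ('u, 'c) bob) : bij_ob C" and x: "x : bo X p"
  shows "F_unit C X p x = cls C X p ((\<lambda>s\<in>fst p. s, star (fst p), star_col C p), \<lambda>v\<in>gV (star (fst p)). x)"
  using assms by (simp add: F_unit_def cls_def)

lemma dsub_star_left:
  assumes X: "bij_functor C X" and C: "involutive_set C" and p: "(p :: ('u, 'c) bob) : bij_ob C"
    and e: "((f, H, ze), x) : gr_elts C X p"
  shows "dsub X (star (fst p)) (star_col C p) (\<lambda>_. H) (\<lambda>_. f) (\<lambda>_. ze) (\<lambda>_. x) H ze x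
     (sx (fst p) f (gi H)) (\<lambda>_ a. a) (\<lambda>_ w. w)"
proof -
  note P = bij_obD[OF p]
  have d: "dgr C X H ze x" and f: "bij_betw f (fst p) (gB H)" "!!s. s : fst p ==> ze (f s) = snd p s"
    using e by (auto simp: gr_elts_iff)
  note d' = dgrD[OF d]
  have fA: "f s : gA H" if "s : fst p" for s using bij_betwE[OF f(1)] that gB_gA[OF d'(2)] by blast
  have "ze (sx (fst p) f (gi H) a) = star_col C p a" if a: "a : dbl (fst p)" for a
  proof -
    have "sx (fst p) (snd p) (cinv C) a = ze (sx (fst p) f (gi H) a)"
      using f(2) fA d'(8) by (intro sx_unique[OF P(1) a]) (auto simp: sx_in sx_dbl[OF P(1)])
    then show ?thesis using a by (simp add: star_col_sx)
  qed
  then show ?thesis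
    unfolding dsub_def
    using sub_star_left[OF P(1) d'(1) f(1)] d'(9,10) det_id[OF X d] by (simp add: cpt_def)
qed

text \<open>Left unit law: \<open>H\<close> itself is a model of its substitution into a
  star.\<close>

lemma F_mult_unit:
  assumes X: "bij_functor C X" and C: "involutive_set C" and p: "(p :: ('u, 'c) bob) : bij_ob C"
    and K: "K : F_ob C X p"
  shows "F_mult C X p (F_unit C (F_fun C X) p K) = K"
proof -
  obtain f H ze x where e: "((f, H, ze), x) : gr_elts C X p" and Ke: "K = cls C X p ((f, H, ze), x)"
    using F_obE[OF K] .
  have KF: "K : bo (F_fun C X) p" using K by simp
  have "F_mult C X p (F_unit C (F_fun C X) p K) = cls C X p ((\<lambda>s\<in>fst p. sx (fst p) f (gi H) ((\<lambda>s\<in>fst p. s) s), H, ze), x)"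
    unfolding F_unit_cls[of p C K "F_fun C X", OF p KF]
    by (rule F_mult_cls[OF X p star_elt[OF C p KF] _ _ dsub_star_left[OF X C p e]])
      (use e Ke star_at_vertex[OF p] in auto)
  also have "(\<lambda>s\<in>fst p. sx (fst p) f (gi H) ((\<lambda>s\<in>fst p. s) s)) = f"
    using e by (auto simp: gr_elts_iff fun_eq_iff sx_in extensional_def)
  finally show ?thesis using Ke by simp
qed

lemma star_at_col:
  assumes C: "involutive_set C" and d: "dgr C X (G :: 'u graph) ze x" and a: "a : dbl (inb G v)"
  shows "ze (sx (inb G v) (\<lambda>s. s) (gi G) a) = star_col C (at_vertex G ze v) a"
proof -
  note d' = dgrD[OF d]
  note f = finite_inb[OF d'(2), of v]
  have iA: "s : gA G" if "s : inb G v" for s using inb_gA[OF d'(2) that] .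
  have "sx (inb G v) (restrict ze (inb G v)) (cinv C) a = ze (sx (inb G v) (\<lambda>s. s) (gi G) a)"
    using iA d'(8) by (intro sx_unique[OF f a]) (auto simp: sx_in sx_dbl[OF f])
  then show ?thesis using a by (simp add: star_col_sx)
qed

lemma dsub_star_right:
  assumes X: "bij_functor C X" and C: "involutive_set C" and d: "dgr C X (G :: 'u graph) ze x"
  shows "dsub X G ze (\<lambda>v. star (inb G v)) (\<lambda>v. \<lambda>s\<in>inb G v. s) (\<lambda>v. star_col C (at_vertex G ze v))
     (\<lambda>v. \<lambda>_\<in>gV (star (inb G v)). x v) G ze x (\<lambda>a. a) (\<lambda>v. sx (inb G v) (\<lambda>s. s) (gi G)) (\<lambda>v _. v)"
proof -
  note d' = dgrD[OF d]
  note f = finite_inb[OF d'(2)]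
  have "det X (star (inb G v)) (star_col C (at_vertex G ze v)) (\<lambda>_\<in>gV (star (inb G v)). x v) G ze x
      (sx (inb G v) (\<lambda>s. s) (gi G)) (\<lambda>_. v)" if v: "v : gV G" for v
    unfolding det_def
  proof (intro conjI ballI)
    show "et (star (inb G v)) G (sx (inb G v) (\<lambda>s. s) (gi G)) (\<lambda>_. v)"
      using sx_et[OF f d'(2) v, of "\<lambda>s. s"] by (simp add: bij_betw_def)
    show "cpt (star (inb G v)) (star_col C (at_vertex G ze v)) ze (sx (inb G v) (\<lambda>s. s) (gi G))"
      unfolding cpt_def using star_at_col[OF C d] by simp
    fix w assume "w : gV (star (inb G v))"
    then have w: "w = undefined" by simp
    have st: "at_vertex (star (inb G v)) (star_col C (at_vertex G ze v)) undefined = at_vertex G ze v"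
      using star_at_vertex[OF d'(5)] by simp
    have "restrict (sx (inb G v) (\<lambda>s. s) (gi G)) (inb (star (inb G v)) undefined) = (\<lambda>s\<in>fst (at_vertex G ze v). s)"
      by (auto simp: fun_eq_iff restrict_def star_nb(3)[OF f] sx_in)
    then show "x v = ba X (at_vertex (star (inb G v)) (star_col C (at_vertex G ze v)) w) (at_vertex G ze v)
      (restrict (sx (inb G v) (\<lambda>s. s) (gi G)) (inb (star (inb G v)) w)) ((\<lambda>_\<in>gV (star (inb G v)). x v) w)"
      unfolding w st using ba_id[OF X d'(5) d'(6)[OF v]] by simp
  qed
  then show ?thesis
    unfolding dsub_def using sub_star_right[OF d'(1)] d'(9,10) by (simp add: cpt_def)
qed

lemma sx_bij:
  assumes S: "finite (S :: 'u set)" and S': "finite (S' :: 'u set)" and b: "bij_betw si S S'"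
  shows "bij_betw (sx S si (dbl_inv S')) (dbl S) (dbl S')"
proof -
  \<comment> \<open>Stated for arbitrary \<open>S\<close>, \<open>S'\<close> and \<open>si\<close>,
    as it is applied to the given bijection and to its inverse.\<close>
  have gen: "sx S si (dbl_inv S') a : dbl S' & sx S' (inv_into S si) (dbl_inv S) (sx S si (dbl_inv S') a) = a"
    if S: "finite (S :: 'u set)" and S': "finite S'" and b: "bij_betw si S S'" and a: "a : dbl S"
    for S S' :: "'u set" and si a
  proof -
    note d = dbl_inv_props[OF S] and d' = dbl_inv_props[OF S']
    have 1: "si s : S'" "inv_into S si (si s) = s" "s : dbl S" if "s : S" for s
      using b that by (auto simp: bij_betw_def dbl_def)
    have 2: "s : dbl S'" if "s : S'" for s using that by (auto simp: dbl_def)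
    have 3: "inv_into S si s : dbl S" if "s : S'" for s
      using bij_betwE[OF bij_betw_inv_into[OF b]] that by (auto simp: dbl_def)
    show ?thesis
    proof (rule sx_cases[OF S a, of si "dbl_inv S'"])
      assume "a : S" "sx S si (dbl_inv S') a = si a"
      then show ?thesis using 1 2 by (simp add: sx_in)
    next
      fix s assume s: "s : S" "a = dbl_inv S s" "sx S si (dbl_inv S') a = dbl_inv S' (si s)"
      have "sx S' (inv_into S si) (dbl_inv S) (dbl_inv S' (si s)) = a"
        using sx_dbl[OF S' 1(1)[OF s(1)], of "inv_into S si" "dbl_inv S"] 1(2)[OF s(1)] s(2) by simp
      then show ?thesis unfolding s(3) using d'(3)[OF 2[OF 1(1)[OF s(1)]]] by simp
    qed
  qed
  have b': "bij_betw (inv_into S si) S' S" using bij_betw_inv_into[OF b] .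
  have "sx S si (dbl_inv S') (sx S' (inv_into S si) (dbl_inv S) a) = a" if a: "a : dbl S'" for a
  proof -
    have "inv_into S' (inv_into S si) s = si s" if "s : S" for s
      using b b' that by (intro inv_into_f_eq) (auto simp: bij_betw_def)
    then have "sx S (inv_into S' (inv_into S si)) (dbl_inv S') c = sx S si (dbl_inv S') c"
      if "c : dbl S" for c
      using dbl_inv_props[OF S] that by (auto simp: sx_def)
    then show ?thesis using gen[OF S' S b' a] by metis
  qed
  then show ?thesis
    using gen[OF S S' b] gen[OF S' S b']
    by (intro bij_betw_byWitness[where f' = "sx S' (inv_into S si) (dbl_inv S)"]) auto
qed

text \<open>The bijection \<open>si\<close> extends to an isomorphism of stars. It carries the star
  decorated by \<open>x\<close>, with relabelled boundary, to the star decorated by the transported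
  operation.\<close>

lemma F_unit_nat:
  assumes X: "bij_functor C X" and C: "involutive_set C"
  shows "nat_on C X (F_fun C X) (F_unit C X :: ('u, 'c) bob => _)"
  unfolding nat_on_def
proof (intro conjI ballI)
  fix p :: "('u, 'c) bob" and x assume "p : bij_ob C" "x : bo X p"
  then show "F_unit C X p x : bo (F_fun C X) p"
    using cls_F_ob[OF star_elt[OF C]] by (simp add: F_unit_cls)
next
  fix p q :: "('u, 'c) bob" and si x
  assume p: "p : bij_ob C" and q: "q : bij_ob C" and s: "si : bij_hom p q" and x: "x : bo X p"
  note P = bij_obD[OF p] and Q = bij_obD[OF q]
  have y: "ba X p q si x : bo X q" using ba_in[OF X p q s x] .
  have b: "bij_betw si (fst p) (fst q)" "!!s. s : fst p ==> snd q (si s) = snd p s" "si : extensional (fst p)"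
    using s by (auto simp: bij_hom_def)
  let ?al = "sx (fst p) si (dbl_inv (fst q))"
  let ?e = "((\<lambda>s\<in>fst p. s, star (fst p), star_col C p), \<lambda>v\<in>gV (star (fst p)). x)"
  let ?e' = "((\<lambda>s\<in>fst q. s, star (fst q), star_col C q), \<lambda>v\<in>gV (star (fst q)). ba X p q si x)"
  note ba = ba_F[OF X s star_elt[OF C p x]]
  have et: "et (star (fst p)) (star (fst q)) ?al (\<lambda>v. v)"
    using sx_et[OF P(1) star_graph[OF Q(1)], of undefined si] b(1) star_nb(3)[OF Q(1)]
    by (simp add: et_def)
  have cp: "cpt (star (fst p)) (star_col C p) (star_col C q) ?al"
    unfolding cpt_def
  proof
    fix a assume "a : gA (star (fst p))"
    then have a: "a : dbl (fst p)" by simp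
    have siq: "si s : fst q" if "s : fst p" for s using b(1) that by (auto simp: bij_betw_def)
    have iv: "star_col C q (dbl_inv (fst q) (si s)) = cinv C (snd p s)" if s: "s : fst p" for s
      using inv_mapsD(2)[OF star_col_maps[OF C q], of "si s"] siq[OF s] b(2)[OF s]
      by (simp add: star_col_in dbl_def)
    show "star_col C q (?al a) = star_col C p a"
      by (rule sx_cases[OF P(1) a, of si "dbl_inv (fst q)"])
        (use iv siq b(2) inv_mapsD(2)[OF star_col_maps[OF C p]] in \<open>auto simp: star_col_in dbl_def\<close>)
  qed
  have rs: "restrict ?al (inb (star (fst p)) undefined) = si"
    using b(3) by (auto simp: fun_eq_iff restrict_def star_nb(3)[OF P(1)] sx_in extensional_def)
  have dt: "det X (star (fst p)) (star_col C p) (\<lambda>v\<in>gV (star (fst p)). x)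
      (star (fst q)) (star_col C q) (\<lambda>v\<in>gV (star (fst q)). ba X p q si x) ?al (\<lambda>v. v)"
    unfolding det_def using et cp rs star_at_vertex[OF p] star_at_vertex[OF q] by simp
  have "(((\<lambda>s\<in>fst q. (\<lambda>s\<in>fst p. s) (inv_into (fst p) si s), star (fst p), star_col C p), \<lambda>v\<in>gV (star (fst p)). x), ?e')
     : gr_rel C X q"
  proof (rule gr_relI[OF ba(2) star_elt[OF C q y] dt])
    show "bij_betw ?al (gA (star (fst p))) (gA (star (fst q)))" using sx_bij[OF P(1) Q(1) b(1)] by simp
    show "bij_betw (\<lambda>v. v) (gV (star (fst p))) (gV (star (fst q)))" by (simp add: bij_betw_def)
    fix s assume s: "s : fst q"
    have "inv_into (fst p) si s : fst p" "si (inv_into (fst p) si s) = s"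
      using b(1) s by (auto simp: bij_betw_def inv_into_into f_inv_into_f)
    then show "?al ((\<lambda>s\<in>fst q. (\<lambda>s\<in>fst p. s) (inv_into (fst p) si s)) s) = (\<lambda>s\<in>fst q. s) s"
      using s by (simp add: sx_in)
  qed
  then show "F_unit C X q (ba X p q si x) = ba (F_fun C X) p q si (F_unit C X p x)"
    unfolding F_unit_cls[OF p x] F_unit_cls[OF q y] ba(1)
    using cls_eq_iff[OF X ba(2) star_elt[OF C q y]] by simp
qed

text \<open>Right unit law on representatives: an element of the free operad is the composite, along
  its own graph, of the units at its vertices.\<close>

lemma F_mult_map_unit:
  assumes X: "bij_functor C X" and C: "involutive_set C" and p: "(p :: ('u, 'c) bob) : bij_ob C"
    and e: "((f, G, ze), x) : gr_elts C X p"
  shows "F_mult C X p (cls C (F_fun C X) p ((f, G, ze), \<lambda>v\<in>gV G. F_unit C X (at_vertex G ze v) (x v))) =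
     cls C X p ((f, G, ze), x)"
    "((f, G, ze), \<lambda>v\<in>gV G. F_unit C X (at_vertex G ze v) (x v)) : gr_elts C (F_fun C X) p"
proof -
  have d: "dgr C X G ze x" and fe: "f : extensional (fst p)" using e by (auto simp: gr_elts_iff)
  note d' = dgrD[OF d]
  show el: "((f, G, ze), \<lambda>v\<in>gV G. F_unit C X (at_vertex G ze v) (x v)) : gr_elts C (F_fun C X) p"
    using e dgr_map[OF F_unit_nat[OF X C] d] by (simp add: gr_elts_iff)
  have "F_mult C X p (cls C (F_fun C X) p ((f, G, ze), \<lambda>v\<in>gV G. F_unit C X (at_vertex G ze v) (x v))) =
      cls C X p ((\<lambda>s\<in>fst p. f s, G, ze), x)"
  proof (rule F_mult_cls[OF X p el _ _ dsub_star_right[OF X C d]])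
    fix v assume v: "v : gV G"
    show "((\<lambda>s\<in>inb G v. s, star (inb G v), star_col C (at_vertex G ze v)), \<lambda>_\<in>gV (star (inb G v)). x v)
        : gr_elts C X (at_vertex G ze v)" using star_elt[OF C d'(5) d'(6)[OF v]] by simp
    show "(\<lambda>v\<in>gV G. F_unit C X (at_vertex G ze v) (x v)) v = cls C X (at_vertex G ze v)
        ((\<lambda>s\<in>inb G v. s, star (inb G v), star_col C (at_vertex G ze v)), \<lambda>_\<in>gV (star (inb G v)). x v)"
      using v F_unit_cls[of _ C, OF d'(5) d'(6)[OF v]] by simp
  qed
  also have "(\<lambda>s\<in>fst p. f s) = f" using fe by (auto simp: fun_eq_iff extensional_def)
  finally show "F_mult C X p (cls C (F_fun C X) p ((f, G, ze), \<lambda>v\<in>gV G. F_unit C X (at_vertex G ze v) (x v))) =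
     cls C X p ((f, G, ze), x)" .
qed

lemma choose_elts:
  assumes "!!v. v : V ==> y v : F_ob C X (P v)"
  shows "EX m H zev x. ALL v:V. ((m v, H v, zev v), x v) : gr_elts C X (P v) &
    y v = cls C X (P v) ((m v, H v, zev v), x v)"
proof -
  define e where "e v = (SOME e. e : gr_elts C X (P v) & y v = cls C X (P v) e)" for v
  have "e v : gr_elts C X (P v) & y v = cls C X (P v) (e v)" if "v : V" for v
  proof -
    have "EX e. e : gr_elts C X (P v) & y v = cls C X (P v) e" using F_obE[OF assms[OF that]] by metis
    then show ?thesis unfolding e_def by (rule someI_ex)
  qed
  then show ?thesis
    by (intro exI[of _ "\<lambda>v. fst (fst (e v))"] exI[of _ "\<lambda>v. fst (snd (fst (e v)))"]
      exI[of _ "\<lambda>v. snd (snd (fst (e v)))"] exI[of _ "\<lambda>v. snd (e v)"]) simp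
qed

text \<open>Fixes representatives of the classes at all vertices together with a model of the
  substitution, so that the multiplication takes a concrete value.\<close>

lemma F_mult_data:
  assumes X: "bij_functor C X" and p: "(p :: ('u, 'c) bob) : bij_ob C"
    and e: "((f, G, ze), y) : gr_elts C (F_fun C X) p"
  obtains m H zev x L ze' x' j q r where
    "!!v. v : gV G ==> ((m v, H v, zev v), x v) : gr_elts C X (at_vertex G ze v)"
    "!!v. v : gV G ==> y v = cls C X (at_vertex G ze v) ((m v, H v, zev v), x v)"
    "data_ok C X G ze H m zev x" "dsub X G ze H m zev x L ze' x' j q r"
    "F_mult C X p (cls C (F_fun C X) p ((f, G, ze), y)) = cls C X p ((\<lambda>s\<in>fst p. j (f s), L, ze'), x')"
    "((\<lambda>s\<in>fst p. j (f s), L, ze'), x') : gr_elts C X p"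
proof -
  have d: "dgr C (F_fun C X) G ze y" and f: "bij_betw f (fst p) (gB G)" "!!s. s : fst p ==> ze (f s) = snd p s"
    using e by (auto simp: gr_elts_iff)
  have "y v : F_ob C X (at_vertex G ze v)" if "v : gV G" for v using dgrD(6)[OF d that] by simp
  then have "EX m H zev x. ALL v:gV G. ((m v, H v, zev v), x v) : gr_elts C X (at_vertex G ze v) &
      y v = cls C X (at_vertex G ze v) ((m v, H v, zev v), x v)" by (rule choose_elts)
  then obtain m H zev x where
    *: "ALL v:gV G. ((m v, H v, zev v), x v) : gr_elts C X (at_vertex G ze v) &
      y v = cls C X (at_vertex G ze v) ((m v, H v, zev v), x v)" by (elim exE) (rule that)
  have y: "((m v, H v, zev v), x v) : gr_elts C X (at_vertex G ze v)"
    "y v = cls C X (at_vertex G ze v) ((m v, H v, zev v), x v)" if "v : gV G" for v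
    using *[rule_format, OF that] by auto
  have ok: "data_ok C X G ze H m zev x" using dgrD(1,3)[OF d] y(1) by (simp add: data_ok_def)
  then obtain j where s: "dsub X G ze H m zev x (sub_graph G H m) (sub_col G H m ze zev) (sub_deco X G H m ze zev x)
      j (glue G H m) (\<lambda>v w. enc (v, w))" using dsub_exists[OF X ok] by blast
  show ?thesis using that[OF y ok s] F_mult_cls[OF X p e y s] dsub_elt[OF X ok s f] by simp
qed

lemma F_mult_nat:
  assumes X: "bij_functor C X"
  shows "nat_on C (F_fun C (F_fun C X)) (F_fun C X) (F_mult C X :: ('u, 'c) bob => _)"
  unfolding nat_on_def
proof (intro conjI ballI)
  fix p :: "('u, 'c) bob" and K assume p: "p : bij_ob C" and "K : bo (F_fun C (F_fun C X)) p"
  then have K: "K : F_ob C (F_fun C X) p" by simp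
  obtain f G ze y where e: "((f, G, ze), y) : gr_elts C (F_fun C X) p" "K = cls C (F_fun C X) p ((f, G, ze), y)"
    using F_obE[OF K] .
  show "F_mult C X p K : bo (F_fun C X) p"
    unfolding e(2) by (rule F_mult_data[OF X p e(1)]) (simp add: cls_F_ob)
next
  fix p q :: "('u, 'c) bob" and si K
  assume p: "p : bij_ob C" and q: "q : bij_ob C" and s: "si : bij_hom p q" and "K : bo (F_fun C (F_fun C X)) p"
  then have K: "K : F_ob C (F_fun C X) p" by simp
  obtain f G ze y where e: "((f, G, ze), y) : gr_elts C (F_fun C X) p" "K = cls C (F_fun C X) p ((f, G, ze), y)"
    using F_obE[OF K] .
  obtain m H zev x L ze' x' j qq r where y: "!!v. v : gV G ==> ((m v, H v, zev v), x v) : gr_elts C X (at_vertex G ze v)"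
    "!!v. v : gV G ==> y v = cls C X (at_vertex G ze v) ((m v, H v, zev v), x v)"
    and sb: "dsub X G ze H m zev x L ze' x' j qq r"
    and F: "F_mult C X p K = cls C X p ((\<lambda>s\<in>fst p. j (f s), L, ze'), x')"
    "((\<lambda>s\<in>fst p. j (f s), L, ze'), x') : gr_elts C X p"
    unfolding e(2) by (rule F_mult_data[OF X p e(1)]) blast
  have "bij_betw si (fst p) (fst q)" using s by (simp add: bij_hom_def)
  then have i: "inv_into (fst p) si s : fst p" if "s : fst q" for s
    using that by (auto simp: bij_betw_def inv_into_into)
  note b1 = ba_F[OF F_functor[OF X] s e(1)] and b2 = ba_F[OF X s F(2)]
  have "F_mult C X q (ba (F_fun C (F_fun C X)) p q si K) =
      cls C X q ((\<lambda>s\<in>fst q. j ((\<lambda>s\<in>fst q. f (inv_into (fst p) si s)) s), L, ze'), x')"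
    unfolding e(2) b1(1) by (rule F_mult_cls[OF X q b1(2) y sb])
  also have "(\<lambda>s\<in>fst q. j ((\<lambda>s\<in>fst q. f (inv_into (fst p) si s)) s)) =
      (\<lambda>s\<in>fst q. (\<lambda>s\<in>fst p. j (f s)) (inv_into (fst p) si s))"
    using i by (auto simp: fun_eq_iff)
  also have "cls C X q ((\<dots>, L, ze'), x') = ba (F_fun C X) p q si (F_mult C X p K)"
    unfolding F(1) b2(1) ..
  finally show "F_mult C X q (ba (F_fun C (F_fun C X)) p q si K) = ba (F_fun C X) p q si (F_mult C X p K)" .
qed

lemma F_mult_hom:
  assumes X: "bij_functor C X"
  shows "(F_mult C X :: ('u, 'c) bob => _) : bfun_hom C (F_fun C (F_fun C X)) (F_fun C X)"
  unfolding bfun_hom_iff using F_mult_nat[OF X] by (simp add: F_mult_def)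

text \<open>\<open>sub_assoc\<close> with decorations. The map from \<open>Nv v\<close> to
  \<open>N\<close> transports operations because its composite with the map from each
  \<open>L (p v w)\<close> does.\<close>

lemma dsub_assoc:
  fixes G :: "'u graph"
  assumes X: "bij_functor C X" and FX: "bij_functor C Y"
    and okY: "data_ok C Y G ze H m zev z" and sY: "dsub Y G ze H m zev z M zeM zM j q p"
    and okM: "data_ok C X M zeM L n zeL t" and sM: "dsub X M zeM L n zeL t N zeN xN j2 q2 p2"
    and okv: "!!v. v : gV G ==> data_ok C X (H v) (zev v) (\<lambda>w. L (p v w)) (nv v) (\<lambda>w. zeL (p v w)) (\<lambda>w. t (p v w))"
    and nv: "!!v w a. v : gV G ==> w : gV (H v) ==> a : inb (H v) w ==> nv v w a = n (p v w) (q v a)"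
    and sv: "!!v. v : gV G ==> dsub X (H v) (zev v) (\<lambda>w. L (p v w)) (nv v) (\<lambda>w. zeL (p v w)) (\<lambda>w. t (p v w))
       (Nv v) (zeNv v) (xNv v) (jv v) (qv v) (pv v)"
  shows "EX Q P. dsub X G ze Nv (\<lambda>v. \<lambda>a\<in>inb G v. jv v (m v a)) zeNv xNv N zeN xN (\<lambda>a. j2 (j a)) Q P"
proof -
  note OY = data_okD[OF okY] and DY = dsubD[OF sY] and OM = data_okD[OF okM] and DM = dsubD[OF sM]
  note Ov = data_okD[OF okv] and Dv = dsubD[OF sv]
  note S = is_subD[OF DY(1)] and SM = is_subD[OF DM(1)] and Sv = is_subD[OF Dv(1)]
  have sv': "is_sub (H v) (\<lambda>w. L (p v w)) (\<lambda>w a. n (p v w) (q v a)) (Nv v) (jv v) (qv v) (pv v)"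
    if v: "v : gV G" for v
    by (rule is_sub_cong[OF Dv(1)[OF v]]) (simp_all add: nv[OF v])
  obtain Q P where QP: "is_sub G Nv (\<lambda>v a. jv v (m v a)) N (\<lambda>a. j2 (j a)) Q P"
    and Q: "!!v a. v : gV G ==> a : gA (H v) ==> Q v (jv v a) = j2 (q v a)"
    "!!v w a. v : gV G ==> w : gV (H v) ==> a : gA (L (p v w)) ==> Q v (qv v w a) = q2 (p v w) a"
    and P: "!!v w x. v : gV G ==> w : gV (H v) ==> x : gV (L (p v w)) ==> P v (pv v w x) = p2 (p v w) x"
    using sub_assoc[OF OY(1) DY(1) OM(1) DM(1) sv'] by blast
  note SN = is_subD[OF QP]
  note dN = dgrD[OF dsub_dgr[OF X okM sM]]
  have c: "cpt G ze zeN (\<lambda>a. j2 (j a))"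
    using cptD[OF DY(4)] cptD[OF DM(4)] S(2) by (simp add: cpt_def)
  have "det X (Nv v) (zeNv v) (xNv v) N zeN xN (Q v) (P v)" if v: "v : gV G" for v
  proof -
    note e = det_D[OF DY(5)[OF v]]
    note dv = dgrD[OF dsub_dgr[OF X okv[OF v] sv[OF v]]]
    have pM: "p v w : gV M" if "w : gV (H v)" for w using et_V[OF e(1) that] .
    have cQ: "cpt (Nv v) (zeNv v) zeN (Q v)"
      unfolding cpt_def
    proof
      fix b assume b: "b : gA (Nv v)"
      consider a where "a : gA (H v)" "b = jv v a"
          | w a where "w : gV (H v)" "a : gA (L (p v w))" "b = qv v w a" using Sv(6)[OF v b] by blast
      then show "zeN (Q v b) = zeNv v b"
        proof cases
          case 1
          then show ?thesis
            using Q(1)[OF v] cptD[OF Dv(4)[OF v]] cptD[OF DM(4)] et_A[OF e(1)] cptD[OF e(2)] by simp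
        next
          case 2
          then show ?thesis
            using Q(2)[OF v] cptD[OF det_D(2)[OF Dv(5)[OF v 2(1)]]] cptD[OF det_D(2)[OF DM(5)[OF pM]]] by simp
        qed
    qed
    have "xN (P v x) = ba X (at_vertex (Nv v) (zeNv v) x) (at_vertex N zeN (P v x)) (restrict (Q v) (inb (Nv v) x)) (xNv v x)"
      if x: "x : gV (Nv v)" for x
    proof -
      obtain w y where w: "w : gV (H v)" and y: "y : gV (L (p v w))" and xx: "x = pv v w y"
        using Sv(9)[OF v x] by blast
      note e1 = det_D[OF Dv(5)[OF v w]] and e2 = det_D[OF DM(5)[OF pM[OF w]]]
      note dL = dgrD[OF OM(3)[OF pM[OF w]]]
      have h: "restrict (Q v) (inb (Nv v) (pv v w y)) :
          bij_hom (at_vertex (Nv v) (zeNv v) (pv v w y)) (at_vertex N zeN (P v (pv v w y)))"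
        using et_hom[OF SN(4)[OF v] dv(2) SN(1) cQ] x xx by simp
      have "ba X (at_vertex (Nv v) (zeNv v) (pv v w y)) (at_vertex N zeN (P v (pv v w y)))
          (restrict (Q v) (inb (Nv v) (pv v w y))) (xNv v (pv v w y)) =
        ba X (at_vertex (L (p v w)) (zeL (p v w)) y) (at_vertex N zeN (P v (pv v w y)))
          (restrict (\<lambda>a. Q v (qv v w a)) (inb (L (p v w)) y)) (t (p v w) y)"
        unfolding e1(3)[OF y]
        by (rule tr_comp[OF X dL(5) dv(5) dN(5) dL(6)[OF y] dL(2) dv(2) SN(1) e1(1,2) y h])
      also have "restrict (\<lambda>a. Q v (qv v w a)) (inb (L (p v w)) y) = restrict (q2 (p v w)) (inb (L (p v w)) y)"
        using Q(2)[OF v w] inb_gA[OF dL(2)] by (auto simp: fun_eq_iff restrict_def)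
      also have "ba X (at_vertex (L (p v w)) (zeL (p v w)) y) (at_vertex N zeN (P v (pv v w y))) \<dots> (t (p v w) y) =
          xN (P v (pv v w y))"
        using e2(3)[OF y] P[OF v w y] by simp
      finally show ?thesis by (simp only: xx)
    qed
    then show ?thesis using SN(4)[OF v] cQ by (simp add: det_def)
  qed
  moreover have "is_sub G Nv (\<lambda>v. \<lambda>a\<in>inb G v. jv v (m v a)) N (\<lambda>a. j2 (j a)) Q P"
    by (rule is_sub_cong[OF QP]) simp_all
  ultimately show ?thesis using DM(2,3) c unfolding dsub_def by blast
qed

lemma F_mult_assoc:
  assumes X: "bij_functor C X" and C: "involutive_set C" and r: "(r :: ('u, 'c) bob) : bij_ob C"
    and K: "KK : F_ob C (F_fun C (F_fun C X)) r"
  shows "F_mult C X r (F_map C (F_fun C (F_fun C X)) (F_fun C X) (F_mult C X) r KK) =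
    F_mult C X r (F_mult C (F_fun C X) r KK)"
proof -
  note FX = F_functor[OF X]
  note FFX = F_functor[OF FX]
  obtain f G ze y where e: "((f, G, ze), y) : gr_elts C (F_fun C (F_fun C X)) r"
    "KK = cls C (F_fun C (F_fun C X)) r ((f, G, ze), y)" using F_obE[OF K] .
  obtain m H zev z M zeM zM j q p where y: "!!v. v : gV G ==> ((m v, H v, zev v), z v) : gr_elts C (F_fun C X) (at_vertex G ze v)"
    "!!v. v : gV G ==> y v = cls C (F_fun C X) (at_vertex G ze v) ((m v, H v, zev v), z v)"
    and okY: "data_ok C (F_fun C X) G ze H m zev z"
    and sY: "dsub (F_fun C X) G ze H m zev z M zeM zM j q p"
    and F: "F_mult C (F_fun C X) r KK = cls C (F_fun C X) r ((\<lambda>s\<in>fst r. j (f s), M, zeM), zM)"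
    "((\<lambda>s\<in>fst r. j (f s), M, zeM), zM) : gr_elts C (F_fun C X) r"
    unfolding e(2) by (rule F_mult_data[OF FX r e(1)]) blast
  note OY = data_okD[OF okY] and DY = dsubD[OF sY]
  note S = is_subD[OF DY(1)]
  have "dgr C (F_fun C X) M zeM zM" using F(2) by (simp add: gr_elts_iff)
  note dM' = dgrD[OF this]
  obtain n L zeL t N zeN xN j2 q2 p2 where
    L: "!!u. u : gV M ==> ((n u, L u, zeL u), t u) : gr_elts C X (at_vertex M zeM u)"
      "!!u. u : gV M ==> zM u = cls C X (at_vertex M zeM u) ((n u, L u, zeL u), t u)"
    and okM: "data_ok C X M zeM L n zeL t" and sM: "dsub X M zeM L n zeL t N zeN xN j2 q2 p2"
    and R: "F_mult C X r (F_mult C (F_fun C X) r KK) = cls C X r ((\<lambda>s\<in>fst r. j2 ((\<lambda>s\<in>fst r. j (f s)) s), N, zeN), xN)"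
    unfolding F(1) by (rule F_mult_data[OF X r F(2)]) blast
  define nv where "nv v w = (\<lambda>a\<in>inb (H v) w. n (p v w) (q v a))" for v w
  \<comment> \<open>Representatives are chosen only once, at the vertices of \<open>M\<close>. As
    transport along \<open>q v\<close> is invertible, the class at a vertex \<open>w\<close> of
    \<open>H v\<close> is represented by the same graph \<open>L (p v w)\<close>, its attachment
    being composed with \<open>q v\<close>. Both iterated substitutions then involve the same
    graphs.\<close>
  have zv: "((nv v w, L (p v w), zeL (p v w)), t (p v w)) : gr_elts C X (at_vertex (H v) (zev v) w)"
    "z v w = cls C X (at_vertex (H v) (zev v) w) ((nv v w, L (p v w), zeL (p v w)), t (p v w))"
    if v: "v : gV G" and w: "w : gV (H v)" for v w
  proof -
    note ev = det_D[OF DY(5)[OF v]] and dv = dgrD[OF OY(3)[OF v]]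
    have pM: "p v w : gV M" using et_V[OF ev(1) w] .
    let ?A = "at_vertex (H v) (zev v) w" and ?B = "at_vertex M zeM (p v w)"
    let ?si = "restrict (q v) (inb (H v) w)"
    have h: "?si : bij_hom ?A ?B" by (rule et_hom[OF ev(1) dv(2) S(1) ev(2) w])
    let ?ta = "\<lambda>t\<in>fst ?B. inv_into (fst ?A) ?si t"
    have h': "?ta : bij_hom ?B ?A" by (rule bij_hom_inv[OF h])
    have bh: "bij_betw ?si (fst ?A) (fst ?B)" using h by (simp add: bij_hom_def)
    have "inv_into (fst ?B) ?ta a = ?si a" if a: "a : fst ?A" for a
    proof (rule inv_into_f_eq)
      show "inj_on ?ta (fst ?B)" using h' by (simp add: bij_hom_def bij_betw_def)
      show "?si a : fst ?B" using bh a by (auto simp: bij_betw_def)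
      then show "?ta (?si a) = a" using bij_betw_inv_into_left[OF bh a] by simp
    qed
    then have eq: "(\<lambda>s\<in>fst ?A. n (p v w) (inv_into (fst ?B) ?ta s)) = nv v w"
      by (auto simp: fun_eq_iff nv_def)
    have "z v w = ba (F_fun C X) ?B ?A ?ta (zM (p v w))"
      unfolding ev(3)[OF w] by (rule ba_inj[OF FX dv(5) dM'(5) h dv(6)[OF w], symmetric])
    then show "z v w = cls C X ?A ((nv v w, L (p v w), zeL (p v w)), t (p v w))"
      using ba_F(1)[OF X h' L(1)[OF pM]] L(2)[OF pM] eq by simp
    show "((nv v w, L (p v w), zeL (p v w)), t (p v w)) : gr_elts C X ?A"
      using ba_F(2)[OF X h' L(1)[OF pM]] eq by simp
  qed
  have okv: "data_ok C X (H v) (zev v) (\<lambda>w. L (p v w)) (nv v) (\<lambda>w. zeL (p v w)) (\<lambda>w. t (p v w))"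
    if v: "v : gV G" for v
    unfolding data_ok_def using dgrD(1,3)[OF OY(3)[OF v]] zv(1)[OF v] by simp
  define Nv zeNv xNv where "Nv v = sub_graph (H v) (\<lambda>w. L (p v w)) (nv v)"
    and "zeNv v = sub_col (H v) (\<lambda>w. L (p v w)) (nv v) (zev v) (\<lambda>w. zeL (p v w))"
    and "xNv v = sub_deco X (H v) (\<lambda>w. L (p v w)) (nv v) (zev v) (\<lambda>w. zeL (p v w)) (\<lambda>w. t (p v w))" for v
  have "EX jv. dsub X (H v) (zev v) (\<lambda>w. L (p v w)) (nv v) (\<lambda>w. zeL (p v w)) (\<lambda>w. t (p v w))
       (Nv v) (zeNv v) (xNv v) jv (glue (H v) (\<lambda>w. L (p v w)) (nv v)) (\<lambda>v w. enc (v, w))" if "v : gV G" for v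
    using dsub_exists[OF X okv[OF that]] unfolding Nv_def zeNv_def xNv_def by blast
  then obtain jv where sv: "!!v. v : gV G ==> dsub X (H v) (zev v) (\<lambda>w. L (p v w)) (nv v) (\<lambda>w. zeL (p v w)) (\<lambda>w. t (p v w))
       (Nv v) (zeNv v) (xNv v) (jv v) (glue (H v) (\<lambda>w. L (p v w)) (nv v)) (\<lambda>v w. enc (v, w))" by metis
  have nv: "nv v w a = n (p v w) (q v a)" if "a : inb (H v) w" for v w a using that by (simp add: nv_def)
  obtain Q P where sN: "dsub X G ze Nv (\<lambda>v. \<lambda>a\<in>inb G v. jv v (m v a)) zeNv xNv N zeN xN (\<lambda>a. j2 (j a)) Q P"
    using dsub_assoc[OF X FX okY sY okM sM okv nv sv] by blast
  have fm: "F_mult C X (at_vertex G ze v) (y v) =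
      cls C X (at_vertex G ze v) ((\<lambda>a\<in>inb G v. jv v (m v a), Nv v, zeNv v), xNv v)"
    "((\<lambda>a\<in>inb G v. jv v (m v a), Nv v, zeNv v), xNv v) : gr_elts C X (at_vertex G ze v)" if v: "v : gV G" for v
  proof -
    show "F_mult C X (at_vertex G ze v) (y v) =
      cls C X (at_vertex G ze v) ((\<lambda>a\<in>inb G v. jv v (m v a), Nv v, zeNv v), xNv v)"
      using F_mult_cls[OF X OY(7) y(1)[OF v] zv[OF v] sv[OF v]] y(2)[OF v] by simp
    have mf: "bij_betw (m v) (fst (at_vertex G ze v)) (gB (H v))"
      "!!s. s : fst (at_vertex G ze v) ==> zev v (m v s) = snd (at_vertex G ze v) s"
      using y(1)[OF v] by (auto simp: gr_elts_iff)
    show "((\<lambda>a\<in>inb G v. jv v (m v a), Nv v, zeNv v), xNv v) : gr_elts C X (at_vertex G ze v)"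
      using dsub_elt[OF X okv[OF v] sv[OF v] mf] by simp
  qed
  note Fm = F_map_cls[OF FFX FX F_mult_nat[OF X] r e(1)]
  have "F_mult C X r (F_map C (F_fun C (F_fun C X)) (F_fun C X) (F_mult C X) r KK) =
      cls C X r ((\<lambda>s\<in>fst r. j2 (j (f s)), N, zeN), xN)"
    unfolding e(2) Fm(1) by (rule F_mult_cls[OF X r Fm(2) fm(2) _ sN]) (simp_all add: fm(1))
  also have "(\<lambda>s\<in>fst r. j2 (j (f s))) = (\<lambda>s\<in>fst r. j2 ((\<lambda>s\<in>fst r. j (f s)) s))" by (auto simp: fun_eq_iff)
  finally show ?thesis unfolding R .
qed

theorem free_modular:
  fixes X :: "('u, 'c, 'x) bfun"
  assumes X: "bij_functor C X" and C: "involutive_set C"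
  shows "modular_operad (free_modop C X)"
  unfolding modular_operad_def free_modop_def
  using C F_functor[OF X] F_mult_hom[OF X] F_mult_unit[OF X C] F_mult_assoc[OF X C] by simp

end

section \<open>Modular operads and their morphisms\<close>

text \<open>The structure map on representatives; composition in an operad is expressed by it from
  here on.\<close>

definition act :: "('u, 'c, 'x) modop => ('u, 'c) bob => ('u, 'c, 'x) gelt => 'x" where
  "act P p e = malg P p (cls (mcol P) (mop P) p e)"

abbreviation rcol :: "('c => 'd) => 'u graph => ('u => 'c) => 'u => 'd" where
  "rcol ph G ze \<equiv> (\<lambda>a\<in>gA G. ph (ze a))"

lemma modopD:
  assumes "modular_operad P"
  shows "involutive_set (mcol P)" "bij_functor (mcol P) (mop P)"
    "nat_on (mcol P) (F_fun (mcol P) (mop P)) (mop P) (malg P)"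
  using assms by (simp_all add: modular_operad_def bfun_hom_iff)

lemma act_in:
  "modular_operad P ==> p : bij_ob (mcol P) ==> e : gr_elts (mcol P) (mop P) p ==> act P p e : bo (mop P) p"
  unfolding act_def using nat_onD(1)[OF modopD(3)] cls_F_ob by (metis F_fun_bo)

lemma act_rel:
  assumes "modular_operad P" "(e, e') : gr_rel (mcol P) (mop P) p"
  shows "act P p e = act P p e'"
  unfolding act_def using cls_eq_iff[OF modopD(2)[OF assms(1)]] gr_rel_elts[OF assms(2)] assms(2) by metis

lemma act_nat:
  assumes P: "modular_operad P" and p: "p : bij_ob (mcol P)" and q: "q : bij_ob (mcol P)"
    and s: "si : bij_hom p q" and e: "((f, G, ze), x) : gr_elts (mcol P) (mop P) p"
  shows "ba (mop P) p q si (act P p ((f, G, ze), x)) =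
     act P q ((\<lambda>s\<in>fst q. f (inv_into (fst p) si s), G, ze), x)"
  unfolding act_def ba_F(1)[OF modopD(2)[OF P] s e, symmetric]
  by (rule nat_onD(2)[OF modopD(3)[OF P] p q s, symmetric]) (use cls_F_ob[OF e] in simp)

context infinite_universe
begin

lemma act_unit:
  assumes P: "modular_operad (P :: ('u, 'c, 'x) modop)" and p: "p : bij_ob (mcol P)" and x: "x : bo (mop P) p"
  shows "act P p ((\<lambda>s\<in>fst p. s, star (fst p), star_col (mcol P) p), \<lambda>v\<in>gV (star (fst p)). x) = x"
  using assms F_unit_cls[OF p x] unfolding act_def modular_operad_def by metis

text \<open>The algebra law unfolded: composing \<open>G\<close> decorated by the composites of the
  \<open>H v\<close> is the same as composing the substituted graph, in any model.\<close>

lemma act_assoc: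
  assumes P: "modular_operad (P :: ('u, 'c, 'x) modop)" and p: "p : bij_ob (mcol P)"
    and e: "((f, G, ze), y) : gr_elts (mcol P) (mop P) p"
    and y: "!!v. v : gV G ==> ((m v, H v, zev v), x v) : gr_elts (mcol P) (mop P) (at_vertex G ze v)"
      "!!v. v : gV G ==> y v = act P (at_vertex G ze v) ((m v, H v, zev v), x v)"
    and s: "dsub (mop P) G ze H m zev x K ze' x' j q r"
  shows "act P p ((f, G, ze), y) = act P p ((\<lambda>s\<in>fst p. j (f s), K, ze'), x')"
proof -
  let ?C = "mcol P" and ?X = "mop P"
  note X = modopD(2)[OF P]
  have d: "dgr ?C ?X G ze y" using e by (simp add: gr_elts_iff)
  define Y where "Y = (\<lambda>v\<in>gV G. cls ?C ?X (at_vertex G ze v) ((m v, H v, zev v), x v))"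
  have dY: "dgr ?C (F_fun ?C ?X) G ze Y"
    using dgrD[OF d] cls_F_ob[OF y(1)] by (intro dgrI) (auto simp: Y_def)
  then have eY: "((f, G, ze), Y) : gr_elts ?C (F_fun ?C ?X) p" using e by (simp add: gr_elts_iff)
  let ?K = "cls ?C (F_fun ?C ?X) p ((f, G, ze), Y)"
  have "malg P p (F_map ?C (F_fun ?C ?X) ?X (malg P) p ?K) = malg P p (F_mult ?C ?X p ?K)"
    using P p cls_F_ob[OF eY] unfolding modular_operad_def by blast
  moreover have "F_map ?C (F_fun ?C ?X) ?X (malg P) p ?K = cls ?C ?X p ((f, G, ze), y)"
  proof -
    have "(\<lambda>v\<in>gV G. malg P (at_vertex G ze v) (Y v)) = y"
      using dgrD(10)[OF d] y(2) by (auto simp: Y_def act_def fun_eq_iff extensional_def)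
    then show ?thesis using F_map_cls(1)[OF F_functor[OF X] X modopD(3)[OF P] p eY] by simp
  qed
  moreover have "F_mult ?C ?X p ?K = cls ?C ?X p ((\<lambda>s\<in>fst p. j (f s), K, ze'), x')"
    by (rule F_mult_cls[OF X p eY y(1) _ s]) (simp_all add: Y_def)
  ultimately show ?thesis by (simp add: act_def)
qed

text \<open>The axioms of an operad as conditions on an operation \<open>a\<close> on
  representatives. The operad of a Segal presheaf is built from these.\<close>

lemma modular_operadI:
  fixes C :: "'c cset" and X :: "('u, 'c, 'x) bfun" and a :: "('u, 'c) bob => ('u, 'c, 'x) gelt => 'x"
  defines "P \<equiv> \<lparr>mcol = C, mop = X, malg = (\<lambda>p\<in>bij_ob C. \<lambda>K\<in>F_ob C X p. a p (SOME e. e : K))\<rparr>"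
  assumes C: "involutive_set C" and X: "bij_functor C X"
    and a_in: "!!p e. p : bij_ob C ==> e : gr_elts C X p ==> a p e : bo X p"
    and a_rel: "!!p e e'. p : bij_ob C ==> (e, e') : gr_rel C X p ==> a p e = a p e'"
    and a_nat: "!!p q si f G ze x. p : bij_ob C ==> q : bij_ob C ==> si : bij_hom p q ==>
      ((f, G, ze), x) : gr_elts C X p ==>
      a q ((\<lambda>s\<in>fst q. f (inv_into (fst p) si s), G, ze), x) = ba X p q si (a p ((f, G, ze), x))"
    and a_unit: "!!p x. p : bij_ob C ==> x : bo X p ==>
      a p ((\<lambda>s\<in>fst p. s, star (fst p), star_col C p), \<lambda>v\<in>gV (star (fst p)). x) = x"
    and a_assoc: "!!p f G ze y m H zev x K ze' x' j q r. p : bij_ob C ==>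
      ((f, G, ze), y) : gr_elts C X p ==> data_ok C X G ze H m zev x ==>
      (!!v. v : gV G ==> y v = a (at_vertex G ze v) ((m v, H v, zev v), x v)) ==>
      dsub X G ze H m zev x K ze' x' j q r ==>
      a p ((f, G, ze), y) = a p ((\<lambda>s\<in>fst p. j (f s), K, ze'), x')"
  shows "modular_operad P" "!!p e. p : bij_ob C ==> e : gr_elts C X p ==> act P p e = a p e"
proof -
  have P[simp]: "mcol P = C" "mop P = X" by (simp_all add: P_def)
  have mc: "malg P p (cls C X p e) = a p e" if p: "p : bij_ob C" and e: "e : gr_elts C X p" for p e
  proof -
    have "(SOME e'. e' : cls C X p e) : cls C X p e" using self_cls[OF X e] by (rule someI)
    then have "a p (SOME e'. e' : cls C X p e) = a p e" using a_rel[OF p] by (metis in_cls)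
    then show ?thesis using p cls_F_ob[OF e] by (simp add: P_def)
  qed
  then show "!!p e. p : bij_ob C ==> e : gr_elts C X p ==> act P p e = a p e" by (simp add: act_def)
  have n: "nat_on C (F_fun C X) X (malg P)"
    unfolding nat_on_def
  proof (intro conjI ballI)
    fix p K assume p: "p : bij_ob C" and "K : bo (F_fun C X) p"
    then obtain f G ze x where e: "((f, G, ze), x) : gr_elts C X p" "K = cls C X p ((f, G, ze), x)"
      using F_obE by (metis F_fun_bo)
    then show "malg P p K : bo X p" using mc[OF p] a_in[OF p] by simp
  next
    fix p q si K assume p: "p : bij_ob C" and q: "q : bij_ob C" and s: "si : bij_hom p q" and "K : bo (F_fun C X) p"
    then obtain f G ze x where e: "((f, G, ze), x) : gr_elts C X p" "K = cls C X p ((f, G, ze), x)"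
      using F_obE by (metis F_fun_bo)
    show "malg P q (ba (F_fun C X) p q si K) = ba X p q si (malg P p K)"
      unfolding e(2) ba_F(1)[OF X s e(1)] mc[OF q ba_F(2)[OF X s e(1)]] mc[OF p e(1)]
      by (rule a_nat[OF p q s e(1)])
  qed
  have h: "malg P : bfun_hom C (F_fun C X) X"
    unfolding bfun_hom_iff using n by (simp add: P_def)
  have u: "malg P p (F_unit C X p x) = x" if p: "p : bij_ob C" and x: "x : bo X p" for p x
    unfolding F_unit_cls[of p C x X, OF p x] using mc[OF p star_elt[of C p x X, OF C p x]] a_unit[OF p x] by simp
  have as: "malg P p (F_map C (F_fun C X) X (malg P) p KK) = malg P p (F_mult C X p KK)"
    if p: "p : bij_ob C" and K: "KK : F_ob C (F_fun C X) p" for p KK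
  proof -
    obtain f G ze y where e: "((f, G, ze), y) : gr_elts C (F_fun C X) p"
      "KK = cls C (F_fun C X) p ((f, G, ze), y)" using F_obE[OF K] .
    obtain m H zev x L ze' x' j q r where y: "!!v. v : gV G ==> ((m v, H v, zev v), x v) : gr_elts C X (at_vertex G ze v)"
      "!!v. v : gV G ==> y v = cls C X (at_vertex G ze v) ((m v, H v, zev v), x v)"
      and ok: "data_ok C X G ze H m zev x" and sb: "dsub X G ze H m zev x L ze' x' j q r"
      and F: "F_mult C X p KK = cls C X p ((\<lambda>s\<in>fst p. j (f s), L, ze'), x')"
      "((\<lambda>s\<in>fst p. j (f s), L, ze'), x') : gr_elts C X p"
      unfolding e(2) by (rule F_mult_data[OF X p e(1)]) blast
    note Fm = F_map_cls[OF F_functor[OF X] X n p e(1)]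
    have "a p ((f, G, ze), \<lambda>v\<in>gV G. malg P (at_vertex G ze v) (y v)) = a p ((\<lambda>s\<in>fst p. j (f s), L, ze'), x')"
      by (rule a_assoc[OF p Fm(2) ok _ sb]) (simp add: y(2) mc[OF data_okD(7)[OF ok] y(1)])
    then show ?thesis unfolding e(2) Fm(1) mc[OF p Fm(2)] F(1)[unfolded e(2)] mc[OF p F(2)] .
  qed
  show "modular_operad P" unfolding modular_operad_def P using C X h u as by blast
qed

end

section \<open>Recoloring, and morphisms of modular operads\<close>

lemma inv_maps_iff:
  "ph : inv_maps C D \<longleftrightarrow> ph : extensional (cols C) & (ALL c:cols C. ph c : cols D & ph (cinv C c) = cinv D (ph c))"
  by (auto simp: inv_maps_def PiE_def)

lemma recolor_simps [simp]: "fst (recolor ph p) = fst p" "s : fst p ==> snd (recolor ph p) s = ph (snd p s)"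
  by (auto simp: recolor_def)

lemma bij_ob_iff:
  "p : bij_ob C \<longleftrightarrow> finite (fst p) & snd p : extensional (fst p) & (ALL s:fst p. snd p s : cols C)"
  by (cases p) (auto simp: bij_ob_def PiE_def)

lemma recolor_ob: "p : bij_ob C ==> ph : inv_maps C D ==> recolor ph p : bij_ob D"
  unfolding bij_ob_iff inv_maps_iff by (simp add: recolor_def)

lemma recolor_hom:
  assumes "si : bij_hom p q" shows "si : bij_hom (recolor ph p) (recolor ph q)"
proof -
  have "si s : fst q" if "s : fst p" for s using assms that by (auto simp: bij_hom_def bij_betw_def)
  then show ?thesis using assms by (auto simp: bij_hom_def)
qed

lemma rcol_maps:
  assumes z: "ze : inv_maps (arcset G) C" and f: "ph : inv_maps C D" and g: "is_graph G"
  shows "rcol ph G ze : inv_maps (arcset G) D"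
proof (rule inv_mapsI)
  note Z = inv_mapsD[OF z]
  have F: "ph c : cols D" "ph (cinv C c) = cinv D (ph c)" if "c : cols C" for c
    using f that by (auto simp: inv_maps_iff)
  fix a assume a: "a : gA G"
  show "rcol ph G ze a : cols D" "rcol ph G ze (gi G a) = cinv D (rcol ph G ze a)"
    using a F[OF Z(1)[OF a]] Z(2)[OF a] gi_in[OF g a] by simp_all
qed simp

lemma pull_functor:
  fixes X :: "('u, 'd, 'x) bfun" and C :: "'c cset"
  assumes X: "bij_functor D X" and f: "ph : inv_maps C D"
  shows "bij_functor C (pull_fun ph X)"
proof -
  note o = recolor_ob[OF _ f]
  show ?thesis
    unfolding bij_functor_def pull_fun_def bfun.simps
  proof (intro conjI ballI)
    fix p q :: "('u, 'c) bob" and si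
    assume a: "p : bij_ob C" "q : bij_ob C" "si : bij_hom p q"
    show "ba X (recolor ph p) (recolor ph q) si : bo X (recolor ph p) \<rightarrow>\<^sub>E bo X (recolor ph q)"
      using X o[OF a(1)] o[OF a(2)] recolor_hom[OF a(3)] unfolding bij_functor_def by blast
  next
    fix p :: "('u, 'c) bob" and x assume a: "p : bij_ob C" "x : bo X (recolor ph p)"
    show "ba X (recolor ph p) (recolor ph p) (\<lambda>s\<in>fst p. s) x = x" using ba_id[OF X o[OF a(1)] a(2)] by simp
  next
    fix p q r :: "('u, 'c) bob" and si ta x
    assume a: "p : bij_ob C" "q : bij_ob C" "r : bij_ob C" "si : bij_hom p q" "ta : bij_hom q r"
      "x : bo X (recolor ph p)"
    show "ba X (recolor ph p) (recolor ph r) (compose (fst p) ta si) x =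
      ba X (recolor ph q) (recolor ph r) ta (ba X (recolor ph p) (recolor ph q) si x)"
      using ba_comp[OF X o[OF a(1)] o[OF a(2)] o[OF a(3)] recolor_hom[OF a(4)] recolor_hom[OF a(5)] a(6)]
      by (simp add: compose_def)
  qed
qed

lemma pull_dgr:
  assumes f: "ph : inv_maps C D" and d: "dgr C (pull_fun ph X) G ze x"
  shows "dgr D X G (rcol ph G ze) x"
proof -
  note d' = dgrD[OF d]
  have "x v : bo X (at_vertex G (rcol ph G ze) v)" if "v : gV G" for v
    using d'(6)[OF that] by (simp add: pull_fun_def recolor_at[OF d'(2)])
  moreover have "rcol ph G ze : inv_maps (arcset G) D" using rcol_maps[OF d'(3) f d'(2)] .
  ultimately show ?thesis using d'(1,10) by (simp add: dgr_def deco_def PiE_iff)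
qed

lemma elts_bd:
  assumes "((f, G, ze), x) : gr_elts C X p" "s : fst p"
  shows "f s : gB G" "f s : gA G"
proof -
  have d: "dgr C X G ze x" and b: "bij_betw f (fst p) (gB G)" using assms by (auto simp: gr_elts_iff)
  show "f s : gB G" using bij_betwE[OF b] assms(2) by blast
  then show "f s : gA G" by (rule gB_gA[OF dgrD(2)[OF d]])
qed

lemma pull_elts:
  assumes f: "ph : inv_maps C D" and e: "((f, G, ze), x) : gr_elts C (pull_fun ph X) p"
  shows "((f, G, rcol ph G ze), x) : gr_elts D X (recolor ph p)"
proof -
  have "f s : gA G" if "s : fst p" for s
    using elts_bd(2)[OF e that] .
  moreover have d: "dgr C (pull_fun ph X) G ze x" using e by (simp add: gr_elts_iff)
  ultimately show ?thesis using e pull_dgr[OF f d] by (simp add: gr_elts_iff)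
qed

lemma pull_det:
  assumes "is_graph G" "is_graph G'" and a: "det (pull_fun ph X) G ze x G' ze' x' al nu"
  shows "det X G (rcol ph G ze) x G' (rcol ph G' ze') x' al nu"
proof -
  note A = det_D[OF a]
  have "cpt G (rcol ph G ze) (rcol ph G' ze') al" using cptD[OF A(2)] et_A[OF A(1)] by (simp add: cpt_def)
  then show ?thesis unfolding det_def using A(1,3) by (simp add: pull_fun_def recolor_at assms(1,2))
qed

lemma pull_malg:
  fixes Q :: "('u, 'd, 'x) modop" and C :: "'c cset"
  assumes X: "bij_functor (mcol Q) (mop Q)" and f: "ph : inv_maps C (mcol Q)" and p: "p : bij_ob C"
    and e: "((f, G, ze), x) : gr_elts C (pull_fun ph (mop Q)) p"
  shows "malg (pull_modop C ph Q) p (cls C (pull_fun ph (mop Q)) p ((f, G, ze), x)) =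
    act Q (recolor ph p) ((f, G, rcol ph G ze), x)"
proof -
  let ?g = "\<lambda>((f :: 'u => 'u, G :: 'u graph, ze :: 'u => 'c), x :: 'u => 'x). ((f, G, rcol ph G ze), x)"
  let ?p = "recolor ph p"
  have rel: "(?g ((f, G, ze), x), ?g e') : gr_rel (mcol Q) (mop Q) ?p"
    if r: "(((f, G, ze), x), e') : gr_rel C (pull_fun ph (mop Q)) p" for e'
  proof -
    obtain f' G' ze' x' where [simp]: "e' = ((f', G', ze'), x')" by (metis surj_pair)
    have e': "((f', G', ze'), x') : gr_elts C (pull_fun ph (mop Q)) p" using gr_rel_elts[OF r] by simp
    have g: "is_graph G" "is_graph G'" using e e' by (auto simp: gr_elts_iff dgrD(2))
    obtain al nu where "det (pull_fun ph (mop Q)) G ze x G' ze' x' al nu" "bij_betw al (gA G) (gA G')"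
        "bij_betw nu (gV G) (gV G')" "!!s. s : fst p ==> al (f s) = f' s"
      using r[unfolded \<open>e' = _\<close>] by (rule gr_relE) blast
    then show ?thesis using pull_det[OF g] pull_elts[OF f e] pull_elts[OF f e']
      by (auto intro!: gr_relI)
  qed
  have "malg (pull_modop C ph Q) p (cls C (pull_fun ph (mop Q)) p ((f, G, ze), x)) =
    malg Q ?p (gr_rel (mcol Q) (mop Q) ?p `` (?g ` cls C (pull_fun ph (mop Q)) p ((f, G, ze), x)))"
    using p cls_F_ob[OF e] by (simp add: pull_modop_def)
  then show ?thesis
    using cls_image[where g = ?g, OF pull_functor[OF X f] X e rel] by (simp add: act_def)
qed

text \<open>Morphisms in terms of representatives and free of extensionality, so that they can be
  given by formulas; \<open>csm_hom_iff\<close> and \<open>csm_homI\<close> translate.\<close>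

definition chom ::
  "('u, 'c, 'x) modop => ('u, 'd, 'y) modop => ('c => 'd) => (('u, 'c) bob => 'x => 'y) => bool" where
  "chom P Q ph th \<longleftrightarrow> ph : inv_maps (mcol P) (mcol Q) & nat_on (mcol P) (mop P) (pull_fun ph (mop Q)) th &
     (ALL p:bij_ob (mcol P). ALL f G ze x. ((f, G, ze), x) : gr_elts (mcol P) (mop P) p -->
        th p (act P p ((f, G, ze), x)) =
        act Q (recolor ph p) ((f, G, rcol ph G ze), \<lambda>v\<in>gV G. th (at_vertex G ze v) (x v)))"

lemma csm_hom_iff:
  assumes P: "modular_operad P" and Q: "modular_operad Q"
  shows "h : csm_hom P Q \<longleftrightarrow> chom P Q (fst h) (snd h) & snd h : extensional (bij_ob (mcol P)) &
     (ALL p:bij_ob (mcol P). snd h p : extensional (bo (mop P) p))"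
proof (cases "fst h : inv_maps (mcol P) (mcol Q) &
    nat_on (mcol P) (mop P) (pull_fun (fst h) (mop Q)) (snd h)")
  case True
  let ?C = "mcol P" and ?X = "mop P" and ?ph = "fst h" and ?th = "snd h"
  let ?Y = "pull_fun ?ph (mop Q)"
  note f = True[THEN conjunct1] and n = True[THEN conjunct2]
  note X = modopD(2)[OF P] and Y = pull_functor[OF modopD(2)[OF Q] f]
  have mp: "mop (pull_modop ?C ?ph Q) = ?Y" by (simp add: pull_modop_def)
  have "(ALL p:bij_ob ?C. ALL K:F_ob ?C ?X p.
          ?th p (malg P p K) = malg (pull_modop ?C ?ph Q) p (F_map ?C ?X ?Y ?th p K)) \<longleftrightarrow>
     (ALL p:bij_ob ?C. ALL f G ze x. ((f, G, ze), x) : gr_elts ?C ?X p -->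
        ?th p (act P p ((f, G, ze), x)) =
        act Q (recolor ?ph p) ((f, G, rcol ?ph G ze), \<lambda>v\<in>gV G. ?th (at_vertex G ze v) (x v)))"
    (is "?L \<longleftrightarrow> ?R")
  proof -
    have key: "malg (pull_modop ?C ?ph Q) p (F_map ?C ?X ?Y ?th p (cls ?C ?X p ((f, G, ze), x))) =
       act Q (recolor ?ph p) ((f, G, rcol ?ph G ze), \<lambda>v\<in>gV G. ?th (at_vertex G ze v) (x v))"
      if p: "p : bij_ob ?C" and e: "((f, G, ze), x) : gr_elts ?C ?X p" for p f G ze x
      unfolding F_map_cls(1)[OF X Y n p e] by (rule pull_malg[OF modopD(2)[OF Q] f p F_map_cls(2)[OF X Y n p e]])
    show ?thesis
    proof
      assume L: ?L
      show ?R
      proof (intro ballI allI impI)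
        fix p f G ze x assume p: "p : bij_ob ?C" and e: "((f, G, ze), x) : gr_elts ?C ?X p"
        show "?th p (act P p ((f, G, ze), x)) =
          act Q (recolor ?ph p) ((f, G, rcol ?ph G ze), \<lambda>v\<in>gV G. ?th (at_vertex G ze v) (x v))"
          using L[rule_format, OF p cls_F_ob[OF e]] key[OF p e] by (simp add: act_def)
      qed
    next
      assume R: ?R
      show ?L
      proof (intro ballI)
        fix p K assume p: "p : bij_ob ?C" and K: "K : F_ob ?C ?X p"
        obtain f G ze x where e: "((f, G, ze), x) : gr_elts ?C ?X p" "K = cls ?C ?X p ((f, G, ze), x)"
          using F_obE[OF K] .
        show "?th p (malg P p K) = malg (pull_modop ?C ?ph Q) p (F_map ?C ?X ?Y ?th p K)"
          using R[rule_format, OF p e(1)] key[OF p e(1)] e(2) by (simp add: act_def)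
      qed
    qed
  qed
  moreover have "h : csm_hom P Q \<longleftrightarrow> ?ph : inv_maps (mcol P) (mcol Q) & ?th : csm_col_hom P (pull_modop ?C ?ph Q)"
    by (cases h) (simp add: csm_hom_def)
  ultimately show ?thesis
    unfolding csm_col_hom_def chom_def mem_Collect_eq mp bfun_hom_iff using True by auto
next
  case False
  then show ?thesis
    unfolding csm_hom_def csm_col_hom_def chom_def bfun_hom_iff by (cases h) (auto simp: pull_modop_def)
qed

lemma chomD:
  assumes "chom P Q ph th"
  shows "ph : inv_maps (mcol P) (mcol Q)"
    "!!p x. p : bij_ob (mcol P) ==> x : bo (mop P) p ==> th p x : bo (mop Q) (recolor ph p)"
    "!!p q si x. p : bij_ob (mcol P) ==> q : bij_ob (mcol P) ==> si : bij_hom p q ==> x : bo (mop P) p ==>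
       th q (ba (mop P) p q si x) = ba (mop Q) (recolor ph p) (recolor ph q) si (th p x)"
    "!!p f G ze x. p : bij_ob (mcol P) ==> ((f, G, ze), x) : gr_elts (mcol P) (mop P) p ==>
        th p (act P p ((f, G, ze), x)) =
        act Q (recolor ph p) ((f, G, rcol ph G ze), \<lambda>v\<in>gV G. th (at_vertex G ze v) (x v))"
  using assms by (auto simp: chom_def nat_on_def pull_fun_def)

lemma chomI:
  assumes "ph : inv_maps (mcol P) (mcol Q)"
    "!!p x. p : bij_ob (mcol P) ==> x : bo (mop P) p ==> th p x : bo (mop Q) (recolor ph p)"
    "!!p q si x. p : bij_ob (mcol P) ==> q : bij_ob (mcol P) ==> si : bij_hom p q ==> x : bo (mop P) p ==>
       th q (ba (mop P) p q si x) = ba (mop Q) (recolor ph p) (recolor ph q) si (th p x)"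
    "!!p f G ze x. p : bij_ob (mcol P) ==> ((f, G, ze), x) : gr_elts (mcol P) (mop P) p ==>
        th p (act P p ((f, G, ze), x)) =
        act Q (recolor ph p) ((f, G, rcol ph G ze), \<lambda>v\<in>gV G. th (at_vertex G ze v) (x v))"
  shows "chom P Q ph th"
  using assms by (auto simp: chom_def nat_on_def pull_fun_def)

lemma chom_cong:
  assumes P: "modular_operad P"
    and "!!p x. p : bij_ob (mcol P) ==> x : bo (mop P) p ==> th' p x = th p x" and c: "chom P Q ph th"
  shows "chom P Q ph th'"
proof (rule chomI)
  note c' = chomD[OF c]
  show "ph : inv_maps (mcol P) (mcol Q)" by (rule c'(1))
  show "th' p x : bo (mop Q) (recolor ph p)" if "p : bij_ob (mcol P)" "x : bo (mop P) p" for p x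
    using c'(2)[OF that] assms(2)[OF that] by simp
  show "th' q (ba (mop P) p q si x) = ba (mop Q) (recolor ph p) (recolor ph q) si (th' p x)"
    if "p : bij_ob (mcol P)" "q : bij_ob (mcol P)" "si : bij_hom p q" "x : bo (mop P) p" for p q si x
    using c'(3)[OF that] assms(2)[OF that(1,4)] assms(2)[OF that(2) ba_in[OF modopD(2)[OF P] that]] by simp
  show "th' p (act P p ((f, G, ze), x)) =
      act Q (recolor ph p) ((f, G, rcol ph G ze), \<lambda>v\<in>gV G. th' (at_vertex G ze v) (x v))"
    if p: "p : bij_ob (mcol P)" and e: "((f, G, ze), x) : gr_elts (mcol P) (mop P) p" for p f G ze x
  proof -
    have d: "dgr (mcol P) (mop P) G ze x" using e by (simp add: gr_elts_iff)
    have "(\<lambda>v\<in>gV G. th' (at_vertex G ze v) (x v)) = (\<lambda>v\<in>gV G. th (at_vertex G ze v) (x v))"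
      using assms(2)[OF dgrD(5)[OF d] dgrD(6)[OF d]] by (auto simp: fun_eq_iff)
    then show ?thesis using c'(4)[OF p e] assms(2)[OF p act_in[OF P p e]] by simp
  qed
qed

lemma csm_homI:
  assumes P: "modular_operad P" and Q: "modular_operad Q" and c: "chom P Q ph th"
  shows "(ph, \<lambda>p\<in>bij_ob (mcol P). \<lambda>x\<in>bo (mop P) p. th p x) : csm_hom P Q"
  unfolding csm_hom_iff[OF P Q] using chom_cong[OF P _ c] by simp

lemma csm_hom_eqI:
  assumes P: "modular_operad P" and Q: "modular_operad Q" and h: "h : csm_hom P Q" "h' : csm_hom P Q"
    and "!!c. c : cols (mcol P) ==> fst h c = fst h' c"
    and "!!p x. p : bij_ob (mcol P) ==> x : bo (mop P) p ==> snd h p x = snd h' p x"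
  shows "h = h'"
proof -
  have "fst h = fst h'"
    using h assms(5) by (intro extensionalityI[where A = "cols (mcol P)"])
      (auto simp: csm_hom_iff[OF P Q] chom_def inv_maps_iff)
  moreover have "snd h = snd h'"
  proof (rule extensionalityI[where A = "bij_ob (mcol P)"])
    show "snd h p = snd h' p" if "p : bij_ob (mcol P)" for p
      using that h assms(6)[OF that] by (intro extensionalityI[where A = "bo (mop P) p"])
        (auto simp: csm_hom_iff[OF P Q])
  qed (use h in \<open>auto simp: csm_hom_iff[OF P Q]\<close>)
  ultimately show ?thesis by (rule prod_eqI)
qed

lemma csm_hom_chom: "modular_operad P ==> modular_operad Q ==> h : csm_hom P Q ==> chom P Q (fst h) (snd h)"
  by (simp add: csm_hom_iff)

lemma rcol_rcol:
  "ze : inv_maps (arcset G) C ==> rcol ps G (rcol ph G ze) = rcol (\<lambda>c\<in>cols C. ps (ph c)) G ze"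
  using inv_mapsD(1) by (fastforce simp: fun_eq_iff)

lemma recolor_recolor:
  "p : bij_ob C ==> recolor ps (recolor ph p) = recolor (\<lambda>c\<in>cols C. ps (ph c)) p"
  by (cases p) (auto simp: recolor_def bij_ob_def fun_eq_iff PiE_def Pi_def)

lemma dgr_recolor:
  assumes "chom P Q ph th" and d: "dgr (mcol P) (mop P) G ze x"
  shows "dgr (mcol Q) (mop Q) G (rcol ph G ze) (\<lambda>v\<in>gV G. th (at_vertex G ze v) (x v))"
proof -
  have f: "ph : inv_maps (mcol P) (mcol Q)" and n: "nat_on (mcol P) (mop P) (pull_fun ph (mop Q)) th"
    using assms(1) by (auto simp: chom_def)
  show ?thesis by (rule pull_dgr[OF f dgr_map[OF n d]])
qed

lemma elts_recolor:
  assumes "chom P Q ph th" and e: "((f, G, ze), x) : gr_elts (mcol P) (mop P) p"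
  shows "((f, G, rcol ph G ze), \<lambda>v\<in>gV G. th (at_vertex G ze v) (x v)) : gr_elts (mcol Q) (mop Q) (recolor ph p)"
proof -
  have "f s : gA G" if "s : fst p" for s
    using elts_bd(2)[OF e that] .
  then show ?thesis using e dgr_recolor[OF assms(1)] by (simp add: gr_elts_iff)
qed

section \<open>Composition of morphisms\<close>

lemma csm_comp_hom:
  fixes P :: "('u, 'c, 'x) modop" and Q :: "('u, 'd, 'y) modop" and R :: "('u, 'e, 'z) modop"
  assumes P: "modular_operad P" and Q: "modular_operad Q" and R: "modular_operad R"
    and f: "f : csm_hom P Q" and g: "g : csm_hom Q R"
  shows "csm_comp P g f : csm_hom P R"
proof -
  note F = chomD[OF csm_hom_chom[OF P Q f]] and G = chomD[OF csm_hom_chom[OF Q R g]]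
  note cf = csm_hom_chom[OF P Q f]
  let ?ph = "\<lambda>c\<in>cols (mcol P). fst g (fst f c)" and ?th = "\<lambda>p x. snd g (recolor (fst f) p) (snd f p x)"
  have c: "chom P R ?ph ?th"
  proof (rule chomI)
    show "?ph : inv_maps (mcol P) (mcol R)"
      using F(1) G(1) involutiveD(1)[OF modopD(1)[OF P]] by (simp add: inv_maps_iff)
    note o = recolor_ob[OF _ F(1)]
    show "?th p x : bo (mop R) (recolor ?ph p)" if "p : bij_ob (mcol P)" "x : bo (mop P) p" for p :: "('u, 'c) bob" and x
      using G(2)[OF o[OF that(1)] F(2)[OF that]] by (simp only: recolor_recolor[OF that(1)])
    show "?th q (ba (mop P) p q si x) = ba (mop R) (recolor ?ph p) (recolor ?ph q) si (?th p x)"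
      if "p : bij_ob (mcol P)" "q : bij_ob (mcol P)" "si : bij_hom p q" "x : bo (mop P) p" for p q :: "('u, 'c) bob" and si x
      using G(3)[OF o[OF that(1)] o[OF that(2)] recolor_hom[OF that(3)] F(2)[OF that(1,4)]]
      by (simp only: F(3)[OF that] recolor_recolor[OF that(1)] recolor_recolor[OF that(2)])
    show "?th p (act P p ((k, K, ze), x)) =
        act R (recolor ?ph p) ((k, K, rcol ?ph K ze), \<lambda>v\<in>gV K. ?th (at_vertex K ze v) (x v))"
      if p: "p : bij_ob (mcol P)" and e: "((k, K, ze), x) : gr_elts (mcol P) (mop P) p" for p :: "('u, 'c) bob" and k K ze x
    proof -
      have d: "dgr (mcol P) (mop P) K ze x" using e by (simp add: gr_elts_iff)
      note d' = dgrD[OF d]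
      have "?th p (act P p ((k, K, ze), x)) = snd g (recolor (fst f) p)
          (act Q (recolor (fst f) p) ((k, K, rcol (fst f) K ze), \<lambda>v\<in>gV K. snd f (at_vertex K ze v) (x v)))"
        using F(4)[OF p e] by simp
      also have "\<dots> = act R (recolor (fst g) (recolor (fst f) p)) ((k, K, rcol (fst g) K (rcol (fst f) K ze)),
          \<lambda>v\<in>gV K. snd g (at_vertex K (rcol (fst f) K ze) v) ((\<lambda>v\<in>gV K. snd f (at_vertex K ze v) (x v)) v))"
        using G(4)[OF o[OF p] elts_recolor[OF cf e]] .
      also have "(\<lambda>v\<in>gV K. snd g (at_vertex K (rcol (fst f) K ze) v) ((\<lambda>v\<in>gV K. snd f (at_vertex K ze v) (x v)) v)) =
          (\<lambda>v\<in>gV K. ?th (at_vertex K ze v) (x v))"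
        by (auto simp: fun_eq_iff recolor_at[OF d'(2)])
      finally show ?thesis unfolding recolor_recolor[OF p] rcol_rcol[OF d'(3)] .
    qed
  qed
  show ?thesis unfolding csm_comp_def by (rule csm_homI[OF P R c])
qed

lemma csm_comp_simps:
  "c : cols (mcol P) ==> fst (csm_comp P g f) c = fst g (fst f c)"
  "p : bij_ob (mcol P) ==> x : bo (mop P) p ==> snd (csm_comp P g f) p x = snd g (recolor (fst f) p) (snd f p x)"
  by (auto simp: csm_comp_def)

lemma csm_comp_assoc:
  fixes P :: "('u, 'c, 'x) modop" and Q :: "('u, 'd, 'y) modop"
  assumes P: "modular_operad P" and Q: "modular_operad Q" and f: "f : csm_hom P Q"
  shows "csm_comp P (csm_comp Q k g) f = csm_comp P k (csm_comp P g f)"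
proof -
  note F = chomD[OF csm_hom_chom[OF P Q f]]
  have r: "recolor (\<lambda>c\<in>cols (mcol P). fst g (fst f c)) p = recolor (fst g) (recolor (fst f) p)"
    if "p : bij_ob (mcol P)" for p :: "('u, 'c) bob" using recolor_recolor[OF that] by metis
  have "fst f c : cols (mcol Q)" if "c : cols (mcol P)" for c using F(1) that by (simp add: inv_maps_iff)
  then have 1: "(\<lambda>c\<in>cols (mcol P). (\<lambda>c\<in>cols (mcol Q). fst k (fst g c)) (fst f c)) =
      (\<lambda>c\<in>cols (mcol P). fst k ((\<lambda>c\<in>cols (mcol P). fst g (fst f c)) c))" by (auto simp: fun_eq_iff)
  have 2: "(\<lambda>p\<in>bij_ob (mcol Q). \<lambda>x\<in>bo (mop Q) p. snd k (recolor (fst g) p) (snd g p x)) (recolor (fst f) p) (snd f p x) =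
      snd k (recolor (\<lambda>c\<in>cols (mcol P). fst g (fst f c)) p)
        ((\<lambda>p\<in>bij_ob (mcol P). \<lambda>x\<in>bo (mop P) p. snd g (recolor (fst f) p) (snd f p x)) p x)"
    if "p : bij_ob (mcol P)" "x : bo (mop P) p" for p :: "('u, 'c) bob" and x
    using F(2)[OF that] recolor_ob[OF that(1) F(1)] r[OF that(1)] that by simp
  show ?thesis
    unfolding csm_comp_def fst_conv snd_conv 1 by (intro arg_cong2[where f = Pair] refl restrict_ext) (rule 2)
qed

lemma csm_id_hom:
  fixes P :: "('u, 'c, 'x) modop"
  assumes P: "modular_operad P" shows "csm_id P : csm_hom P P"
proof -
  let ?ph = "\<lambda>c\<in>cols (mcol P). c"
  have r: "recolor ?ph p = p" if "p : bij_ob (mcol P)" for p :: "('u, 'c) bob"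
    using that by (cases p) (auto simp: recolor_def bij_ob_def fun_eq_iff PiE_def Pi_def extensional_def)
  have rc: "rcol ?ph G ze = ze" if "ze : inv_maps (arcset G) (mcol P)" for G :: "'u graph" and ze
    using inv_mapsD(1,3)[OF that] by (auto simp: fun_eq_iff extensional_def)
  have "chom P P ?ph (\<lambda>p x. x)"
  proof (rule chomI)
    show "?ph : inv_maps (mcol P) (mcol P)"
      using involutiveD(1)[OF modopD(1)[OF P]] by (simp add: inv_maps_iff)
    show "act P p ((f, G, ze), x) = act P (recolor ?ph p) ((f, G, rcol ?ph G ze), \<lambda>v\<in>gV G. x v)"
      if "p : bij_ob (mcol P)" and e: "((f, G, ze), x) : gr_elts (mcol P) (mop P) p" for p :: "('u, 'c) bob" and f G ze x
    proof -
      have d: "dgr (mcol P) (mop P) G ze x" using e by (simp add: gr_elts_iff)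
      have "(\<lambda>v\<in>gV G. x v) = x" using dgrD(10)[OF d] by (auto simp: fun_eq_iff extensional_def)
      then show ?thesis using r[OF that(1)] rc[OF dgrD(3)[OF d]] by simp
    qed
  qed (simp_all add: r)
  from csm_homI[OF P P this] show ?thesis unfolding csm_id_def .
qed

lemma csm_id_comp:
  fixes P :: "('u, 'c, 'x) modop" and Q :: "('u, 'd, 'y) modop"
  assumes P: "modular_operad P" and Q: "modular_operad Q" and f: "f : csm_hom P Q"
  shows "csm_comp P f (csm_id P) = f" "csm_comp P (csm_id Q) f = f"
proof -
  note F = chomD[OF csm_hom_chom[OF P Q f]]
  have r: "recolor (\<lambda>c\<in>cols (mcol P). c) p = p" if "p : bij_ob (mcol P)" for p :: "('u, 'c) bob"
    using that by (cases p) (auto simp: recolor_def bij_ob_def fun_eq_iff PiE_def Pi_def extensional_def)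
  have o: "recolor (fst f) p : bij_ob (mcol Q)" if "p : bij_ob (mcol P)" for p :: "('u, 'c) bob"
    by (rule recolor_ob[OF that F(1)])
  show "csm_comp P f (csm_id P) = f"
    by (rule csm_hom_eqI[OF P Q csm_comp_hom[OF P P Q csm_id_hom[OF P] f] f])
      (auto simp: csm_comp_simps csm_id_def r)
  show "csm_comp P (csm_id Q) f = f"
    by (rule csm_hom_eqI[OF P Q csm_comp_hom[OF P Q Q f csm_id_hom[OF Q]] f])
      (use F(1) F(2) o in \<open>simp_all add: csm_comp_simps csm_id_def inv_maps_iff\<close>)
qed

section \<open>Morphisms out of the operad of a graph\<close>

lemma gi_bij:
  assumes g: "is_graph G"
  shows "bij_betw (gi G) (inb G v) (nb G v)" "bij_betw (gi G) (nb G v) (inb G v)"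
proof -
  have i: "gi G (gi G a) = a" "gi G a : inb G v" if "a : nb G v" for a
    using gi_gi[OF g nb_gA[OF g that]] that by (auto simp: inb_def)
  have i': "gi G (gi G a) = a" "gi G a : nb G v" if "a : inb G v" for a
    using gi_gi[OF g inb_gA[OF g that]] that by (auto simp: inb_iff[OF g])
  show "bij_betw (gi G) (inb G v) (nb G v)"
    by (rule bij_betw_byWitness[where f' = "gi G"]) (use i i' in auto)
  show "bij_betw (gi G) (nb G v) (inb G v)"
    by (rule bij_betw_byWitness[where f' = "gi G"]) (use i i' in auto)
qed

lemma et_from_inb:
  assumes h: "is_graph H" and g: "is_graph G"
    and a: "!!a. a : gA H ==> al a : gA G" "!!a. a : gA H ==> al (gi H a) = gi G (al a)"
    and v: "!!w. w : gV H ==> nu w : gV G" "!!w. w : gV H ==> bij_betw al (inb H w) (inb G (nu w))"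
  shows "et H G al nu"
proof -
  have "bij_betw al (nb H w) (nb G (nu w))" if w: "w : gV H" for w
  proof -
    have "bij_betw (gi G \<circ> (al \<circ> gi H)) (nb H w) (nb G (nu w))"
      by (rule bij_betw_trans[OF bij_betw_trans[OF gi_bij(2)[OF h] v(2)[OF w]] gi_bij(1)[OF g]])
    moreover have "(gi G \<circ> (al \<circ> gi H)) b = al b" if "b : nb H w" for b
      using nb_gA[OF h that] a gi_gi[OF g] by simp
    ultimately show ?thesis using bij_betw_cong[of "nb H w" "gi G \<circ> (al \<circ> gi H)" al] by blast
  qed
  then show ?thesis using a v by (simp add: et_def)
qed

lemma vf_bo: "bo (vertex_fun G) p = {v : gV G. inj_on (snd p) (fst p) & snd p ` fst p = inb G v}"
  and vf_ba: "v : bo (vertex_fun G) p ==> ba (vertex_fun G) p q si v = v"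
  by (simp_all add: vertex_fun_def)

lemma vf_bo_hom:
  assumes s: "si : bij_hom p q" and v: "v : bo (vertex_fun G) p"
  shows "v : bo (vertex_fun G) q"
proof -
  have b: "si ` fst p = fst q" "!!s. s : fst p ==> snd q (si s) = snd p s" "inj_on si (fst p)"
    using s by (auto simp: bij_hom_def bij_betw_def)
  have "inj_on (snd q \<circ> si) (fst p)" using v b(2) by (auto simp: vf_bo inj_on_def)
  then have "inj_on (snd q) (fst q)" using inj_on_imageI b(1) by metis
  moreover have "snd q ` fst q = snd p ` fst p" unfolding b(1)[symmetric] image_image using b(2) by simp
  ultimately show ?thesis using v by (simp add: vf_bo)
qed

lemma vf_functor: "bij_functor C (vertex_fun (G :: 'u graph))"
  unfolding bij_functor_def
proof (intro conjI ballI)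
  fix p q :: "('u, 'u) bob" and si assume s: "si : bij_hom p q"
  have "ba (vertex_fun G) p q si : extensional (bo (vertex_fun G) p)" by (simp add: vertex_fun_def)
  then show "ba (vertex_fun G) p q si : bo (vertex_fun G) p \<rightarrow>\<^sub>E bo (vertex_fun G) q"
    unfolding PiE_iff using vf_bo_hom[OF s] by (simp add: vf_ba)
next
  fix p q r :: "('u, 'u) bob" and si ta x assume s: "si : bij_hom p q" and x: "x : bo (vertex_fun G) p"
  show "ba (vertex_fun G) p r (compose (fst p) ta si) x = ba (vertex_fun G) q r ta (ba (vertex_fun G) p q si x)"
    using vf_bo_hom[OF s x] x by (simp add: vf_ba)
qed (simp add: vf_ba)

lemma vf_at: "v : bo (vertex_fun G) (at_vertex H ze w) \<longleftrightarrow> v : gV G & bij_betw ze (inb H w) (inb G v)"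
  by (auto simp: vf_bo bij_betw_def)

lemma arcset_simps [simp]: "cols (arcset G) = gA G" "cinv (arcset G) = gi G"
  by (simp_all add: arcset_def)

text \<open>The coloring and the decoration of \<open>H\<close> are the arc part and the vertex part
  of a map to \<open>G\<close>. The condition under which \<open>v\<close> is allowed as a label,
  that the coloring maps \<open>inb\<close> bijectively to \<open>inb G v\<close>, is local
  bijectivity.\<close>

lemma vf_dgr:
  assumes g: "is_graph G"
  shows "dgr (arcset G) (vertex_fun G) H ze x \<longleftrightarrow>
    connected_graph H & et H G ze x & ze : extensional (gA H) & x : extensional (gV H)"
proof
  assume d: "dgr (arcset G) (vertex_fun G) H ze x"
  note d' = dgrD[OF d]
  have "et H G ze x"
    using d'(6,7,8) by (intro et_from_inb[OF d'(2) g]) (simp_all add: vf_at)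
  then show "connected_graph H & et H G ze x & ze : extensional (gA H) & x : extensional (gV H)"
    using d' by simp
next
  assume r: "connected_graph H & et H G ze x & ze : extensional (gA H) & x : extensional (gV H)"
  then have e: "et H G ze x" and h: "is_graph H" using conn_graph by auto
  show "dgr (arcset G) (vertex_fun G) H ze x"
    using r et_inb[OF e h g] et_A[OF e] et_i[OF e] et_V[OF e] by (intro dgrI) (simp_all add: vf_at)
qed

lemma vf_elts:
  assumes g: "is_graph G"
  shows "((f, H, ze), x) : gr_elts (arcset G) (vertex_fun G) p \<longleftrightarrow>
    connected_graph H & et H G ze x & ze : extensional (gA H) & x : extensional (gV H) &
    f : extensional (fst p) & bij_betw f (fst p) (gB H) & (ALL s:fst p. ze (f s) = snd p s)"
  unfolding gr_elts_iff vf_dgr[OF g] by blast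

text \<open>Relabelling acts trivially on vertex labels, so a transport of such decorations is an
  etale map over \<open>G\<close>.\<close>

lemma vf_det:
  assumes "dgr C (vertex_fun G) K ze x"
  shows "det (vertex_fun G) K ze x L ze' x' al nu \<longleftrightarrow> et K L al nu & cpt K ze ze' al & (ALL w:gV K. x' (nu w) = x w)"
  unfolding det_def using dgrD(6)[OF assms] by (simp add: vf_ba)

text \<open>The place at which the generator \<open>v\<close> lives: \<open>inb G v\<close> colored
  by the inclusion.\<close>

definition gob :: "'u graph => 'u => ('u, 'u) bob" where
  "gob G v = at_vertex G (\<lambda>a. a) v"

definition gen :: "'u graph => 'u => 'u gelts" where
  "gen G v = F_unit (arcset G) (vertex_fun G) (gob G v) v"

lemma gob_ob: "is_graph G ==> gob G v : bij_ob (arcset G)"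
  using finite_inb[of G v] inb_gA[of G _ v] by (auto simp: gob_def at_vertex_def bij_ob_def)

lemma gob_fst [simp]: "fst (gob G v) = inb G v"
  by (simp add: gob_def)

lemma gob_snd: "a : inb G v ==> snd (gob G v) a = a"
  by (simp add: gob_def)

lemma gob_bo: "v : gV G ==> v : bo (vertex_fun G) (gob G v)"
  by (simp add: gob_def vf_at bij_betw_def)

lemma recolor_gob: "recolor ph (gob G v) = at_vertex G ph v"
  by (auto simp: gob_def recolor_def at_vertex_def fun_eq_iff)

lemma gmod_simps [simp]:
  "mcol (gmod G) = arcset G" "mop (gmod G) = F_fun (arcset G) (vertex_fun G)"
  "malg (gmod G) = F_mult (arcset G) (vertex_fun G)"
  by (simp_all add: gmod_def free_modop_def)

lemma act_gmod: "act (gmod G) p e = F_mult (arcset G) (vertex_fun G) p (cls (arcset G) (F_fun (arcset G) (vertex_fun G)) p e)"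
  by (simp add: act_def)

text \<open>Pullback of the decoration \<open>y\<close> along the etale map \<open>ze\<close>,
  \<open>x\<close> from \<open>H\<close> to \<open>G\<close>. Transport goes from \<open>H\<close>
  to \<open>G\<close>, so the operation at \<open>x w\<close> is moved back along the inverse of the
  bijection from \<open>inb H w\<close> to \<open>inb G (x w)\<close>.\<close>

definition pb ::
  "('u, 'c, 'x) bfun => 'u graph => ('u => 'c) => ('u => 'x) => 'u graph => ('u => 'u) => ('u => 'u) =>
     'u => 'x" where
  "pb X G ph y H ze x = (\<lambda>w\<in>gV H. ba X (at_vertex G ph (x w)) (at_vertex H (rcol ph H ze) w)
     (\<lambda>b\<in>inb G (x w). inv_into (inb H w) (restrict ze (inb H w)) b) (y (x w)))"

text \<open>As transport along a bijection is invertible, the pulled back decoration is the only one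
  that the etale map transports to \<open>y\<close>.\<close>

lemma pb_props:
  assumes X: "bij_functor C X" and d: "dgr C X G ph y" and h: "connected_graph H" and e: "et H G ze x"
  shows "dgr C X H (rcol ph H ze) (pb X G ph y H ze x)"
    "det X H (rcol ph H ze) (pb X G ph y H ze x) G ph y ze x"
    "!!z. dgr C X H (rcol ph H ze) z ==> det X H (rcol ph H ze) z G ph y ze x ==> z = pb X G ph y H ze x"
proof -
  note d' = dgrD[OF d] and g = conn_graph[OF h]
  let ?ze = "rcol ph H ze"
  have c: "cpt H ?ze ph ze" by (simp add: cpt_def)
  have m: "?ze : inv_maps (arcset H) C"
    by (rule inv_mapsI) (use et_A[OF e] et_i[OF e] d'(7,8) gi_in[OF g] in auto)
  note o = at_ob[OF g m]
  let ?si = "\<lambda>w. restrict ze (inb H w)" and ?ta = "\<lambda>w. \<lambda>b\<in>inb G (x w). inv_into (inb H w) (restrict ze (inb H w)) b"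
  have s: "?si w : bij_hom (at_vertex H ?ze w) (at_vertex G ph (x w))" if "w : gV H" for w
    by (rule et_hom[OF e g d'(2) c that])
  have t: "?ta w : bij_hom (at_vertex G ph (x w)) (at_vertex H ?ze w)" if "w : gV H" for w
    using bij_hom_inv[OF s[OF that]] by simp
  have yo: "y (x w) : bo X (at_vertex G ph (x w))" if "w : gV H" for w using d'(6)[OF et_V[OF e that]] .
  show 1: "dgr C X H ?ze (pb X G ph y H ze x)"
    using ba_in[OF X d'(5) o t yo] inv_mapsD(1,2)[OF m] h by (intro dgrI) (simp_all add: pb_def)
  show "det X H ?ze (pb X G ph y H ze x) G ph y ze x"
    unfolding det_def
  proof (intro conjI ballI e c)
    fix w assume w: "w : gV H"
    have b: "bij_betw (?si w) (inb H w) (inb G (x w))" using s[OF w] by (simp add: bij_hom_def)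
    have "?si w (?ta w u) = u" if u: "u : inb G (x w)" for u
      using bij_betw_inv_into_right[OF b u] u by simp
    then have id: "(\<lambda>u\<in>fst (at_vertex G ph (x w)). ?si w (?ta w u)) = (\<lambda>u\<in>fst (at_vertex G ph (x w)). u)"
      by (intro restrict_ext) (simp only: at_fst)
    show "y (x w) = ba X (at_vertex H ?ze w) (at_vertex G ph (x w)) (?si w) (pb X G ph y H ze x w)"
      using ba_comp[OF X d'(5) o d'(5) t[OF w] s[OF w] yo[OF w]] ba_id[OF X d'(5) yo[OF w]] w
      unfolding id by (simp add: pb_def)
  qed
  fix z assume z: "dgr C X H ?ze z" and dz: "det X H ?ze z G ph y ze x"
  note z' = dgrD[OF z]
  have "z w = pb X G ph y H ze x w" if w: "w : gV H" for w
    using ba_inj[OF X o d'(5) s[OF w] z'(6)[OF w]] det_D(3)[OF dz w] w by (simp add: pb_def)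
  then show "z = pb X G ph y H ze x"
    using z'(10) by (intro extensionalityI[where A = "gV H"]) (auto simp: pb_def)
qed

text \<open>Functoriality of pullback for etale maps over \<open>G\<close>, a consequence of the
  uniqueness in \<open>pb_props\<close>.\<close>

lemma pb_pb:
  assumes X: "bij_functor C X" and d: "dgr C X G ph y" and h': "connected_graph H'" and e': "et H' G ze' x'"
    and h: "connected_graph H" and e: "et H H' al nu" and c: "cpt H ze ze' al" and v: "!!w. w : gV H ==> x' (nu w) = x w"
  shows "rcol (rcol ph H' ze') H al = rcol ph H ze"
    "pb X H' (rcol ph H' ze') (pb X G ph y H' ze' x') H al nu = pb X G ph y H ze x" (is "?z = _")
    "det X H (rcol ph H ze) (pb X G ph y H ze x) H' (rcol ph H' ze') (pb X G ph y H' ze' x') al nu"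
proof -
  show 1: "rcol (rcol ph H' ze') H al = rcol ph H ze"
    using et_A[OF e] cptD[OF c] by (auto simp: fun_eq_iff)
  have g: "is_graph H" using conn_graph[OF h] .
  note p' = pb_props[OF X d h' e']
  note pz = pb_props[OF X p'(1) h e, unfolded 1]
  have "det X H (rcol ph H ze) ?z G ph y (\<lambda>a. ze' (al a)) (\<lambda>w. x' (nu w))"
    by (rule det_comp[OF X pz(1) p'(1) d pz(2) p'(2)])
  then have dz: "det X H (rcol ph H ze) ?z G ph y ze x"
    using det_cong[OF g, of "\<lambda>a. ze' (al a)" ze "\<lambda>w. x' (nu w)" x] cptD[OF c] v by blast
  have e0: "et H G ze x" using det_D(1)[OF dz] .
  show 2: "?z = pb X G ph y H ze x" by (rule pb_props(3)[OF X d h e0 pz(1) dz])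
  show "det X H (rcol ph H ze) (pb X G ph y H ze x) H' (rcol ph H' ze') (pb X G ph y H' ze' x') al nu"
    using pz(2) unfolding 2 .
qed

text \<open>An element of the operad of \<open>G\<close> is represented by a graph \<open>H\<close>
  over \<open>G\<close>; its image is the composite in \<open>P\<close> of the pulled back
  decoration of \<open>H\<close>. The choice of a representative is harmless by
  \<open>gext_cls\<close>.\<close>

definition gext ::
  "('u, 'c, 'x) modop => 'u graph => ('u => 'c) => ('u => 'x) => ('u, 'u) bob => 'u gelts => 'x" where
  "gext P G ph y p K = (case SOME e. e : K of ((f, H, ze), x) =>
     act P (recolor ph p) ((f, H, rcol ph H ze), pb (mop P) G ph y H ze x))"

definition mk ::
  "('u, 'c, 'x) modop => 'u graph => ('u => 'c) => ('u => 'x) => ('u, 'u, 'u gelts, 'c, 'x) csm_mor" where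
  "mk P G ph y = (ph, \<lambda>p\<in>bij_ob (arcset G). \<lambda>K\<in>F_ob (arcset G) (vertex_fun G) p. gext P G ph y p K)"

text \<open>Together with \<open>fst h\<close> this is the decoration of \<open>G\<close> that
  corresponds to \<open>h\<close>; the inverse correspondence is \<open>mk\<close>.\<close>

definition vals :: "'u graph => ('u, 'u, 'u gelts, 'c, 'x) csm_mor => 'u => 'x" where
  "vals G h = (\<lambda>v\<in>gV G. snd h (gob G v) (gen G v))"

abbreviation gcls :: "'u graph => ('u, 'u) bob => ('u, 'u, 'u) gelt => 'u gelts" where
  "gcls G p e \<equiv> cls (arcset G) (vertex_fun G) p e"

abbreviation gelt_set :: "'u graph => ('u, 'u) bob => ('u, 'u, 'u) gelt set" where
  "gelt_set G p \<equiv> gr_elts (arcset G) (vertex_fun G) p"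

lemma pb_elts:
  assumes P: "modular_operad P" and d: "dgr (mcol P) (mop P) G ph y" and e: "((f, H, ze), x) : gelt_set G p"
  shows "((f, H, rcol ph H ze), pb (mop P) G ph y H ze x) : gr_elts (mcol P) (mop P) (recolor ph p)"
proof -
  note e' = e[unfolded vf_elts[OF dgrD(2)[OF d]]]
  show ?thesis
    using pb_props(1)[OF modopD(2)[OF P] d, of H ze x] e' elts_bd(2)[OF e] by (simp add: gr_elts_iff)
qed

lemma pb_rel:
  assumes P: "modular_operad P" and d: "dgr (mcol P) (mop P) G ph y"
    and r: "(((f, H, ze), x), ((f', H', ze'), x')) : gr_rel (arcset G) (vertex_fun G) p"
  shows "(((f, H, rcol ph H ze), pb (mop P) G ph y H ze x), ((f', H', rcol ph H' ze'), pb (mop P) G ph y H' ze' x'))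
     : gr_rel (mcol P) (mop P) (recolor ph p)"
proof -
  note X = modopD(2)[OF P] and g = dgrD(2)[OF d]
  have e: "((f, H, ze), x) : gelt_set G p" and e': "((f', H', ze'), x') : gelt_set G p"
    using gr_rel_elts[OF r] by auto
  have dv: "dgr (arcset G) (vertex_fun G) H ze x" using e by (simp add: gr_elts_iff)
  note E = e[unfolded vf_elts[OF g]] and E' = e'[unfolded vf_elts[OF g]]
  obtain al nu where a: "det (vertex_fun G) H ze x H' ze' x' al nu" "bij_betw al (gA H) (gA H')"
    "bij_betw nu (gV H) (gV H')" "!!s. s : fst p ==> al (f s) = f' s"
    using r by (rule gr_relE) blast
  note a1 = a(1)[unfolded vf_det[OF dv]]
  have "det (mop P) H (rcol ph H ze) (pb (mop P) G ph y H ze x) H' (rcol ph H' ze') (pb (mop P) G ph y H' ze' x') al nu"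
    using a1 E E' by (intro pb_pb(3)[OF X d]) auto
  then show ?thesis by (rule gr_relI[OF pb_elts[OF P d e] pb_elts[OF P d e'] _ a(2,3)]) (simp add: a(4))
qed

lemma gext_cls:
  assumes P: "modular_operad P" and d: "dgr (mcol P) (mop P) G ph y" and e: "((f, H, ze), x) : gelt_set G p"
  shows "gext P G ph y p (gcls G p ((f, H, ze), x)) =
    act P (recolor ph p) ((f, H, rcol ph H ze), pb (mop P) G ph y H ze x)"
proof -
  let ?K = "gcls G p ((f, H, ze), x)"
  obtain f' H' ze' x' where s: "(SOME e. e : ?K) = ((f', H', ze'), x')" by (metis surj_pair)
  have "(SOME e. e : ?K) : ?K" using self_cls[OF vf_functor e] by (rule someI)
  then have r: "(((f, H, ze), x), ((f', H', ze'), x')) : gr_rel (arcset G) (vertex_fun G) p"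
    unfolding s by (simp add: in_cls)
  show ?thesis unfolding gext_def s using act_rel[OF P pb_rel[OF P d r]] by simp
qed

text \<open>If \<open>K\<close> over \<open>G\<close> arises by substituting graphs
  \<open>L v\<close> over \<open>G\<close>, the same holds for the pulled back decorations. With
  \<open>act_assoc\<close> this makes \<open>gext\<close> compatible with composition.\<close>

lemma pb_dsub:
  assumes X: "bij_functor C X" and d: "dgr C X G ph y"
    and ok: "data_ok (arcset G) (vertex_fun G) H ze L m zev x"
    and s: "dsub (vertex_fun G) H ze L m zev x K ze' x' j q r"
  shows "dsub X H (rcol ph H ze) L m (\<lambda>v. rcol ph (L v) (zev v)) (\<lambda>v. pb X G ph y (L v) (zev v) (x v))
    K (rcol ph K ze') (pb X G ph y K ze' x') j q r"
proof -
  note g = dgrD(2)[OF d] and O = data_okD[OF ok] and D = dsubD[OF s]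
  note S = is_subD[OF D(1)]
  have dK: "dgr (arcset G) (vertex_fun G) K ze' x'" by (rule dsub_dgr[OF vf_functor ok s])
  note K = dK[unfolded vf_dgr[OF g]]
  have "det X (L v) (rcol ph (L v) (zev v)) (pb X G ph y (L v) (zev v) (x v)) K (rcol ph K ze') (pb X G ph y K ze' x') (q v) (r v)"
    if v: "v : gV H" for v
    using D(5)[OF v, unfolded vf_det[OF O(3)[OF v]]] K O(3)[OF v, unfolded vf_dgr[OF g]]
    by (intro pb_pb(3)[OF X d]) auto
  moreover have "cpt H (rcol ph H ze) (rcol ph K ze') j" using cptD[OF D(4)] S(2) by (simp add: cpt_def)
  ultimately show ?thesis using D(1) by (simp add: dsub_def pb_def)
qed

context infinite_universe
begin

lemma gmod_modular: "is_graph (G :: 'u graph) ==> modular_operad (gmod G)"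
  unfolding gmod_def by (rule free_modular[OF vf_functor involutive_arcset])

lemma gext_chom:
  assumes P: "modular_operad P" and d: "dgr (mcol P) (mop P) (G :: 'u graph) ph y"
  shows "chom (gmod G) P ph (gext P G ph y)"
proof (rule chomI)
  note X = modopD(2)[OF P] and d' = dgrD[OF d]
  note g = d'(2) and f = d'(3)
  show "ph : inv_maps (mcol (gmod G)) (mcol P)" using f by simp
  have o: "recolor ph p : bij_ob (mcol P)" if "p : bij_ob (arcset G)" for p :: "('u, 'u) bob"
    by (rule recolor_ob[OF that f])
  show "gext P G ph y p K : bo (mop P) (recolor ph p)" if p: "p : bij_ob (mcol (gmod G))" and K: "K : bo (mop (gmod G)) p" for p K
  proof -
    obtain k H ze x where e: "((k, H, ze), x) : gelt_set G p" "K = gcls G p ((k, H, ze), x)"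
      using K F_obE by (metis F_fun_bo gmod_simps(2))
    show ?thesis unfolding e(2) gext_cls[OF P d e(1)] using act_in[OF P o pb_elts[OF P d e(1)]] p by simp
  qed
  show "gext P G ph y q (ba (mop (gmod G)) p q si K) = ba (mop P) (recolor ph p) (recolor ph q) si (gext P G ph y p K)"
    if p: "p : bij_ob (mcol (gmod G))" and q: "q : bij_ob (mcol (gmod G))" and s: "si : bij_hom p q"
      and K: "K : bo (mop (gmod G)) p" for p q si K
  proof -
    obtain k H ze x where e: "((k, H, ze), x) : gelt_set G p" "K = gcls G p ((k, H, ze), x)"
      using K F_obE by (metis F_fun_bo gmod_simps(2))
    have po: "recolor ph p : bij_ob (mcol P)" "recolor ph q : bij_ob (mcol P)" using o p q by auto
    have 1: "ba (mop (gmod G)) p q si K = gcls G q ((\<lambda>s\<in>fst q. k (inv_into (fst p) si s), H, ze), x)"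
      using ba_F(1)[OF vf_functor s e(1)] e(2) by simp
    show ?thesis
      unfolding 1 unfolding gext_cls[OF P d ba_F(2)[OF vf_functor s e(1)]] e(2) gext_cls[OF P d e(1)]
        act_nat[OF P po recolor_hom[OF s] pb_elts[OF P d e(1)]] by simp
  qed
  show "gext P G ph y p (act (gmod G) p ((k, H, ze), Y)) =
      act P (recolor ph p) ((k, H, rcol ph H ze), \<lambda>v\<in>gV H. gext P G ph y (at_vertex H ze v) (Y v))"
    if p: "p : bij_ob (mcol (gmod G))" and e: "((k, H, ze), Y) : gr_elts (mcol (gmod G)) (mop (gmod G)) p" for p k H ze Y
  proof -
    have p': "p : bij_ob (arcset G)" and e': "((k, H, ze), Y) : gr_elts (arcset G) (F_fun (arcset G) (vertex_fun G)) p"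
      using p e by auto
    have dY: "dgr (arcset G) (F_fun (arcset G) (vertex_fun G)) H ze Y" using e' by (simp add: gr_elts_iff)
    obtain m L zev x K ze' x' j q r where
      Y: "!!v. v : gV H ==> ((m v, L v, zev v), x v) : gelt_set G (at_vertex H ze v)"
        "!!v. v : gV H ==> Y v = gcls G (at_vertex H ze v) ((m v, L v, zev v), x v)"
      and ok: "data_ok (arcset G) (vertex_fun G) H ze L m zev x"
      and s: "dsub (vertex_fun G) H ze L m zev x K ze' x' j q r"
      and F: "F_mult (arcset G) (vertex_fun G) p (cls (arcset G) (F_fun (arcset G) (vertex_fun G)) p ((k, H, ze), Y)) =
          gcls G p ((\<lambda>s\<in>fst p. j (k s), K, ze'), x')"
        "((\<lambda>s\<in>fst p. j (k s), K, ze'), x') : gelt_set G p"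
      by (rule F_mult_data[OF vf_functor p' e']) blast
    have hg: "is_graph H" using data_okD(6)[OF ok] .
    have gv: "gext P G ph y (at_vertex H ze v) (Y v) =
        act P (at_vertex H (rcol ph H ze) v) ((m v, L v, rcol ph (L v) (zev v)), pb (mop P) G ph y (L v) (zev v) (x v))"
      "((m v, L v, rcol ph (L v) (zev v)), pb (mop P) G ph y (L v) (zev v) (x v))
        : gr_elts (mcol P) (mop P) (at_vertex H (rcol ph H ze) v)" if v: "v : gV H" for v
      using gext_cls[OF P d Y(1)[OF v]] Y(2)[OF v] pb_elts[OF P d Y(1)[OF v]] by (simp_all add: recolor_at[OF hg])
    have rm: "rcol ph H ze : inv_maps (arcset H) (mcol P)" using rcol_maps[OF dgrD(3)[OF dY] f hg] .
    have el: "((k, H, rcol ph H ze), \<lambda>v\<in>gV H. gext P G ph y (at_vertex H ze v) (Y v)) : gr_elts (mcol P) (mop P) (recolor ph p)"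
    proof -
      have "gext P G ph y (at_vertex H ze v) (Y v) : bo (mop P) (at_vertex H (rcol ph H ze) v)" if v: "v : gV H" for v
        unfolding gv(1)[OF v] by (rule act_in[OF P at_ob[OF hg rm] gv(2)[OF v]])
      then have "dgr (mcol P) (mop P) H (rcol ph H ze) (\<lambda>v\<in>gV H. gext P G ph y (at_vertex H ze v) (Y v))"
        using rm dgrD(1)[OF dY] by (simp add: dgr_def deco_def)
      then show ?thesis using e' elts_bd(2)[OF e'] by (simp add: gr_elts_iff)
    qed
    have "act P (recolor ph p) ((k, H, rcol ph H ze), \<lambda>v\<in>gV H. gext P G ph y (at_vertex H ze v) (Y v)) =
        act P (recolor ph p) ((\<lambda>s\<in>fst (recolor ph p). j (k s), K, rcol ph K ze'), pb (mop P) G ph y K ze' x')"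
      by (rule act_assoc[OF P o[OF p'] el gv(2) _ pb_dsub[OF X d ok s]]) (simp_all add: gv(1))
    also have "\<dots> = gext P G ph y p (act (gmod G) p ((k, H, ze), Y))"
      unfolding act_gmod F(1) gext_cls[OF P d F(2)] by simp
    finally show ?thesis by simp
  qed
qed

lemma mk_hom:
  assumes P: "modular_operad P" and d: "dgr (mcol P) (mop P) (G :: 'u graph) ph y"
  shows "mk P G ph y : csm_hom (gmod G) P"
  using csm_homI[OF gmod_modular[OF dgrD(2)[OF d]] P gext_chom[OF P d]] by (simp add: mk_def)

lemma mk_fst [simp]: "fst (mk P G ph y) = ph"
  by (simp add: mk_def)

lemma mk_cls:
  assumes P: "modular_operad P" and d: "dgr (mcol P) (mop P) (G :: 'u graph) ph y"
    and p: "p : bij_ob (arcset G)" and e: "((f, H, ze), x) : gelt_set G p"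
  shows "snd (mk P G ph y) p (gcls G p ((f, H, ze), x)) =
    act P (recolor ph p) ((f, H, rcol ph H ze), pb (mop P) G ph y H ze x)"
  using gext_cls[OF P d e] p cls_F_ob[OF e] by (simp add: mk_def)

lemma gen_in: "is_graph (G :: 'u graph) ==> v : gV G ==> gen G v : F_ob (arcset G) (vertex_fun G) (gob G v)"
  unfolding gen_def using nat_onD(1)[OF F_unit_nat[OF vf_functor involutive_arcset] gob_ob gob_bo] by simp

lemma hom_vals:
  assumes P: "modular_operad P" and g: "connected_graph (G :: 'u graph)" and h: "h : csm_hom (gmod G) P"
  shows "dgr (mcol P) (mop P) G (fst h) (vals G h)"
proof -
  note gg = conn_graph[OF g]
  note C = chomD[OF csm_hom_chom[OF gmod_modular[OF gg] P h]]
  have "fst h : inv_maps (arcset G) (mcol P)" using C(1) by simp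
  moreover have "snd h (gob G v) (gen G v) : bo (mop P) (at_vertex G (fst h) v)" if "v : gV G" for v
    using C(2)[of "gob G v" "gen G v"] gob_ob[OF gg] gen_in[OF gg that] by (simp add: recolor_gob)
  ultimately show ?thesis using g by (simp add: dgr_def deco_def vals_def)
qed

text \<open>Naturality of the unit moves the generator from \<open>gob G (x w)\<close> to the vertex
  \<open>w\<close> of any graph over \<open>G\<close>.\<close>

lemma F_unit_gen:
  assumes g: "is_graph (G :: 'u graph)" and h: "is_graph H" and e: "et H G ze x" and w: "w : gV H"
  shows "F_unit (arcset G) (vertex_fun G) (at_vertex H ze w) (x w) =
    ba (F_fun (arcset G) (vertex_fun G)) (gob G (x w)) (at_vertex H ze w)
      (\<lambda>b\<in>inb G (x w). inv_into (inb H w) (restrict ze (inb H w)) b) (gen G (x w))"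
    "(\<lambda>b\<in>inb G (x w). inv_into (inb H w) (restrict ze (inb H w)) b) : bij_hom (gob G (x w)) (at_vertex H ze w)"
    "at_vertex H ze w : bij_ob (arcset G)"
proof -
  have s: "restrict ze (inb H w) : bij_hom (at_vertex H ze w) (at_vertex G (\<lambda>a. a) (x w))"
    by (rule et_hom[OF e h g _ w]) (simp add: cpt_def)
  show t: "(\<lambda>b\<in>inb G (x w). inv_into (inb H w) (restrict ze (inb H w)) b) : bij_hom (gob G (x w)) (at_vertex H ze w)"
    using bij_hom_inv[OF s] by (simp add: gob_def)
  show o: "at_vertex H ze w : bij_ob (arcset G)"
    using finite_inb[OF h] inb_gA[OF h] et_A[OF e] by (auto simp: at_vertex_def bij_ob_def)
  have b: "x w : bo (vertex_fun G) (gob G (x w))" using gob_bo[OF et_V[OF e w]] .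
  show "F_unit (arcset G) (vertex_fun G) (at_vertex H ze w) (x w) =
    ba (F_fun (arcset G) (vertex_fun G)) (gob G (x w)) (at_vertex H ze w)
      (\<lambda>b\<in>inb G (x w). inv_into (inb H w) (restrict ze (inb H w)) b) (gen G (x w))"
    using nat_onD(2)[OF F_unit_nat[OF vf_functor involutive_arcset[OF g]] gob_ob[OF g] o t b] vf_ba[OF b]
    by (simp add: gen_def)
qed

lemma hom_unit:
  assumes P: "modular_operad P" and g: "connected_graph (G :: 'u graph)" and h: "h : csm_hom (gmod G) P"
    and hg: "is_graph H" and et: "et H G ze x" and w: "w : gV H"
  shows "snd h (at_vertex H ze w) (F_unit (arcset G) (vertex_fun G) (at_vertex H ze w) (x w)) =
    pb (mop P) G (fst h) (vals G h) H ze x w"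
proof -
  note gg = conn_graph[OF g]
  note C = chomD[OF csm_hom_chom[OF gmod_modular[OF gg] P h]]
  note U = F_unit_gen[OF gg hg et w]
  have v: "x w : gV G" using et_V[OF et w] .
  have "snd h (at_vertex H ze w) (F_unit (arcset G) (vertex_fun G) (at_vertex H ze w) (x w)) =
      ba (mop P) (recolor (fst h) (gob G (x w))) (recolor (fst h) (at_vertex H ze w))
    (\<lambda>b\<in>inb G (x w). inv_into (inb H w) (restrict ze (inb H w)) b) (snd h (gob G (x w)) (gen G (x w)))"
    unfolding U(1) using C(3)[of "gob G (x w)" "at_vertex H ze w"] gob_ob[OF gg] U(2,3) gen_in[OF gg v] by simp
  then show ?thesis using w v by (simp add: pb_def vals_def recolor_gob recolor_at[OF hg])
qed

text \<open>By the right unit law an element of the free operad is a composite of units, whose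
  images are known from \<open>hom_unit\<close>. So every morphism is given by the formula that
  defines \<open>mk\<close>, and it is determined by its colors and \<open>vals\<close>.\<close>

lemma hom_cls:
  assumes P: "modular_operad P" and g: "connected_graph (G :: 'u graph)" and h: "h : csm_hom (gmod G) P"
    and p: "p : bij_ob (arcset G)" and e: "((f, H, ze), x) : gelt_set G p"
  shows "snd h p (gcls G p ((f, H, ze), x)) =
    act P (recolor (fst h) p) ((f, H, rcol (fst h) H ze), pb (mop P) G (fst h) (vals G h) H ze x)"
proof -
  note gg = conn_graph[OF g]
  note C = chomD[OF csm_hom_chom[OF gmod_modular[OF gg] P h]]
  note E = e[unfolded vf_elts[OF gg]]
  have hg: "is_graph H" and et: "et H G ze x" using E conn_graph by auto
  note M = F_mult_map_unit[OF vf_functor involutive_arcset[OF gg] p e]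
  have "snd h p (gcls G p ((f, H, ze), x)) = snd h p (act (gmod G) p
      ((f, H, ze), \<lambda>v\<in>gV H. F_unit (arcset G) (vertex_fun G) (at_vertex H ze v) (x v)))"
    unfolding act_gmod M(1) ..
  also have "\<dots> = act P (recolor (fst h) p) ((f, H, rcol (fst h) H ze), \<lambda>v\<in>gV H. snd h (at_vertex H ze v)
      ((\<lambda>v\<in>gV H. F_unit (arcset G) (vertex_fun G) (at_vertex H ze v) (x v)) v))"
    using C(4)[of p f H ze] p M(2) by simp
  also have "(\<lambda>v\<in>gV H. snd h (at_vertex H ze v) ((\<lambda>v\<in>gV H. F_unit (arcset G) (vertex_fun G) (at_vertex H ze v) (x v)) v)) =
      pb (mop P) G (fst h) (vals G h) H ze x"
    using hom_unit[OF P g h hg et] by (intro extensionalityI[where A = "gV H"]) (simp_all add: pb_def)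
  finally show ?thesis .
qed

lemma gmod_hom_eqI:
  assumes P: "modular_operad P" and g: "connected_graph (G :: 'u graph)"
    and h: "h : csm_hom (gmod G) P" "h' : csm_hom (gmod G) P"
    and c: "!!a. a : gA G ==> fst h a = fst h' a" and v: "!!v. v : gV G ==> vals G h v = vals G h' v"
  shows "h = h'"
proof -
  note gg = conn_graph[OF g]
  have "fst h : inv_maps (arcset G) (mcol P)" "fst h' : inv_maps (arcset G) (mcol P)"
    using hom_vals[OF P g] h by (auto simp: dgr_def)
  then have f: "fst h = fst h'"
    using inv_mapsD(3) c by (intro extensionalityI[where A = "gA G"]) auto
  have e: "vals G h = vals G h'"
    using v by (intro extensionalityI[where A = "gV G"]) (auto simp: vals_def)
  show ?thesis
  proof (rule csm_hom_eqI[OF gmod_modular[OF gg] P h])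
    fix p :: "('u, 'u) bob" and K assume p: "p : bij_ob (mcol (gmod G))" and "K : bo (mop (gmod G)) p"
    then obtain k H ze x where K: "((k, H, ze), x) : gelt_set G p" "K = gcls G p ((k, H, ze), x)"
      using F_obE by (metis F_fun_bo gmod_simps(2))
    show "snd h p K = snd h' p K"
      using hom_cls[OF P g h(1) _ K(1)] hom_cls[OF P g h(2) _ K(1)] p unfolding K(2) f e by simp
  qed (simp add: f)
qed

text \<open>The generator is represented by a star over \<open>G\<close>. The pulled back decoration
  of this star is the unit at \<open>y v\<close>, so the unit law of \<open>P\<close>
  applies.\<close>

lemma mk_vals:
  assumes P: "modular_operad P" and d: "dgr (mcol P) (mop P) (G :: 'u graph) ph y"
  shows "vals G (mk P G ph y) = y"
proof (rule extensionalityI[where A = "gV G"])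
  note d' = dgrD[OF d] and X = modopD(2)[OF P]
  note g = d'(2)
  show "vals G (mk P G ph y) : extensional (gV G)" by (simp add: vals_def)
  show "y : extensional (gV G)" by (rule d'(10))
  fix v assume v: "v : gV G"
  note go = gob_ob[OF g, of v] and gb = gob_bo[OF v]
  let ?S = "inb G v"
  let ?ze = "star_col (arcset G) (gob G v)"
  note se = star_elt[OF involutive_arcset[OF g] go gb, unfolded gob_fst]
  note f = finite_inb[OF g, of v]
  have u: "act P (at_vertex G ph v) ((\<lambda>s\<in>?S. s, star ?S, star_col (mcol P) (at_vertex G ph v)), \<lambda>w\<in>gV (star ?S). y v) = y v"
    using act_unit[OF P d'(5) d'(6)[OF v]] by simp
  have rc: "rcol ph (star ?S) ?ze = star_col (mcol P) (at_vertex G ph v)"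
  proof (rule extensionalityI[where A = "gA (star ?S)"])
    show "star_col (mcol P) (at_vertex G ph v) : extensional (gA (star ?S))" by (simp add: star_col_sx)
    fix a assume a: "a : gA (star ?S)"
    have sA: "s : gA G" if "s : ?S" for s using inb_gA[OF g that] .
    have "sx ?S (restrict ph ?S) (cinv (mcol P)) a = ph (sx ?S (snd (gob G v)) (gi G) a)"
      using sA d'(8) by (intro sx_unique[OF f]) (use a in \<open>auto simp: sx_in sx_dbl[OF f] gob_snd\<close>)
    then show "rcol ph (star ?S) ?ze a = star_col (mcol P) (at_vertex G ph v) a"
      using a by (simp add: star_col_sx)
  qed simp
  have iA: "inb (star ?S) undefined = ?S" by (rule star_nb(3)[OF f])
  have rs: "restrict ?ze ?S = (\<lambda>s\<in>?S. s)"
    using star_col_in[of _ "gob G v" "arcset G"] by (auto simp: fun_eq_iff gob_snd)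
  have iv: "(\<lambda>b\<in>?S. inv_into ?S (\<lambda>s\<in>?S. s) b) = (\<lambda>s\<in>?S. s)"
    by (rule restrict_ext) (auto intro: inv_into_f_eq simp: inj_on_def)
  have pbe: "pb (mop P) G ph y (star ?S) ?ze (\<lambda>w\<in>gV (star ?S). v) = (\<lambda>w\<in>gV (star ?S). y v)"
  proof -
    have at: "at_vertex (star ?S) (star_col (mcol P) (at_vertex G ph v)) undefined = at_vertex G ph v"
      using star_at_vertex[OF d'(5)] by simp
    have "ba (mop P) (at_vertex G ph v) (at_vertex G ph v) (\<lambda>s\<in>?S. s) (y v) = y v"
      using ba_id[OF X d'(5) d'(6)[OF v]] by simp
    then show ?thesis unfolding pb_def rc by (auto simp: fun_eq_iff iA rs iv at)
  qed
  have "snd (mk P G ph y) (gob G v) (gen G v) = y v"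
    using mk_cls[OF P d go se] unfolding recolor_gob rc pbe u unfolding gen_def F_unit_cls[OF go gb] by simp
  then show "vals G (mk P G ph y) v = y v" using v by (simp add: vals_def)
qed

lemma mk_eq:
  assumes P: "modular_operad P" and g: "connected_graph (G :: 'u graph)" and h: "h : csm_hom (gmod G) P"
  shows "mk P G (fst h) (vals G h) = h"
  by (rule gmod_hom_eqI[OF P g mk_hom[OF P hom_vals[OF P g h]] h])
    (simp_all add: mk_vals[OF P hom_vals[OF P g h]])

end

section \<open>Morphisms between operads of graphs\<close>

lemma comp_fst: "a : gA G ==> fst (csm_comp (gmod G) h f) a = fst h (fst f a)"
  by (simp add: csm_comp_def)

lemma U_hom_hat [simp]: "U_hom (hat G) H = U_hom G H" "U_hom G (hat H) = U_hom G H"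
  by (simp_all add: U_hom_def)

lemma pb_id:
  assumes X: "bij_functor C X" and d: "dgr C X G ph y"
  shows "pb X G ph y G (\<lambda>a\<in>gA G. a) (\<lambda>v\<in>gV G. v) = y" "rcol ph G (\<lambda>a\<in>gA G. a) = ph"
proof -
  note d' = dgrD[OF d]
  show r: "rcol ph G (\<lambda>a\<in>gA G. a) = ph"
    using d'(9) by (auto simp: fun_eq_iff extensional_def)
  have dt: "det X G ph y G ph y (\<lambda>a\<in>gA G. a) (\<lambda>v\<in>gV G. v)"
    by (rule det_cong[THEN iffD1, OF d'(2) _ _ det_id[OF X d]]) simp_all
  show "pb X G ph y G (\<lambda>a\<in>gA G. a) (\<lambda>v\<in>gV G. v) = y"
    using pb_props(3)[OF X d d'(1) det_D(1)[OF dt], of y] dt d unfolding r by simp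
qed

text \<open>
  The morphism of an etale map, the collapse of \<open>G\<close> to a star, the inclusion of the star of a vertex, and
  the refinement \<open>G \<rightarrow> G{H\<^sub>v}\<close>.
\<close>

definition etm :: "'u graph => 'u graph => ('u => 'u) => ('u => 'u) => 'u umor" where
  "etm G H al nu = mk (gmod H) G (restrict al (gA G))
     (\<lambda>v\<in>gV G. F_unit (arcset H) (vertex_fun H) (at_vertex G al v) (nu v))"

definition contr :: "'u graph => 'u set => ('u => 'u) => 'u umor" where
  "contr G S f = mk (gmod G) (star S) (\<lambda>a\<in>dbl S. sx S f (gi G) a)
     (\<lambda>_\<in>{undefined}. gcls G (S, f) ((f, G, \<lambda>a\<in>gA G. a), \<lambda>v\<in>gV G. v))"

definition iota :: "'u graph => 'u => 'u umor" where
  "iota G v = etm (star (inb G v)) G (sx (inb G v) (\<lambda>s. s) (gi G)) (\<lambda>_. v)"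

definition refine ::
  "'u graph => ('u => 'u graph) => ('u => 'u => 'u) => 'u graph => ('u => 'u) => ('u => 'u => 'u) =>
     ('u => 'u => 'u) => 'u umor" where
  "refine G H m K j q p = mk (gmod K) G (restrict j (gA G))
     (\<lambda>v\<in>gV G. gcls K (at_vertex G j v) ((m v, H v, restrict (q v) (gA (H v))), restrict (p v) (gV (H v))))"

lemma etm_cong:
  assumes g: "is_graph G" and "!!a. a : gA G ==> al a = al' a" "!!v. v : gV G ==> nu v = nu' v"
  shows "etm G H al nu = etm G H al' nu'"
proof -
  have "restrict al (gA G) = restrict al' (gA G)" using assms(2) by (intro restrict_ext) simp
  moreover have at: "at_vertex G al v = at_vertex G al' v" for v using at_cong[OF g assms(2)] .
  moreover have "(\<lambda>v\<in>gV G. F_unit (arcset H) (vertex_fun H) (at_vertex G al v) (nu v)) =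
    (\<lambda>v\<in>gV G. F_unit (arcset H) (vertex_fun H) (at_vertex G al' v) (nu' v))"
    by (intro restrict_ext) (simp only: assms(3) at)
  ultimately show ?thesis unfolding etm_def by simp
qed

lemma etm_hat [simp]: "etm (hat G) H = etm G H" "etm G (hat H) = etm G H"
  by (simp_all add: etm_def fun_eq_iff mk_def gext_def pb_def)

context infinite_universe
begin

section \<open>Composition with etale maps, collapses and refinements\<close>

lemma comp_vals:
  assumes g: "is_graph (G :: 'u graph)" and v: "v : gV G"
  shows "vals G (csm_comp (gmod G) h f) v = snd h (at_vertex G (fst f) v) (vals G f v)"
  using gob_ob[OF g] gen_in[OF g v] v by (simp add: vals_def csm_comp_simps recolor_gob)

lemma U_comp:
  assumes "connected_graph (G :: 'u graph)" "connected_graph H" "modular_operad P"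
    "f : U_hom G H" "h : csm_hom (gmod H) P"
  shows "csm_comp (gmod G) h f : csm_hom (gmod G) P"
  by (rule csm_comp_hom[OF gmod_modular gmod_modular assms(3) _ assms(5)])
    (use assms conn_graph in \<open>auto simp: U_hom_def\<close>)

lemma etm_dgr:
  assumes g: "connected_graph (G :: 'u graph)" and h: "is_graph H" and e: "et G H al nu"
  shows "dgr (mcol (gmod H)) (mop (gmod H)) G (restrict al (gA G))
     (\<lambda>v\<in>gV G. F_unit (arcset H) (vertex_fun H) (at_vertex G al v) (nu v))"
proof -
  note gg = conn_graph[OF g]
  have e': "et G H (restrict al (gA G)) (restrict nu (gV G))"
    using e et_cong[OF gg, of al "restrict al (gA G)" nu "restrict nu (gV G)"] by simp
  have d: "dgr (arcset H) (vertex_fun H) G (restrict al (gA G)) (restrict nu (gV G))"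
    using g e' by (simp add: vf_dgr[OF h])
  have "(\<lambda>v\<in>gV G. F_unit (arcset H) (vertex_fun H) (at_vertex G al v) (nu v)) =
    (\<lambda>v\<in>gV G. F_unit (arcset H) (vertex_fun H) (at_vertex G (restrict al (gA G)) v) (restrict nu (gV G) v))"
    using at_cong[OF gg, of al "restrict al (gA G)"] by (intro restrict_ext) simp
  then show ?thesis using dgr_map[OF F_unit_nat[OF vf_functor involutive_arcset[OF h]] d] by simp
qed

lemma etm_hom:
  assumes "connected_graph (G :: 'u graph)" "connected_graph H" "et G H al nu"
  shows "etm G H al nu : U_hom G H"
  unfolding U_hom_def etm_def
  by (rule mk_hom[OF gmod_modular etm_dgr]) (use assms conn_graph in auto)

lemma etm_fst: "a : gA G ==> fst (etm G H al nu) a = al a"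
  by (simp add: etm_def)

lemma etm_vals:
  assumes "connected_graph (G :: 'u graph)" "connected_graph H" "et G H al nu" "v : gV G"
  shows "vals G (etm G H al nu) v = F_unit (arcset H) (vertex_fun H) (at_vertex G al v) (nu v)"
  unfolding etm_def
  using mk_vals[OF gmod_modular etm_dgr, OF conn_graph[OF assms(2)] assms(1) conn_graph[OF assms(2)] assms(3)] assms(4)
  by simp

text \<open>In terms of decorations, restriction along the morphism of an etale map is
  pullback.\<close>

lemma nerve_etm:
  assumes P: "modular_operad P" and g: "connected_graph (G :: 'u graph)" and h: "connected_graph H"
    and e: "et G H al nu" and k: "k : csm_hom (gmod H) P"
  shows "vals G (csm_comp (gmod G) k (etm G H al nu)) = pb (mop P) H (fst k) (vals H k) G al nu"
    "fst (csm_comp (gmod G) k (etm G H al nu)) = rcol (fst k) G al"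
proof -
  note gg = conn_graph[OF g]
  have "vals G (csm_comp (gmod G) k (etm G H al nu)) v = pb (mop P) H (fst k) (vals H k) G al nu v"
    if v: "v : gV G" for v
  proof -
    have "at_vertex G (fst (etm G H al nu)) v = at_vertex G al v"
      using etm_fst by (intro at_cong[OF gg])
    then show ?thesis
      using hom_unit[OF P h k gg e v] etm_vals[OF g h e v] by (simp add: comp_vals[OF gg v])
  qed
  then show "vals G (csm_comp (gmod G) k (etm G H al nu)) = pb (mop P) H (fst k) (vals H k) G al nu"
    by (intro extensionalityI[where A = "gV G"]) (auto simp: vals_def pb_def)
  show "fst (csm_comp (gmod G) k (etm G H al nu)) = rcol (fst k) G al"
    by (simp add: csm_comp_def etm_def restrict_def fun_eq_iff)
qed

text \<open>Both sides are units of \<open>K\<close> moved to the vertex \<open>w\<close> by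
  naturality. It gives functoriality of \<open>etm\<close>.\<close>

lemma pb_units:
  assumes l: "is_graph (L :: 'u graph)" and h: "is_graph H" and k: "is_graph K"
    and e: "et L H ze x" and e': "et H K be mu" and w: "w : gV L"
  shows "pb (F_fun (arcset K) (vertex_fun K)) H (restrict be (gA H))
       (\<lambda>v\<in>gV H. F_unit (arcset K) (vertex_fun K) (at_vertex H be v) (mu v)) L ze x w =
    F_unit (arcset K) (vertex_fun K) (at_vertex L (\<lambda>a. be (ze a)) w) (mu (x w))"
proof -
  let ?A = "at_vertex H be (x w)" and ?B = "at_vertex L (\<lambda>a. be (ze a)) w"
  have v: "x w : gV H" using et_V[OF e w] .
  have A: "at_vertex H (restrict be (gA H)) (x w) = ?A" by (rule at_cong[OF h]) simp
  have B: "at_vertex L (rcol (restrict be (gA H)) L ze) w = ?B"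
    using et_A[OF e] by (intro at_cong[OF l]) simp
  have s: "restrict ze (inb L w) : bij_hom ?B ?A"
    by (rule et_hom[OF e l h _ w]) (simp add: cpt_def)
  have t: "(\<lambda>b\<in>inb H (x w). inv_into (inb L w) (restrict ze (inb L w)) b) : bij_hom ?A ?B"
    using bij_hom_inv[OF s] by simp
  have o: "?A : bij_ob (arcset K)" "?B : bij_ob (arcset K)"
    using finite_inb[OF h] finite_inb[OF l] inb_gA[OF h] inb_gA[OF l] et_A[OF e] et_A[OF e']
    by (auto simp: at_vertex_def bij_ob_def)
  have b: "mu (x w) : bo (vertex_fun K) ?A"
    using et_V[OF e' v] et_inb[OF e' h k v] by (simp add: vf_at)
  show ?thesis
    using nat_onD(2)[OF F_unit_nat[OF vf_functor involutive_arcset[OF k]] o t b] vf_ba[OF b]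
    by (simp only: pb_def restrict_apply'[OF w] restrict_apply'[OF v] A B)
qed

lemma etm_comp:
  assumes g: "connected_graph (G :: 'u graph)" and h: "connected_graph H" and k: "connected_graph K"
    and e: "et G H al nu" and e': "et H K be mu"
  shows "csm_comp (gmod G) (etm H K be mu) (etm G H al nu) = etm G K (\<lambda>a. be (al a)) (\<lambda>v. mu (nu v))"
proof -
  note gg = conn_graph[OF g] conn_graph[OF h] conn_graph[OF k]
  note M = gmod_modular[OF gg(3)]
  note hom = etm_hom[OF h k e', unfolded U_hom_def]
  note e2 = et_comp[OF e e']
  show ?thesis
  proof (rule gmod_hom_eqI[OF M g])
    show "csm_comp (gmod G) (etm H K be mu) (etm G H al nu) : csm_hom (gmod G) (gmod K)"
      by (rule U_comp[OF g h M etm_hom[OF g h e] hom])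
    show "etm G K (\<lambda>a. be (al a)) (\<lambda>v. mu (nu v)) : csm_hom (gmod G) (gmod K)"
      using etm_hom[OF g k e2] by (simp add: U_hom_def)
    fix a assume a: "a : gA G"
    then show "fst (csm_comp (gmod G) (etm H K be mu) (etm G H al nu)) a = fst (etm G K (\<lambda>a. be (al a)) (\<lambda>v. mu (nu v))) a"
      using et_A[OF e a] by (simp add: comp_fst etm_fst)
  next
    fix v assume v: "v : gV G"
    have "vals H (etm H K be mu) = (\<lambda>v\<in>gV H. F_unit (arcset K) (vertex_fun K) (at_vertex H be v) (mu v))"
      unfolding etm_def by (rule mk_vals[OF M etm_dgr[OF h gg(3) e']])
    then show "vals G (csm_comp (gmod G) (etm H K be mu) (etm G H al nu)) v = vals G (etm G K (\<lambda>a. be (al a)) (\<lambda>v. mu (nu v))) v"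
      using nerve_etm(1)[OF M g h e hom] pb_units[OF gg e e' v] etm_vals[OF g k e2 v] by (simp add: etm_def)
  qed
qed

lemma etm_id:
  assumes g: "connected_graph (G :: 'u graph)"
  shows "etm G G (\<lambda>a. a) (\<lambda>v. v) = csm_id (gmod G)"
proof -
  note gg = conn_graph[OF g]
  note M = gmod_modular[OF gg]
  show ?thesis
  proof (rule gmod_hom_eqI[OF M g])
    show "etm G G (\<lambda>a. a) (\<lambda>v. v) : csm_hom (gmod G) (gmod G)"
      using etm_hom[OF g g et_id] by (simp add: U_hom_def)
    show "csm_id (gmod G) : csm_hom (gmod G) (gmod G)" by (rule csm_id_hom[OF M])
    show "fst (etm G G (\<lambda>a. a) (\<lambda>v. v)) a = fst (csm_id (gmod G)) a" if "a : gA G" for a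
      using that by (simp add: etm_fst csm_id_def)
    show "vals G (etm G G (\<lambda>a. a) (\<lambda>v. v)) v = vals G (csm_id (gmod G)) v" if v: "v : gV G" for v
      using etm_vals[OF g g et_id v] gob_ob[OF gg, of v] gen_in[OF gg v] v
      by (simp add: vals_def csm_id_def) (simp add: gen_def gob_def)
  qed
qed

text \<open>On graphs over \<open>H\<close> the morphism acts by composing with the etale map to
  \<open>K\<close>.\<close>

lemma etm_cls:
  assumes h: "connected_graph (H :: 'u graph)" and k: "connected_graph K" and e: "et H K be mu"
    and p: "p : bij_ob (arcset H)" and el: "((f, L, ze), x) : gelt_set H p"
  shows "snd (etm H K be mu) p (gcls H p ((f, L, ze), x)) =
     gcls K (recolor be p) ((f, L, \<lambda>a\<in>gA L. be (ze a)), \<lambda>w\<in>gV L. mu (x w))"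
proof -
  note gg = conn_graph[OF h] conn_graph[OF k]
  note M = gmod_modular[OF gg(2)]
  note E = el[unfolded vf_elts[OF gg(1)]]
  have l: "connected_graph L" and lg: "is_graph L" and eL: "et L H ze x" using E conn_graph by auto
  have hom: "etm H K be mu : csm_hom (gmod H) (gmod K)" using etm_hom[OF h k e] by (simp add: U_hom_def)
  have vl: "vals H (etm H K be mu) = (\<lambda>v\<in>gV H. F_unit (arcset K) (vertex_fun K) (at_vertex H be v) (mu v))"
    unfolding etm_def by (rule mk_vals[OF M etm_dgr[OF h gg(2) e]])
  have fs: "fst (etm H K be mu) = restrict be (gA H)" by (simp add: etm_def)
  have rp: "recolor (restrict be (gA H)) p = recolor be p"
    using bij_obD(3)[OF p] by (auto simp: recolor_def fun_eq_iff)
  have rc: "rcol (restrict be (gA H)) L ze = (\<lambda>a\<in>gA L. be (ze a))" (is "_ = ?ze")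
    using et_A[OF eL] by (auto simp: fun_eq_iff)
  have "be a : gA K" if "a : gA H" for a using et_A[OF e that] .
  then have ob: "recolor be p : bij_ob (arcset K)"
    using p by (auto simp: bij_ob_iff recolor_def)
  have eK: "et L K ?ze (\<lambda>w\<in>gV L. mu (x w))"
    using et_comp[OF eL e] et_cong[OF lg, of ?ze "\<lambda>a. be (ze a)" "\<lambda>w\<in>gV L. mu (x w)" "\<lambda>w. mu (x w)"] by simp
  have el': "((f, L, ?ze), \<lambda>w\<in>gV L. mu (x w)) : gelt_set K (recolor be p)"
    unfolding vf_elts[OF gg(2)] using E eK elts_bd(2)[OF el] by simp
  have pbe: "pb (F_fun (arcset K) (vertex_fun K)) H (restrict be (gA H))
       (\<lambda>v\<in>gV H. F_unit (arcset K) (vertex_fun K) (at_vertex H be v) (mu v)) L ze x =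
     (\<lambda>w\<in>gV L. F_unit (arcset K) (vertex_fun K) (at_vertex L ?ze w) ((\<lambda>w\<in>gV L. mu (x w)) w))"
    using pb_units[OF lg gg eL e] at_cong[OF lg, of "\<lambda>a. be (ze a)" ?ze]
    by (intro extensionalityI[where A = "gV L"]) (simp_all add: pb_def)
  show ?thesis
    unfolding hom_cls[OF M h hom p el] vl fs rp rc gmod_simps pbe act_gmod
    by (rule F_mult_map_unit(1)[OF vf_functor involutive_arcset[OF gg(2)] ob el'])
qed

text \<open>The element to which a collapse sends the generator: \<open>G\<close> over itself, its
  boundary labelled by \<open>f\<close>.\<close>

lemma contr_elt:
  assumes g: "connected_graph (G :: 'u graph)" and f: "bij_betw f S (gB G)" "f : extensional S"
  shows "((f, G, \<lambda>a\<in>gA G. a), \<lambda>v\<in>gV G. v) : gelt_set G (S, f)" "(S, f) : bij_ob (arcset G)" "finite S"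
proof -
  note gg = conn_graph[OF g]
  have B: "f s : gA G" if "s : S" for s using bij_betwE[OF f(1)] that gB_gA[OF gg] by blast
  have "finite (gB G)" using finite_gA[OF gg] gB_gA[OF gg] by (meson finite_subset subsetI)
  then show fin: "finite S" using f(1) bij_betw_finite by blast
  have "et G G (\<lambda>a\<in>gA G. a) (\<lambda>v\<in>gV G. v)"
    using et_id[of G] et_cong[OF gg, of "\<lambda>a. a" "\<lambda>a\<in>gA G. a" "\<lambda>v. v" "\<lambda>v\<in>gV G. v"] by simp
  then show "((f, G, \<lambda>a\<in>gA G. a), \<lambda>v\<in>gV G. v) : gelt_set G (S, f)"
    unfolding vf_elts[OF gg] using g f B by simp
  show "(S, f) : bij_ob (arcset G)" using fin f B by (simp add: bij_ob_iff)
qed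

lemma contr_star_col:
  assumes f: "f : extensional S"
  shows "(\<lambda>a\<in>dbl S. sx S f (gi G) a) = star_col (arcset G) (S, f)"
  by (auto simp: star_col_sx fun_eq_iff)

lemma contr_dgr:
  assumes g: "connected_graph (G :: 'u graph)" and f: "bij_betw f S (gB G)" "f : extensional S"
  shows "dgr (mcol (gmod G)) (mop (gmod G)) (star S) (\<lambda>a\<in>dbl S. sx S f (gi G) a)
     (\<lambda>_\<in>{undefined}. gcls G (S, f) ((f, G, \<lambda>a\<in>gA G. a), \<lambda>v\<in>gV G. v))"
proof -
  note gg = conn_graph[OF g] and e = contr_elt[OF g f]
  have "at_vertex (star S) (star_col (arcset G) (S, f)) undefined = (S, f)"
    using star_at_vertex[OF e(2)] by simp
  then show ?thesis
    unfolding contr_star_col[OF f(2)] dgr_def deco_def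
    using star_conn[OF e(3)] star_col_maps[OF involutive_arcset[OF gg] e(2)] cls_F_ob[OF e(1)] by auto
qed

lemma contr_hom:
  assumes g: "connected_graph (G :: 'u graph)" and f: "bij_betw f S (gB G)" "f : extensional S"
  shows "contr G S f : U_hom (star S) G"
  unfolding U_hom_def contr_def by (rule mk_hom[OF gmod_modular[OF conn_graph[OF g]] contr_dgr[OF g f]])

lemma contr_fst: "a : dbl S ==> fst (contr G S f) a = sx S f (gi G) a"
  by (simp add: contr_def)

lemma contr_vals:
  assumes g: "connected_graph (G :: 'u graph)" and f: "bij_betw f S (gB G)" "f : extensional S"
  shows "vals (star S) (contr G S f) undefined = gcls G (S, f) ((f, G, \<lambda>a\<in>gA G. a), \<lambda>v\<in>gV G. v)"
    "at_vertex (star S) (fst (contr G S f)) undefined = (S, f)"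
proof -
  show "vals (star S) (contr G S f) undefined = gcls G (S, f) ((f, G, \<lambda>a\<in>gA G. a), \<lambda>v\<in>gV G. v)"
    unfolding contr_def using mk_vals[OF gmod_modular[OF conn_graph[OF g]] contr_dgr[OF g f]] by simp
  show "at_vertex (star S) (fst (contr G S f)) undefined = (S, f)"
    unfolding contr_def mk_fst contr_star_col[OF f(2)] using star_at_vertex[OF contr_elt(2)[OF g f]] by simp
qed

lemma contr_comp_vals:
  assumes g: "connected_graph (G :: 'u graph)" and f: "bij_betw f S (gB G)" "f : extensional S"
  shows "vals (star S) (csm_comp (gmod (star S)) h (contr G S f)) undefined =
    snd h (S, f) (gcls G (S, f) ((f, G, \<lambda>a\<in>gA G. a), \<lambda>v\<in>gV G. v))"
  using comp_vals[OF star_graph[OF contr_elt(3)[OF g f]], of undefined h "contr G S f"] contr_vals[OF g f] by simp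

text \<open>Restriction along a collapse is composition in \<open>P\<close>. Through this,
  naturality of a map of presheaves becomes compatibility with composition.\<close>

lemma nerve_contr:
  assumes P: "modular_operad P" and g: "connected_graph (G :: 'u graph)"
    and f: "bij_betw f S (gB G)" "f : extensional S" and h: "h : csm_hom (gmod G) P"
  shows "vals (star S) (csm_comp (gmod (star S)) h (contr G S f)) undefined =
    act P (S, \<lambda>s\<in>S. fst h (f s)) ((f, G, fst h), vals G h)"
proof -
  note X = modopD(2)[OF P] and e = contr_elt[OF g f] and d = hom_vals[OF P g h]
  show ?thesis
    unfolding contr_comp_vals[OF g f] hom_cls[OF P g h e(2,1)] pb_id[OF X d] by (simp add: recolor_def)
qed

lemma iota_et: "is_graph (G :: 'u graph) ==> v : gV G ==>
  et (star (inb G v)) G (sx (inb G v) (\<lambda>s. s) (gi G)) (\<lambda>_. v)"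
  using sx_et[OF finite_inb, of G G v "\<lambda>s. s"] by (simp add: bij_betw_def)

lemma iota_hom: "connected_graph (G :: 'u graph) ==> v : gV G ==> iota G v : U_hom (star (inb G v)) G"
  unfolding iota_def
  by (rule etm_hom[OF star_conn[OF finite_inb] _ iota_et]) (simp_all add: conn_graph)

lemma pb_iota:
  assumes X: "bij_functor C X" and C: "involutive_set C" and d: "dgr C X (G :: 'u graph) ph y" and v: "v : gV G"
  shows "pb X G ph y (star (inb G v)) (sx (inb G v) (\<lambda>s. s) (gi G)) (\<lambda>_. v) = (\<lambda>_\<in>{undefined}. y v)"
    "rcol ph (star (inb G v)) (sx (inb G v) (\<lambda>s. s) (gi G)) = star_col C (at_vertex G ph v)"
proof -
  let ?S = "inb G v"
  let ?ze = "sx ?S (\<lambda>s. s) (gi G)"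
  note d' = dgrD[OF d] and D = dsubD(5)[OF dsub_star_right[OF X C d] v]
  note f = finite_inb[OF d'(2), of v]
  show r: "rcol ph (star ?S) ?ze = star_col C (at_vertex G ph v)"
    using star_at_col[OF C d, of _ v] by (intro extensionalityI[where A = "dbl ?S"]) (auto simp: star_col_sx)
  have "dgr C X (star ?S) (star_col C (at_vertex G ph v)) (\<lambda>_\<in>{undefined}. y v)"
    using star_elt[OF C d'(5)[of v] d'(6)[OF v]] by (simp add: gr_elts_iff)
  then show "pb X G ph y (star ?S) ?ze (\<lambda>_. v) = (\<lambda>_\<in>{undefined}. y v)"
    using pb_props(3)[OF X d star_conn[OF f] iota_et[OF d'(2) v], of "\<lambda>_\<in>{undefined}. y v"] D unfolding r by simp
qed

text \<open>Restriction to the star of \<open>v\<close> reads off the operation at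
  \<open>v\<close>.\<close>

lemma nerve_iota:
  assumes P: "modular_operad P" and g: "connected_graph (G :: 'u graph)" and v: "v : gV G" and h: "h : csm_hom (gmod G) P"
  shows "vals (star (inb G v)) (csm_comp (gmod (star (inb G v))) h (iota G v)) = (\<lambda>_\<in>{undefined}. vals G h v)"
    "fst (csm_comp (gmod (star (inb G v))) h (iota G v)) = star_col (mcol P) (at_vertex G (fst h) v)"
proof -
  note gg = conn_graph[OF g]
  note s = star_conn[OF finite_inb[OF gg, of v]]
  note N = nerve_etm[OF P s g iota_et[OF gg v] h, folded iota_def]
  note pb = pb_iota[OF modopD(2,1)[OF P] hom_vals[OF P g h] v]
  show "vals (star (inb G v)) (csm_comp (gmod (star (inb G v))) h (iota G v)) = (\<lambda>_\<in>{undefined}. vals G h v)"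
    unfolding N(1) pb(1) ..
  show "fst (csm_comp (gmod (star (inb G v))) h (iota G v)) = star_col (mcol P) (at_vertex G (fst h) v)"
    unfolding N(2) pb(2) ..
qed

text \<open>The image of the generator \<open>v\<close> is the class of a graph \<open>K\<close>
  over \<open>H\<close>. The collapse sends the generator of the star to \<open>K\<close> over
  itself, and the etale map carries this to \<open>K\<close> over \<open>H\<close>.\<close>

lemma iota_factor:
  assumes g: "connected_graph (G :: 'u graph)" and h: "connected_graph H" and v: "v : gV G"
    and f: "f : U_hom G H" and el: "((m, K, ze), x) : gelt_set H (at_vertex G (fst f) v)"
    and val: "vals G f v = gcls H (at_vertex G (fst f) v) ((m, K, ze), x)"
  shows "csm_comp (gmod (star (inb G v))) f (iota G v) =
    csm_comp (gmod (star (inb G v))) (etm K H ze x) (contr K (inb G v) m)"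
proof -
  note gg = conn_graph[OF g] conn_graph[OF h]
  let ?S = "inb G v"
  note fin = finite_inb[OF gg(1), of v]
  note s = star_conn[OF fin]
  note E = el[unfolded vf_elts[OF gg(2)] at_fst at_snd]
  have k: "connected_graph K" and e: "et K H ze x" and m: "bij_betw m ?S (gB K)" "m : extensional ?S"
    and ms: "!!s. s : ?S ==> ze (m s) = fst f s" using E by auto
  note M = gmod_modular[OF gg(2)]
  have fh: "f : csm_hom (gmod G) (gmod H)" and eh: "etm K H ze x : csm_hom (gmod K) (gmod H)"
    using f etm_hom[OF k h e] by (auto simp: U_hom_def)
  have fm: "fst f (gi G a) = gi H (fst f a)" if "a : gA G" for a
    using inv_mapsD(2)[of "fst f" G "arcset H"] hom_vals[OF M g fh] that by (simp add: dgr_def)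
  show ?thesis
  proof (rule gmod_hom_eqI[OF M s])
    show "csm_comp (gmod (star ?S)) f (iota G v) : csm_hom (gmod (star ?S)) (gmod H)"
      by (rule U_comp[OF s g M iota_hom[OF g v] fh])
    show "csm_comp (gmod (star ?S)) (etm K H ze x) (contr K ?S m) : csm_hom (gmod (star ?S)) (gmod H)"
      by (rule U_comp[OF s k M contr_hom[OF k m] eh])
    fix a assume "a : gA (star ?S)"
    then have a: "a : dbl ?S" by simp
    have mA: "m t : gA K" if "t : ?S" for t using elts_bd(2)[OF el] that by simp
    have 1: "fst f (sx ?S (\<lambda>s. s) (gi G) a) = sx ?S (fst f) (gi H) a"
      using fm inb_gA[OF gg(1)] by (intro sx_unique[OF fin a, symmetric]) (auto simp: sx_in sx_dbl[OF fin])
    have 2: "ze (sx ?S m (gi K) a) = sx ?S (fst f) (gi H) a"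
      using ms mA et_i[OF e] by (intro sx_unique[OF fin a, symmetric]) (auto simp: sx_in sx_dbl[OF fin])
    have 3: "sx ?S m (gi K) a : gA K"
      by (rule sx_cases[OF fin a, of m "gi K"]) (use mA gi_in[OF conn_graph[OF k]] in auto)
    show "fst (csm_comp (gmod (star ?S)) f (iota G v)) a = fst (csm_comp (gmod (star ?S)) (etm K H ze x) (contr K ?S m)) a"
      using a 1 2 3 by (simp add: comp_fst contr_fst etm_fst iota_def)
  next
    fix w assume "w : gV (star ?S)"
    then have w: "w = undefined" by simp
    have rz: "(\<lambda>a\<in>gA K. ze ((\<lambda>a\<in>gA K. a) a)) = ze" "(\<lambda>w\<in>gV K. x ((\<lambda>w\<in>gV K. w) w)) = x"
      using E by (auto simp: fun_eq_iff extensional_def)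
    have rp: "recolor ze (?S, m) = at_vertex G (fst f) v"
      using ms by (auto simp: recolor_def at_vertex_def fun_eq_iff)
    have "vals (star ?S) (csm_comp (gmod (star ?S)) (etm K H ze x) (contr K ?S m)) undefined =
        gcls H (at_vertex G (fst f) v) ((m, K, ze), x)"
      unfolding contr_comp_vals[OF k m] etm_cls[OF k h e contr_elt(2,1)[OF k m]] rz rp ..
    then show "vals (star ?S) (csm_comp (gmod (star ?S)) f (iota G v)) w =
        vals (star ?S) (csm_comp (gmod (star ?S)) (etm K H ze x) (contr K ?S m)) w"
      unfolding w nerve_iota(1)[OF M g v fh] val by simp
  qed
qed

text \<open>The refinement sends \<open>v\<close> to the class of \<open>H v\<close> over
  \<open>K\<close>. The factorization says that \<open>G\<close>, decorated by these classes,
  multiplies to \<open>K\<close> over itself, and \<open>K\<close> is a model of exactly this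
  substitution.\<close>

lemma refine_factor:
  assumes ok: "sub_ok (G :: 'u graph) H m" and mx: "!!v. v : gV G ==> m v : extensional (inb G v)"
    and s: "is_sub G H m K j q p" and f: "bij_betw f S (gB G)" "f : extensional S"
  shows "refine G H m K j q p : U_hom G K"
    "contr K S (\<lambda>s\<in>S. j (f s)) = csm_comp (gmod (star S)) (refine G H m K j q p) (contr G S f)"
    "!!v. v : gV G ==> vals G (refine G H m K j q p) v =
       gcls K (at_vertex G j v) ((m v, H v, restrict (q v) (gA (H v))), restrict (p v) (gV (H v)))"
    "!!v. v : gV G ==>
       ((m v, H v, restrict (q v) (gA (H v))), restrict (p v) (gV (H v))) : gelt_set K (at_vertex G j v)"
proof -
  note O = sub_okD[OF ok] and I = is_subD[OF s]
  have k: "connected_graph K" using sub_conn[OF ok s] .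
  note M = gmod_modular[OF I(1)]
  let ?r = "refine G H m K j q p" and ?j = "restrict j (gA G)"
  let ?y = "\<lambda>v\<in>gV G. gcls K (at_vertex G j v) ((m v, H v, restrict (q v) (gA (H v))), restrict (p v) (gV (H v)))"
  have at: "at_vertex G ?j v = at_vertex G j v" for v by (rule at_cong[OF O(2)]) simp
  show el: "((m v, H v, restrict (q v) (gA (H v))), restrict (p v) (gV (H v))) : gelt_set K (at_vertex G j v)"
    if v: "v : gV G" for v
    unfolding vf_elts[OF I(1)]
    using O(3,5,7)[OF v] mx[OF v] I(4,5)[OF v]
      et_cong[OF O(4)[OF v], of "restrict (q v) (gA (H v))" "q v" "restrict (p v) (gV (H v))" "p v"]
    by simp
  have jm: "?j : inv_maps (arcset G) (arcset K)"
    using I(2,3) gi_in[OF O(2)] by (intro inv_mapsI) auto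
  have d: "dgr (mcol (gmod K)) (mop (gmod K)) G ?j ?y"
    unfolding dgr_def deco_def using O(1) jm cls_F_ob[OF el] at by simp
  show r: "?r : U_hom G K" unfolding U_hom_def refine_def by (rule mk_hom[OF M d])
  have vl: "vals G ?r = ?y" unfolding refine_def by (rule mk_vals[OF M d])
  then show "vals G ?r v = gcls K (at_vertex G j v) ((m v, H v, restrict (q v) (gA (H v))), restrict (p v) (gV (H v)))"
    if "v : gV G" for v using that by simp
  have fr: "fst ?r = ?j" by (simp add: refine_def)
  have rh: "?r : csm_hom (gmod G) (gmod K)" using r by (simp add: U_hom_def)
  have jf: "bij_betw (\<lambda>s\<in>S. j (f s)) S (gB K)" "(\<lambda>s\<in>S. j (f s)) : extensional S"
    using bij_betw_trans[OF f(1) I(10)] by (simp_all add: comp_def)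
  note fin = contr_elt(3)[OF O(1) f]
  note st = star_conn[OF fin]
  have fA: "f t : gA G" if "t : S" for t using bij_betwE[OF f(1)] that gB_gA[OF O(2)] by blast
  show "contr K S (\<lambda>s\<in>S. j (f s)) = csm_comp (gmod (star S)) ?r (contr G S f)"
  proof (rule gmod_hom_eqI[OF M st])
    show "contr K S (\<lambda>s\<in>S. j (f s)) : csm_hom (gmod (star S)) (gmod K)"
      using contr_hom[OF k jf] by (simp add: U_hom_def)
    show "csm_comp (gmod (star S)) ?r (contr G S f) : csm_hom (gmod (star S)) (gmod K)"
      by (rule U_comp[OF st O(1) M contr_hom[OF O(1) f] rh])
    fix a assume "a : gA (star S)"
    then have a: "a : dbl S" by simp
    have "sx S (\<lambda>s\<in>S. j (f s)) (gi K) a = j (sx S f (gi G) a)"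
      using fA I(3) by (intro sx_unique[OF fin a]) (auto simp: sx_in sx_dbl[OF fin])
    moreover have "sx S f (gi G) a : gA G"
      by (rule sx_cases[OF fin a, of f "gi G"]) (use fA gi_in[OF O(2)] in auto)
    ultimately show "fst (contr K S (\<lambda>s\<in>S. j (f s))) a = fst (csm_comp (gmod (star S)) ?r (contr G S f)) a"
      using a by (simp add: comp_fst contr_fst fr)
  next
    fix w assume "w : gV (star S)"
    then have w: "w = undefined" by simp
    note e = contr_elt[OF O(1) f]
    have rp: "recolor ?j (S, f) = (S, \<lambda>s\<in>S. j (f s))"
      using fA by (auto simp: recolor_def fun_eq_iff)
    have oK: "(S, \<lambda>s\<in>S. j (f s)) : bij_ob (arcset K)" using contr_elt(2)[OF k jf] .
    have eF: "((f, G, ?j), ?y) : gr_elts (arcset K) (F_fun (arcset K) (vertex_fun K)) (S, \<lambda>s\<in>S. j (f s))"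
      unfolding gr_elts_iff using d f fA by simp
    \<comment> \<open>With \<open>K\<close> mapped to itself by the identity, \<open>q v\<close> and
      \<open>p v\<close> are maps over \<open>K\<close>, hence transports of decorations.\<close>
    have ds: "dsub (vertex_fun K) G ?j H m (\<lambda>v. restrict (q v) (gA (H v))) (\<lambda>v. restrict (p v) (gV (H v)))
        K (\<lambda>a\<in>gA K. a) (\<lambda>v\<in>gV K. v) j q p"
      unfolding dsub_def
    proof (intro conjI ballI s)
      show "cpt G ?j (\<lambda>a\<in>gA K. a) j" using I(2) by (simp add: cpt_def)
      fix v assume v: "v : gV G"
      have dv: "dgr (arcset K) (vertex_fun K) (H v) (restrict (q v) (gA (H v))) (restrict (p v) (gV (H v)))"
        using el[OF v] by (simp add: gr_elts_iff)
      show "det (vertex_fun K) (H v) (restrict (q v) (gA (H v))) (restrict (p v) (gV (H v))) K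
          (\<lambda>a\<in>gA K. a) (\<lambda>v\<in>gV K. v) (q v) (p v)"
        unfolding vf_det[OF dv] using I(4)[OF v] et_A[OF I(4)[OF v]] et_V[OF I(4)[OF v]] by (simp add: cpt_def)
    qed simp_all
    have Fm: "F_mult (arcset K) (vertex_fun K) (S, \<lambda>s\<in>S. j (f s))
        (cls (arcset K) (F_fun (arcset K) (vertex_fun K)) (S, \<lambda>s\<in>S. j (f s)) ((f, G, ?j), ?y)) =
      gcls K (S, \<lambda>s\<in>S. j (f s)) ((\<lambda>s\<in>fst (S, \<lambda>s\<in>S. j (f s)). j (f s), K, \<lambda>a\<in>gA K. a), \<lambda>v\<in>gV K. v)"
      by (rule F_mult_cls[OF vf_functor oK eF _ _ ds]) (simp_all add: at el)
    note pbi = pb_id[OF modopD(2)[OF M] d]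
    have "vals (star S) (csm_comp (gmod (star S)) ?r (contr G S f)) undefined =
        act (gmod K) (S, \<lambda>s\<in>S. j (f s)) ((f, G, ?j), ?y)"
      unfolding contr_comp_vals[OF O(1) f] hom_cls[OF M O(1) rh e(2,1)] fr vl pbi rp ..
    then show "vals (star S) (contr K S (\<lambda>s\<in>S. j (f s))) w = vals (star S) (csm_comp (gmod (star S)) ?r (contr G S f)) w"
      unfolding w act_gmod Fm contr_vals(1)[OF k jf] by simp
  qed
qed

end

section \<open>Morphisms of presheaves\<close>

lemma psh_homD:
  assumes "ta : psh_hom X Y"
  shows "ta : extensional U_ob" "G : U_ob ==> ta G : extensional (pob X G)"
    "G : U_ob ==> x : pob X G ==> ta G x : pob Y G"
    "G : U_ob ==> H : U_ob ==> f : U_hom G H ==> x : pob X H ==> ta G (par X G H f x) = par Y G H f (ta H x)"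
  using assms by (auto simp: psh_hom_def PiE_def)

lemma psh_hom_eqI:
  assumes "ta : psh_hom X Y" "ta' : psh_hom X Y" "!!G x. G : U_ob ==> x : pob X G ==> ta G x = ta' G x"
  shows "ta = ta'"
proof (rule extensionalityI[where A = U_ob])
  show "ta : extensional U_ob" "ta' : extensional U_ob" using psh_homD(1) assms by auto
  show "ta G = ta' G" if "G : U_ob" for G
    using psh_homD(2)[OF assms(1) that] psh_homD(2)[OF assms(2) that] assms(3)[OF that]
    by (intro extensionalityI[where A = "pob X G"])
qed

lemma psh_homI:
  assumes "!!G x. G : U_ob ==> x : pob X G ==> t G x : pob Y G"
    "!!G H f x. G : U_ob ==> H : U_ob ==> f : U_hom G H ==> x : pob X H ==> par X G H f x : pob X G ==>
       t G (par X G H f x) = par Y G H f (t H x)"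
    "!!G H f x. G : U_ob ==> H : U_ob ==> f : U_hom G H ==> x : pob X H ==> par X G H f x : pob X G"
  shows "(\<lambda>G\<in>U_ob. \<lambda>x\<in>pob X G. t G x) : psh_hom X Y"
  using assms by (auto simp: psh_hom_def)

lemma presheafD:
  assumes "presheaf X"
  shows "G : U_ob ==> H : U_ob ==> f : U_hom G H ==> x : pob X H ==> par X G H f x : pob X G"
    "G : U_ob ==> x : pob X G ==> par X G G (csm_id (gmod G)) x = x"
    "G : U_ob ==> H : U_ob ==> K : U_ob ==> f : U_hom G H ==> g : U_hom H K ==> x : pob X K ==>
       par X G H f (par X H K g x) = par X G K (csm_comp (gmod G) g f) x"
  using assms by (auto simp: presheaf_def)

lemma psh_comp_apply: "G : U_ob ==> x : pob X G ==> psh_comp X si ta G x = si G (ta G x)"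
  by (simp add: psh_comp_def)

text \<open>The reformulations of the Segal condition below conjugate one map into another by
  bijections; each is an instance of this.\<close>

lemma bij_square:
  assumes p: "bij_betw p A A'" and q: "bij_betw q B B'" and f: "f ` A \<subseteq> B"
    and c: "!!a. a : A ==> q (f a) = g (p a)"
  shows "bij_betw f A B \<longleftrightarrow> bij_betw g A' B'"
proof -
  have fB: "f a : B" if "a : A" for a using f that by blast
  have "bij_betw f A B \<longleftrightarrow> bij_betw (q \<circ> f) A B'"
  proof
    assume "bij_betw f A B" then show "bij_betw (q \<circ> f) A B'" using q by (rule bij_betw_trans)
  next
    assume qf: "bij_betw (q \<circ> f) A B'"
    have "bij_betw (inv_into B q \<circ> (q \<circ> f)) A B" by (rule bij_betw_trans[OF qf bij_betw_inv_into[OF q]])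
    moreover have "(inv_into B q \<circ> (q \<circ> f)) a = f a" if "a : A" for a
      using bij_betw_inv_into_left[OF q fB[OF that]] by simp
    ultimately show "bij_betw f A B" using bij_betw_cong[of A "inv_into B q \<circ> (q \<circ> f)" f B] by blast
  qed
  also have "\<dots> \<longleftrightarrow> bij_betw (g \<circ> p) A B'" by (rule bij_betw_cong) (simp add: c)
  also have "\<dots> \<longleftrightarrow> bij_betw g A' B'" using bij_betw_comp_iff[OF p] by blast
  finally show ?thesis .
qed

section \<open>The exceptional edge\<close>

lemma edge_simps [simp]:
  "gV exc_edge = {}" "gA exc_edge = {eps, eps_dg}" "gB exc_edge = {eps, eps_dg}" "gD exc_edge = {}"
  "nb exc_edge v = {}" "inb exc_edge v = {}" "dA exc_edge = {}"
  by (auto simp: exc_edge_def nb_def inb_def dA_def)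

definition emap :: "'u graph => 'u => 'u => 'u" where
  "emap G a e = (if e = eps then a else gi G a)"

text \<open>For an arc \<open>a\<close> of a connected graph this is \<open>edge_mor G a\<close>,
  given by an etale map so that the rules for \<open>etm\<close> apply.\<close>

definition emor :: "'u graph => 'u => 'u umor" where
  "emor G a = etm exc_edge G (emap G a) (\<lambda>v. v)"

context infinite_universe
begin

lemma eps_dg_neq: "(eps_dg :: 'u) ~= eps"
proof -
  have "EX a :: 'u. a ~= eps" using inf_U by (metis (full_types) ex_new_if_finite finite.emptyI finite_insert insertCI)
  then show ?thesis unfolding eps_dg_def by (rule someI_ex)
qed

lemma edge_gi: "gi exc_edge (eps :: 'u) = eps_dg" "gi exc_edge (eps_dg :: 'u) = eps"
  using eps_dg_neq by (auto simp: exc_edge_def)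

lemma edge_graph: "is_graph (exc_edge :: 'u graph)"
  unfolding is_graph_def using eps_dg_neq edge_gi by (auto simp: exc_edge_def dA_def)

lemma edge_conn: "connected_graph (exc_edge :: 'u graph)"
proof (rule connI[OF edge_graph])
  fix A1 V1 :: "'u set"
  assume "A1 \<subseteq> gA exc_edge" "V1 \<subseteq> gV exc_edge" and i: "!!a. a : A1 ==> gi exc_edge a : A1"
  then show "(A1 = {} & V1 = {}) | (A1 = gA exc_edge & V1 = gV exc_edge)"
    using i[of eps] i[of eps_dg] edge_gi by auto
qed simp

lemma edge_U: "(exc_edge :: 'u graph) : U_ob"
  using edge_conn by (simp add: U_ob_def safe_def)

lemma emap_et: "is_graph (G :: 'u graph) ==> a : gA G ==> et exc_edge G (emap G a) nu"
  using eps_dg_neq edge_gi by (auto simp: et_def emap_def gi_in gi_gi)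

lemma emor_hom: "connected_graph (G :: 'u graph) ==> a : gA G ==> emor G a : U_hom exc_edge G"
  unfolding emor_def by (rule etm_hom[OF edge_conn _ emap_et]) (auto simp: conn_graph)

lemma emor_fst: "fst (emor (G :: 'u graph) a) eps = a" "fst (emor G a) eps_dg = gi G a"
  using eps_dg_neq by (simp_all add: emor_def etm_fst emap_def)

lemma edge_hom_eqI:
  assumes P: "modular_operad P" and h: "h : csm_hom (gmod (exc_edge :: 'u graph)) P" "h' : csm_hom (gmod exc_edge) P"
    and e: "fst h eps = fst h' eps"
  shows "h = h'"
proof (rule gmod_hom_eqI[OF P edge_conn h])
  have "fst k eps_dg = cinv (mcol P) (fst k eps)" if "k : csm_hom (gmod (exc_edge :: 'u graph)) P" for k
    using inv_mapsD(2)[OF dgrD(3)[OF hom_vals[OF P edge_conn that]], of eps] edge_gi by simp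
  note this[OF h(1)] this[OF h(2)]
  then show "fst h a = fst h' a" if "a : gA exc_edge" for a using that e by auto
qed simp

lemma edge_mor_eq:
  assumes "connected_graph (G :: 'u graph)" "a : gA G"
  shows "edge_mor G a = emor G a"
  unfolding edge_mor_def
proof (rule the_equality)
  show "emor G a : U_hom exc_edge G & fst (emor G a) eps = a" using emor_hom[OF assms] emor_fst by blast
  fix f assume f: "f : U_hom exc_edge G & fst f eps = a"
  show "f = emor G a"
    by (rule edge_hom_eqI[OF gmod_modular[OF conn_graph[OF assms(1)]]])
      (use f emor_hom[OF assms] emor_fst in \<open>auto simp: U_hom_def\<close>)
qed

lemma etm_emor:
  assumes g: "connected_graph (G :: 'u graph)" and h: "connected_graph H" and e: "et G H al nu" and a: "a : gA G"
  shows "csm_comp (gmod exc_edge) (etm G H al nu) (emor G a) = emor H (al a)"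
proof -
  have "csm_comp (gmod exc_edge) (etm G H al nu) (emor G a) = etm exc_edge H (\<lambda>x. al (emap G a x)) (\<lambda>v. nu v)"
    unfolding emor_def by (rule etm_comp[OF edge_conn g h emap_et[OF conn_graph[OF g] a] e])
  also have "\<dots> = emor H (al a)"
    unfolding emor_def using et_i[OF e a] by (intro etm_cong[OF edge_graph]) (auto simp: emap_def)
  finally show ?thesis .
qed

lemma U_emor:
  assumes g: "connected_graph (G :: 'u graph)" and h: "connected_graph H" and f: "f : U_hom G H" and a: "a : gA G"
  shows "csm_comp (gmod exc_edge) f (emor G a) = emor H (fst f a)" "fst f a : gA H"
proof -
  note M = gmod_modular[OF conn_graph[OF h]]
  have f': "f : csm_hom (gmod G) (gmod H)" using f by (simp add: U_hom_def)
  show fa: "fst f a : gA H" using dgrD(7)[OF hom_vals[OF M g f'] a] by simp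
  show "csm_comp (gmod exc_edge) f (emor G a) = emor H (fst f a)"
    by (rule edge_hom_eqI[OF M U_comp[OF edge_conn g M emor_hom[OF g a] f']])
      (use emor_hom[OF h fa] in \<open>simp_all add: U_hom_def comp_fst emor_fst\<close>)
qed

section \<open>The two models of the star at a vertex\<close>

lemma star_at_simps [simp]:
  "gA (star_at G v) = dbl (nb G v)" "gV (star_at G v) = {v}" "gi (star_at G v) = dbl_inv (nb G v)"
  "gB (star_at G v) = dg (nb G v) ` nb G v" "nb (star_at G v) v = nb G v" "dA (star_at G v) = nb G v"
  by (auto simp: star_at_def nb_def dA_def)

lemma finite_nb: "is_graph G ==> finite (nb G v)"
  by (meson finite_gA finite_subset nb_gA subsetI)

lemma star_at_graph:
  assumes g: "is_graph (G :: 'u graph)"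
  shows "is_graph (star_at G v)"
proof -
  let ?N = "nb G v"
  note f = finite_nb[OF g, of v]
  note d = dg_props[OF f] dbl_inv_props[OF f]
  have ne: "dbl_inv ?N a ~= a" if "a : dbl ?N" for a using d(7)[OF that] by auto
  have 1: "dbl_inv ?N : dbl ?N \<rightarrow>\<^sub>E dbl ?N"
    using d(5) by (auto simp: PiE_def dbl_inv_def[of ?N] simp del: restrict_apply)
  have 2: "dbl_inv ?N ` ?N = dg ?N ` ?N" using d(3) by (intro image_cong) auto
  show ?thesis
    unfolding is_graph_def star_at_simps 2
    using f 1 d(2,6) ne by (auto simp: star_at_def dbl_def)
qed

lemma star_at_conn:
  assumes g: "is_graph (G :: 'u graph)"
  shows "connected_graph (star_at G v)"
proof (rule connI[OF star_at_graph[OF g]])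
  let ?N = "nb G v"
  note f = finite_nb[OF g, of v]
  note d = dbl_inv_props[OF f]
  show "gA (star_at G v) ~= {} | gV (star_at G v) ~= {}" by simp
  fix A1 V1
  assume A1: "A1 \<subseteq> gA (star_at G v)" and V1: "V1 \<subseteq> gV (star_at G v)" and i: "!!a. a : A1 ==> gi (star_at G v) a : A1"
    and co: "!!w a. w : gV (star_at G v) ==> a : nb (star_at G v) w ==> a : A1 \<longleftrightarrow> w : V1"
  have "a : A1 \<longleftrightarrow> v : V1" if a: "a : dbl ?N" for a
  proof -
    have "dbl_inv ?N a : A1 \<longleftrightarrow> a : A1" using i d(4)[OF a] by (metis star_at_simps(3))
    moreover have "a : ?N | dbl_inv ?N a : ?N" using d(5)[OF a] by blast
    ultimately show ?thesis using co[of v] by auto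
  qed
  then show "(A1 = {} & V1 = {}) | (A1 = gA (star_at G v) & V1 = gV (star_at G v))" using A1 V1 by auto
qed

lemma star_at_U: "is_graph (G :: 'u graph) ==> star_at G v : U_ob"
  using star_at_conn[of G v] dg_props(2)[OF finite_nb, of G v] by (auto simp: U_ob_def safe_def dbl_def)

text \<open>
  There are two models of the corolla at \<open>v\<close>: the Segal core is built from
  \<open>star_at G v\<close>, while operations live at \<open>star (inb G v)\<close>.
\<close>

definition kap :: "'u graph => 'u => 'u => 'u" where
  "kap G v = sx (inb G v) (\<lambda>s. dbl_inv (nb G v) (gi G s)) (dbl_inv (nb G v))"

definition lam :: "'u graph => 'u => 'u => 'u" where
  "lam G v = sx (nb G v) (\<lambda>d. dbl_inv (inb G v) (gi G d)) (dbl_inv (inb G v))"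

text \<open>In \<open>star (inb G v)\<close> the boundary is named by \<open>inb G v\<close>, in
  \<open>star_at G v\<close> the darts are named by \<open>nb G v\<close>. So \<open>s\<close> has
  to correspond to the partner of the dart \<open>gi G s\<close>. The two maps are mutually inverse
  and compatible with the maps to \<open>G\<close>.\<close>

lemma kap_lam:
  assumes g: "is_graph (G :: 'u graph)" and v: "v : gV G"
  shows "et (star (inb G v)) (star_at G v) (kap G v) (\<lambda>_. v)" (is ?A)
    "et (star_at G v) (star (inb G v)) (lam G v) (\<lambda>_. undefined)" (is ?B)
    "a : dbl (inb G v) ==> lam G v (kap G v a) = a"
    "b : dbl (nb G v) ==> kap G v (lam G v b) = b"
    "a : dbl (inb G v) ==> vertex_col G v (kap G v a) = sx (inb G v) (\<lambda>s. s) (gi G) a"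
    "b : dbl (nb G v) ==> sx (inb G v) (\<lambda>s. s) (gi G) (lam G v b) = vertex_col G v b"
    "et (star_at G v) G (vertex_col G v) (\<lambda>_. v)" (is ?C)
proof -
  let ?S = "inb G v" and ?N = "nb G v"
  note fS = finite_inb[OF g, of v] and fN = finite_nb[OF g, of v]
  note S = dbl_inv_props[OF fS] and N = dbl_inv_props[OF fN]
  have SN: "gi G s : ?N" "gi G (gi G s) = s" if "s : ?S" for s
    using that inb_iff[OF g] gi_gi[OF g] by auto
  have NS: "gi G d : ?S" "gi G (gi G d) = d" if "d : ?N" for d
    using that gi_gi[OF g nb_gA[OF g that]] by (auto simp: inb_def)
  have dS: "s : dbl ?S" if "s : ?S" for s using that by (simp add: dbl_def)
  have dN: "s : dbl ?N" if "s : ?N" for s using that by (simp add: dbl_def)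
  have k1: "kap G v s = dbl_inv ?N (gi G s)" "kap G v (dbl_inv ?S s) = gi G s" if "s : ?S" for s
    unfolding kap_def sx_dbl[OF fS that] sx_in[OF that] by (simp_all only: N(4)[OF dN[OF SN(1)[OF that]]])
  have l1: "lam G v d = dbl_inv ?S (gi G d)" "lam G v (dbl_inv ?N d) = gi G d" if "d : ?N" for d
    unfolding lam_def sx_dbl[OF fN that] sx_in[OF that] by (simp_all only: S(4)[OF dS[OF NS(1)[OF that]]])
  have cS: "a : ?S | (EX s:?S. a = dbl_inv ?S s)" if "a : dbl ?S" for a using S(4,5)[OF that] by metis
  have cN: "a : ?N | (EX s:?N. a = dbl_inv ?N s)" if "a : dbl ?N" for a using N(4,5)[OF that] by metis
  show "lam G v (kap G v a) = a" if "a : dbl ?S" for a using cS[OF that] k1 l1 SN by auto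
  show kl: "kap G v (lam G v b) = b" if "b : dbl ?N" for b using cN[OF that] k1 l1 NS by auto
  have vc: "vertex_col G v d = d" "vertex_col G v (dbl_inv ?N d) = gi G d" if "d : ?N" for d
    using that N(3,4,5)[OF dN[OF that]] dN[OF that] by (simp_all add: vertex_col_def)
  show "vertex_col G v (kap G v a) = sx ?S (\<lambda>s. s) (gi G) a" if "a : dbl ?S" for a
    using cS[OF that] k1 vc SN by (auto simp: sx_in sx_dbl[OF fS])
  show lv: "sx ?S (\<lambda>s. s) (gi G) (lam G v b) = vertex_col G v b" if "b : dbl ?N" for b
    using cN[OF that] l1 vc NS by (auto simp: sx_in sx_dbl[OF fS])
  have inbN: "inb (star_at G v) v = dbl_inv ?N ` ?N" by (simp add: inb_def)
  have "bij_betw (\<lambda>s. dbl_inv ?N (gi G s)) ?S (dbl_inv ?N ` ?N)"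
    by (rule bij_betw_byWitness[where f' = "\<lambda>a. gi G (dbl_inv ?N a)"]) (use SN NS N(4) dN in auto)
  then show ?A
    unfolding kap_def using sx_et[OF fS star_at_graph[OF g, of v], where v = v and m = "\<lambda>s. dbl_inv ?N (gi G s)"] inbN by simp
  have lA: "lam G v b : dbl ?S" if "b : dbl ?N" for b using cN[OF that] l1 NS S(3) dS by auto
  have li: "lam G v (dbl_inv ?N b) = dbl_inv ?S (lam G v b)" if "b : dbl ?N" for b
    using cN[OF that] l1 NS S(4) dS N(4) dN by auto
  have "bij_betw (lam G v) ?N (dbl_inv ?S ` ?S)"
    by (rule bij_betw_byWitness[where f' = "kap G v"]) (use l1 k1 SN NS S(4) dS in auto)
  moreover have "nb (star ?S) undefined = dbl_inv ?S ` ?S"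
    unfolding star_nb(1)[OF fS] using S(1) by (intro image_cong) auto
  ultimately show ?B unfolding et_def using lA li by simp
  show ?C
    unfolding et_def
  proof (intro conjI ballI)
    fix a assume a: "a : gA (star_at G v)"
    then have a': "a : dbl ?N" by simp
    show "vertex_col G v a : gA G" using cN[OF a'] vc nb_gA[OF g] gi_in[OF g] by auto
    show "vertex_col G v (gi (star_at G v) a) = gi G (vertex_col G v a)"
      using cN[OF a'] vc NS N(4) dN by auto
  next
    fix w assume "w : gV (star_at G v)"
    then have w: "w = v" by simp
    show "v : gV G" using v .
    show "bij_betw (vertex_col G v) (nb (star_at G v) w) (nb G v)"
      using vc(1) by (simp add: w bij_betw_def inj_on_def)
  qed
qed

text \<open>The description in \<open>vertex_mor\<close> has a unique solution because a morphism is
  determined by its colors and its values on generators; an etale map provides it.\<close>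

lemma vertex_mor_eq:
  assumes c: "connected_graph (G :: 'u graph)" and v: "v : gV G"
  shows "vertex_mor G v = etm (star_at G v) G (vertex_col G v) (\<lambda>_. v)"
    "vertex_mor G v : U_hom (star_at G v) G"
proof -
  note g = conn_graph[OF c]
  note e = kap_lam(7)[OF g v]
  let ?T = "star_at G v"
  note t = star_at_conn[OF g, of v]
  let ?e = "etm ?T G (vertex_col G v) (\<lambda>_. v)"
  have eh: "?e : U_hom ?T G" by (rule etm_hom[OF t c e])
  let ?p = "(inb ?T v, \<lambda>a\<in>inb ?T v. a)"
  have gp: "gob ?T v = ?p" by (simp add: gob_def at_vertex_def)
  have gen: "generator ?T ?p v = gen ?T v" unfolding generator_def gen_def gp ..
  have rp: "recolor (vertex_col G v) ?p = at_vertex ?T (vertex_col G v) v"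
    unfolding gp[symmetric] by (rule recolor_gob)
  have vm: "vertex_mor G v = (THE f. f : U_hom ?T G & fst f = vertex_col G v &
      snd f ?p (gen ?T v) = generator G (at_vertex ?T (vertex_col G v) v) v)"
    unfolding vertex_mor_def Let_def rp gen ..
  have vv: "snd f ?p (gen ?T v) = vals ?T f v" for f :: "'u umor" by (simp add: vals_def gp)
  have ve: "vals ?T ?e v = generator G (at_vertex ?T (vertex_col G v) v) v"
    using etm_vals[OF t c e, of v] by (simp add: generator_def)
  have fe: "fst ?e = vertex_col G v" by (simp add: etm_def vertex_col_def fun_eq_iff)
  show eq: "vertex_mor G v = ?e"
    unfolding vm vv
  proof (rule the_equality)
    show "?e : U_hom ?T G & fst ?e = vertex_col G v & vals ?T ?e v = generator G (at_vertex ?T (vertex_col G v) v) v"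
      using eh fe ve by blast
    fix f assume f: "f : U_hom ?T G & fst f = vertex_col G v &
      vals ?T f v = generator G (at_vertex ?T (vertex_col G v) v) v"
    show "f = ?e"
      by (rule gmod_hom_eqI[OF gmod_modular[OF g] t]) (use f eh fe ve in \<open>auto simp: U_hom_def\<close>)
  qed
  show "vertex_mor G v : U_hom ?T G" unfolding eq by (rule eh)
qed

section \<open>The nerve\<close>

lemma U_modular: "(G :: 'u graph) : U_ob ==> modular_operad (gmod G)"
  by (rule gmod_modular[OF conn_graph[OF U_conn]])

lemma nerve_simps: "pob (nerve P) G = csm_hom (gmod G) P"
  "h : csm_hom (gmod H) P ==> par (nerve P) G H f h = csm_comp (gmod G) h f"
  by (simp_all add: nerve_def)

lemma nerve_presheaf:
  assumes P: "modular_operad (P :: ('u, 'c, 'x) modop)"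
  shows "presheaf (nerve P)"
  unfolding presheaf_def
proof (intro conjI ballI)
  fix G H :: "'u graph" and f assume G: "G : U_ob" and H: "H : U_ob" and f: "f : U_hom G H"
  show "par (nerve P) G H f : pob (nerve P) H \<rightarrow>\<^sub>E pob (nerve P) G"
    using U_comp[OF U_conn[OF G] U_conn[OF H] P f] by (auto simp: nerve_def)
next
  fix G :: "'u graph" and x assume G: "G : U_ob" and x: "x : pob (nerve P) G"
  then show "par (nerve P) G G (csm_id (gmod G)) x = x"
    using csm_id_comp(1)[OF U_modular[OF G] P] by (simp add: nerve_simps)
next
  fix G H K :: "'u graph" and f g x assume G: "G : U_ob" and H: "H : U_ob" and K: "K : U_ob" and f: "f : U_hom G H"
    and g: "g : U_hom H K" and x: "x : pob (nerve P) K"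
  have xg: "csm_comp (gmod H) x g : csm_hom (gmod H) P"
    using U_comp[OF U_conn[OF H] U_conn[OF K] P g] x by (simp add: nerve_simps)
  show "par (nerve P) G K (csm_comp (gmod G) g f) x = par (nerve P) G H f (par (nerve P) H K g x)"
    using x xg csm_comp_assoc[OF U_modular[OF G] U_modular[OF H], of f x g] f by (simp add: nerve_simps U_hom_def)
qed

lemma nerve_map_id:
  assumes P: "modular_operad (P :: ('u, 'c, 'x) modop)"
  shows "nerve_map P (csm_id P) = psh_id (nerve P)"
  unfolding nerve_map_def psh_id_def nerve_simps
  using csm_id_comp(2)[OF U_modular P] by (intro restrict_ext) simp

lemma nerve_map_comp:
  assumes P: "modular_operad (P :: ('u, 'c, 'x) modop)" and Q: "modular_operad Q" and R: "modular_operad R"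
    and f: "f : csm_hom P Q" and g: "g : csm_hom Q R"
  shows "nerve_map P (csm_comp P g f) = psh_comp (nerve P) (nerve_map Q g) (nerve_map P f)"
  unfolding nerve_map_def psh_comp_def nerve_simps
proof (intro restrict_ext)
  fix G :: "'u graph" and h assume G: "G : U_ob" and h: "h : csm_hom (gmod G) P"
  have "csm_comp (gmod G) f h : csm_hom (gmod G) Q" by (rule csm_comp_hom[OF U_modular[OF G] P Q h f])
  then show "csm_comp (gmod G) (csm_comp P g f) h =
     (\<lambda>G\<in>U_ob. \<lambda>h\<in>csm_hom (gmod G) Q. csm_comp (gmod G) g h) G
       ((\<lambda>G\<in>U_ob. \<lambda>h\<in>csm_hom (gmod G) P. csm_comp (gmod G) f h) G h)"
    using G h csm_comp_assoc[OF U_modular[OF G] P h, of g f] by simp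
qed

lemma nerve_map_hom:
  assumes P: "modular_operad (P :: ('u, 'c, 'x) modop)" and Q: "modular_operad Q" and g: "g : csm_hom P Q"
  shows "nerve_map P g : psh_hom (nerve P) (nerve Q)"
  unfolding nerve_map_def nerve_simps(1)[symmetric]
proof (rule psh_homI)
  fix G :: "'u graph" and h assume G: "G : U_ob" and h: "h : pob (nerve P) G"
  then show "csm_comp (gmod G) g h : pob (nerve Q) G"
    using csm_comp_hom[OF U_modular[OF G] P Q _ g] by (simp add: nerve_simps)
next
  fix G H :: "'u graph" and f h assume G: "G : U_ob" and H: "H : U_ob" and f: "f : U_hom G H" and h: "h : pob (nerve P) H"
  show "par (nerve P) G H f h : pob (nerve P) G" by (rule presheafD(1)[OF nerve_presheaf[OF P] G H f h])
  have "csm_comp (gmod H) g h : csm_hom (gmod H) Q"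
    using csm_comp_hom[OF U_modular[OF H] P Q _ g] h by (simp add: nerve_simps)
  then show "csm_comp (gmod G) g (par (nerve P) G H f h) = par (nerve Q) G H f (csm_comp (gmod H) g h)"
    using h f csm_comp_assoc[OF U_modular[OF G] U_modular[OF H], of f g h] by (simp add: nerve_simps U_hom_def)
qed

end

section \<open>The Segal condition\<close>

text \<open>The color of \<open>x\<close> at the arc \<open>a\<close>; the colors of
  \<open>X\<close> are its elements over the exceptional edge.\<close>

definition col :: "('u, 'p) psh => 'u graph => 'p => 'u => 'p" where
  "col X G x a = par X exc_edge G (emor G a) x"

text \<open>Families of elements over the stars whose colors agree along internal edges, read at
  both ends of the edge. By \<open>sc_hom_bij\<close> they are the maps out of the Segal
  core.\<close>

definition match :: "('u, 'p) psh => 'u graph => ('u => 'p) set" where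
  "match X G = {z : (\<Pi>\<^sub>E v\<in>gV G. pob X (star_at G v)). ALL a:dA G. gi G a : dA G -->
     col X (star_at G (tA G a)) (z (tA G a)) (dbl_inv (nb G (tA G a)) a) =
     col X (star_at G (tA G (gi G a))) (z (tA G (gi G a))) (gi G a)}"

abbreviation sc_cls :: "'u graph => 'u graph => 'u \<times> 'u umor => ('u \<times> 'u umor) set" where
  "sc_cls G K e \<equiv> eqcl (sc_rel G K) `` {e}"

text \<open>The map out of the Segal core given by a matching family; matching makes the values on a
  class agree, as \<open>the_elem\<close> requires.\<close>

definition sc_ext :: "('u, 'p) psh => 'u graph => ('u => 'p) => 'u graph => ('u \<times> 'u umor) set => 'p" where
  "sc_ext X G z = (\<lambda>K\<in>U_ob. \<lambda>k\<in>pob (sc_coeq G) K. the_elem ((\<lambda>(v, h). par X K (star_at G v) h (z v)) ` k))"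

lemma the_elem_class:
  assumes "!!x y. (x, y) : r ==> f x = f y"
  shows "the_elem (f ` (eqcl r `` {e})) = f e"
proof -
  have "f y = f e" if "(e, y) : eqcl r" for y using eqcl_invariant[OF that, of f] assms by simp
  then have "f ` (eqcl r `` {e}) \<subseteq> {f e}" by auto
  moreover have "f e : f ` (eqcl r `` {e})" using eqcl_refl[of e r] by (intro imageI) simp
  ultimately have "f ` (eqcl r `` {e}) = {f e}" by blast
  then show ?thesis by simp
qed

lemma image_class:
  assumes "!!x y. (x, y) : r ==> (f x, f y) : eqcl s"
  shows "eqcl s `` (f ` (eqcl r `` {e})) = eqcl s `` {f e}"
proof -
  have "(f e, f y) : eqcl s" if "(e, y) : eqcl r" for y
    using that unfolding eqcl_def[of r]
  proof (induction rule: rtrancl_induct)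
    case base show ?case by (rule eqcl_refl)
  next
    case (step y z)
    then have "(f y, f z) : eqcl s" using assms[of y z] assms[of z y] eqcl_sym[of "f z" "f y" s] by auto
    then show ?case by (rule eqcl_trans[OF step.IH])
  qed
  then show ?thesis using eqcl_refl[of e r] eqcl_trans by fast
qed

context infinite_universe
begin

lemma U_comp_U:
  assumes "(G :: 'u graph) : U_ob" "H : U_ob" "K : U_ob" "f : U_hom G H" "h : U_hom H K"
  shows "csm_comp (gmod G) h f : U_hom G K"
  using U_comp[OF U_conn[OF assms(1)] U_conn[OF assms(2)] U_modular[OF assms(3)] assms(4)] assms(5)
  by (simp add: U_hom_def)

lemma U_assoc:
  assumes "(G :: 'u graph) : U_ob" "H : U_ob" "f : U_hom G H"
  shows "csm_comp (gmod G) (csm_comp (gmod H) k g) f = csm_comp (gmod G) k (csm_comp (gmod G) g f)"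
  using csm_comp_assoc[OF U_modular[OF assms(1)] U_modular[OF assms(2)]] assms(3) by (simp add: U_hom_def)

lemma U_id:
  assumes "(G :: 'u graph) : U_ob"
  shows "csm_id (gmod G) : U_hom G G"
    "H : U_ob ==> f : U_hom G H ==> csm_comp (gmod G) f (csm_id (gmod G)) = f"
    "H : U_ob ==> f : U_hom H G ==> csm_comp (gmod H) (csm_id (gmod G)) f = f"
  using csm_id_hom[OF U_modular[OF assms]] csm_id_comp(1)[OF U_modular[OF assms] U_modular]
    csm_id_comp(2)[OF U_modular U_modular[OF assms]] by (auto simp: U_hom_def)

lemma rep_nerve: "rep G = nerve (gmod G)"
  by (simp add: rep_def nerve_def U_hom_def)

lemma rep_simps: "pob (rep G) K = U_hom K G" "h : U_hom L G ==> par (rep G) K L f h = csm_comp (gmod K) h f"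
  by (simp_all add: rep_def)

lemma rep_presheaf: "(G :: 'u graph) : U_ob ==> presheaf (rep G)"
  unfolding rep_nerve by (rule nerve_presheaf[OF U_modular])

lemma col_par:
  assumes X: "presheaf X" and G: "(G :: 'u graph) : U_ob" and H: "H : U_ob" and f: "f : U_hom G H"
    and x: "x : pob X H" and a: "a : gA G"
  shows "col X G (par X G H f x) a = col X H x (fst f a)"
  unfolding col_def presheafD(3)[OF X edge_U G H emor_hom[OF U_conn[OF G] a] f x]
    U_emor(1)[OF U_conn[OF G] U_conn[OF H] f a] ..

lemma col_etm:
  assumes X: "presheaf X" and G: "(G :: 'u graph) : U_ob" and H: "H : U_ob" and e: "et G H al nu"
    and x: "x : pob X H" and a: "a : gA G"
  shows "col X G (par X G H (etm G H al nu) x) a = col X H x (al a)"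
  using col_par[OF X G H etm_hom[OF U_conn[OF G] U_conn[OF H] e] x a] etm_fst[OF a] by metis

lemma col_in:
  assumes X: "presheaf X" and G: "(G :: 'u graph) : U_ob" and x: "x : pob X G" and a: "a : gA G"
  shows "col X G x a : pob X exc_edge"
  unfolding col_def by (rule presheafD(1)[OF X edge_U G emor_hom[OF U_conn[OF G] a] x])

lemma col_nat:
  assumes t: "ta : psh_hom X Y" and G: "(G :: 'u graph) : U_ob" and x: "x : pob X G" and a: "a : gA G"
  shows "ta exc_edge (col X G x a) = col Y G (ta G x) a"
  unfolding col_def by (rule psh_homD(4)[OF t edge_U G emor_hom[OF U_conn[OF G] a] x])

lemma yoneda:
  assumes X: "presheaf X" and G: "(G :: 'u graph) : U_ob"
  shows "bij_betw (\<lambda>ta. ta G (csm_id (gmod G))) (psh_hom (rep G) X) (pob X G)"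
proof (rule bij_betw_byWitness[where f' = "\<lambda>x. \<lambda>K\<in>U_ob. \<lambda>h\<in>pob (rep G) K. par X K G h x"])
  note i = U_id[OF G]
  let ?w = "\<lambda>x. \<lambda>K\<in>U_ob. \<lambda>h\<in>pob (rep G) K. par X K G h x"
  have w: "?w x : psh_hom (rep G) X" if x: "x : pob X G" for x
  proof (rule psh_homI)
    fix K h assume "K : U_ob" "h : pob (rep G) K"
    then show "par X K G h x : pob X K" using presheafD(1)[OF X _ G _ x] by (simp add: rep_simps)
  next
    fix K L :: "'u graph" and f h assume *: "K : U_ob" "L : U_ob" "f : U_hom K L" "h : pob (rep G) L"
    then have h: "h : U_hom L G" by (simp add: rep_simps)
    show "par (rep G) K L f h : pob (rep G) K" using U_comp_U[OF *(1,2) G *(3) h] h by (simp add: rep_simps)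
    show "par X K G (par (rep G) K L f h) x = par X K L f (par X L G h x)"
      using presheafD(3)[OF X *(1,2) G *(3) h x] h by (simp add: rep_simps)
  qed
  show "ALL ta:psh_hom (rep G) X. ?w (ta G (csm_id (gmod G))) = ta"
  proof
    fix ta assume t: "ta : psh_hom (rep G) X"
    have tx: "ta G (csm_id (gmod G)) : pob X G" using psh_homD(3)[OF t G] i(1) by (simp add: rep_simps)
    show "?w (ta G (csm_id (gmod G))) = ta"
    proof (rule psh_hom_eqI[OF w[OF tx] t])
      fix K h assume K: "K : U_ob" and h: "h : pob (rep G) K"
      then have h': "h : U_hom K G" by (simp add: rep_simps)
      then show "?w (ta G (csm_id (gmod G))) K h = ta K h"
        using psh_homD(4)[OF t K G h', of "csm_id (gmod G)"] i(1) i(3)[OF K h'] K by (simp add: rep_simps)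
    qed
  qed
  show "ALL x:pob X G. ?w x G (csm_id (gmod G)) = x"
    using presheafD(2)[OF X G] i(1) G by (simp add: rep_simps)
  show "(\<lambda>ta. ta G (csm_id (gmod G))) ` psh_hom (rep G) X \<subseteq> pob X G"
  proof (intro image_subsetI)
    fix ta assume t: "ta : psh_hom (rep G) X"
    show "ta G (csm_id (gmod G)) : pob X G" using psh_homD(3)[OF t G] i(1) by (simp add: rep_simps)
  qed
  show "?w ` pob X G \<subseteq> psh_hom (rep G) X" using w by blast
qed

lemma tA_nb:
  assumes "is_graph G" "a : dA G" shows "a : nb G (tA G a)" "tA G a : gV G"
  using nb_iff[OF assms(1)] tA_gV[OF assms] assms(2) by auto

lemma edge_at:
  assumes g: "is_graph (G :: 'u graph)" and a: "a : dbl (nb G v)"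
  shows "edge_mor (star_at G v) a = emor (star_at G v) a" "emor (star_at G v) a : U_hom exc_edge (star_at G v)"
  using edge_mor_eq[OF star_at_conn[OF g]] emor_hom[OF star_at_conn[OF g]] a by auto

lemma nb_dbl: "a : nb G v ==> a : dbl (nb G v)"
  by (simp add: dbl_def)

lemma dbl_inv_dbl: "is_graph (G :: 'u graph) ==> a : nb G v ==> dbl_inv (nb G v) a : dbl (nb G v)"
  using dbl_inv_props(3)[OF finite_nb nb_dbl] .

lemma sc_relE:
  assumes g: "is_graph (G :: 'u graph)" and "(e, e') : sc_rel G K"
  obtains a f where "a : dA G" "gi G a : dA G" "f : U_hom K exc_edge"
    "e = (tA G a, csm_comp (gmod K) (emor (star_at G (tA G a)) (dbl_inv (nb G (tA G a)) a)) f)"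
    "e' = (tA G (gi G a), csm_comp (gmod K) (emor (star_at G (tA G (gi G a))) (gi G a)) f)"
proof -
  obtain a f where *: "a : dA G" "gi G a : dA G" "f : U_hom K exc_edge"
    "e = (tA G a, csm_comp (gmod K) (edge_mor (star_at G (tA G a)) (gi (star_at G (tA G a)) a)) f)"
    "e' = (tA G (gi G a), csm_comp (gmod K) (edge_mor (star_at G (tA G (gi G a))) (gi G a)) f)"
    using assms(2) unfolding sc_rel_def by blast
  show ?thesis
    using that[OF *(1-3)] *(4,5) edge_at(1)[OF g dbl_inv_dbl[OF g tA_nb(1)[OF g *(1)]]]
      edge_at(1)[OF g nb_dbl[OF tA_nb(1)[OF g *(2)]]] by simp
qed

lemma sc_relI:
  assumes g: "is_graph (G :: 'u graph)" and a: "a : dA G" "gi G a : dA G" "f : U_hom K exc_edge"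
  shows "((tA G a, csm_comp (gmod K) (emor (star_at G (tA G a)) (dbl_inv (nb G (tA G a)) a)) f),
    (tA G (gi G a), csm_comp (gmod K) (emor (star_at G (tA G (gi G a))) (gi G a)) f)) : sc_rel G K"
  unfolding sc_rel_def
  using a edge_at(1)[OF g dbl_inv_dbl[OF g tA_nb(1)[OF g a(1)]]] edge_at(1)[OF g nb_dbl[OF tA_nb(1)[OF g a(2)]]]
  by (intro CollectI exI[of _ a] exI[of _ f]) simp

lemma sc_cls_ob:
  assumes "v : gV G" "h : U_hom K (star_at G v)"
  shows "sc_cls G K (v, h) : pob (sc_coeq G) K"
  using assms by (auto simp: sc_coeq_def sc_elts_def intro: quotientI)

lemma sc_obE:
  assumes "k : pob (sc_coeq G) K"
  obtains v h where "v : gV G" "h : U_hom K (star_at G v)" "k = sc_cls G K (v, h)"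
  using assms by (auto simp: sc_coeq_def sc_elts_def elim!: quotientE)

lemma sc_par:
  assumes G: "(G :: 'u graph) : U_ob" and K: "K : U_ob" and L: "L : U_ob" and f: "f : U_hom K L"
    and v: "v : gV G" and h: "h : U_hom L (star_at G v)"
  shows "par (sc_coeq G) K L f (sc_cls G L (v, h)) = sc_cls G K (v, csm_comp (gmod K) h f)"
proof -
  note g = conn_graph[OF U_conn[OF G]]
  have "eqcl (sc_rel G K) `` ((\<lambda>(v, h). (v, csm_comp (gmod K) h f)) ` sc_cls G L (v, h)) =
      eqcl (sc_rel G K) `` {(\<lambda>(v, h). (v, csm_comp (gmod K) h f)) (v, h)}"
  proof (rule image_class)
    fix x y assume "(x, y) : sc_rel G L"
    then obtain a k where a: "a : dA G" "gi G a : dA G" and k: "k : U_hom L exc_edge"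
      and x: "x = (tA G a, csm_comp (gmod L) (emor (star_at G (tA G a)) (dbl_inv (nb G (tA G a)) a)) k)"
      and y: "y = (tA G (gi G a), csm_comp (gmod L) (emor (star_at G (tA G (gi G a))) (gi G a)) k)"
      by (rule sc_relE[OF g])
    have "csm_comp (gmod K) k f : U_hom K exc_edge" by (rule U_comp_U[OF K L edge_U f k])
    from sc_relI[OF g a this]
    show "((\<lambda>(v, h). (v, csm_comp (gmod K) h f)) x, (\<lambda>(v, h). (v, csm_comp (gmod K) h f)) y) : eqcl (sc_rel G K)"
      unfolding x y prod.case U_assoc[OF K L f] by (rule eqcl_base)
  qed
  then show ?thesis using sc_cls_ob[OF v h] by (simp add: sc_coeq_def)
qed

lemma matchD:
  assumes "z : match X G"
  shows "v : gV G ==> z v : pob X (star_at G v)" "z : extensional (gV G)"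
    "a : dA G ==> gi G a : dA G ==> col X (star_at G (tA G a)) (z (tA G a)) (dbl_inv (nb G (tA G a)) a) =
     col X (star_at G (tA G (gi G a))) (z (tA G (gi G a))) (gi G a)"
  using assms by (auto simp: match_def PiE_iff)

lemma sc_ext_cls:
  assumes X: "presheaf X" and G: "(G :: 'u graph) : U_ob" and z: "z : match X G" and K: "K : U_ob"
    and v: "v : gV G" and h: "h : U_hom K (star_at G v)"
  shows "sc_ext X G z K (sc_cls G K (v, h)) = par X K (star_at G v) h (z v)"
proof -
  note g = conn_graph[OF U_conn[OF G]]
  have "the_elem ((\<lambda>(v, h). par X K (star_at G v) h (z v)) ` sc_cls G K (v, h)) =
    (\<lambda>(v, h). par X K (star_at G v) h (z v)) (v, h)"
  proof (rule the_elem_class)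
    fix x y assume "(x, y) : sc_rel G K"
    then obtain a k where a: "a : dA G" "gi G a : dA G" and k: "k : U_hom K exc_edge"
      and x: "x = (tA G a, csm_comp (gmod K) (emor (star_at G (tA G a)) (dbl_inv (nb G (tA G a)) a)) k)"
      and y: "y = (tA G (gi G a), csm_comp (gmod K) (emor (star_at G (tA G (gi G a))) (gi G a)) k)"
      by (rule sc_relE[OF g])
    have p: "par X K (star_at G w) (csm_comp (gmod K) (emor (star_at G w) b) k) (z w) =
        par X K exc_edge k (col X (star_at G w) (z w) b)" if "w : gV G" "b : dbl (nb G w)" for w b
      unfolding col_def
      by (rule presheafD(3)[OF X K edge_U star_at_U[OF g] k edge_at(2)[OF g that(2)] matchD(1)[OF z that(1)], symmetric])
    show "(\<lambda>(v, h). par X K (star_at G v) h (z v)) x = (\<lambda>(v, h). par X K (star_at G v) h (z v)) y"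
      unfolding x y prod.case
        p[OF tA_nb(2)[OF g a(1)] dbl_inv_dbl[OF g tA_nb(1)[OF g a(1)]]]
        p[OF tA_nb(2)[OF g a(2)] nb_dbl[OF tA_nb(1)[OF g a(2)]]] matchD(3)[OF z a] ..
  qed
  then show ?thesis using sc_cls_ob[OF v h] K by (simp add: sc_ext_def)
qed

lemma sc_ext_hom:
  assumes X: "presheaf X" and G: "(G :: 'u graph) : U_ob" and z: "z : match X G"
  shows "sc_ext X G z : psh_hom (sc_coeq G) X"
proof -
  note g = conn_graph[OF U_conn[OF G]]
  let ?t = "\<lambda>K k. the_elem ((\<lambda>(v, h). par X K (star_at G v) h (z v)) ` k)"
  have t: "?t K (sc_cls G K (v, h)) = par X K (star_at G v) h (z v)"
    if "K : U_ob" "v : gV G" "h : U_hom K (star_at G v)" for K v h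
    using sc_ext_cls[OF X G z that] sc_cls_ob[OF that(2,3)] that(1) by (simp add: sc_ext_def)
  show ?thesis
    unfolding sc_ext_def
  proof (rule psh_homI)
    fix K k assume K: "K : U_ob" and "k : pob (sc_coeq G) K"
    then obtain v h where v: "v : gV G" "h : U_hom K (star_at G v)" and k: "k = sc_cls G K (v, h)" using sc_obE by blast
    show "?t K k : pob X K"
      unfolding k t[OF K v] by (rule presheafD(1)[OF X K star_at_U[OF g] v(2) matchD(1)[OF z v(1)]])
  next
    fix K L :: "'u graph" and f k assume K: "K : U_ob" and L: "L : U_ob" and f: "f : U_hom K L" and "k : pob (sc_coeq G) L"
    then obtain v h where v: "v : gV G" and h: "h : U_hom L (star_at G v)" and k: "k = sc_cls G L (v, h)" using sc_obE by blast
    note hf = U_comp_U[OF K L star_at_U[OF g] f h]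
    show "par (sc_coeq G) K L f k : pob (sc_coeq G) K"
      unfolding k sc_par[OF G K L f v h] by (rule sc_cls_ob[OF v hf])
    show "?t K (par (sc_coeq G) K L f k) = par X K L f (?t L k)"
      unfolding k sc_par[OF G K L f v h] t[OF K v hf] t[OF L v h]
      by (rule presheafD(3)[OF X K L star_at_U[OF g] f h matchD(1)[OF z v], symmetric])
  qed
qed

text \<open>The Yoneda lemma for each star: a map out of the coequalizer is determined by its values
  at the identities of the stars. The generating pairs for the identity of the exceptional edge give
  the matching condition, and precomposition yields all other pairs.\<close>

lemma sc_hom_bij:
  assumes X: "presheaf X" and G: "(G :: 'u graph) : U_ob"
  shows "bij_betw (\<lambda>si. \<lambda>v\<in>gV G. si (star_at G v) (sc_cls G (star_at G v) (v, csm_id (gmod (star_at G v)))))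
    (psh_hom (sc_coeq G) X) (match X G)"
proof (rule bij_betw_byWitness[where f' = "sc_ext X G"])
  note g = conn_graph[OF U_conn[OF G]]
  note i = U_id[OF star_at_U[OF g]]
  let ?q = "\<lambda>si. \<lambda>v\<in>gV G. si (star_at G v) (sc_cls G (star_at G v) (v, csm_id (gmod (star_at G v))))"
  have sh: "si K (sc_cls G K (v, h)) = par X K (star_at G v) h (?q si v)"
    if s: "si : psh_hom (sc_coeq G) X" and K: "K : U_ob" and v: "v : gV G" and h: "h : U_hom K (star_at G v)" for si K v h
    using psh_homD(4)[OF s K star_at_U[OF g] h sc_cls_ob[OF v i(1)]] sc_par[OF G K star_at_U[OF g] h v i(1)]
      i(3)[OF K h] v by simp
  have q: "?q si : match X G" if s: "si : psh_hom (sc_coeq G) X" for si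
  proof -
    have 1: "?q si v : pob X (star_at G v)" if "v : gV G" for v
      using psh_homD(3)[OF s star_at_U[OF g] sc_cls_ob[OF that i(1)]] that by simp
    have "col X (star_at G (tA G a)) (?q si (tA G a)) (dbl_inv (nb G (tA G a)) a) =
     col X (star_at G (tA G (gi G a))) (?q si (tA G (gi G a))) (gi G a)" if a: "a : dA G" "gi G a : dA G" for a
    proof -
      have c: "col X (star_at G w) (?q si w) b = si exc_edge (sc_cls G exc_edge (w, csm_comp (gmod exc_edge) (emor (star_at G w) b) (csm_id (gmod exc_edge))))"
        if "w : gV G" "b : dbl (nb G w)" for w b
        unfolding col_def using sh[OF s edge_U that(1) edge_at(2)[OF g that(2)]]
          U_id(2)[OF edge_U star_at_U[OF g] edge_at(2)[OF g that(2)]] by simp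
      have "sc_cls G exc_edge e = sc_cls G exc_edge e'" if "(e, e') : sc_rel G exc_edge" for e e'
        using eqcl_base[OF that] eqcl_sym eqcl_trans by fast
      from this[OF sc_relI[OF g a U_id(1)[OF edge_U]]] show ?thesis
        unfolding c[OF tA_nb(2)[OF g a(1)] dbl_inv_dbl[OF g tA_nb(1)[OF g a(1)]]]
          c[OF tA_nb(2)[OF g a(2)] nb_dbl[OF tA_nb(1)[OF g a(2)]]] by (rule arg_cong)
    qed
    then show ?thesis unfolding match_def using 1 by (intro CollectI conjI PiE_I ballI impI) auto
  qed
  then show "?q ` psh_hom (sc_coeq G) X \<subseteq> match X G" by blast
  show "sc_ext X G ` match X G \<subseteq> psh_hom (sc_coeq G) X" using sc_ext_hom[OF X G] by blast
  show "ALL si:psh_hom (sc_coeq G) X. sc_ext X G (?q si) = si"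
  proof
    fix si assume s: "si : psh_hom (sc_coeq G) X"
    show "sc_ext X G (?q si) = si"
    proof (rule psh_hom_eqI[OF sc_ext_hom[OF X G q[OF s]] s])
      fix K k assume K: "K : U_ob" and "k : pob (sc_coeq G) K"
      then obtain v h where v: "v : gV G" "h : U_hom K (star_at G v)" and k: "k = sc_cls G K (v, h)" using sc_obE by blast
      show "sc_ext X G (?q si) K k = si K k" unfolding k sc_ext_cls[OF X G q[OF s] K v] sh[OF s K v] ..
    qed
  qed
  show "ALL z:match X G. ?q (sc_ext X G z) = z"
  proof
    fix z assume z: "z : match X G"
    show "?q (sc_ext X G z) = z"
      using sc_ext_cls[OF X G z star_at_U[OF g] _ i(1)] presheafD(2)[OF X star_at_U[OF g] matchD(1)[OF z]] matchD(2)[OF z]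
      by (intro extensionalityI[where A = "gV G"]) auto
  qed
qed

lemma vertex_in_match:
  assumes X: "presheaf X" and G: "(G :: 'u graph) : U_ob" and x: "x : pob X G"
  shows "(\<lambda>v\<in>gV G. par X (star_at G v) G (vertex_mor G v) x) : match X G"
proof -
  note c = U_conn[OF G]
  note g = conn_graph[OF c]
  have cl: "col X (star_at G v) (par X (star_at G v) G (vertex_mor G v) x) a = col X G x (vertex_col G v a)"
    if v: "v : gV G" and a: "a : dbl (nb G v)" for v a
    unfolding vertex_mor_eq(1)[OF c v] by (rule col_etm[OF X star_at_U[OF g] G kap_lam(7)[OF g v] x]) (simp add: a)
  have vc: "vertex_col G v a = a" "vertex_col G v (dbl_inv (nb G v) a) = gi G a" if "a : nb G v" for v a
    using that dbl_inv_props(3,4,5)[OF finite_nb[OF g] nb_dbl[OF that]] nb_dbl[OF that] by (simp_all add: vertex_col_def)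
  show ?thesis
    unfolding match_def
  proof (intro CollectI conjI PiE_I ballI impI)
    fix a assume a: "a : dA G" "gi G a : dA G"
    note t = tA_nb[OF g a(1)] and t' = tA_nb[OF g a(2)]
    show "col X (star_at G (tA G a)) ((\<lambda>v\<in>gV G. par X (star_at G v) G (vertex_mor G v) x) (tA G a)) (dbl_inv (nb G (tA G a)) a) =
     col X (star_at G (tA G (gi G a))) ((\<lambda>v\<in>gV G. par X (star_at G v) G (vertex_mor G v) x) (tA G (gi G a))) (gi G a)"
      unfolding restrict_apply'[OF t(2)] restrict_apply'[OF t'(2)] cl[OF t(2) dbl_inv_dbl[OF g t(1)]] cl[OF t'(2) nb_dbl[OF t'(1)]]
        vc(2)[OF t(1)] vc(1)[OF t'(1)] ..
  qed (use presheafD(1)[OF X star_at_U[OF g] G vertex_mor_eq(2)[OF c] x] in auto)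
qed

text \<open>The \<open>vertex_mor G v\<close> are the family obtained by restricting the identity of
  \<open>G\<close> to the stars, and \<open>sc_map\<close> is the map that this family
  defines.\<close>

lemma vertex_match:
  assumes G: "(G :: 'u graph) : U_ob"
  shows "(\<lambda>v\<in>gV G. vertex_mor G v) : match (rep G) G" "sc_map G = sc_ext (rep G) G (\<lambda>v\<in>gV G. vertex_mor G v)"
proof -
  note c = U_conn[OF G]
  note g = conn_graph[OF c]
  note vm = vertex_mor_eq[OF c]
  have "(\<lambda>v\<in>gV G. par (rep G) (star_at G v) G (vertex_mor G v) (csm_id (gmod G))) : match (rep G) G"
    by (rule vertex_in_match[OF rep_presheaf[OF G] G]) (simp add: rep_simps U_id(1)[OF G])
  moreover have "(\<lambda>v\<in>gV G. par (rep G) (star_at G v) G (vertex_mor G v) (csm_id (gmod G))) = (\<lambda>v\<in>gV G. vertex_mor G v)"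
    using U_id(3)[OF G star_at_U[OF g] vm(2)] by (intro restrict_ext) (simp add: rep_simps U_id(1)[OF G])
  ultimately show "(\<lambda>v\<in>gV G. vertex_mor G v) : match (rep G) G" by simp
  show "sc_map G = sc_ext (rep G) G (\<lambda>v\<in>gV G. vertex_mor G v)"
    unfolding sc_map_def sc_ext_def
  proof (intro restrict_ext)
    fix K k assume K: "K : U_ob" and "k : pob (sc_coeq G) K"
    then obtain u d where u: "u : gV G" "d : U_hom K (star_at G u)" and k: "k = sc_cls G K (u, d)" using sc_obE by blast
    \<comment> \<open>\<open>eqcl\<close> relates arbitrary pairs, so one has to check that a class
      of the core contains only pairs over vertices of \<open>G\<close>.\<close>
    have "fst e : gV G" if "(e, e') : sc_rel G K" for e e'
      using that tA_nb(2)[OF g] by (auto simp: sc_rel_def)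
    moreover have "fst e' : gV G" if "(e, e') : sc_rel G K" for e e'
      using that tA_nb(2)[OF g] by (auto simp: sc_rel_def)
    ultimately have inv: "fst e : gV G \<longleftrightarrow> fst e' : gV G" if "(e, e') : sc_rel G K" for e e' using that by blast
    have "v : gV G" if "(v, h) : k" for v h
      using eqcl_invariant[of "(u, d)" "(v, h)" "sc_rel G K" "\<lambda>e. fst e : gV G"] that inv u(1) unfolding k by simp
    then have "csm_comp (gmod K) (vertex_mor G v) h = par (rep G) K (star_at G v) h ((\<lambda>v\<in>gV G. vertex_mor G v) v)"
      if "(v, h) : k" for v h using that vm(2) by (simp add: rep_simps)
    then have "(\<lambda>(v, h). csm_comp (gmod K) (vertex_mor G v) h) ` k =
        (\<lambda>(v, h). par (rep G) K (star_at G v) h ((\<lambda>v\<in>gV G. vertex_mor G v) v)) ` k"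
      by (intro image_cong) auto
    then show "the_elem ((\<lambda>(v, h). csm_comp (gmod K) (vertex_mor G v) h) ` k) =
      the_elem ((\<lambda>(v, h). par (rep G) K (star_at G v) h ((\<lambda>v\<in>gV G. vertex_mor G v) v)) ` k)" by simp
  qed
qed

text \<open>By \<open>yoneda\<close> on one side and \<open>sc_hom_bij\<close> on the other,
  composition with \<open>sc_map\<close> becomes restriction to the stars.\<close>

lemma segal_match:
  assumes X: "presheaf (X :: ('u, 'p) psh)"
  shows "segal X \<longleftrightarrow> (ALL G:U_ob. gV G ~= {} -->
    bij_betw (\<lambda>x. \<lambda>v\<in>gV G. par X (star_at G v) G (vertex_mor G v) x) (pob X G) (match X G))"
proof -
  have "bij_betw (\<lambda>ta. psh_comp (sc_coeq G) ta (sc_map G)) (psh_hom (rep G) X) (psh_hom (sc_coeq G) X) \<longleftrightarrow>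
    bij_betw (\<lambda>x. \<lambda>v\<in>gV G. par X (star_at G v) G (vertex_mor G v) x) (pob X G) (match X G)"
    if G: "G : U_ob" for G :: "'u graph"
  proof (rule bij_square[OF yoneda[OF X G] sc_hom_bij[OF X G]])
    note c = U_conn[OF G]
    note g = conn_graph[OF c]
    note vm = vertex_match[OF G]
    note sh = sc_ext_hom[OF rep_presheaf[OF G] G vm(1), folded vm(2)]
    note i = U_id[OF star_at_U[OF g]]
    show "(\<lambda>ta. psh_comp (sc_coeq G) ta (sc_map G)) ` psh_hom (rep G) X \<subseteq> psh_hom (sc_coeq G) X"
    proof (intro image_subsetI)
      fix ta assume t: "ta : psh_hom (rep G) X"
      show "psh_comp (sc_coeq G) ta (sc_map G) : psh_hom (sc_coeq G) X"
        unfolding psh_comp_def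
      proof (rule psh_homI)
        fix K L :: "'u graph" and f k assume K: "K : U_ob" and L: "L : U_ob" and f: "f : U_hom K L" and k: "k : pob (sc_coeq G) L"
        then obtain v h where v: "v : gV G" "h : U_hom L (star_at G v)" and kk: "k = sc_cls G L (v, h)" using sc_obE by blast
        show "par (sc_coeq G) K L f k : pob (sc_coeq G) K"
          unfolding kk sc_par[OF G K L f v] by (rule sc_cls_ob[OF v(1) U_comp_U[OF K L star_at_U[OF g] f v(2)]])
        show "ta K (sc_map G K (par (sc_coeq G) K L f k)) = par X K L f (ta L (sc_map G L k))"
          unfolding psh_homD(4)[OF sh K L f k] by (rule psh_homD(4)[OF t K L f psh_homD(3)[OF sh L k]])
      qed (rule psh_homD(3)[OF t _ psh_homD(3)[OF sh]])
    qed
    fix ta assume t: "ta : psh_hom (rep G) X"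
    show "(\<lambda>v\<in>gV G. psh_comp (sc_coeq G) ta (sc_map G) (star_at G v) (sc_cls G (star_at G v) (v, csm_id (gmod (star_at G v))))) =
      (\<lambda>v\<in>gV G. par X (star_at G v) G (vertex_mor G v) (ta G (csm_id (gmod G))))"
    proof (intro restrict_ext)
      fix v assume v: "v : gV G"
      note vh = vertex_mor_eq(2)[OF c v]
      have "psh_comp (sc_coeq G) ta (sc_map G) (star_at G v) (sc_cls G (star_at G v) (v, csm_id (gmod (star_at G v)))) =
          ta (star_at G v) (sc_ext (rep G) G (\<lambda>v\<in>gV G. vertex_mor G v) (star_at G v) (sc_cls G (star_at G v) (v, csm_id (gmod (star_at G v)))))"
        using psh_comp_apply[OF star_at_U[OF g] sc_cls_ob[OF v i(1)]] vm(2) by simp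
      also have "\<dots> = ta (star_at G v) (par (rep G) (star_at G v) G (vertex_mor G v) (csm_id (gmod G)))"
        unfolding sc_ext_cls[OF rep_presheaf[OF G] G vm(1) star_at_U[OF g] v i(1)] restrict_apply'[OF v]
          rep_simps(2)[OF vh] rep_simps(2)[OF U_id(1)[OF G]] i(2)[OF G vh] U_id(3)[OF G star_at_U[OF g] vh] ..
      also have "\<dots> = par X (star_at G v) G (vertex_mor G v) (ta G (csm_id (gmod G)))"
        by (rule psh_homD(4)[OF t star_at_U[OF g] G vh]) (simp add: rep_simps U_id(1)[OF G])
      finally show "psh_comp (sc_coeq G) ta (sc_map G) (star_at G v) (sc_cls G (star_at G v) (v, csm_id (gmod (star_at G v)))) =
        par X (star_at G v) G (vertex_mor G v) (ta G (csm_id (gmod G)))" .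
    qed
  qed
  then show ?thesis unfolding segal_def by blast
qed

end

section \<open>Decorations of graphs by elements of a presheaf\<close>

lemma vals_hat [simp]: "vals (hat G) h = vals G h"
  by (simp add: vals_def gob_def gen_def)

definition pcol :: "('u, 'p) psh => 'p cset" where
  "pcol X = \<lparr>cols = pob X exc_edge, cinv = par X exc_edge exc_edge (emor exc_edge eps_dg)\<rparr>"

text \<open>For a bijection \<open>si\<close> from \<open>S\<close> to \<open>S'\<close>, the
  isomorphism of stars that extends it.\<close>

definition stm :: "'u set => 'u set => ('u => 'u) => 'u umor" where
  "stm S S' si = etm (star S) (star S') (sx S si (dbl_inv S')) (\<lambda>_. undefined)"

text \<open>The operations of \<open>X\<close>: elements over stars, sorted by the colors of their
  boundary arcs.\<close>

definition pops :: "('u, 'p) psh => ('u, 'p) bob => 'p set" where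
  "pops X p = {x : pob X (star (fst p)). ALL s:fst p. col X (star (fst p)) x s = snd p s}"

text \<open>\<open>X\<close> is contravariant, so a bijection acts through the morphism of its
  inverse.\<close>

definition pfun :: "('u, 'p) psh => ('u, 'p, 'p) bfun" where
  "pfun X = \<lparr>bo = pops X,
     ba = (\<lambda>p q si. \<lambda>x\<in>pops X p. par X (star (fst q)) (star (fst p)) (stm (fst q) (fst p) (inv_into (fst p) si)) x)\<rparr>"

definition res :: "('u, 'p) psh => 'u graph => 'p => 'u => 'p" where
  "res X G x v = par X (star (inb G v)) G (iota G v) x"

definition dec :: "('u, 'p) psh => 'u graph => 'p => ('u => 'p) \<times> ('u => 'p)" where
  "dec X G x = (\<lambda>a\<in>gA G. col X G x a, \<lambda>v\<in>gV G. res X G x v)"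

definition Dec :: "('u, 'p) psh => 'u graph => (('u => 'p) \<times> ('u => 'p)) set" where
  "Dec X G = {(ze, y). dgr (pcol X) (pfun X) G ze y}"

lemma pcol_simps [simp]: "cols (pcol X) = pob X exc_edge" "cinv (pcol X) c = par X exc_edge exc_edge (emor exc_edge eps_dg) c"
  by (simp_all add: pcol_def)

lemma pfun_bo [simp]: "bo (pfun X) = pops X"
  by (simp add: pfun_def)

lemma popsD:
  assumes "x : pops X p"
  shows "x : pob X (star (fst p))" "s : fst p ==> col X (star (fst p)) x s = snd p s"
  using assms by (auto simp: pops_def)

context infinite_universe
begin

lemma stm_et:
  assumes "finite (S :: 'u set)" "finite S'" "bij_betw si S S'"
  shows "et (star S) (star S') (sx S si (dbl_inv S')) (\<lambda>_. undefined)"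
  using sx_et[OF assms(1) star_graph[OF assms(2)], where v = undefined and m = si] assms(3) star_nb(3)[OF assms(2)] by simp

lemma stm_hom:
  assumes "finite (S :: 'u set)" "finite S'" "bij_betw si S S'"
  shows "stm S S' si : U_hom (star S) (star S')"
  unfolding stm_def by (rule etm_hom[OF star_conn[OF assms(1)] star_conn[OF assms(2)] stm_et[OF assms]])

lemma stm_cong:
  assumes f: "finite (S :: 'u set)" and e: "!!s. s : S ==> si s = si' s"
  shows "stm S S' si = stm S S' si'"
  unfolding stm_def
proof (rule etm_cong[OF star_graph[OF f]])
  fix a assume "a : gA (star S)"
  then have a: "a : dbl S" by simp
  show "sx S si (dbl_inv S') a = sx S si' (dbl_inv S') a"
    by (rule sx_cases[OF f a, of si "dbl_inv S'"]) (simp_all add: e sx_in sx_dbl[OF f])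
qed simp

lemma stm_id:
  assumes f: "finite (S :: 'u set)"
  shows "stm S S (\<lambda>s. s) = csm_id (gmod (star S))"
proof -
  have "stm S S (\<lambda>s. s) = etm (star S) (star S) (\<lambda>a. a) (\<lambda>v. v)"
    unfolding stm_def by (rule etm_cong[OF star_graph[OF f]]) (use sx_unique[OF f, of _ "\<lambda>a. a"] in auto)
  then show ?thesis using etm_id[OF star_conn[OF f]] by simp
qed

lemma stm_comp:
  assumes f: "finite (S :: 'u set)" "finite S'" "finite S''" and s: "bij_betw si S S'" and t: "bij_betw ta S' S''"
  shows "csm_comp (gmod (star S)) (stm S' S'' ta) (stm S S' si) = stm S S'' (\<lambda>s. ta (si s))"
proof -
  have "csm_comp (gmod (star S)) (stm S' S'' ta) (stm S S' si) =
      etm (star S) (star S'') (\<lambda>a. sx S' ta (dbl_inv S'') (sx S si (dbl_inv S') a)) (\<lambda>v. undefined)"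
    unfolding stm_def
    by (rule etm_comp[OF star_conn[OF f(1)] star_conn[OF f(2)] star_conn[OF f(3)] stm_et[OF f(1,2) s] stm_et[OF f(2,3) t]])
  also have "\<dots> = stm S S'' (\<lambda>s. ta (si s))"
    unfolding stm_def
  proof (rule etm_cong[OF star_graph[OF f(1)]])
    fix a assume "a : gA (star S)"
    then have a: "a : dbl S" by simp
    have "si s : S'" if "s : S" for s using bij_betwE[OF s] that by blast
    then show "sx S' ta (dbl_inv S'') (sx S si (dbl_inv S') a) = sx S (\<lambda>s. ta (si s)) (dbl_inv S'') a"
      by (intro sx_unique[OF f(1) a, symmetric]) (simp_all add: sx_in sx_dbl[OF f(1)] sx_dbl[OF f(2)])
  qed simp
  finally show ?thesis .
qed

lemma emor_eps: "emor exc_edge (eps :: 'u) = csm_id (gmod exc_edge)"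
  by (rule edge_hom_eqI[OF U_modular[OF edge_U]])
    (use emor_hom[OF edge_conn, of eps] U_id(1)[OF edge_U] in \<open>simp_all add: U_hom_def emor_fst csm_id_def\<close>)

lemma col_gi:
  assumes X: "presheaf X" and G: "(G :: 'u graph) : U_ob" and x: "x : pob X G" and a: "a : gA G"
  shows "col X G x (gi G a) = cinv (pcol X) (col X G x a)"
proof -
  note e = emor_hom[OF U_conn[OF G] a] and d = emor_hom[OF edge_conn, of eps_dg]
  have "csm_comp (gmod exc_edge) (emor G a) (emor exc_edge eps_dg) = emor G (gi G a)"
    using U_emor(1)[OF edge_conn U_conn[OF G] e, of eps_dg] by (simp add: emor_fst)
  then show ?thesis
    unfolding col_def pcol_simps using presheafD(3)[OF X edge_U edge_U G _ e x, of "emor exc_edge eps_dg"] d by simp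
qed

lemma pcol_inv:
  assumes X: "presheaf (X :: ('u, 'p) psh)"
  shows "involutive_set (pcol X)"
proof -
  have d: "emor exc_edge (eps_dg :: 'u) : U_hom exc_edge exc_edge" by (rule emor_hom[OF edge_conn]) simp
  have "csm_comp (gmod exc_edge) (emor exc_edge eps_dg) (emor exc_edge eps_dg) = csm_id (gmod (exc_edge :: 'u graph))"
    using U_emor(1)[OF edge_conn edge_conn d, of eps_dg] by (simp add: emor_fst edge_gi emor_eps)
  then show ?thesis
    unfolding involutive_set_def
    using presheafD(1)[OF X edge_U edge_U d] presheafD(3)[OF X edge_U edge_U edge_U d d] presheafD(2)[OF X edge_U] by simp
qed

lemma pfun_functor:
  assumes X: "presheaf (X :: ('u, 'p) psh)"
  shows "bij_functor (pcol X) (pfun X)"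
  unfolding bij_functor_def
proof (intro conjI ballI)
  have hom: "finite (fst p) & finite (fst q) & bij_betw (inv_into (fst p) si) (fst q) (fst p)"
    if "p : bij_ob (pcol X)" "q : bij_ob (pcol X)" "si : bij_hom p q" for p q :: "('u, 'p) bob" and si
    using bij_obD(1)[OF that(1)] bij_obD(1)[OF that(2)] that(3) by (simp add: bij_hom_def bij_betw_inv_into)
  have m: "par X (star (fst q)) (star (fst p)) (stm (fst q) (fst p) (inv_into (fst p) si)) x : pops X q"
    if p: "p : bij_ob (pcol X)" and q: "q : bij_ob (pcol X)" and s: "si : bij_hom p q" and x: "x : pops X p"
    for p q :: "('u, 'p) bob" and si x
  proof -
    note h = hom[OF p q s]
    have h': "finite (fst p)" "finite (fst q)" "bij_betw (inv_into (fst p) si) (fst q) (fst p)" using h by auto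
    have "col X (star (fst q)) (par X (star (fst q)) (star (fst p)) (stm (fst q) (fst p) (inv_into (fst p) si)) x) t = snd q t"
      if t: "t : fst q" for t
    proof -
      have 1: "inv_into (fst p) si t : fst p" using bij_betwE[OF h'(3)] t by blast
      have 2: "si (inv_into (fst p) si t) = t" using s t by (auto simp: bij_hom_def bij_betw_inv_into_right)
      have "snd q (si (inv_into (fst p) si t)) = snd p (inv_into (fst p) si t)" using s 1 by (auto simp: bij_hom_def)
      moreover have "col X (star (fst q)) (par X (star (fst q)) (star (fst p)) (stm (fst q) (fst p) (inv_into (fst p) si)) x) t =
          col X (star (fst p)) x (inv_into (fst p) si t)"
        unfolding stm_def
        using col_etm[OF X star_U[OF h'(2)] star_U[OF h'(1)] stm_et[OF h'(2,1,3)] popsD(1)[OF x], of t] t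
        by (simp add: sx_in dbl_def)
      ultimately show ?thesis using popsD(2)[OF x 1] 2 by simp
    qed
    then show ?thesis
      unfolding pops_def
      using presheafD(1)[OF X star_U[OF h'(2)] star_U[OF h'(1)] stm_hom[OF h'(2,1,3)] popsD(1)[OF x]] by simp
  qed
  fix p q :: "('u, 'p) bob" and si assume p: "p : bij_ob (pcol X)" and q: "q : bij_ob (pcol X)" and s: "si : bij_hom p q"
  show "ba (pfun X) p q si : bo (pfun X) p \<rightarrow>\<^sub>E bo (pfun X) q" using m[OF p q s] by (simp add: pfun_def)
  fix r :: "('u, 'p) bob" and ta x assume r: "r : bij_ob (pcol X)" and t: "ta : bij_hom q r" and x': "x : bo (pfun X) p"
  then have x: "x : pops X p" by simp
  have h: "finite (fst p)" "finite (fst q)" "finite (fst r)" "bij_betw (inv_into (fst p) si) (fst q) (fst p)"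
    "bij_betw (inv_into (fst q) ta) (fst r) (fst q)" using hom[OF p q s] hom[OF q r t] by auto
  have b: "bij_betw si (fst p) (fst q)" "bij_betw ta (fst q) (fst r)" using s t by (auto simp: bij_hom_def)
  have i: "inv_into (fst p) (compose (fst p) ta si) u = inv_into (fst p) si (inv_into (fst q) ta u)" if u: "u : fst r" for u
  proof -
    have 1: "inv_into (fst q) ta u : fst q" using bij_betwE[OF h(5)] u by blast
    have 2: "inv_into (fst p) si (inv_into (fst q) ta u) : fst p" using bij_betwE[OF h(4)] 1 by blast
    have "inj_on (compose (fst p) ta si) (fst p)"
      using bij_betw_trans[OF b] by (simp add: bij_betw_def compose_def comp_def inj_on_def)
    moreover have "compose (fst p) ta si (inv_into (fst p) si (inv_into (fst q) ta u)) = u"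
      using 2 bij_betw_inv_into_right[OF b(1) 1] bij_betw_inv_into_right[OF b(2) u] by (simp add: compose_def)
    ultimately show ?thesis using inv_into_f_eq 2 by metis
  qed
  have "par X (star (fst r)) (star (fst p)) (stm (fst r) (fst p) (inv_into (fst p) (compose (fst p) ta si))) x =
      par X (star (fst r)) (star (fst q)) (stm (fst r) (fst q) (inv_into (fst q) ta))
        (par X (star (fst q)) (star (fst p)) (stm (fst q) (fst p) (inv_into (fst p) si)) x)"
    unfolding presheafD(3)[OF X star_U[OF h(3)] star_U[OF h(2)] star_U[OF h(1)] stm_hom[OF h(3,2,5)] stm_hom[OF h(2,1,4)] popsD(1)[OF x]]
      stm_comp[OF h(3,2,1,5,4)] using stm_cong[OF h(3), of "inv_into (fst p) (compose (fst p) ta si)"] i by simp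
  then show "ba (pfun X) p r (compose (fst p) ta si) x = ba (pfun X) q r ta (ba (pfun X) p q si x)"
    using x m[OF p q s x] by (simp add: pfun_def)
next
  fix p :: "('u, 'p) bob" and x assume p: "p : bij_ob (pcol X)" and x': "x : bo (pfun X) p"
  then have x: "x : pops X p" by simp
  note f = bij_obD(1)[OF p]
  have "stm (fst p) (fst p) (inv_into (fst p) (\<lambda>s\<in>fst p. s)) = stm (fst p) (fst p) (\<lambda>s. s)"
  proof (rule stm_cong[OF f])
    fix s assume "s : fst p"
    then show "inv_into (fst p) (\<lambda>s\<in>fst p. s) s = s" by (intro inv_into_f_eq) (auto simp: inj_on_def)
  qed
  then show "ba (pfun X) p p (\<lambda>s\<in>fst p. s) x = x"
    using x stm_id[OF f] presheafD(2)[OF X star_U[OF f] popsD(1)[OF x]] by (simp add: pfun_def)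
qed

lemma res_in:
  assumes X: "presheaf X" and G: "(G :: 'u graph) : U_ob" and x: "x : pob X G" and v: "v : gV G"
  shows "res X G x v : pob X (star (inb G v))"
    "a : dbl (inb G v) ==> col X (star (inb G v)) (res X G x v) a = col X G x (sx (inb G v) (\<lambda>s. s) (gi G) a)"
proof -
  note c = U_conn[OF G]
  note g = conn_graph[OF c]
  note s = star_U[OF finite_inb[OF g, of v]]
  show "res X G x v : pob X (star (inb G v))"
    unfolding res_def by (rule presheafD(1)[OF X s G iota_hom[OF c v] x])
  show "col X (star (inb G v)) (res X G x v) a = col X G x (sx (inb G v) (\<lambda>s. s) (gi G) a)" if "a : dbl (inb G v)"
    unfolding res_def iota_def by (rule col_etm[OF X s G iota_et[OF g v] x]) (simp add: that)
qed

lemma dec_dgr: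
  assumes X: "presheaf X" and G: "(G :: 'u graph) : U_ob" and x: "x : pob X G"
  shows "dgr (pcol X) (pfun X) G (\<lambda>a\<in>gA G. col X G x a) (\<lambda>v\<in>gV G. res X G x v)"
proof (rule dgrI)
  note c = U_conn[OF G]
  note g = conn_graph[OF c]
  show "connected_graph G" by (rule c)
  show "(\<lambda>a\<in>gA G. col X G x a) a : cols (pcol X)" if "a : gA G" for a using col_in[OF X G x that] that by simp
  show "(\<lambda>a\<in>gA G. col X G x a) (gi G a) = cinv (pcol X) ((\<lambda>a\<in>gA G. col X G x a) a)" if "a : gA G" for a
    using col_gi[OF X G x that] that gi_in[OF g that] by simp
  show "(\<lambda>v\<in>gV G. res X G x v) v : bo (pfun X) (at_vertex G (\<lambda>a\<in>gA G. col X G x a) v)" if v: "v : gV G" for v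
    using res_in[OF X G x v] v inb_gA[OF g] by (simp add: pops_def dbl_def sx_in)
qed simp_all

lemma dec_in: "presheaf X ==> (G :: 'u graph) : U_ob ==> x : pob X G ==> dec X G x : Dec X G"
  using dec_dgr by (simp add: dec_def Dec_def)

text \<open>The Segal core uses the stars \<open>star_at G v\<close>, decorations use
  \<open>star (inb G v)\<close>; \<open>kap\<close> and \<open>lam\<close> translate. A matching
  family also colors the arcs of \<open>G\<close>: each edge has an end at a vertex, where
  \<open>Z\<close> reads its color, and on internal edges matching makes the two readings
  agree.\<close>

lemma match_dec:
  assumes X: "presheaf (X :: ('u, 'p) psh)" and G: "(G :: 'u graph) : U_ob" and V: "gV G ~= {}"
  defines "Z \<equiv> \<lambda>z a. if a : dA G then col X (star_at G (tA G a)) (z (tA G a)) a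
       else col X (star_at G (tA G (gi G a))) (z (tA G (gi G a))) (dbl_inv (nb G (tA G (gi G a))) (gi G a))"
  defines "Q \<equiv> \<lambda>z. (\<lambda>a\<in>gA G. Z z a,
     \<lambda>v\<in>gV G. par X (star (inb G v)) (star_at G v) (etm (star (inb G v)) (star_at G v) (kap G v) (\<lambda>_. v)) (z v))"
  shows "bij_betw Q (match X G) (Dec X G)"
    "x : pob X G ==> Q (\<lambda>v\<in>gV G. par X (star_at G v) G (vertex_mor G v) x) = dec X G x"
proof -
  note c = U_conn[OF G]
  note g = conn_graph[OF c]
  note T = star_at_U[OF g] and S = star_U[OF finite_inb[OF g]]
  note Tc = star_at_conn[OF g] and Sc = star_conn[OF finite_inb[OF g]]
  note kl = kap_lam[OF g]
  let ?K = "\<lambda>v. etm (star (inb G v)) (star_at G v) (kap G v) (\<lambda>_. v)"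
  let ?L = "\<lambda>v. etm (star_at G v) (star (inb G v)) (lam G v) (\<lambda>_. undefined)"
  have Kh: "?K v : U_hom (star (inb G v)) (star_at G v)" if "v : gV G" for v by (rule etm_hom[OF Sc Tc kl(1)[OF that]])
  have Lh: "?L v : U_hom (star_at G v) (star (inb G v))" if "v : gV G" for v by (rule etm_hom[OF Tc Sc kl(2)[OF that]])
  have KL: "csm_comp (gmod (star_at G v)) (?K v) (?L v) = csm_id (gmod (star_at G v))" if v: "v : gV G" for v
    unfolding etm_comp[OF Tc Sc Tc kl(2)[OF v] kl(1)[OF v]] etm_id[OF Tc, symmetric]
    by (rule etm_cong[OF star_at_graph[OF g]]) (use kl(4)[OF v] in auto)
  have LK: "csm_comp (gmod (star (inb G v))) (?L v) (?K v) = csm_id (gmod (star (inb G v)))" if v: "v : gV G" for v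
    unfolding etm_comp[OF Sc Tc Sc kl(1)[OF v] kl(2)[OF v]] etm_id[OF Sc, symmetric]
    by (rule etm_cong[OF star_graph[OF finite_inb[OF g]]]) (use kl(3)[OF v] in auto)
  have vc: "vertex_col G v a = a" "vertex_col G v (dbl_inv (nb G v) a) = gi G a" if "a : nb G v" for v a
    using that dbl_inv_props(3,4,5)[OF finite_nb[OF g] nb_dbl[OF that]] nb_dbl[OF that] by (simp_all add: vertex_col_def)
  have cstar: "col X (star_at G v) y (dbl_inv (nb G v) a) = cinv (pcol X) (col X (star_at G v) y a)"
    if "y : pob X (star_at G v)" "a : dbl (nb G v)" for v y a
    using col_gi[OF X T that(1)] that(2) by simp
  have tv: "tA G a = v" "a : dA G" "v : gV G" if "a : nb G v" for a v
    using that nb_iff[OF g] nb_gV[OF g that] by auto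
  have Zn: "Z z a = col X (star_at G v) (z v) a" if "a : nb G v" for z a v
    using tv[OF that] by (simp add: Z_def)
  have Zi: "Z z (gi G a) = col X (star_at G v) (z v) (dbl_inv (nb G v) a)" if z: "z : match X G" and a: "a : nb G v" for z a v
    using tv[OF a] matchD(3)[OF z tv(2)[OF a]] gi_gi[OF g nb_gA[OF g a]] by (simp add: Z_def)
  have ac: "(EX v:gV G. a : nb G v) | (EX v:gV G. gi G a : nb G v)" if "a : gA G" for a
    using conn_arc_cases[OF c V that] tA_nb[OF g] by blast
  \<comment> \<open>The inverse of \<open>Q\<close> forgets the coloring, which can be recovered:
    each edge of \<open>G\<close> occurs in some star, whose element carries its color.\<close>
  let ?R = "\<lambda>(ze :: 'u => 'p, y). \<lambda>v\<in>gV G. par X (star_at G v) (star (inb G v)) (?L v) (y v)"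
  have Qd: "dgr (pcol X) (pfun X) G (fst (Q z)) (snd (Q z))" if z: "z : match X G" for z
  proof (rule dgrI)
    note zp = matchD(1)[OF z]
    have Zc: "Z z a : pob X exc_edge & Z z (gi G a) = cinv (pcol X) (Z z a)" if a: "a : nb G v" for a v
      unfolding Zn[OF a] Zi[OF z a] cstar[OF zp[OF tv(3)[OF a]] nb_dbl[OF a]]
      using col_in[OF X T zp[OF tv(3)[OF a]], of a] nb_dbl[OF a] by simp
    have Za: "Z z a : pob X exc_edge & Z z (gi G a) = cinv (pcol X) (Z z a)" if a: "a : gA G" for a
      using ac[OF a]
    proof
      assume "EX v:gV G. a : nb G v" then show ?thesis using Zc by blast
    next
      assume "EX v:gV G. gi G a : nb G v"
      then obtain v where "gi G a : nb G v" by blast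
      from Zc[OF this] show ?thesis
        using involutiveD[OF pcol_inv[OF X], of "Z z (gi G a)"] gi_gi[OF g a] by simp
    qed
    show "connected_graph G" by (rule c)
    show "fst (Q z) : extensional (gA G)" "snd (Q z) : extensional (gV G)" by (simp_all add: Q_def)
    show "fst (Q z) a : cols (pcol X)" if "a : gA G" for a using Za[OF that] that by (simp add: Q_def)
    show "fst (Q z) (gi G a) = cinv (pcol X) (fst (Q z) a)" if "a : gA G" for a
      using Za[OF that] that gi_in[OF g that] by (simp add: Q_def)
    fix v assume v: "v : gV G"
    have "col X (star (inb G v)) (par X (star (inb G v)) (star_at G v) (?K v) (z v)) s = Z z s" if s: "s : inb G v" for s
    proof -
      have sn: "gi G s : nb G v" "gi G (gi G s) = s" using s inb_iff[OF g] gi_gi[OF g] by auto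
      have "kap G v s = dbl_inv (nb G v) (gi G s)" using s by (simp add: kap_def sx_in)
      then show ?thesis
        using col_etm[OF X S T kl(1)[OF v] zp[OF v], of s] s Zi[OF z sn(1)] sn(2) by (simp add: dbl_def)
    qed
    then show "snd (Q z) v : bo (pfun X) (at_vertex G (fst (Q z)) v)"
      using v presheafD(1)[OF X S T Kh[OF v] zp[OF v]] inb_gA[OF g] by (simp add: Q_def pops_def)
  qed
  have Rm: "?R (ze, y) : match X G" "!!a. a : gA G ==> Z (?R (ze, y)) a = ze a"
    if d: "dgr (pcol X) (pfun X) G ze y" for ze y
  proof -
    note d' = dgrD[OF d]
    have yv: "y v : pops X (at_vertex G ze v)" if "v : gV G" for v using d'(6)[OF that] by simp
    have yp: "y v : pob X (star (inb G v))" if "v : gV G" for v using popsD(1)[OF yv[OF that]] by simp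
    have rp: "?R (ze, y) v : pob X (star_at G v)" if "v : gV G" for v
      using presheafD(1)[OF X T S Lh[OF that] yp[OF that]] that by simp
    have cr: "col X (star_at G v) (?R (ze, y) v) a = ze a" "col X (star_at G v) (?R (ze, y) v) (dbl_inv (nb G v) a) = ze (gi G a)"
      if a: "a : nb G v" for v a
    proof -
      note v = tv(3)[OF a]
      have i: "gi G a : inb G v" "gi G (gi G a) = a" using a gi_gi[OF g nb_gA[OF g a]] by (auto simp: inb_def)
      have l: "lam G v a = dbl_inv (inb G v) (gi G a)" using a by (simp add: lam_def sx_in)
      have yi: "col X (star (inb G v)) (y v) (gi G a) = ze (gi G a)" using popsD(2)[OF yv[OF v], of "gi G a"] i by simp
      have "col X (star_at G v) (?R (ze, y) v) a = cinv (pcol X) (ze (gi G a))"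
        using col_etm[OF X T S kl(2)[OF v] yp[OF v], of a] nb_dbl[OF a] l v yi
          col_gi[OF X S yp[OF v], of "gi G a"] i by (simp add: dbl_def)
      also have "\<dots> = ze a" using d'(8)[OF gi_in[OF g nb_gA[OF g a]]] i(2) by simp
      finally show r: "col X (star_at G v) (?R (ze, y) v) a = ze a" .
      show "col X (star_at G v) (?R (ze, y) v) (dbl_inv (nb G v) a) = ze (gi G a)"
        unfolding cstar[OF rp[OF v] nb_dbl[OF a]] r using d'(8)[OF nb_gA[OF g a]] by simp
    qed
    show m: "?R (ze, y) : match X G"
      unfolding match_def
    proof (intro CollectI conjI PiE_I ballI impI)
      fix a assume a: "a : dA G" "gi G a : dA G"
      show "col X (star_at G (tA G a)) (?R (ze, y) (tA G a)) (dbl_inv (nb G (tA G a)) a) =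
        col X (star_at G (tA G (gi G a))) (?R (ze, y) (tA G (gi G a))) (gi G a)"
        unfolding cr(2)[OF tA_nb(1)[OF g a(1)]] cr(1)[OF tA_nb(1)[OF g a(2)]] ..
    qed (use rp in auto)
    fix a assume a: "a : gA G"
    from ac[OF a] show "Z (?R (ze, y)) a = ze a"
    proof (elim disjE bexE)
      fix v assume v: "a : nb G v" show ?thesis unfolding Zn[OF v] by (rule cr(1)[OF v])
    next
      fix v assume v: "gi G a : nb G v"
      show ?thesis using Zi[OF m v] cr(2)[OF v] gi_gi[OF g a] by simp
    qed
  qed
  show "bij_betw Q (match X G) (Dec X G)"
  proof (rule bij_betw_byWitness[where f' = ?R])
    show "ALL z:match X G. ?R (Q z) = z"
    proof
      fix z assume z: "z : match X G"
      have "par X (star_at G v) (star (inb G v)) (?L v) (par X (star (inb G v)) (star_at G v) (?K v) (z v)) = z v" if v: "v : gV G" for v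
        unfolding presheafD(3)[OF X T S T Lh[OF v] Kh[OF v] matchD(1)[OF z v]] KL[OF v] by (rule presheafD(2)[OF X T matchD(1)[OF z v]])
      then show "?R (Q z) = z" using matchD(2)[OF z] by (intro extensionalityI[where A = "gV G"]) (auto simp: Q_def)
    qed
    show "ALL d:Dec X G. Q (?R d) = d"
    proof
      fix d assume "d : Dec X G"
      then obtain ze y where dd: "d = (ze, y)" and d: "dgr (pcol X) (pfun X) G ze y" by (auto simp: Dec_def)
      have "par X (star (inb G v)) (star_at G v) (?K v) (par X (star_at G v) (star (inb G v)) (?L v) (y v)) = y v" if v: "v : gV G" for v
      proof -
        have yp: "y v : pob X (star (inb G v))" using popsD(1)[of "y v" X] dgrD(6)[OF d v] by fastforce
        show ?thesis unfolding presheafD(3)[OF X S T S Kh[OF v] Lh[OF v] yp] LK[OF v] by (rule presheafD(2)[OF X S yp])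
      qed
      then have "snd (Q (?R (ze, y))) = y"
        using dgrD(10)[OF d] by (intro extensionalityI[where A = "gV G"]) (auto simp: Q_def)
      moreover have "fst (Q (?R (ze, y))) = ze"
        using dgrD(9)[OF d] Rm(2)[OF d] by (intro extensionalityI[where A = "gA G"]) (auto simp: Q_def)
      ultimately show "Q (?R d) = d" unfolding dd by (simp only: prod_eq_iff fst_conv snd_conv simp_thms)
    qed
    show "Q ` match X G \<subseteq> Dec X G" using Qd by (auto simp: Dec_def case_prod_unfold)
    show "?R ` Dec X G \<subseteq> match X G" using Rm(1) by (auto simp: Dec_def)
  qed
  assume x: "x : pob X G"
  let ?z = "\<lambda>v\<in>gV G. par X (star_at G v) G (vertex_mor G v) x"
  have cz: "col X (star_at G v) (?z v) a = col X G x (vertex_col G v a)" if v: "v : gV G" and a: "a : dbl (nb G v)" for v a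
    using col_etm[OF X T G kl(7)[OF v] x, of a] a v vertex_mor_eq(1)[OF c v] by simp
  have "Z ?z a = col X G x a" if a: "a : gA G" for a
  proof (cases "a : dA G")
    case True
    note t = tA_nb[OF g True]
    show ?thesis using True cz[OF t(2) nb_dbl[OF t(1)]] vc(1)[OF t(1)] by (simp add: Z_def)
  next
    case False
    then have "gi G a : dA G" using conn_arc_cases[OF c V a] by blast
    note t = tA_nb[OF g this]
    show ?thesis using False cz[OF t(2) dbl_inv_dbl[OF g t(1)]] vc(2)[OF t(1)] gi_gi[OF g a] by (simp add: Z_def)
  qed
  moreover have "par X (star (inb G v)) (star_at G v) (?K v) (?z v) = res X G x v" if v: "v : gV G" for v
  proof -
    have "csm_comp (gmod (star (inb G v))) (vertex_mor G v) (?K v) = iota G v"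
      unfolding vertex_mor_eq(1)[OF c v] iota_def etm_comp[OF Sc Tc c kl(1)[OF v] kl(7)[OF v]]
      by (rule etm_cong[OF star_graph[OF finite_inb[OF g]]]) (use kl(5)[OF v] in auto)
    then show ?thesis
      using presheafD(3)[OF X S T G Kh[OF v] vertex_mor_eq(2)[OF c v] x] v by (simp add: res_def)
  qed
  ultimately show "Q ?z = dec X G x" unfolding Q_def dec_def by (auto simp: fun_eq_iff)
qed

text \<open>Such a \<open>G\<close> is isomorphic to the exceptional edge, and a decoration of it is
  the color of one arc.\<close>

lemma dec_no_vertices:
  assumes X: "presheaf (X :: ('u, 'p) psh)" and G: "(G :: 'u graph) : U_ob" and V: "gV G = {}"
  shows "bij_betw (dec X G) (pob X G) (Dec X G)"
proof -
  note c = U_conn[OF G]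
  note g = conn_graph[OF c]
  obtain a where a: "a : gA G" using conn_nonempty[OF c] V by blast
  have A: "gA G = {a, gi G a}" by (rule conn_edge[OF c V a])
  let ?f = "etm G exc_edge (\<lambda>b. if b = a then eps else eps_dg) (\<lambda>v. v)"
  have e: "et G exc_edge (\<lambda>b. if b = a then eps else eps_dg) (\<lambda>v. v)"
    unfolding et_def using A V gi_neq[OF g a] gi_gi[OF g a] edge_gi by auto
  note fh = etm_hom[OF c edge_conn e] and eh = emor_hom[OF c a]
  have fe: "csm_comp (gmod G) (emor G a) ?f = csm_id (gmod G)"
    unfolding emor_def etm_comp[OF c edge_conn c e emap_et[OF g a]] etm_id[OF c, symmetric]
    by (rule etm_cong[OF g]) (use A gi_neq[OF g a] eps_dg_neq in \<open>auto simp: emap_def\<close>)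
  have ef: "csm_comp (gmod exc_edge) ?f (emor G a) = csm_id (gmod exc_edge)"
    using etm_emor[OF c edge_conn e a] emor_eps by simp
  have bk: "par X G exc_edge ?f (col X G x a) = x" if "x : pob X G" for x
    unfolding col_def presheafD(3)[OF X G edge_U G fh eh that] fe by (rule presheafD(2)[OF X G that])
  show ?thesis
  proof (rule bij_betw_byWitness[where f' = "\<lambda>(ze, y). par X G exc_edge ?f (ze a)"])
    show "ALL x:pob X G. (\<lambda>(ze, y). par X G exc_edge ?f (ze a)) (dec X G x) = x" using bk a by (simp add: dec_def)
    show "ALL d:Dec X G. dec X G ((\<lambda>(ze, y). par X G exc_edge ?f (ze a)) d) = d"
    proof
      fix d assume "d : Dec X G"
      then obtain ze y where dd: "d = (ze, y)" and d: "dgr (pcol X) (pfun X) G ze y" by (auto simp: Dec_def)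
      note d' = dgrD[OF d]
      have z: "ze a : pob X exc_edge" using d'(7)[OF a] by simp
      note x = presheafD(1)[OF X G edge_U fh z]
      have ca: "col X G (par X G exc_edge ?f (ze a)) a = ze a"
        unfolding col_def presheafD(3)[OF X edge_U G edge_U eh fh z] ef by (rule presheafD(2)[OF X edge_U z])
      have "col X G (par X G exc_edge ?f (ze a)) b = ze b" if "b : gA G" for b
        using that A ca col_gi[OF X G x a] d'(8)[OF a] by auto
      then have "(\<lambda>b\<in>gA G. col X G (par X G exc_edge ?f (ze a)) b) = ze"
        using d'(9) by (intro extensionalityI[where A = "gA G"]) auto
      moreover have "y = (\<lambda>_. undefined)" using d'(10) V by (simp add: extensional_def fun_eq_iff)
      ultimately show "dec X G ((\<lambda>(ze, y). par X G exc_edge ?f (ze a)) d) = d"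
        unfolding dd dec_def by (simp add: V) (simp add: restrict_def)
    qed
    show "dec X G ` pob X G \<subseteq> Dec X G" using dec_in[OF X G] by blast
    show "(\<lambda>(ze, y). par X G exc_edge ?f (ze a)) ` Dec X G \<subseteq> pob X G"
      using presheafD(1)[OF X G edge_U fh] dgrD(7)[of "pcol X" "pfun X" G, OF _ a] by (fastforce simp: Dec_def)
  qed
qed

text \<open>\<open>segal\<close> exempts graphs without vertices. For these the condition on
  decorations holds for every presheaf, so it can be stated for all graphs.\<close>

lemma segal_dec:
  assumes X: "presheaf (X :: ('u, 'p) psh)"
  shows "segal X \<longleftrightarrow> (ALL G:U_ob. bij_betw (dec X G) (pob X G) (Dec X G))"
proof -
  have "bij_betw (\<lambda>x. \<lambda>v\<in>gV G. par X (star_at G v) G (vertex_mor G v) x) (pob X G) (match X G) \<longleftrightarrow>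
      bij_betw (dec X G) (pob X G) (Dec X G)" if G: "G : U_ob" and V: "gV G ~= {}" for G :: "'u graph"
  proof (rule bij_square[OF _ match_dec(1)[OF X G V]])
    show "bij_betw (\<lambda>x. x) (pob X G) (pob X G)" by (simp add: bij_betw_def)
    show "(\<lambda>x. \<lambda>v\<in>gV G. par X (star_at G v) G (vertex_mor G v) x) ` pob X G \<subseteq> match X G"
      using vertex_in_match[OF X G] by blast
  qed (rule match_dec(2)[OF X G V])
  then show ?thesis unfolding segal_match[OF X] using dec_no_vertices[OF X] by blast
qed

end

context infinite_universe
begin

section \<open>The Segal condition for nerves, and its invariance under isomorphism\<close>

lemma star_hom_eqI:
  assumes P: "modular_operad P" and S: "finite (S :: 'u set)"
    and h: "h : csm_hom (gmod (star S)) P" "h' : csm_hom (gmod (star S)) P"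
    and e: "!!s. s : S ==> fst h s = fst h' s" "vals (star S) h undefined = vals (star S) h' undefined"
  shows "h = h'"
proof (rule gmod_hom_eqI[OF P star_conn[OF S] h])
  note d = hom_vals[OF P star_conn[OF S] h(1)] hom_vals[OF P star_conn[OF S] h(2)]
  fix a assume "a : gA (star S)"
  then have a: "a : dbl S" by simp
  have "fst h (dbl_inv S s) = fst h' (dbl_inv S s)" if "s : S" for s
    using dgrD(8)[OF d(1), of s] dgrD(8)[OF d(2), of s] that e(1) by (simp add: dbl_def)
  then show "fst h a = fst h' a"
    using e(1) dbl_inv_props(4,5)[OF S a] by metis
qed (simp add: e(2))

lemma nerve_col:
  assumes P: "modular_operad P" and G: "connected_graph (G :: 'u graph)" and h: "h : csm_hom (gmod G) P" and a: "a : gA G"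
  shows "col (nerve P) G h a : csm_hom (gmod exc_edge) P" "fst (col (nerve P) G h a) eps = fst h a"
  unfolding col_def nerve_simps(2)[OF h]
  using U_comp[OF edge_conn G P emor_hom[OF G a] h] by (simp_all add: comp_fst emor_fst)

lemma nerve_res:
  assumes P: "modular_operad P" and G: "connected_graph (G :: 'u graph)" and h: "h : csm_hom (gmod G) P" and v: "v : gV G"
  shows "res (nerve P) G h v : csm_hom (gmod (star (inb G v))) P"
    "vals (star (inb G v)) (res (nerve P) G h v) undefined = vals G h v"
    "s : inb G v ==> fst (res (nerve P) G h v) s = fst h s"
  unfolding res_def nerve_simps(2)[OF h]
  using U_comp[OF star_conn[OF finite_inb[OF conn_graph[OF G]]] G P iota_hom[OF G v] h] nerve_iota[OF P G v h]
  by (simp_all add: star_col_in)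

lemma star_hom_bo:
  assumes P: "modular_operad P" and S: "finite (S :: 'u set)" and h: "h : csm_hom (gmod (star S)) P"
  shows "vals (star S) h undefined : bo (mop P) (S, restrict (fst h) S)"
  using dgrD(6)[OF hom_vals[OF P star_conn[OF S] h], of undefined] star_nb(3)[OF S] by (simp add: at_vertex_def)

text \<open>A decoration of \<open>G\<close> in the nerve consists of morphisms out of edges and
  stars. Reading off their colors and values gives a decoration of \<open>G\<close> in
  \<open>P\<close>, and \<open>mk\<close> turns this into the unique morphism that restricts to the
  given ones.\<close>

lemma nerve_segal:
  assumes P: "modular_operad (P :: ('u, 'c, 'x) modop)"
  shows "segal (nerve P)"
  unfolding segal_dec[OF nerve_presheaf[OF P]]
proof (intro ballI)
  fix G :: "'u graph" assume G: "G : U_ob"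
  note c = U_conn[OF G]
  note g = conn_graph[OF c]
  note X = nerve_presheaf[OF P]
  let ?ph = "\<lambda>ze. \<lambda>a\<in>gA G. fst (ze a) eps" and ?z = "\<lambda>y. \<lambda>v\<in>gV G. vals (star (inb G v)) (y v) undefined"
  have d: "dgr (mcol P) (mop P) G (?ph ze) (?z y)" (is ?A)
    "!!v. v : gV G ==> y v : csm_hom (gmod (star (inb G v))) P"
    "!!v s. v : gV G ==> s : inb G v ==> fst (y v) s = fst (ze s) eps"
    "!!a. a : gA G ==> ze a : csm_hom (gmod exc_edge) P"
    if dd: "dgr (pcol (nerve P)) (pfun (nerve P)) G ze y" for ze y
  proof -
    note d' = dgrD[OF dd]
    show z: "ze a : csm_hom (gmod exc_edge) P" if "a : gA G" for a using d'(7)[OF that] by (simp add: nerve_simps)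
    have yp: "y v : pops (nerve P) (at_vertex G ze v)" if "v : gV G" for v using d'(6)[OF that] by simp
    show yh: "y v : csm_hom (gmod (star (inb G v))) P" if "v : gV G" for v
      using popsD(1)[OF yp[OF that]] by (simp add: nerve_simps)
    show ys: "fst (y v) s = fst (ze s) eps" if "v : gV G" "s : inb G v" for v s
      using popsD(2)[OF yp[OF that(1)], of s] that nerve_col(2)[OF P star_conn[OF finite_inb[OF g]] yh[OF that(1)], of s]
      by (simp add: dbl_def)
    have dz: "dgr (mcol P) (mop P) exc_edge (fst (ze a)) (vals exc_edge (ze a))" if "a : gA G" for a
      by (rule hom_vals[OF P edge_conn z[OF that]])
    show ?A
    proof (rule dgrI[OF c])
      show "?ph ze a : cols (mcol P)" if "a : gA G" for a using dgrD(7)[OF dz[OF that], of eps] that by simp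
      show "?ph ze (gi G a) = cinv (mcol P) (?ph ze a)" if a: "a : gA G" for a
        using d'(8)[OF a] dgrD(8)[OF dz[OF a], of eps] a gi_in[OF g a] z[OF a] by (simp add: nerve_simps comp_fst emor_fst edge_gi)
      fix v assume v: "v : gV G"
      have "restrict (fst (y v)) (inb G v) = restrict (?ph ze) (inb G v)"
        using ys[OF v] inb_gA[OF g] by (intro restrict_ext) auto
      then show "?z y v : bo (mop P) (at_vertex G (?ph ze) v)"
        using star_hom_bo[OF P finite_inb[OF g] yh[OF v]] v by (simp add: at_vertex_def)
    qed simp_all
  qed
  have inj: "h = h'" if h: "h : csm_hom (gmod G) P" "h' : csm_hom (gmod G) P" and e: "dec (nerve P) G h = dec (nerve P) G h'" for h h'
  proof (rule gmod_hom_eqI[OF P c h])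
    have "(\<lambda>a\<in>gA G. col (nerve P) G h a) = (\<lambda>a\<in>gA G. col (nerve P) G h' a)" using e by (simp add: dec_def)
    then show "fst h a = fst h' a" if "a : gA G" for a
      using that nerve_col(2)[OF P c h(1) that] nerve_col(2)[OF P c h(2) that] by (metis restrict_apply')
    have "(\<lambda>v\<in>gV G. res (nerve P) G h v) = (\<lambda>v\<in>gV G. res (nerve P) G h' v)" using e by (simp add: dec_def)
    then show "vals G h v = vals G h' v" if "v : gV G" for v
      using that nerve_res(2)[OF P c h(1) that] nerve_res(2)[OF P c h(2) that] by (metis restrict_apply')
  qed
  have surj: "EX h:csm_hom (gmod G) P. dec (nerve P) G h = (ze, y)"
    if dd: "dgr (pcol (nerve P)) (pfun (nerve P)) G ze y" for ze y
  proof
    note D = d[OF dd] and d' = dgrD[OF dd]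
    let ?h = "mk P G (?ph ze) (?z y)"
    show h: "?h : csm_hom (gmod G) P" by (rule mk_hom[OF P D(1)])
    have "col (nerve P) G ?h a = ze a" if a: "a : gA G" for a
      by (rule edge_hom_eqI[OF P nerve_col(1)[OF P c h a] D(4)[OF a]]) (simp add: nerve_col(2)[OF P c h a] a)
    moreover have "res (nerve P) G ?h v = y v" if v: "v : gV G" for v
      using nerve_res[OF P c h v] D(2,3)[OF v] mk_vals[OF P D(1)] v inb_gA[OF g]
      by (intro star_hom_eqI[OF P finite_inb[OF g]]) auto
    ultimately show "dec (nerve P) G ?h = (ze, y)"
      using d'(9,10) by (auto simp: dec_def fun_eq_iff extensional_def)
  qed
  show "bij_betw (dec (nerve P) G) (pob (nerve P) G) (Dec (nerve P) G)"
    unfolding bij_betw_def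
  proof
    show "inj_on (dec (nerve P) G) (pob (nerve P) G)" using inj by (intro inj_onI) (simp add: nerve_simps)
    show "dec (nerve P) G ` pob (nerve P) G = Dec (nerve P) G"
    proof
      show "dec (nerve P) G ` pob (nerve P) G \<subseteq> Dec (nerve P) G" using dec_in[OF X G] by blast
      show "Dec (nerve P) G \<subseteq> dec (nerve P) G ` pob (nerve P) G"
      proof
        fix e assume "e : Dec (nerve P) G"
        then obtain ze y where e: "e = (ze, y)" "dgr (pcol (nerve P)) (pfun (nerve P)) G ze y" by (auto simp: Dec_def)
        from surj[OF e(2)] obtain h where "h : csm_hom (gmod G) P" "dec (nerve P) G h = e" unfolding e(1) by blast
        then show "e : dec (nerve P) G ` pob (nerve P) G" unfolding nerve_simps by blast
      qed
    qed
  qed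
qed

lemma psh_isoE:
  assumes "psh_iso (X :: ('u, 'p) psh) Y"
  obtains ta si where "ta : psh_hom X Y" "si : psh_hom Y X"
    "!!G x. G : U_ob ==> x : pob X G ==> si G (ta G x) = x" "!!G y. G : U_ob ==> y : pob Y G ==> ta G (si G y) = y"
proof -
  obtain ta si where t: "ta : psh_hom X Y" "si : psh_hom Y X"
    and c: "psh_comp X si ta = psh_id X" "psh_comp Y ta si = psh_id Y"
    using assms unfolding psh_iso_def by blast
  have "si G (ta G x) = x" if "G : U_ob" "x : pob X G" for G x
    using psh_comp_apply[OF that, of si ta] c(1) that by (simp add: psh_id_def)
  moreover have "ta G (si G y) = y" if "G : U_ob" "y : pob Y G" for G y
    using psh_comp_apply[OF that, of ta si] c(2) that by (simp add: psh_id_def)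
  ultimately show ?thesis using that t by blast
qed

lemma match_nat:
  assumes t: "ta : psh_hom X Y" and G: "(G :: 'u graph) : U_ob" and z: "z : match X G"
  shows "(\<lambda>v\<in>gV G. ta (star_at G v) (z v)) : match Y G"
  unfolding match_def
proof (intro CollectI conjI PiE_I ballI impI)
  note g = conn_graph[OF U_conn[OF G]]
  note n = col_nat[OF t star_at_U[OF g] matchD(1)[OF z]]
  fix a assume a: "a : dA G" "gi G a : dA G"
  note A = tA_nb[OF g a(1)] and B = tA_nb[OF g a(2)]
  show "col Y (star_at G (tA G a)) ((\<lambda>v\<in>gV G. ta (star_at G v) (z v)) (tA G a)) (dbl_inv (nb G (tA G a)) a) =
     col Y (star_at G (tA G (gi G a))) ((\<lambda>v\<in>gV G. ta (star_at G v) (z v)) (tA G (gi G a))) (gi G a)"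
    using n[OF A(2), of "dbl_inv (nb G (tA G a)) a"] n[OF B(2), of "gi G a"] matchD(3)[OF z a]
      dbl_inv_dbl[OF g A(1)] nb_dbl[OF B(1)] A(2) B(2) by simp
qed (use psh_homD(3)[OF t star_at_U[OF conn_graph[OF U_conn[OF G]]] matchD(1)[OF z]] in auto)

text \<open>The isomorphism transports matching families, compatibly with restriction to the
  stars.\<close>

lemma segal_iso:
  assumes X: "presheaf (X :: ('u, 'p) psh)" and Y: "presheaf (Y :: ('u, 'q) psh)" and i: "psh_iso X Y" and s: "segal Y"
  shows "segal X"
proof -
  obtain ta si where t: "ta : psh_hom X Y" and s': "si : psh_hom Y X"
    and st: "!!G x. G : U_ob ==> x : pob X G ==> si G (ta G x) = x" and ts: "!!G y. G : U_ob ==> y : pob Y G ==> ta G (si G y) = y"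
    using psh_isoE[OF i] by blast
  have "bij_betw (\<lambda>x. \<lambda>v\<in>gV G. par X (star_at G v) G (vertex_mor G v) x) (pob X G) (match X G) \<longleftrightarrow>
      bij_betw (\<lambda>x. \<lambda>v\<in>gV G. par Y (star_at G v) G (vertex_mor G v) x) (pob Y G) (match Y G)"
    if G: "G : U_ob" for G :: "'u graph"
  proof (rule bij_square)
    note c = U_conn[OF G]
    note T = star_at_U[OF conn_graph[OF c]]
    show "bij_betw (ta G) (pob X G) (pob Y G)"
      by (rule bij_betw_byWitness[where f' = "si G"]) (use st[OF G] ts[OF G] psh_homD(3)[OF t G] psh_homD(3)[OF s' G] in auto)
    show "bij_betw (\<lambda>z. \<lambda>v\<in>gV G. ta (star_at G v) (z v)) (match X G) (match Y G)"
    proof (rule bij_betw_byWitness[where f' = "\<lambda>z. \<lambda>v\<in>gV G. si (star_at G v) (z v)"])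
      show "ALL z:match X G. (\<lambda>v\<in>gV G. si (star_at G v) ((\<lambda>v\<in>gV G. ta (star_at G v) (z v)) v)) = z"
      proof
        fix z assume z: "z : match X G"
        show "(\<lambda>v\<in>gV G. si (star_at G v) ((\<lambda>v\<in>gV G. ta (star_at G v) (z v)) v)) = z"
          using st[OF T matchD(1)[OF z]] matchD(2)[OF z] by (intro extensionalityI[where A = "gV G"]) auto
      qed
      show "ALL z:match Y G. (\<lambda>v\<in>gV G. ta (star_at G v) ((\<lambda>v\<in>gV G. si (star_at G v) (z v)) v)) = z"
      proof
        fix z assume z: "z : match Y G"
        show "(\<lambda>v\<in>gV G. ta (star_at G v) ((\<lambda>v\<in>gV G. si (star_at G v) (z v)) v)) = z"
          using ts[OF T matchD(1)[OF z]] matchD(2)[OF z] by (intro extensionalityI[where A = "gV G"]) auto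
      qed
    qed (use match_nat[OF t G] match_nat[OF s' G] in auto)
    show "(\<lambda>x. \<lambda>v\<in>gV G. par X (star_at G v) G (vertex_mor G v) x) ` pob X G \<subseteq> match X G"
      using vertex_in_match[OF X G] by blast
    show "(\<lambda>v\<in>gV G. ta (star_at G v) ((\<lambda>v\<in>gV G. par X (star_at G v) G (vertex_mor G v) x) v)) =
        (\<lambda>v\<in>gV G. par Y (star_at G v) G (vertex_mor G v) (ta G x))" if "x : pob X G" for x
      using psh_homD(4)[OF t T G vertex_mor_eq(2)[OF c] that] by (intro restrict_ext) simp
  qed
  then show ?thesis using s unfolding segal_match[OF X] segal_match[OF Y] by blast
qed

section \<open>Full faithfulness of the nerve\<close>

definition ecol :: "('u, 'c, 'x) modop => 'c => ('u, 'u, 'u gelts, 'c, 'x) csm_mor" where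
  "ecol P c = mk P exc_edge (\<lambda>a\<in>{eps, eps_dg}. if a = eps then c else cinv (mcol P) c) (\<lambda>_\<in>{}. undefined)"

text \<open>\<open>ecol\<close> and \<open>opm\<close> are the morphisms from the edge and from a
  star that classify a color and an operation of \<open>P\<close>. Testing on them recovers a
  morphism of operads from its nerve.\<close>

definition opm :: "('u, 'c, 'x) modop => ('u, 'c) bob => 'x => ('u, 'u, 'u gelts, 'c, 'x) csm_mor" where
  "opm P p x = mk P (star (fst p)) (star_col (mcol P) p) (\<lambda>_\<in>{undefined}. x)"

lemma ecol_hom:
  assumes P: "modular_operad (P :: ('u, 'c, 'x) modop)" and c: "c : cols (mcol P)"
  shows "ecol P c : csm_hom (gmod exc_edge) P" "fst (ecol P c) eps = c" "fst (ecol P c) eps_dg = cinv (mcol P) c"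
proof -
  note i = involutiveD[OF modopD(1)[OF P] c]
  have "dgr (mcol P) (mop P) exc_edge (\<lambda>a\<in>{eps, eps_dg}. if a = eps then c else cinv (mcol P) c) (\<lambda>_\<in>{}. undefined)"
    by (rule dgrI[OF edge_conn]) (use c i edge_gi eps_dg_neq in auto)
  then show "ecol P c : csm_hom (gmod exc_edge) P" unfolding ecol_def by (rule mk_hom[OF P])
qed (use eps_dg_neq in \<open>simp_all add: ecol_def\<close>)

lemma opm_hom:
  assumes P: "modular_operad (P :: ('u, 'c, 'x) modop)" and p: "p : bij_ob (mcol P)" and x: "x : bo (mop P) p"
  shows "opm P p x : csm_hom (gmod (star (fst p))) P" "vals (star (fst p)) (opm P p x) undefined = x"
    "s : fst p ==> fst (opm P p x) s = snd p s" "at_vertex (star (fst p)) (fst (opm P p x)) undefined = p"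
proof -
  have d: "dgr (mcol P) (mop P) (star (fst p)) (star_col (mcol P) p) (\<lambda>_\<in>{undefined}. x)"
    using star_elt[OF modopD(1)[OF P] p x] by (simp add: gr_elts_iff)
  show "opm P p x : csm_hom (gmod (star (fst p))) P" unfolding opm_def by (rule mk_hom[OF P d])
  show "vals (star (fst p)) (opm P p x) undefined = x" unfolding opm_def mk_vals[OF P d] by simp
  show "fst (opm P p x) s = snd p s" if "s : fst p" using that by (simp add: opm_def star_col_in)
  show "at_vertex (star (fst p)) (fst (opm P p x)) undefined = p" by (simp add: opm_def star_at_vertex[OF p])
qed

lemma star_hom_opm:
  assumes P: "modular_operad (P :: ('u, 'c, 'x) modop)" and p: "p : bij_ob (mcol P)" and x: "x : bo (mop P) p"
    and h: "h : csm_hom (gmod (star (fst p))) P" "!!s. s : fst p ==> fst h s = snd p s" "vals (star (fst p)) h undefined = x"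
  shows "h = opm P p x"
  by (rule star_hom_eqI[OF P bij_obD(1)[OF p] h(1)]) (use opm_hom[OF P p x] h in simp_all)

lemma nerve_map_inj:
  assumes P: "modular_operad (P :: ('u, 'c, 'x) modop)" and Q: "modular_operad (Q :: ('u, 'd, 'y) modop)"
    and g: "g : csm_hom P Q" "g' : csm_hom P Q" and e: "nerve_map P g = nerve_map P g'"
  shows "g = g'"
proof (rule csm_hom_eqI[OF P Q g])
  have ee: "csm_comp (gmod G) g h = csm_comp (gmod G) g' h" if "G : U_ob" "h : csm_hom (gmod G) P" for G h
    using fun_cong[OF fun_cong[OF e, of G], of h] that by (simp add: nerve_map_def)
  fix c assume c: "c : cols (mcol P)"
  note E = ecol_hom[OF P c]
  show "fst g c = fst g' c"
    using ee[OF edge_U E(1)] comp_fst[of eps exc_edge g "ecol P c"] comp_fst[of eps exc_edge g' "ecol P c"] E(2) by simp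
next
  have ee: "csm_comp (gmod G) g h = csm_comp (gmod G) g' h" if "G : U_ob" "h : csm_hom (gmod G) P" for G h
    using fun_cong[OF fun_cong[OF e, of G], of h] that by (simp add: nerve_map_def)
  fix p x assume p: "p : bij_ob (mcol P)" and x: "x : bo (mop P) p"
  note O = opm_hom[OF P p x] and f = bij_obD(1)[OF p]
  show "snd g p x = snd g' p x"
    using ee[OF star_U[OF f] O(1)] comp_vals[OF star_graph[OF f], of undefined g "opm P p x"]
      comp_vals[OF star_graph[OF f], of undefined g' "opm P p x"] O(2,4) by simp
qed

text \<open>\<open>ph\<close> and \<open>th\<close> are read off from the classifying morphisms.
  Naturality along arcs (\<open>A\<close>) and along stars of vertices (\<open>B\<close>) shows that
  they determine \<open>ta\<close>; naturality along collapses (\<open>E\<close>) shows that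
  \<open>th\<close> preserves composition.\<close>

lemma nerve_map_surj:
  assumes P: "modular_operad (P :: ('u, 'c, 'x) modop)" and Q: "modular_operad (Q :: ('u, 'd, 'y) modop)"
    and t: "ta : psh_hom (nerve P) (nerve Q)"
  shows "EX g:csm_hom P Q. nerve_map P g = ta"
proof -
  define ph where "ph = (\<lambda>c\<in>cols (mcol P). fst (ta exc_edge (ecol P c)) eps)"
  define th where "th = (\<lambda>(p :: ('u, 'c) bob) x. vals (star (fst p)) (ta (star (fst p)) (opm P p x)) undefined)"
  have th: "ta G h : csm_hom (gmod G) Q" if "G : U_ob" "h : csm_hom (gmod G) P" for G h
    using psh_homD(3)[OF t that(1)] that(2) by (simp add: nerve_simps)
  have A: "fst (ta G h) a = ph (fst h a)" if G: "G : U_ob" and h: "h : csm_hom (gmod G) P" and a: "a : gA G" for G h a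
  proof -
    note c = U_conn[OF G]
    have ca: "fst h a : cols (mcol P)" using dgrD(7)[OF hom_vals[OF P c h] a] .
    have "col (nerve P) G h a = ecol P (fst h a)"
      by (rule edge_hom_eqI[OF P nerve_col(1)[OF P c h a] ecol_hom(1)[OF P ca]])
        (simp add: nerve_col(2)[OF P c h a] ecol_hom(2)[OF P ca])
    then have "ta exc_edge (ecol P (fst h a)) = col (nerve Q) G (ta G h) a"
      using col_nat[OF t G _ a, of h] h by (simp add: nerve_simps)
    then show ?thesis using nerve_col(2)[OF Q c th[OF G h] a] ca by (simp add: ph_def)
  qed
  have B: "vals G (ta G h) v = th (at_vertex G (fst h) v) (vals G h v)"
    if G: "G : U_ob" and h: "h : csm_hom (gmod G) P" and v: "v : gV G" for G h v
  proof -
    note c = U_conn[OF G]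
    note d = dgrD[OF hom_vals[OF P c h]]
    note S = star_U[OF finite_inb[OF conn_graph[OF c]], of v]
    have "res (nerve P) G h v = opm P (at_vertex G (fst h) v) (vals G h v)"
      by (rule star_hom_opm[OF P d(5) d(6)[OF v]]) (use nerve_res[OF P c h v] in simp_all)
    then have "ta (star (inb G v)) (opm P (at_vertex G (fst h) v) (vals G h v)) = res (nerve Q) G (ta G h) v"
      unfolding res_def using psh_homD(4)[OF t S G iota_hom[OF c v], of h] h by (simp add: nerve_simps)
    then show ?thesis using nerve_res(2)[OF Q c th[OF G h] v] by (simp add: th_def)
  qed
  have E: "((f, G, rcol ph G ze), \<lambda>v\<in>gV G. th (at_vertex G ze v) (x v)) : gr_elts (mcol Q) (mop Q) (recolor ph p)"
    "th p (act P p ((f, G, ze), x)) = act Q (recolor ph p) ((f, G, rcol ph G ze), \<lambda>v\<in>gV G. th (at_vertex G ze v) (x v))"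
    if p: "p : bij_ob (mcol P)" and e: "((f, G, ze), x) : gr_elts (mcol P) (mop P) p" for p :: "('u, 'c) bob" and f G ze x
  proof -
    have d: "dgr (mcol P) (mop P) G ze x" and f: "bij_betw f (fst p) (gB G)" "f : extensional (fst p)"
      and fz: "!!s. s : fst p ==> ze (f s) = snd p s" using e by (auto simp: gr_elts_iff)
    note c = dgrD(1)[OF d]
    \<comment> \<open>\<open>G\<close> may be a nodeless loop, at which presheaves are not defined;
      \<open>hat G\<close> generates the same operad and is an object of the category.\<close>
    note H = hat_U[OF c] and S = star_U[OF bij_obD(1)[OF p]]
    let ?h = "mk P G ze x"
    have h: "?h : csm_hom (gmod G) P" by (rule mk_hom[OF P d])
    have h': "?h : csm_hom (gmod (hat G)) P" using h by simp
    have vl: "vals G ?h = x" by (rule mk_vals[OF P d])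
    have k: "ta (hat G) ?h : csm_hom (gmod G) Q" using th[OF H h'] by simp
    note dk = hom_vals[OF Q c k]
    have fk: "fst (ta (hat G) ?h) = rcol ph G ze"
      using A[OF H h'] dgrD(9)[OF dk] by (intro extensionalityI[where A = "gA G"]) auto
    have vk: "vals G (ta (hat G) ?h) = (\<lambda>v\<in>gV G. th (at_vertex G ze v) (x v))"
      using B[OF H h'] vl dgrD(10)[OF dk] by (intro extensionalityI[where A = "gV G"]) auto
    have rp: "(fst p, \<lambda>s\<in>fst p. rcol ph G ze (f s)) = recolor ph p"
      using elts_bd(2)[OF e] fz by (auto simp: recolor_def fun_eq_iff)
    show "((f, G, rcol ph G ze), \<lambda>v\<in>gV G. th (at_vertex G ze v) (x v)) : gr_elts (mcol Q) (mop Q) (recolor ph p)"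
      unfolding gr_elts_iff using dk[unfolded fk vk] f fz elts_bd(2)[OF e] by simp
    let ?c = "contr G (fst p) f"
    have ch: "?c : U_hom (star (fst p)) (hat G)" using contr_hom[OF c f] by simp
    have ps: "(fst p, \<lambda>s\<in>fst p. fst ?h (f s)) = p"
      using fz bij_obD(2)[OF p] by (auto simp: fun_eq_iff extensional_def intro!: prod_eqI)
    have hc: "csm_comp (gmod (star (fst p))) ?h ?c : csm_hom (gmod (star (fst p))) P"
      by (rule U_comp[OF U_conn[OF S] c P contr_hom[OF c f] h])
    have "csm_comp (gmod (star (fst p))) ?h ?c = opm P p (act P p ((f, G, ze), x))"
    proof (rule star_hom_opm[OF P p act_in[OF P p e] hc])
      show "fst (csm_comp (gmod (star (fst p))) ?h ?c) s = snd p s" if "s : fst p" for s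
        using comp_fst[of s "star (fst p)" ?h ?c] contr_fst[of s "fst p" G f] that fz by (simp add: dbl_def sx_in)
      show "vals (star (fst p)) (csm_comp (gmod (star (fst p))) ?h ?c) undefined = act P p ((f, G, ze), x)"
        using nerve_contr[OF P c f h] ps vl by simp
    qed
    then have "ta (star (fst p)) (opm P p (act P p ((f, G, ze), x))) = csm_comp (gmod (star (fst p))) (ta (hat G) ?h) ?c"
      using psh_homD(4)[OF t S H ch, of ?h] h k by (simp add: nerve_simps)
    then show "th p (act P p ((f, G, ze), x)) = act Q (recolor ph p) ((f, G, rcol ph G ze), \<lambda>v\<in>gV G. th (at_vertex G ze v) (x v))"
      using nerve_contr[OF Q c f k] unfolding fk vk rp th_def by simp
  qed
  have ch: "chom P Q ph th"
  proof (rule chomI)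
    have "ph c : cols (mcol Q) & ph (cinv (mcol P) c) = cinv (mcol Q) (ph c)" if c: "c : cols (mcol P)" for c
    proof -
      note e = ecol_hom[OF P c]
      note d = hom_vals[OF Q edge_conn th[OF edge_U e(1)]]
      show ?thesis
        using A[OF edge_U e(1), of eps] A[OF edge_U e(1), of eps_dg] e(2,3) dgrD(7)[OF d, of eps] dgrD(8)[OF d, of eps] edge_gi by simp
    qed
    then show pm: "ph : inv_maps (mcol P) (mcol Q)" unfolding inv_maps_iff by (simp add: ph_def)
    show "th p x : bo (mop Q) (recolor ph p)" if p: "p : bij_ob (mcol P)" and x: "x : bo (mop P) p" for p x
    proof -
      note o = opm_hom[OF P p x] and f = bij_obD(1)[OF p]
      have "restrict (fst (ta (star (fst p)) (opm P p x))) (fst p) = (\<lambda>s\<in>fst p. ph (snd p s))"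
        using A[OF star_U[OF f] o(1)] o(3) by (intro restrict_ext) (simp add: dbl_def)
      then show ?thesis using star_hom_bo[OF Q f th[OF star_U[OF f] o(1)]] by (simp add: th_def recolor_def)
    qed
    show "th p (act P p ((f, G, ze), x)) = act Q (recolor ph p) ((f, G, rcol ph G ze), \<lambda>v\<in>gV G. th (at_vertex G ze v) (x v))"
      if "p : bij_ob (mcol P)" "((f, G, ze), x) : gr_elts (mcol P) (mop P) p" for p :: "('u, 'c) bob" and f G ze x
      by (rule E(2)[OF that])
    fix p q :: "('u, 'c) bob" and si x
    assume p: "p : bij_ob (mcol P)" and q: "q : bij_ob (mcol P)" and s: "si : bij_hom p q" and x: "x : bo (mop P) p"
    note e = star_elt[OF modopD(1)[OF P] p x]
    note e' = ba_F(2)[OF modopD(2)[OF P] s e]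
    \<comment> \<open>Every operation is the composite of the star decorated by it. Relabelling its
      boundary gives another composite, so naturality is a case of compatibility with
      composition.\<close>
    have "th q (ba (mop P) p q si x) = th q (ba (mop P) p q si (act P p ((\<lambda>s\<in>fst p. s, star (fst p), star_col (mcol P) p), \<lambda>v\<in>gV (star (fst p)). x)))"
      unfolding act_unit[OF P p x] ..
    also have "\<dots> = ba (mop Q) (recolor ph p) (recolor ph q) si (th p (act P p ((\<lambda>s\<in>fst p. s, star (fst p), star_col (mcol P) p), \<lambda>v\<in>gV (star (fst p)). x)))"
      unfolding act_nat[OF P p q s e] E(2)[OF q e'] E(2)[OF p e]
        act_nat[OF Q recolor_ob[OF p pm] recolor_ob[OF q pm] recolor_hom[OF s] E(1)[OF p e]] recolor_simps(1) ..
    finally show "th q (ba (mop P) p q si x) = ba (mop Q) (recolor ph p) (recolor ph q) si (th p x)"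
      unfolding act_unit[OF P p x] .
  qed
  let ?g = "(ph, \<lambda>p\<in>bij_ob (mcol P). \<lambda>x\<in>bo (mop P) p. th p x)"
  have g: "?g : csm_hom P Q" by (rule csm_homI[OF P Q ch])
  have "nerve_map P ?g = ta"
  proof (rule psh_hom_eqI[OF nerve_map_hom[OF P Q g] t])
    fix G :: "'u graph" and h assume G: "G : U_ob" and "h : pob (nerve P) G"
    then have h: "h : csm_hom (gmod G) P" by (simp add: nerve_simps)
    note c = U_conn[OF G]
    note d = dgrD[OF hom_vals[OF P c h]]
    have "csm_comp (gmod G) ?g h = ta G h"
    proof (rule gmod_hom_eqI[OF Q c csm_comp_hom[OF U_modular[OF G] P Q h g] th[OF G h]])
      show "fst (csm_comp (gmod G) ?g h) a = fst (ta G h) a" if "a : gA G" for a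
        using A[OF G h that] comp_fst[OF that, of ?g h] by simp
      show "vals G (csm_comp (gmod G) ?g h) v = vals G (ta G h) v" if "v : gV G" for v
        using B[OF G h that] comp_vals[OF conn_graph[OF c] that, of ?g h] d(5)[of v] d(6)[OF that] by simp
    qed
    then show "nerve_map P ?g G h = ta G h" using G h by (simp add: nerve_map_def)
  qed
  then show ?thesis using g by blast
qed

lemma nerve_full_faithful:
  assumes P: "modular_operad (P :: ('u, 'c, 'x) modop)" and Q: "modular_operad (Q :: ('u, 'd, 'y) modop)"
  shows "bij_betw (nerve_map P) (csm_hom P Q) (psh_hom (nerve P) (nerve Q))"
  unfolding bij_betw_def
proof
  show "inj_on (nerve_map P) (csm_hom P Q)" using nerve_map_inj[OF P Q] by (intro inj_onI)
  show "nerve_map P ` csm_hom P Q = psh_hom (nerve P) (nerve Q)"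
    using nerve_map_hom[OF P Q] nerve_map_surj[OF P Q] by (intro equalityI subsetI) blast+
qed

end

section \<open>The operad of a Segal presheaf\<close>

lemma iota_hat [simp]: "iota (hat G) = iota G"
  by (simp add: iota_def fun_eq_iff)

lemma emor_hat [simp]: "emor (hat G) = emor G"
proof (rule ext)
  fix a
  have "emap (hat G) a = emap G a" by (rule ext) (simp add: emap_def)
  then show "emor (hat G) a = emor G a" by (simp only: emor_def etm_hat)
qed

text \<open>The element over \<open>hat G\<close> with the decoration \<open>ze\<close>,
  \<open>x\<close>; for a Segal presheaf it exists and is unique.\<close>

definition und :: "('u, 'p) psh => 'u graph => ('u => 'p) => ('u => 'p) => 'p" where
  "und X G ze x = inv_into (pob X (hat G)) (dec X (hat G)) (ze, x)"

definition pact :: "('u, 'p) psh => ('u, 'p) bob => ('u, 'p, 'p) gelt => 'p" where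
  "pact X p = (\<lambda>((f, G, ze), x). par X (star (fst p)) (hat G) (contr G (fst p) f) (und X G ze x))"

definition pmod :: "('u, 'p) psh => ('u, 'p, 'p) modop" where
  "pmod X = \<lparr>mcol = pcol X, mop = pfun X,
     malg = (\<lambda>p\<in>bij_ob (pcol X). \<lambda>K\<in>F_ob (pcol X) (pfun X) p. pact X p (SOME e. e : K))\<rparr>"

section \<open>Collapses and star inclusions under etale maps and relabelling\<close>

context infinite_universe
begin

text \<open>Over \<open>G'\<close>, the graph \<open>G\<close> with the map \<open>al\<close>,
  \<open>nu\<close> is isomorphic to \<open>G'\<close> itself with the same boundary labels, so both
  define the same class. Hence the composition of a Segal presheaf will depend only on
  classes.\<close>

lemma contr_etm:
  assumes g: "connected_graph (G :: 'u graph)" and g': "connected_graph G'" and e: "et G G' al nu"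
    and b: "bij_betw al (gA G) (gA G')" "bij_betw nu (gV G) (gV G')"
    and f: "bij_betw f S (gB G)" "f : extensional S" and f': "bij_betw f' S (gB G')" "f' : extensional S"
    and ff: "!!s. s : S ==> al (f s) = f' s"
  shows "csm_comp (gmod (star S)) (etm G G' al nu) (contr G S f) = contr G' S f'"
proof -
  note gg = conn_graph[OF g] conn_graph[OF g']
  note M = gmod_modular[OF gg(2)]
  note ce = contr_elt[OF g f] and ce' = contr_elt[OF g' f']
  have eh: "etm G G' al nu : csm_hom (gmod G) (gmod G')" using etm_hom[OF g g' e] by (simp add: U_hom_def)
  show ?thesis
  proof (rule star_hom_eqI[OF M ce(3)])
    show "csm_comp (gmod (star S)) (etm G G' al nu) (contr G S f) : csm_hom (gmod (star S)) (gmod G')"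
      by (rule U_comp[OF star_conn[OF ce(3)] g M contr_hom[OF g f] eh])
    show "contr G' S f' : csm_hom (gmod (star S)) (gmod G')" using contr_hom[OF g' f'] by (simp add: U_hom_def)
    have fA: "f s : gA G" if "s : S" for s using bij_betwE[OF f(1)] that gB_gA[OF gg(1)] by blast
    show "fst (csm_comp (gmod (star S)) (etm G G' al nu) (contr G S f)) s = fst (contr G' S f') s" if "s : S" for s
      using that ff fA by (simp add: comp_fst contr_fst etm_fst dbl_def sx_in)
    have r: "recolor al (S, f) = (S, f')" using ff f'(2) by (auto simp: recolor_def fun_eq_iff extensional_def)
    have i: "(\<lambda>a\<in>gA G. al ((\<lambda>a\<in>gA G. a) a)) = restrict al (gA G)" "(\<lambda>w\<in>gV G. nu ((\<lambda>v\<in>gV G. v) w)) = restrict nu (gV G)"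
      by (auto simp: fun_eq_iff)
    have e2: "et G G' (restrict al (gA G)) (restrict nu (gV G))"
      using e et_cong[OF gg(1), of "restrict al (gA G)" al "restrict nu (gV G)" nu] by simp
    have el: "((f, G, restrict al (gA G)), restrict nu (gV G)) : gelt_set G' (S, f')"
      unfolding vf_elts[OF gg(2)] using g e2 f ff fA by simp
    then have dg: "dgr (arcset G') (vertex_fun G') G (restrict al (gA G)) (restrict nu (gV G))" by (simp add: gr_elts_iff)
    have "det (vertex_fun G') G (restrict al (gA G)) (restrict nu (gV G)) G' (\<lambda>a\<in>gA G'. a) (\<lambda>v\<in>gV G'. v) al nu"
      unfolding vf_det[OF dg] using e et_A[OF e] et_V[OF e] by (simp add: cpt_def)
    then have "(((f, G, restrict al (gA G)), restrict nu (gV G)), ((f', G', \<lambda>a\<in>gA G'. a), \<lambda>v\<in>gV G'. v)) : gr_rel (arcset G') (vertex_fun G') (S, f')"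
      using ff by (intro gr_relI[OF el ce'(1) _ b]) simp_all
    then have "gcls G' (S, f') ((f, G, restrict al (gA G)), restrict nu (gV G)) = gcls G' (S, f') ((f', G', \<lambda>a\<in>gA G'. a), \<lambda>v\<in>gV G'. v)"
      by (rule cls_eq_iff[OF vf_functor el ce'(1), THEN iffD2])
    then show "vals (star S) (csm_comp (gmod (star S)) (etm G G' al nu) (contr G S f)) undefined = vals (star S) (contr G' S f') undefined"
      unfolding contr_comp_vals[OF g f] etm_cls[OF g g' e ce(2,1)] r i contr_vals(1)[OF g' f'] .
  qed
qed

text \<open>Relabelling the star amounts to relabelling the boundary of \<open>G\<close>, which will
  give naturality of the composition.\<close>

lemma contr_stm:
  assumes g: "connected_graph (G :: 'u graph)" and f: "bij_betw f S (gB G)" "f : extensional S"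
    and S': "finite S'" and s: "bij_betw si S' S"
  shows "csm_comp (gmod (star S')) (contr G S f) (stm S' S si) = contr G S' (\<lambda>s\<in>S'. f (si s))"
proof -
  note gg = conn_graph[OF g]
  note M = gmod_modular[OF gg]
  note ce = contr_elt[OF g f]
  note S = ce(3)
  have sS: "si t : S" if "t : S'" for t using bij_betwE[OF s] that by blast
  have f': "bij_betw (\<lambda>s\<in>S'. f (si s)) S' (gB G)" "(\<lambda>s\<in>S'. f (si s)) : extensional S'"
    using bij_betw_trans[OF s f(1)] by (simp_all add: comp_def)
  have ch: "contr G S f : csm_hom (gmod (star S)) (gmod G)" using contr_hom[OF g f] by (simp add: U_hom_def)
  note st = star_conn[OF S] star_conn[OF S']
  show ?thesis
  proof (rule star_hom_eqI[OF M S'])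
    show "csm_comp (gmod (star S')) (contr G S f) (stm S' S si) : csm_hom (gmod (star S')) (gmod G)"
      by (rule U_comp[OF st(2,1) M stm_hom[OF S' S s] ch])
    show "contr G S' (\<lambda>s\<in>S'. f (si s)) : csm_hom (gmod (star S')) (gmod G)" using contr_hom[OF g f'] by (simp add: U_hom_def)
    show "fst (csm_comp (gmod (star S')) (contr G S f) (stm S' S si)) t = fst (contr G S' (\<lambda>s\<in>S'. f (si s))) t" if "t : S'" for t
      using that sS by (simp add: comp_fst contr_fst stm_def etm_fst dbl_def sx_in)
    \<comment> \<open>Pullback along \<open>stm\<close> transports along the inverse of its
      restriction to \<open>S'\<close>; this is that inverse in the form in which \<open>pb\<close>
      contains it.\<close>
    define si' where "si' = (\<lambda>b\<in>S. inv_into S' (restrict (sx S' si (dbl_inv S)) S') b)"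
    have rs: "restrict (sx S' si (dbl_inv S)) S' = restrict si S'" by (intro restrict_ext) (simp add: sx_in)
    have bs: "bij_betw (restrict si S') S' S" using s by (simp add: bij_betw_def)
    have b': "bij_betw si' S S'" unfolding si'_def rs using bij_betw_inv_into[OF bs] by (simp add: bij_betw_def)
    have i': "inv_into S si' t = si t" if t: "t : S'" for t
    proof -
      have "si' (si t) = t" using bij_betw_inv_into_left[OF bs t] t sS[OF t] by (simp add: si'_def rs)
      then show ?thesis using inv_into_f_eq[of si' S "si t"] b' sS[OF t] by (simp add: bij_betw_def)
    qed
    let ?q = "(S', \<lambda>s\<in>S'. f (si s))"
    have sb: "si' : bij_hom (S, f) ?q"
      using b' i' bij_betw_inv_into_left[OF b'] bij_betwE[OF b'] by (auto simp: bij_hom_def) (auto simp: si'_def)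
    have at: "at_vertex (star S') (rcol (fst (contr G S f)) (star S') (sx S' si (dbl_inv S))) undefined = ?q"
      using sS by (auto simp: at_vertex_def star_nb(3)[OF S'] dbl_def contr_fst sx_in fun_eq_iff)
    have fs: "(\<lambda>s\<in>fst ?q. f (inv_into (fst (S, f)) si' s)) = (\<lambda>s\<in>S'. f (si s))" using i' by (auto simp: fun_eq_iff)
    have "vals (star S') (csm_comp (gmod (star S')) (contr G S f) (stm S' S si)) undefined =
        ba (F_fun (arcset G) (vertex_fun G)) (S, f) ?q si' (gcls G (S, f) ((f, G, \<lambda>a\<in>gA G. a), \<lambda>v\<in>gV G. v))"
      unfolding stm_def nerve_etm(1)[OF M st(2,1) stm_et[OF S' S s] ch]
      using contr_vals[OF g f] at by (simp add: pb_def star_nb(3)[OF S] star_nb(3)[OF S'] si'_def)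
    also have "\<dots> = gcls G ?q ((\<lambda>s\<in>S'. f (si s), G, \<lambda>a\<in>gA G. a), \<lambda>v\<in>gV G. v)"
      unfolding ba_F(1)[OF vf_functor sb ce(1)] fs ..
    finally show "vals (star S') (csm_comp (gmod (star S')) (contr G S f) (stm S' S si)) undefined =
        vals (star S') (contr G S' (\<lambda>s\<in>S'. f (si s))) undefined"
      unfolding contr_vals(1)[OF g f'] .
  qed
qed

text \<open>The class of a star over itself is its generator. This will give the unit law.\<close>

lemma contr_star:
  assumes S: "finite (S :: 'u set)"
  shows "contr (star S) S (\<lambda>s\<in>S. s) = csm_id (gmod (star S))"
proof -
  note c = star_conn[OF S]
  have f: "bij_betw (\<lambda>s\<in>S. s) S (gB (star S))" "(\<lambda>s\<in>S. s) : extensional S" by (simp_all add: bij_betw_def)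
  have go: "gob (star S) undefined = (S, \<lambda>s\<in>S. s)" by (simp add: gob_def at_vertex_def star_nb(3)[OF S])
  have sc: "star_col (arcset (star S)) (S, \<lambda>s\<in>S. s) = (\<lambda>a\<in>dbl S. a)"
    unfolding star_col_sx fst_conv snd_conv by (rule restrict_ext) (use sx_unique[OF S, of _ "\<lambda>a. a" "\<lambda>s\<in>S. s" "dbl_inv S"] in simp)
  have gb: "undefined : bo (vertex_fun (star S)) (S, \<lambda>s\<in>S. s)" using gob_bo[of undefined "star S"] go by simp
  have "gen (star S) undefined = gcls (star S) (S, \<lambda>s\<in>S. s) ((\<lambda>s\<in>S. s, star S, \<lambda>a\<in>dbl S. a), \<lambda>v\<in>{undefined}. v)"
    unfolding gen_def go F_unit_cls[OF contr_elt(2)[OF c f] gb] using sc by (simp add: restrict_def cong: if_cong)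
  moreover have "vals (star S) (csm_id (gmod (star S))) undefined = gen (star S) undefined"
    using gob_ob[OF star_graph[OF S], of undefined] gen_in[OF star_graph[OF S], of undefined] by (simp add: vals_def csm_id_def)
  ultimately have v: "vals (star S) (contr (star S) S (\<lambda>s\<in>S. s)) undefined = vals (star S) (csm_id (gmod (star S))) undefined"
    unfolding contr_vals(1)[OF c f] by simp
  show ?thesis
    by (rule star_hom_eqI[OF gmod_modular[OF star_graph[OF S]] S _ _ _ v])
      (use contr_hom[OF c f] U_id(1)[OF star_U[OF S]] in \<open>auto simp: U_hom_def csm_id_def contr_fst sx_in dbl_def\<close>)
qed

lemma iota_star:
  assumes S: "finite (S :: 'u set)"
  shows "iota (star S) undefined = csm_id (gmod (star S))"
proof -
  have "iota (star S) undefined = etm (star S) (star S) (\<lambda>a. a) (\<lambda>v. v)"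
    unfolding iota_def star_nb(3)[OF S]
    by (rule etm_cong[OF star_graph[OF S]]) (use sx_unique[OF S, of _ "\<lambda>a. a"] in auto)
  then show ?thesis using etm_id[OF star_conn[OF S]] by simp
qed

text \<open>Both composites are the etale map from the star that sends its vertex to
  \<open>nu v\<close> and \<open>s\<close> to \<open>al s\<close>.\<close>

lemma etm_iota:
  assumes g: "connected_graph (G :: 'u graph)" and g': "connected_graph G'" and e: "et G G' al nu" and v: "v : gV G"
  shows "csm_comp (gmod (star (inb G v))) (etm G G' al nu) (iota G v) =
    csm_comp (gmod (star (inb G v))) (iota G' (nu v)) (stm (inb G v) (inb G' (nu v)) al)"
proof -
  note gg = conn_graph[OF g] conn_graph[OF g']
  note S = finite_inb[OF gg(1), of v] and S' = finite_inb[OF gg(2), of "nu v"]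
  note b = et_inb[OF e gg v]
  have "csm_comp (gmod (star (inb G v))) (etm G G' al nu) (iota G v) =
      etm (star (inb G v)) G' (\<lambda>a. al (sx (inb G v) (\<lambda>s. s) (gi G) a)) (\<lambda>_. nu v)"
    unfolding iota_def by (rule etm_comp[OF star_conn[OF S] g g' iota_et[OF gg(1) v] e])
  also have "\<dots> = etm (star (inb G v)) G'
      (\<lambda>a. sx (inb G' (nu v)) (\<lambda>s. s) (gi G') (sx (inb G v) al (dbl_inv (inb G' (nu v))) a)) (\<lambda>_. nu v)"
  proof (rule etm_cong[OF star_graph[OF S]])
    fix a assume "a : gA (star (inb G v))"
    then have a: "a : dbl (inb G v)" by simp
    have al: "al s : inb G' (nu v)" if "s : inb G v" for s using bij_betwE[OF b] that by blast
    have 1: "sx (inb G v) al (gi G') a = al (sx (inb G v) (\<lambda>s. s) (gi G) a)"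
      by (rule sx_unique[OF S a]) (use et_i[OF e] inb_gA[OF gg(1)] in \<open>auto simp: sx_in sx_dbl[OF S]\<close>)
    have 2: "sx (inb G v) al (gi G') a = sx (inb G' (nu v)) (\<lambda>s. s) (gi G') (sx (inb G v) al (dbl_inv (inb G' (nu v))) a)"
      by (rule sx_unique[OF S a]) (use al in \<open>auto simp: sx_in sx_dbl[OF S] sx_dbl[OF S']\<close>)
    show "al (sx (inb G v) (\<lambda>s. s) (gi G) a) =
      sx (inb G' (nu v)) (\<lambda>s. s) (gi G') (sx (inb G v) al (dbl_inv (inb G' (nu v))) a)" using 1 2 by simp
  qed simp
  also have "\<dots> = csm_comp (gmod (star (inb G v))) (iota G' (nu v)) (stm (inb G v) (inb G' (nu v)) al)"
    unfolding iota_def stm_def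
    by (rule etm_comp[OF star_conn[OF S] star_conn[OF S'] g' stm_et[OF S S' b] iota_et[OF gg(2) et_V[OF e v]], symmetric])
  finally show ?thesis .
qed

section \<open>Composition in a Segal presheaf\<close>

context
  fixes X :: "('u, 'p) psh"
  assumes X: "presheaf X" and seg: "segal X"
begin

abbreviation "XC \<equiv> pcol X"
abbreviation "XF \<equiv> pfun X"

lemmas XF = pfun_functor[OF X] and XC = pcol_inv[OF X]

lemma dec_bij: "(G :: 'u graph) : U_ob ==> bij_betw (dec X G) (pob X G) (Dec X G)"
  using seg segal_dec[OF X] by blast

lemma dec_eqI:
  assumes G: "(G :: 'u graph) : U_ob" and w: "w : pob X G" "w' : pob X G"
    and c: "!!a. a : gA G ==> col X G w a = col X G w' a" and r: "!!v. v : gV G ==> res X G w v = res X G w' v"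
  shows "w = w'"
proof -
  have "dec X G w = dec X G w'" unfolding dec_def using c r by (simp cong: restrict_cong)
  then show ?thesis using dec_bij[OF G] w by (auto simp: bij_betw_def inj_on_def)
qed

lemma und_props:
  assumes d: "dgr XC XF (G :: 'u graph) ze x"
  shows "und X G ze x : pob X (hat G)" "a : gA G ==> col X (hat G) (und X G ze x) a = ze a"
    "v : gV G ==> res X (hat G) (und X G ze x) v = x v"
proof -
  note H = hat_U[OF dgrD(1)[OF d]]
  have i: "(ze, x) : Dec X (hat G)" using dgr_hat[OF d] by (simp add: Dec_def)
  have im: "dec X (hat G) ` pob X (hat G) = Dec X (hat G)" using dec_bij[OF H] by (simp add: bij_betw_def)
  show "und X G ze x : pob X (hat G)" unfolding und_def by (rule inv_into_into) (simp add: im i)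
  have "dec X (hat G) (und X G ze x) = (ze, x)" unfolding und_def by (rule f_inv_into_f) (simp add: im i)
  then have e: "(\<lambda>a\<in>gA G. col X (hat G) (und X G ze x) a) = ze" "(\<lambda>v\<in>gV G. res X (hat G) (und X G ze x) v) = x"
    by (simp_all add: dec_def)
  show "col X (hat G) (und X G ze x) a = ze a" if "a : gA G" using fun_cong[OF e(1), of a] that by simp
  show "res X (hat G) (und X G ze x) v = x v" if "v : gV G" using fun_cong[OF e(2), of v] that by simp
qed

lemma und_dec:
  assumes G: "(G :: 'u graph) : U_ob" and x: "x : pob X G"
  shows "und X G (fst (dec X G x)) (snd (dec X G x)) = x"
  unfolding und_def hat_id[OF G] prod.collapse using dec_bij[OF G] x by (simp add: bij_betw_inv_into_left)

lemma und_eqI: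
  assumes d: "dgr XC XF (G :: 'u graph) ze x" and w: "w : pob X (hat G)"
    and c: "!!a. a : gA G ==> col X (hat G) w a = ze a" and r: "!!v. v : gV G ==> res X (hat G) w v = x v"
  shows "und X G ze x = w"
  by (rule dec_eqI[OF hat_U[OF dgrD(1)[OF d]] und_props(1)[OF d] w]) (use und_props(2,3)[OF d] c r in auto)

text \<open>Both elements over \<open>hat G\<close> have the same colors and the same restrictions
  to stars; the latter because \<open>x' (nu v)\<close> is \<open>x v\<close> moved along the
  bijection that \<open>al\<close> induces on \<open>inb G v\<close>.\<close>

lemma und_et:
  assumes d: "dgr XC XF (G :: 'u graph) ze x" and d': "dgr XC XF G' ze' x'" and t: "det XF G ze x G' ze' x' al nu"
  shows "und X G ze x = par X (hat G) (hat G') (etm G G' al nu) (und X G' ze' x')"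
proof (rule und_eqI[OF d])
  let ?w = "und X G' ze' x'"
  note c = dgrD(1)[OF d] and c' = dgrD(1)[OF d']
  note g = conn_graph[OF c] and g' = conn_graph[OF c']
  note H = hat_U[OF c] and H' = hat_U[OF c']
  note e = det_D[OF t]
  note u = und_props[OF d']
  have eh: "etm G G' al nu : U_hom (hat G) (hat G')" using etm_hom[OF c c' e(1)] by simp
  show "par X (hat G) (hat G') (etm G G' al nu) ?w : pob X (hat G)" by (rule presheafD(1)[OF X H H' eh u(1)])
  show "col X (hat G) (par X (hat G) (hat G') (etm G G' al nu) ?w) a = ze a" if a: "a : gA G" for a
    using col_par[OF X H H' eh u(1), of a] a u(2)[OF et_A[OF e(1) a]] cptD[OF e(2) a] by (simp add: etm_fst)
  fix v assume v: "v : gV G"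
  let ?S = "inb G v" and ?S' = "inb G' (nu v)"
  note nv = et_V[OF e(1) v]
  note fS = finite_inb[OF g, of v] and fS' = finite_inb[OF g', of "nu v"]
  note b = et_inb[OF e(1) g g' v]
  have b2: "bij_betw (restrict al ?S) ?S ?S'" using b by (simp add: bij_betw_def)
  note bi = bij_betw_inv_into[OF b2]
  have xv: "x v : pops X (at_vertex G ze v)" using dgrD(6)[OF d v] by simp
  have xp: "x v : pob X (star ?S)" using popsD(1)[OF xv] by simp
  have x': "x' (nu v) = par X (star ?S') (star ?S) (stm ?S' ?S (inv_into ?S (restrict al ?S))) (x v)"
    using e(3)[OF v] xv by (simp add: pfun_def)
  have i1: "iota G v : U_hom (star ?S) (hat G)" "iota G' (nu v) : U_hom (star ?S') (hat G')"
    using iota_hom[OF c v] iota_hom[OF c' nv] by auto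
  note s1 = stm_hom[OF fS fS' b] and s2 = stm_hom[OF fS' fS bi]
  have "res X (hat G) (par X (hat G) (hat G') (etm G G' al nu) ?w) v =
      par X (star ?S) (hat G') (csm_comp (gmod (star ?S)) (iota G' (nu v)) (stm ?S ?S' al)) ?w"
    using presheafD(3)[OF X star_U[OF fS] H H' i1(1) eh u(1)] etm_iota[OF c c' e(1) v] by (simp add: res_def)
  also have "\<dots> = par X (star ?S) (star ?S') (stm ?S ?S' al) (x' (nu v))"
    using presheafD(3)[OF X star_U[OF fS] star_U[OF fS'] H' s1 i1(2) u(1)] u(3)[OF nv] by (simp add: res_def)
  also have "\<dots> = par X (star ?S) (star ?S) (csm_id (gmod (star ?S))) (x v)"
  proof -
    have "stm ?S ?S (\<lambda>s. inv_into ?S (restrict al ?S) (al s)) = stm ?S ?S (\<lambda>s. s)"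
      by (rule stm_cong[OF fS]) (use bij_betw_inv_into_left[OF b2] in simp)
    then show ?thesis
      unfolding x' presheafD(3)[OF X star_U[OF fS] star_U[OF fS'] star_U[OF fS] s1 s2 xp] stm_comp[OF fS fS' fS b bi]
      using stm_id[OF fS] by simp
  qed
  also have "\<dots> = x v" by (rule presheafD(2)[OF X star_U[OF fS] xp])
  finally show "res X (hat G) (par X (hat G) (hat G') (etm G G' al nu) ?w) v = x v" .
qed

lemma pact_in:
  assumes p: "(p :: ('u, 'p) bob) : bij_ob XC" and e: "((f, G, ze), x) : gr_elts XC XF p"
  shows "pact X p ((f, G, ze), x) : pops X p"
proof -
  have d: "dgr XC XF G ze x" and f: "bij_betw f (fst p) (gB G)" "f : extensional (fst p)"
    and fz: "!!s. s : fst p ==> ze (f s) = snd p s" using e by (auto simp: gr_elts_iff)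
  note c = dgrD(1)[OF d]
  note H = hat_U[OF c] and S = star_U[OF bij_obD(1)[OF p]]
  have ch: "contr G (fst p) f : U_hom (star (fst p)) (hat G)" using contr_hom[OF c f] by simp
  note u = und_props[OF d]
  have "col X (star (fst p)) (pact X p ((f, G, ze), x)) s = snd p s" if s: "s : fst p" for s
    using col_par[OF X S H ch u(1), of s] s fz[OF s] u(2)[OF elts_bd(2)[OF e s]] by (simp add: pact_def contr_fst dbl_def sx_in)
  then show ?thesis unfolding pops_def using presheafD(1)[OF X S H ch u(1)] by (simp add: pact_def)
qed

text \<open>An isomorphism relates the two extended elements by \<open>und_et\<close> and the two
  collapses by \<open>contr_etm\<close>.\<close>

lemma pact_rel:
  assumes p: "(p :: ('u, 'p) bob) : bij_ob XC" and r: "(((f, G, ze), x), ((f', G', ze'), x')) : gr_rel XC XF p"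
  shows "pact X p ((f, G, ze), x) = pact X p ((f', G', ze'), x')"
proof -
  obtain al nu where t: "det XF G ze x G' ze' x' al nu" and b: "bij_betw al (gA G) (gA G')" "bij_betw nu (gV G) (gV G')"
    and ff: "!!s. s : fst p ==> al (f s) = f' s" using r unfolding gr_rel_iff by blast
  have d: "dgr XC XF G ze x" "dgr XC XF G' ze' x'" and f: "bij_betw f (fst p) (gB G)" "f : extensional (fst p)"
    and f': "bij_betw f' (fst p) (gB G')" "f' : extensional (fst p)" using r by (auto simp: gr_rel_iff gr_elts_iff)
  note c = dgrD(1)[OF d(1)] and c' = dgrD(1)[OF d(2)]
  have h: "contr G (fst p) f : U_hom (star (fst p)) (hat G)" "etm G G' al nu : U_hom (hat G) (hat G')"
    using contr_hom[OF c f] etm_hom[OF c c' det_D(1)[OF t]] by auto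
  have ce: "csm_comp (gmod (star (fst p))) (etm G G' al nu) (contr G (fst p) f) = contr G' (fst p) f'"
    by (rule contr_etm[OF c c' det_D(1)[OF t] b f f']) (rule ff)
  show ?thesis
    unfolding pact_def prod.case und_et[OF d t]
      presheafD(3)[OF X star_U[OF bij_obD(1)[OF p]] hat_U[OF c] hat_U[OF c'] h und_props(1)[OF d(2)]] ce ..
qed

lemma pact_nat:
  assumes p: "(p :: ('u, 'p) bob) : bij_ob XC" and q: "q : bij_ob XC" and s: "si : bij_hom p q"
    and e: "((f, G, ze), x) : gr_elts XC XF p"
  shows "pact X q ((\<lambda>s\<in>fst q. f (inv_into (fst p) si s), G, ze), x) = ba XF p q si (pact X p ((f, G, ze), x))"
proof -
  have d: "dgr XC XF G ze x" and f: "bij_betw f (fst p) (gB G)" "f : extensional (fst p)" using e by (auto simp: gr_elts_iff)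
  note c = dgrD(1)[OF d]
  note fp = bij_obD(1)[OF p] and fq = bij_obD(1)[OF q]
  have b: "bij_betw (inv_into (fst p) si) (fst q) (fst p)" using s by (simp add: bij_hom_def bij_betw_inv_into)
  have ch: "contr G (fst p) f : U_hom (star (fst p)) (hat G)" using contr_hom[OF c f] by simp
  have "ba XF p q si (pact X p ((f, G, ze), x)) =
      par X (star (fst q)) (star (fst p)) (stm (fst q) (fst p) (inv_into (fst p) si)) (pact X p ((f, G, ze), x))"
    using pact_in[OF p e] by (simp add: pfun_def)
  also have "\<dots> = pact X q ((\<lambda>s\<in>fst q. f (inv_into (fst p) si s), G, ze), x)"
    unfolding pact_def prod.case
      presheafD(3)[OF X star_U[OF fq] star_U[OF fp] hat_U[OF c] stm_hom[OF fq fp b] ch und_props(1)[OF d]]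
      contr_stm[OF c f fq b] ..
  finally show ?thesis ..
qed

text \<open>The element over the star with decoration \<open>x\<close> is \<open>x\<close> itself,
  and the collapse of a star is the identity.\<close>

lemma pact_unit:
  assumes p: "(p :: ('u, 'p) bob) : bij_ob XC" and x: "x : pops X p"
  shows "pact X p ((\<lambda>s\<in>fst p. s, star (fst p), star_col XC p), \<lambda>v\<in>gV (star (fst p)). x) = x"
proof -
  let ?S = "fst p"
  note f = bij_obD(1)[OF p]
  note U = star_U[OF f]
  note xp = popsD(1)[OF x]
  have d: "dgr XC XF (star ?S) (star_col XC p) (\<lambda>v\<in>gV (star ?S). x)"
    using star_elt[OF XC p, of x XF] x by (simp add: gr_elts_iff)
  have "und X (star ?S) (star_col XC p) (\<lambda>v\<in>gV (star ?S). x) = x"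
  proof (rule und_eqI[OF d], unfold hat_id[OF U])
    show "x : pob X (star ?S)" by (rule xp)
    fix a assume "a : gA (star ?S)"
    then have a: "a : dbl ?S" by simp
    have "sx ?S (snd p) (cinv XC) a = col X (star ?S) x a"
      by (rule sx_unique[OF f a]) (use popsD(2)[OF x] col_gi[OF X U xp] in \<open>auto simp: dbl_def\<close>)
    then show "col X (star ?S) x a = star_col XC p a" using a by (simp add: star_col_sx)
  next
    fix v assume "v : gV (star ?S)"
    then have v: "v = undefined" by simp
    show "res X (star ?S) x v = (\<lambda>v\<in>gV (star ?S). x) v"
      unfolding v res_def star_nb(3)[OF f] iota_star[OF f] using presheafD(2)[OF X U xp] by simp
  qed
  then show ?thesis
    unfolding pact_def prod.case hat_id[OF U] contr_star[OF f] using presheafD(2)[OF X U xp] by simp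
qed

lemma pact_assoc:
  assumes p: "(p :: ('u, 'p) bob) : bij_ob XC" and e: "((f, G, ze), y) : gr_elts XC XF p"
    and ok: "data_ok XC XF G ze H m zev x"
    and y: "!!v. v : gV G ==> y v = pact X (at_vertex G ze v) ((m v, H v, zev v), x v)"
    and s: "dsub XF G ze H m zev x K ze' x' j q r"
  shows "pact X p ((f, G, ze), y) = pact X p ((\<lambda>s\<in>fst p. j (f s), K, ze'), x')"
proof -
  have d: "dgr XC XF G ze y" and f: "bij_betw f (fst p) (gB G)" "f : extensional (fst p)" using e by (auto simp: gr_elts_iff)
  note O = data_okD[OF ok] and D = dsubD[OF s] and dK = dsub_dgr[OF XF ok s]
  note c = dgrD(1)[OF d] and cK = dgrD(1)[OF dK]
  note g = conn_graph[OF c]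
  note UG = hat_U[OF c] and UK = hat_U[OF cK]
  let ?w = "und X K ze' x'" and ?R = "refine G H m K j q r"
  note u = und_props[OF dK]
  have mx: "m v : extensional (inb G v)" if "v : gV G" for v using O(5)[OF that] by (simp add: gr_elts_iff)
  have R1: "?R : U_hom G K" by (rule refine_factor(1)[OF O(1) _ D(1) f]) (rule mx)
  have R2: "contr K (fst p) (\<lambda>s\<in>fst p. j (f s)) = csm_comp (gmod (star (fst p))) ?R (contr G (fst p) f)"
    by (rule refine_factor(2)[OF O(1) _ D(1) f]) (rule mx)
  have Rh: "?R : U_hom (hat G) (hat K)" using R1 by simp
  have Rf: "fst ?R = restrict j (gA G)" by (simp add: refine_def)
  have at: "at_vertex G (fst ?R) v = at_vertex G j v" for v unfolding Rf by (rule at_cong[OF g]) simp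
  \<comment> \<open>This is tested on stars of vertices. By \<open>iota_factor\<close>, restriction
    along the refinement and the star inclusion of \<open>v\<close> is restriction along
    \<open>q v\<close> followed by restriction along the collapse of \<open>H v\<close>. The former
    gives the element over \<open>H v\<close> by \<open>und_et\<close>, the latter its composite,
    which is \<open>y v\<close>.\<close>
  have "und X G ze y = par X (hat G) (hat K) ?R ?w"
  proof (rule und_eqI[OF d])
    show "par X (hat G) (hat K) ?R ?w : pob X (hat G)" by (rule presheafD(1)[OF X UG UK Rh u(1)])
    show "col X (hat G) (par X (hat G) (hat K) ?R ?w) a = ze a" if a: "a : gA G" for a
      using col_par[OF X UG UK Rh u(1), of a] a u(2)[OF is_subD(2)[OF D(1) a]] cptD[OF D(4) a] Rf by simp
    fix v assume v: "v : gV G"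
    let ?S = "inb G v"
    let ?E = "etm (H v) K (restrict (q v) (gA (H v))) (restrict (r v) (gV (H v)))"
    note S = star_U[OF finite_inb[OF g, of v]]
    note dH = O(3)[OF v]
    note cH = dgrD(1)[OF dH]
    note t = D(5)[OF v]
    have E: "?E = etm (H v) K (q v) (r v)" by (rule etm_cong[OF conn_graph[OF cH]]) simp_all
    have Eh: "etm (H v) K (q v) (r v) : U_hom (hat (H v)) (hat K)" using etm_hom[OF cH cK det_D(1)[OF t]] by simp
    have mv: "bij_betw (m v) ?S (gB (H v))" using O(5)[OF v] by (simp add: gr_elts_iff)
    have ih: "iota G v : U_hom (star ?S) (hat G)" using iota_hom[OF c v] by simp
    have ch: "contr (H v) ?S (m v) : U_hom (star ?S) (hat (H v))" using contr_hom[OF cH mv mx[OF v]] by simp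
    have Ri: "csm_comp (gmod (star ?S)) ?R (iota G v) = csm_comp (gmod (star ?S)) (etm (H v) K (q v) (r v)) (contr (H v) ?S (m v))"
      unfolding E[symmetric]
    proof (rule iota_factor[OF c cK v R1, unfolded at])
      show "((m v, H v, restrict (q v) (gA (H v))), restrict (r v) (gV (H v))) : gelt_set K (at_vertex G j v)"
        by (rule refine_factor(4)[OF O(1) _ D(1) f v]) (rule mx)
      show "vals G ?R v = gcls K (at_vertex G j v) ((m v, H v, restrict (q v) (gA (H v))), restrict (r v) (gV (H v)))"
        by (rule refine_factor(3)[OF O(1) _ D(1) f v]) (rule mx)
    qed
    have "res X (hat G) (par X (hat G) (hat K) ?R ?w) v = par X (star ?S) (hat K) (csm_comp (gmod (star ?S)) ?R (iota G v)) ?w"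
      using presheafD(3)[OF X S UG UK ih Rh u(1)] by (simp add: res_def)
    also have "\<dots> = par X (star ?S) (hat (H v)) (contr (H v) ?S (m v)) (und X (H v) (zev v) (x v))"
      unfolding Ri und_et[OF dH dK t] by (rule presheafD(3)[OF X S hat_U[OF cH] UK ch Eh u(1), symmetric])
    finally show "res X (hat G) (par X (hat G) (hat K) ?R ?w) v = y v" using y[OF v] by (simp add: pact_def)
  qed
  moreover have "contr G (fst p) f : U_hom (star (fst p)) (hat G)" using contr_hom[OF c f] by simp
  ultimately show ?thesis
    unfolding pact_def prod.case R2
    using presheafD(3)[OF X star_U[OF bij_obD(1)[OF p]] UG UK _ Rh u(1)] by simp
qed

lemma pmod_modular:
  shows "modular_operad (pmod X)" "!!p e. p : bij_ob XC ==> e : gr_elts XC XF p ==> act (pmod X) p e = pact X p e"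
proof -
  have i: "pact X p e : bo XF p" if "p : bij_ob XC" "e : gr_elts XC XF p" for p e
  proof -
    obtain f G ze x where e: "e = ((f, G, ze), x)" by (metis surj_pair)
    show ?thesis using pact_in[OF that(1)] that(2) unfolding e by simp
  qed
  have r: "pact X p e = pact X p e'" if "p : bij_ob XC" "(e, e') : gr_rel XC XF p" for p e e'
  proof -
    obtain f G ze x where e: "e = ((f, G, ze), x)" by (metis surj_pair)
    obtain f' G' ze' x' where e': "e' = ((f', G', ze'), x')" by (metis surj_pair)
    show ?thesis using pact_rel[OF that(1)] that(2) unfolding e e' by simp
  qed
  have u: "pact X p ((\<lambda>s\<in>fst p. s, star (fst p), star_col XC p), \<lambda>v\<in>gV (star (fst p)). x) = x"
    if "p : bij_ob XC" "x : bo XF p" for p x using pact_unit that by simp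
  note I = modular_operadI[OF XC XF i r pact_nat u pact_assoc]
  show "modular_operad (pmod X)" unfolding pmod_def by (rule I(1))
  show "!!p e. p : bij_ob XC ==> e : gr_elts XC XF p ==> act (pmod X) p e = pact X p e"
    unfolding pmod_def by (rule I(2))
qed

lemma pmod_simps [simp]: "mcol (pmod X) = XC" "mop (pmod X) = XF"
  by (simp_all add: pmod_def)

text \<open>The two morphisms are compared on generators. The image of \<open>v\<close> under
  \<open>f\<close> is a graph \<open>K\<close> over \<open>H\<close>, and the right-hand side
  composes the decoration of \<open>K\<close> pulled back from \<open>H\<close>. By
  \<open>und_et\<close> and \<open>iota_factor\<close> this composite is \<open>x\<close> restricted
  along \<open>f\<close> and then to the star of \<open>v\<close>.\<close>

lemma pmod_nat:
  assumes G: "(G :: 'u graph) : U_ob" and H: "H : U_ob" and f: "f : U_hom G H" and x: "x : pob X H"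
  shows "mk (pmod X) G (fst (dec X G (par X G H f x))) (snd (dec X G (par X G H f x))) =
    csm_comp (gmod G) (mk (pmod X) H (fst (dec X H x)) (snd (dec X H x))) f" (is "?l = csm_comp _ ?k f")
proof -
  note P = pmod_modular(1)
  note c = U_conn[OF G] and cH = U_conn[OF H]
  note g = conn_graph[OF c] and gH = conn_graph[OF cH]
  have dg: "dgr (mcol (pmod X)) (mop (pmod X)) K (fst (dec X K z)) (snd (dec X K z))" if "K : U_ob" "z : pob X K" for K z
    using dec_dgr[OF X that] by (simp add: dec_def)
  note fx = presheafD(1)[OF X G H f x]
  have f': "f : csm_hom (gmod G) (gmod H)" using f by (simp add: U_hom_def)
  have k: "?k : csm_hom (gmod H) (pmod X)" by (rule mk_hom[OF P dg[OF H x]])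
  show ?thesis
  proof (rule gmod_hom_eqI[OF P c mk_hom[OF P dg[OF G fx]] U_comp[OF c cH P f k]])
    fix a assume a: "a : gA G"
    show "fst ?l a = fst (csm_comp (gmod G) ?k f) a"
      using a U_emor(2)[OF c cH f a] col_par[OF X G H f x a] by (simp add: comp_fst dec_def)
  next
    fix v assume v: "v : gV G"
    let ?p = "at_vertex G (fst f) v" and ?S = "inb G v"
    let ?ph = "fst (dec X H x)" and ?y = "snd (dec X H x)"
    note S = star_U[OF finite_inb[OF g, of v]]
    have fm: "dgr (arcset H) (F_fun (arcset H) (vertex_fun H)) G (fst f) (vals G f)"
      using hom_vals[OF U_modular[OF H] c f'] by simp
    have po: "?p : bij_ob (arcset H)" by (rule dgrD(5)[OF fm])
    have "vals G f v : F_ob (arcset H) (vertex_fun H) ?p" using dgrD(6)[OF fm v] by simp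
    then obtain m K ka z where el: "((m, K, ka), z) : gelt_set H ?p" and vl: "vals G f v = gcls H ?p ((m, K, ka), z)"
      by (rule F_obE)
    have K: "connected_graph K" "et K H ka z" "m : extensional ?S" "bij_betw m ?S (gB K)"
      using el[unfolded vf_elts[OF gH]] by auto
    have dH: "dgr XC XF H ?ph ?y" using dg[OF H x] by simp
    note pbp = pb_props[OF XF dH K(1,2)]
    have h: "contr K ?S m : U_hom (star ?S) (hat K)" "etm K H ka z : U_hom (hat K) H" "iota G v : U_hom (star ?S) G"
      using contr_hom[OF K(1,4,3)] etm_hom[OF K(1) cH K(2)] iota_hom[OF c v] by auto
    have el': "((m, K, rcol ?ph K ka), pb XF H ?ph ?y K ka z) : gr_elts XC XF (recolor ?ph ?p)"
      using pb_elts[OF P dg[OF H x] el] by simp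
    have ro: "recolor ?ph ?p : bij_ob XC" by (rule recolor_ob[OF po dgrD(3)[OF dH]])
    have "vals G (csm_comp (gmod G) ?k f) v = act (pmod X) (recolor ?ph ?p) ((m, K, rcol ?ph K ka), pb XF H ?ph ?y K ka z)"
      unfolding comp_vals[OF g v] vl mk_cls[OF P dg[OF H x] po el] by simp
    also have "\<dots> = par X (star ?S) (hat K) (contr K ?S m) (par X (hat K) H (etm K H ka z) x)"
      unfolding pmod_modular(2)[OF ro el'] pact_def prod.case und_et[OF pbp(1) dH pbp(2)] und_dec[OF H x] hat_id[OF H] by simp
    also have "\<dots> = par X (star ?S) H (csm_comp (gmod (star ?S)) f (iota G v)) x"
      unfolding presheafD(3)[OF X S hat_U[OF K(1)] H h(1,2) x] iota_factor[OF c cH v f el vl] ..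
    also have "\<dots> = res X G (par X G H f x) v"
      unfolding res_def by (rule presheafD(3)[OF X S G H h(3) f x, symmetric])
    finally show "vals G ?l v = vals G (csm_comp (gmod G) ?k f) v"
      using mk_vals[OF P dg[OF G fx]] v by (simp add: dec_def)
  qed
qed

lemma pmod_iso: "psh_iso X (nerve (pmod X))"
proof -
  note P = pmod_modular(1)
  let ?k = "\<lambda>G x. mk (pmod X) G (fst (dec X G x)) (snd (dec X G x))"
  let ?u = "\<lambda>G h. und X G (fst h) (vals G h)"
  have dg: "dgr (mcol (pmod X)) (mop (pmod X)) K (fst (dec X K z)) (snd (dec X K z))" if "K : U_ob" "z : pob X K" for K z
    using dec_dgr[OF X that] by (simp add: dec_def)
  have k: "?k G x : csm_hom (gmod G) (pmod X)" if "G : U_ob" "x : pob X G" for G x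
    by (rule mk_hom[OF P dg[OF that]])
  have d: "dgr XC XF G (fst h) (vals G h)" if "G : U_ob" "h : csm_hom (gmod G) (pmod X)" for G h
    using hom_vals[OF P U_conn[OF that(1)] that(2)] by simp
  have u: "?u G h : pob X G" if "G : U_ob" "h : csm_hom (gmod G) (pmod X)" for G h
    using und_props(1)[OF d[OF that]] hat_id[OF that(1)] by simp
  have uk: "?u G (?k G x) = x" if "G : U_ob" "x : pob X G" for G x
    unfolding mk_fst mk_vals[OF P dg[OF that]] by (rule und_dec[OF that])
  have ku: "?k G (?u G h) = h" if G: "G : U_ob" and h: "h : csm_hom (gmod G) (pmod X)" for G h
  proof -
    note dd = d[OF G h]
    have "fst (dec X G (?u G h)) = fst h"
      using und_props(2)[OF dd] hat_id[OF G] dgrD(9)[OF dd] by (intro extensionalityI[where A = "gA G"]) (simp_all add: dec_def)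
    moreover have "snd (dec X G (?u G h)) = vals G h"
      using und_props(3)[OF dd] hat_id[OF G] dgrD(10)[OF dd] by (intro extensionalityI[where A = "gV G"]) (simp_all add: dec_def)
    ultimately show ?thesis using mk_eq[OF P U_conn[OF G] h] by simp
  qed
  have t: "(\<lambda>G\<in>U_ob. \<lambda>x\<in>pob X G. ?k G x) : psh_hom X (nerve (pmod X))"
  proof (rule psh_homI)
    fix G H :: "'u graph" and f x assume *: "G : U_ob" "H : U_ob" "f : U_hom G H" "x : pob X H"
    show "?k G (par X G H f x) = par (nerve (pmod X)) G H f (?k H x)"
      unfolding nerve_simps(2)[OF k[OF *(2,4)]] by (rule pmod_nat[OF *])
    show "par X G H f x : pob X G" by (rule presheafD(1)[OF X *])
  qed (use k in \<open>simp add: nerve_simps\<close>)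
  have s: "(\<lambda>G\<in>U_ob. \<lambda>h\<in>pob (nerve (pmod X)) G. ?u G h) : psh_hom (nerve (pmod X)) X"
  proof (rule psh_homI)
    fix G H :: "'u graph" and f h assume *: "G : U_ob" "H : U_ob" "f : U_hom G H" and h': "h : pob (nerve (pmod X)) H"
    then have h: "h : csm_hom (gmod H) (pmod X)" by (simp add: nerve_simps)
    show "par (nerve (pmod X)) G H f h : pob (nerve (pmod X)) G" by (rule presheafD(1)[OF nerve_presheaf[OF P] * h'])
    \<comment> \<open>Naturality of the inverse follows from that of the map, by writing
      \<open>h\<close> as the image of its preimage over \<open>H\<close>.\<close>
    have "par (nerve (pmod X)) G H f h = ?k G (par X G H f (?u H h))"
      unfolding nerve_simps(2)[OF h] pmod_nat[OF * u[OF *(2) h]] ku[OF *(2) h] ..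
    then show "?u G (par (nerve (pmod X)) G H f h) = par X G H f (?u H h)"
      using uk[OF *(1) presheafD(1)[OF X * u[OF *(2) h]]] by simp
  qed (use u in \<open>simp add: nerve_simps\<close>)
  show ?thesis
    unfolding psh_iso_def
  proof (intro bexI[OF _ t] bexI[OF _ s] conjI)
    show "psh_comp X (\<lambda>G\<in>U_ob. \<lambda>h\<in>pob (nerve (pmod X)) G. ?u G h) (\<lambda>G\<in>U_ob. \<lambda>x\<in>pob X G. ?k G x) = psh_id X"
      unfolding psh_comp_def psh_id_def using uk k by (intro restrict_ext) (simp add: nerve_simps)
    show "psh_comp (nerve (pmod X)) (\<lambda>G\<in>U_ob. \<lambda>x\<in>pob X G. ?k G x) (\<lambda>G\<in>U_ob. \<lambda>h\<in>pob (nerve (pmod X)) G. ?u G h) = psh_id (nerve (pmod X))"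
      unfolding psh_comp_def psh_id_def using ku u by (intro restrict_ext) (simp add: nerve_simps)
  qed
qed

end

end

theorem theorem2:
  assumes "infinite (UNIV :: 'u set)"
  shows
    "(\<forall>P :: ('u, 'c, 'x) modop. modular_operad P \<longrightarrow>
        presheaf (nerve P) \<and> nerve_map P (csm_id P) = psh_id (nerve P))
   \<and> (\<forall>(P :: ('u, 'c, 'x) modop) (Q :: ('u, 'd, 'y) modop) (R :: ('u, 'e, 'z) modop).
        modular_operad P \<and> modular_operad Q \<and> modular_operad R \<longrightarrow>
        (\<forall>f\<in>csm_hom P Q. \<forall>g\<in>csm_hom Q R.
           nerve_map P (csm_comp P g f) =
           psh_comp (nerve P) (nerve_map Q g) (nerve_map P f)))
   \<and> (\<forall>(P :: ('u, 'c, 'x) modop) (Q :: ('u, 'd, 'y) modop).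
        modular_operad P \<and> modular_operad Q \<longrightarrow>
        bij_betw (nerve_map P) (csm_hom P Q) (psh_hom (nerve P) (nerve Q)))
   \<and> (\<forall>X :: ('u, 'p) psh. presheaf X \<longrightarrow>
        (segal X \<longleftrightarrow>
          (\<exists>P :: ('u, 'p, 'p) modop. modular_operad P \<and> psh_iso X (nerve P))))
   \<and> (\<forall>(X :: ('u, 'p) psh) (P :: ('u, 'c, 'x) modop).
        presheaf X \<and> modular_operad P \<and> psh_iso X (nerve P) \<longrightarrow> segal X)"
proof -
  interpret infinite_universe "TYPE('u)" by unfold_locales (rule assms)
  show ?thesis
  proof (intro conjI allI impI ballI)
    fix P :: "('u, 'c, 'x) modop"
    assume P: "modular_operad P"
    show "presheaf (nerve P)" by (rule nerve_presheaf[OF P])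
    show "nerve_map P (csm_id P) = psh_id (nerve P)" by (rule nerve_map_id[OF P])
  next
    fix P :: "('u, 'c, 'x) modop" and Q :: "('u, 'd, 'y) modop" and R :: "('u, 'e, 'z) modop" and f g
    assume "modular_operad P & modular_operad Q & modular_operad R" "f : csm_hom P Q" "g : csm_hom Q R"
    then show "nerve_map P (csm_comp P g f) = psh_comp (nerve P) (nerve_map Q g) (nerve_map P f)"
      using nerve_map_comp by blast
  next
    fix P :: "('u, 'c, 'x) modop" and Q :: "('u, 'd, 'y) modop"
    assume "modular_operad P & modular_operad Q"
    then show "bij_betw (nerve_map P) (csm_hom P Q) (psh_hom (nerve P) (nerve Q))" using nerve_full_faithful by blast
  next
    fix X :: "('u, 'p) psh"
    assume X: "presheaf X"
    show "segal X \<longleftrightarrow> (EX P :: ('u, 'p, 'p) modop. modular_operad P & psh_iso X (nerve P))"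
      using pmod_modular(1)[OF X] pmod_iso[OF X] segal_iso[OF X nerve_presheaf] nerve_segal by blast
  next
    fix X :: "('u, 'p) psh" and P :: "('u, 'c, 'x) modop"
    assume "presheaf X & modular_operad P & psh_iso X (nerve P)"
    then show "segal X" using segal_iso[of X "nerve P"] nerve_presheaf[of P] nerve_segal[of P] by blast
  qed
qed

end
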